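(* Let $\mu\in\{0,1\}$. Let $S$ be a degenerate generating subset of an abelian group $G$ with $0\in S$ and let $H$ be a hyper-atom of $S$. Let $T$ be a finite subset of $G$ such that $3-\mu\le |S|\le \max(4-2\mu,|S|)\le |T|$, $S+T$ is aperiodic and $|S|+|T|-\mu=|S+T|\le \frac{2|G|+2\mu}{3}$. Then one of the following holds: (i) $\mu=0$ and $|G|=3|S|=3|T|=4\kappa_2(T^* )=12$. (ii) $\mu=0$ and $\{S,T\}$ is an $H$-essential pair. (iii) There are $H$-progressions $S=\bigcup_{0\le i\le u}S_i$ and $T=\bigcup_{0\le i\le t}T_i$ with a same difference such that one of the sets $S\setminus S_u$, $T\setminus T_t$ is $H$-periodic and the other is $(H,-\nu)$-periodic, and $|T_t+S_u|=|T_t|+|S_u|-\nu-\mu$, where $\nu$ is an integer with $0\le \nu\le 1-\mu$. Moreover $|T+H|-|T|\le |H|-\mu$.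
   Context: Groups are abelian, written additively; $A+B=\{a+b: a\in A, b\in B\}$. A set $X$ is $H$-periodic if $X+H=X$; it is periodic if it is $H$-periodic for some nonzero subgroup $H$, and aperiodic otherwise. $X^*$ denotes an arbitrary translate of the nonempty set $X$ containing $0$. Let $S$ be a finite generating subset of $G$ with $0\in S$. For $X\subset G$ put $\partial_S(X)=(X+S)\setminus X$ and $X^S=G\setminus (X+S)$. For $|G|\ge 2k-1$, $\kappa_k(S)=\min\{|\partial_S(X)| : \infty>|X|\ge k \text{ and } |X^S|\ge k\}$, where $\min\emptyset=|G|-2k+1$ ($\kappa_2(T^* )$ is given by the same formula with $T^*$ in place of $S$). A $k$-fragment of $S$ is a finite $X\subset G$ with $|X|\ge k$, $|X^S|\ge k$ and $|\partial_S(X)|=\kappa_k(S)$. $S$ is degenerate if some subgroup of $G$ is a $2$-fragment of $S$; a maximal subgroup which is a $2$-fragment of a degenerate $S$ is called a hyper-atom of $S$. Let $H$ be a subgroup of $G$. A set is $(H,-j)$-periodic if it is obtained by deleting $j$ elements from an $H$-periodic set. An $H$-decomposition of $A$ is a partition $A=\bigcup_{i\in I}A_i$ where each $A_i$ is the nonempty intersection of some $H$-coset with $A$. An $H$-decomposition $X=\bigcup_{0\le i\le u}X_i$ is called an $H$-progression with difference $d\in G/H$ if $X_i+H+d=X_{i+1}+H$ for $0\le i\le u-1$. The pair $\{S,T\}$ is an $H$-essential pair if $S=\bigcup_{0\le i\le u}S_i$ and $T=\bigcup_{0\le i\le t}T_i$ are $H$-progressions with the same difference such that $|S+H|-|S|=|T+H|-|T|=|H|$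 and one of the following holds: (a) $|H|-1=|S_0|=|S_u|=|T_0|=|T_t|=1$; (b) $|S_u|=|T_t|=1$, $|S_{u-1}|=|T_{t-1}|=|H|-1$ and $T_{t-1}+S_u=T_t+S_{u-1}$; (c) there are two subgroups $K_0,K_1$ of order $2$ such that $H=K_0\oplus K_1$, $S_0^*=T_0^*=K_0$ and $S_u^*=T_t^*=K_1$. *)

theory Defs
  imports "HOL-Algebra.Coset" "HOL-Algebra.Generated_Groups" "HOL-Library.Disjoint_Sets"
begin

text \<open>
  Abelian groups are locales \<^locale>\<open>comm_group\<close> in multiplicative notation, so the sumset
  $A+B$ is the set product \<^term>\<open>A <#>\<^bsub>G\<^esub> B\<close>, the neutral element $0$ is \<^term>\<open>\<one>\<^bsub>G\<^esub>\<close>, and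
  the elements of $G/H$ are the cosets in \<^term>\<open>carrier (G Mod H)\<close>.

  The group may be infinite, while \<^const>\<open>card\<close> is \<open>0\<close> on infinite sets; lower and upper bounds on the
  size of possibly infinite sets therefore treat the infinite case explicitly.
\<close>

definition H_periodic :: "('a, 'b) monoid_scheme \<Rightarrow> 'a set \<Rightarrow> 'a set \<Rightarrow> bool" where
  "H_periodic G H X \<longleftrightarrow> X \<subseteq> carrier G \<and> X <#>\<^bsub>G\<^esub> H = X"

definition periodic :: "('a, 'b) monoid_scheme \<Rightarrow> 'a set \<Rightarrow> bool" where
  "periodic G X \<longleftrightarrow> (\<exists>H. subgroup H G \<and> H \<noteq> {\<one>\<^bsub>G\<^esub>} \<and> H_periodic G H X)"

abbreviation aperiodic :: "('a, 'b) monoid_scheme \<Rightarrow> 'a set \<Rightarrow> bool" where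
  "aperiodic G X \<equiv> \<not> periodic G X"

definition periodic_minus :: "('a, 'b) monoid_scheme \<Rightarrow> 'a set \<Rightarrow> nat \<Rightarrow> 'a set \<Rightarrow> bool" where
  "periodic_minus G H j X \<longleftrightarrow>
     (\<exists>P D. H_periodic G H P \<and> D \<subseteq> P \<and> finite D \<and> card D = j \<and> X = P - D)"

text \<open>
  The possible values of $X^*$, an arbitrary translate of \<open>X\<close> containing $0$. An assertion about $X^*$
  is read as an assertion about every element of this set, which is nonempty whenever \<open>X\<close> is.
\<close>

definition pointed_translates :: "('a, 'b) monoid_scheme \<Rightarrow> 'a set \<Rightarrow> 'a set set" where
  "pointed_translates G X = {X #>\<^bsub>G\<^esub> g | g. g \<in> carrier G \<and> \<one>\<^bsub>G\<^esub> \<in> X #>\<^bsub>G\<^esub> g}"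

definition boundary :: "('a, 'b) monoid_scheme \<Rightarrow> 'a set \<Rightarrow> 'a set \<Rightarrow> 'a set" where
  "boundary G S X = (X <#>\<^bsub>G\<^esub> S) - X"

definition exterior :: "('a, 'b) monoid_scheme \<Rightarrow> 'a set \<Rightarrow> 'a set \<Rightarrow> 'a set" where
  "exterior G S X = carrier G - (X <#>\<^bsub>G\<^esub> S)"

definition k_separating :: "('a, 'b) monoid_scheme \<Rightarrow> nat \<Rightarrow> 'a set \<Rightarrow> 'a set set" where
  "k_separating G k S =
     {X. X \<subseteq> carrier G \<and> finite X \<and> k \<le> card X \<and>
         (infinite (exterior G S X) \<or> k \<le> card (exterior G S X))}"

text \<open>
  The first branch is $|G|-2k+1$, an exact subtraction when $|G| \ge 2k-1$. For finite \<open>S\<close> and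
  infinite \<open>G\<close> that branch is never taken.
\<close>

definition kappa :: "('a, 'b) monoid_scheme \<Rightarrow> nat \<Rightarrow> 'a set \<Rightarrow> nat" where
  "kappa G k S =
     (if k_separating G k S = {} then order G + 1 - 2 * k
      else (LEAST n. \<exists>X \<in> k_separating G k S. n = card (boundary G S X)))"

definition k_fragment :: "('a, 'b) monoid_scheme \<Rightarrow> nat \<Rightarrow> 'a set \<Rightarrow> 'a set \<Rightarrow> bool" where
  "k_fragment G k S X \<longleftrightarrow> X \<in> k_separating G k S \<and> card (boundary G S X) = kappa G k S"

definition degenerate :: "('a, 'b) monoid_scheme \<Rightarrow> 'a set \<Rightarrow> bool" where
  "degenerate G S \<longleftrightarrow> (\<exists>H. subgroup H G \<and> k_fragment G 2 S H)"

text \<open>Maximality is with respect to inclusion.\<close>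

definition hyper_atom :: "('a, 'b) monoid_scheme \<Rightarrow> 'a set \<Rightarrow> 'a set \<Rightarrow> bool" where
  "hyper_atom G S H \<longleftrightarrow>
     subgroup H G \<and> k_fragment G 2 S H \<and>
     (\<forall>K. subgroup K G \<and> k_fragment G 2 S K \<and> H \<subseteq> K \<longrightarrow> K = H)"

definition H_decomposition ::
  "('a, 'b) monoid_scheme \<Rightarrow> 'a set \<Rightarrow> 'a set \<Rightarrow> 'i set \<Rightarrow> ('i \<Rightarrow> 'a set) \<Rightarrow> bool" where
  "H_decomposition G H A I As \<longleftrightarrow>
     A = (\<Union>i\<in>I. As i) \<and> disjoint_family_on As I \<and>
     (\<forall>i\<in>I. As i \<noteq> {} \<and> (\<exists>C \<in> rcosets\<^bsub>G\<^esub> H. As i = C \<inter> A))"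

text \<open>
  \<open>H_progression G H d X u Xs\<close>: the sets \<open>Xs 0, \<dots>, Xs u\<close> form an \<open>H\<close>-progression with union \<open>X\<close> and
  difference \<open>d\<close>, an element of $G/H$.
\<close>

definition H_progression ::
  "('a, 'b) monoid_scheme \<Rightarrow> 'a set \<Rightarrow> 'a set \<Rightarrow> 'a set \<Rightarrow> nat \<Rightarrow> (nat \<Rightarrow> 'a set) \<Rightarrow> bool" where
  "H_progression G H d X u Xs \<longleftrightarrow>
     d \<in> carrier (G Mod H) \<and> H_decomposition G H X {..u} Xs \<and>
     (\<forall>i<u. (Xs i <#>\<^bsub>G\<^esub> H) \<otimes>\<^bsub>G Mod H\<^esub> d = Xs (Suc i) <#>\<^bsub>G\<^esub> H)"

definition internal_direct_sum ::
  "('a, 'b) monoid_scheme \<Rightarrow> 'a set \<Rightarrow> 'a set \<Rightarrow> 'a set \<Rightarrow> bool" where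
  "internal_direct_sum G H K0 K1 \<longleftrightarrow> H = K0 <#>\<^bsub>G\<^esub> K1 \<and> K0 \<inter> K1 = {\<one>\<^bsub>G\<^esub>}"

text \<open>
  The cardinalities below are meant for finite \<open>H\<close>, \<open>S\<close> and \<open>T\<close>. The second alternative mentions the
  indices $u-1$ and $t-1$ and hence presupposes that \<open>u\<close> and \<open>t\<close> are positive.
\<close>

definition H_essential_pair ::
  "('a, 'b) monoid_scheme \<Rightarrow> 'a set \<Rightarrow> 'a set \<Rightarrow> 'a set \<Rightarrow> bool" where
  "H_essential_pair G H S T \<longleftrightarrow>
     (\<exists>d u t Ss Ts.
        H_progression G H d S u Ss \<and> H_progression G H d T t Ts \<and>
        card (S <#>\<^bsub>G\<^esub> H) = card S + card H \<and> card (T <#>\<^bsub>G\<^esub> H) = card T + card H \<and>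
        ((card H = 2 \<and> card (Ss 0) = 1 \<and> card (Ss u) = 1 \<and> card (Ts 0) = 1 \<and> card (Ts t) = 1) \<or>
         (0 < u \<and> 0 < t \<and> card (Ss u) = 1 \<and> card (Ts t) = 1 \<and>
          card (Ss (u - 1)) + 1 = card H \<and> card (Ts (t - 1)) + 1 = card H \<and>
          Ts (t - 1) <#>\<^bsub>G\<^esub> Ss u = Ts t <#>\<^bsub>G\<^esub> Ss (u - 1)) \<or>
         (\<exists>K0 K1. subgroup K0 G \<and> subgroup K1 G \<and> card K0 = 2 \<and> card K1 = 2 \<and>
            internal_direct_sum G H K0 K1 \<and>
            (\<forall>Y \<in> pointed_translates G (Ss 0). Y = K0) \<and>
            (\<forall>Y \<in> pointed_translates G (Ts 0). Y = K0) \<and>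
            (\<forall>Y \<in> pointed_translates G (Ss u). Y = K1) \<and>
            (\<forall>Y \<in> pointed_translates G (Ts t). Y = K1))))"

end

theory Submission
  imports Defs
begin

text \<open>
  Put \<open>h = |H|\<close> and project onto \<open>Q = G/H\<close>; let \<open>A\<close> and \<open>B\<close> be the images of \<open>S\<close> and \<open>T\<close>, and \<open>|A| = u + 1\<close>.
  Since \<open>H\<close> is a 2-fragment, \<open>|X + S| \<ge> |X| + u h\<close> for every 2-separating \<open>X\<close>, and since it is a
  maximal subgroup of this kind, \<open>|L + A| > |L| + u\<close> for every finite nontrivial subgroup \<open>L\<close> of \<open>Q\<close>
  with \<open>L + A \<noteq> Q\<close>.

  The first inequality, applied to subsets of the fibres of \<open>T\<close>, shows that \<open>S + T\<close> has at least
  \<open>u h + |T_b|\<close> elements over \<open>b + A\<close> whenever the fibre \<open>T_b\<close> has two elements. Comparing with the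
  size of \<open>S + T\<close> yields \<open>|A + B| \<le> |A| + |B| - 1\<close>, together with a bound for the sum of the
  deficiencies \<open>h - |(S + T) \<inter> c|\<close> over the elements \<open>c\<close> of \<open>A + B\<close>, each weighted by its number of
  representations. Strict inequality forces \<open>A + B = Q\<close>, and the weighted bound with Kneser's theorem
  leaves only a group of order 12. In case of equality the weighted bound says that most elements of
  \<open>A + B\<close> with nonzero deficiency have a single representation; Hamidoune's description of 2-atoms, itself
  a consequence of Kneser's theorem, then shows that \<open>A\<close> and \<open>B\<close> are progressions with the same difference.

  Along the progressions, \<open>S + T\<close> is compared with the paths that traverse the fibres of \<open>S\<close> at
  one fixed position in \<open>T\<close>, and vice versa. If the only layer of \<open>S + T\<close> that is not a full coset
  is an end layer, its size is controlled by Kneser's theorem and the third alternative holds; if both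
  end layers or an inner layer are not full, the pair is essential.
\<close>

text \<open>Everything is measured by two parameters: |S| = u h + g + \<mu> and |S + T| = |T| + u h
  + g. Here g + \<mu> < h, since S has no period and so is not a union of H-cosets. The obstacle
  behind most case distinctions is that the fragment inequality speaks only about sets with at least
  two elements. Over a one-point fibre of T the sumset may have u h elements instead of u h + 1.
  This happens only for g = \<mu> = 0, and S + T is then a mere translate of S over that column.
  Such columns (\<open>exact\<close>) cost one unit each in the weighted count; the arithmetic shows
  that they are too few, or so many that S + T acquires a period. Aperiodicity enters in the form
  that no nontrivial element stabilizes S, T or S + T. The bound by two thirds of |G| gives |Q|
  \<ge> 3 u, so a proper subgroup L with L + A = Q cannot spoil the strict inequality for L + A. The
  hypotheses on fragments concern S alone; hence the argument is symmetric under reversing both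
  progressions, but not under exchanging S and T.\<close>

lemma card_eq_fibres:
  assumes "finite X" "\<And>y. y \<in> f ` X \<Longrightarrow> card {x \<in> X. f x = y} = q"
  shows "card X = q * card (f ` X)"
proof -
  have "card X = (\<Sum>y\<in>f ` X. card {x \<in> X. f x = y})"
    using sum.image_gen[OF assms(1), of "\<lambda>_. 1::nat" f] by simp
  also have "\<dots> = q * card (f ` X)" using assms(2) by simp
  finally show ?thesis .
qed

definition stabilizer :: "('a, 'b) monoid_scheme \<Rightarrow> 'a set \<Rightarrow> 'a set" where
  "stabilizer G X = {g \<in> carrier G. (\<lambda>x. g \<otimes>\<^bsub>G\<^esub> x) ` X = X}"

section \<open>Translates, sumsets and inverses in an abelian group\<close>

context comm_group
begin

lemma set_mult_iff: "z \<in> X <#> Y \<longleftrightarrow> (\<exists>x\<in>X. \<exists>y\<in>Y. z = x \<otimes> y)"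
  by (auto simp: set_mult_def)

lemma set_multI: "x \<in> X \<Longrightarrow> y \<in> Y \<Longrightarrow> x \<otimes> y \<in> X <#> Y"
  by (auto simp: set_mult_def)

lemma finite_set_mult: "finite X \<Longrightarrow> finite Y \<Longrightarrow> finite (X <#> Y)"
  by (simp add: set_mult_def)

lemma inv_cancel [simp]:
  "x \<in> carrier G \<Longrightarrow> y \<in> carrier G \<Longrightarrow> x \<otimes> (inv x \<otimes> y) = y"
  "x \<in> carrier G \<Longrightarrow> y \<in> carrier G \<Longrightarrow> inv x \<otimes> (x \<otimes> y) = y"
  "x \<in> carrier G \<Longrightarrow> y \<in> carrier G \<Longrightarrow> y \<otimes> x \<otimes> inv x = y"
  "x \<in> carrier G \<Longrightarrow> y \<in> carrier G \<Longrightarrow> y \<otimes> inv x \<otimes> x = y"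
  by (simp_all add: m_assoc[symmetric]) (simp_all add: m_assoc)

text \<open>Rewriting modulo associativity and commutativity may separate an element from its
  inverse; these rules cancel across the factors in between.\<close>

lemma cancel_ac:
  "x \<in> carrier G \<Longrightarrow> y \<in> carrier G \<Longrightarrow> x \<otimes> (y \<otimes> inv x) = y"
  "x \<in> carrier G \<Longrightarrow> y \<in> carrier G \<Longrightarrow> z \<in> carrier G \<Longrightarrow> x \<otimes> (y \<otimes> (inv x \<otimes> z)) = y \<otimes> z"
  "x \<in> carrier G \<Longrightarrow> y \<in> carrier G \<Longrightarrow> z \<in> carrier G \<Longrightarrow> x \<otimes> (y \<otimes> (z \<otimes> inv x)) = y \<otimes> z"
  by (simp_all add: m_lcomm[of x])

lemmas abelian_simps = m_ac inv_mult cancel_ac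

lemma set_mult_comm: "X \<subseteq> carrier G \<Longrightarrow> Y \<subseteq> carrier G \<Longrightarrow> X <#> Y = Y <#> X"
  by (auto simp: set_mult_iff) (metis m_comm subsetD)+

lemma card_translate:
  assumes "x \<in> carrier G" "Y \<subseteq> carrier G"
  shows "card ((\<otimes>) x ` Y) = card Y"
  using assms by (intro card_image inj_onI) (auto simp: subset_iff)

lemma translate_translate:
  assumes "x \<in> carrier G" "y \<in> carrier G" "Y \<subseteq> carrier G"
  shows "(\<otimes>) x ` (\<otimes>) y ` Y = (\<otimes>) (x \<otimes> y) ` Y"
  using assms by (auto simp: image_iff subset_iff m_assoc)

lemma translate_one: "Y \<subseteq> carrier G \<Longrightarrow> (\<otimes>) \<one> ` Y = Y"
  by (auto simp: image_iff subset_iff)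

lemma translate_inv_iff:
  assumes "x \<in> carrier G" "Y \<subseteq> carrier G" "z \<in> carrier G"
  shows "z \<in> (\<otimes>) x ` Y \<longleftrightarrow> inv x \<otimes> z \<in> Y"
proof
  assume "z \<in> (\<otimes>) x ` Y"
  then show "inv x \<otimes> z \<in> Y" using assms by (auto simp: subset_iff)
next
  assume "inv x \<otimes> z \<in> Y"
  moreover have "z = x \<otimes> (inv x \<otimes> z)" using assms by simp
  ultimately show "z \<in> (\<otimes>) x ` Y" by blast
qed

lemma card_set_mult_ge_right:
  assumes "X \<subseteq> carrier G" "Y \<subseteq> carrier G" "X \<noteq> {}" "finite X" "finite Y"
  shows "card Y \<le> card (X <#> Y)"
proof -
  obtain x where x: "x \<in> X" using assms by auto
  have "(\<otimes>) x ` Y \<subseteq> X <#> Y" using x by (auto intro: set_multI)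
  then have "card ((\<otimes>) x ` Y) \<le> card (X <#> Y)"
    using assms by (intro card_mono finite_set_mult) auto
  moreover have "card ((\<otimes>) x ` Y) = card Y" using card_translate assms x by blast
  ultimately show ?thesis by simp
qed

lemma card_set_mult_ge_left:
  assumes "X \<subseteq> carrier G" "Y \<subseteq> carrier G" "Y \<noteq> {}" "finite X" "finite Y"
  shows "card X \<le> card (X <#> Y)"
  using card_set_mult_ge_right[of Y X] set_mult_comm[of X Y] assms by simp

lemma set_mult_singleton: "{x} <#> Y = (\<otimes>) x ` Y"
  by (auto simp: set_mult_def)

lemma set_mult_translate:
  assumes "x \<in> carrier G" "X \<subseteq> carrier G" "Y \<subseteq> carrier G"
  shows "((\<otimes>) x ` X) <#> Y = (\<otimes>) x ` (X <#> Y)"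
  using set_mult_assoc[of "{x}" X Y] assms by (simp add: set_mult_singleton)

subsection \<open>Stabilizers\<close>

lemma stabilizer_subset: "stabilizer G X \<subseteq> carrier G"
  by (auto simp: stabilizer_def)

lemma stabilizer_subgroup:
  assumes "X \<subseteq> carrier G"
  shows "subgroup (stabilizer G X) G"
proof (rule subgroupI)
  show "stabilizer G X \<subseteq> carrier G" by (rule stabilizer_subset)
  show "stabilizer G X \<noteq> {}"
    using translate_one[OF assms] by (auto simp: stabilizer_def)
next
  fix a assume a: "a \<in> stabilizer G X"
  then have "a \<in> carrier G" "(\<otimes>) a ` X = X" by (auto simp: stabilizer_def)
  then have "(\<otimes>) (inv a) ` X = X"
    using translate_translate[of "inv a" a X] translate_one[OF assms] assms by simp
  then show "inv a \<in> stabilizer G X" using \<open>a \<in> carrier G\<close> by (simp add: stabilizer_def)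
next
  fix a b assume "a \<in> stabilizer G X" "b \<in> stabilizer G X"
  then show "a \<otimes> b \<in> stabilizer G X"
    using translate_translate[of a b X] assms by (simp add: stabilizer_def)
qed

lemma stabilizer_mult:
  assumes "g \<in> stabilizer G X" "x \<in> X"
  shows "g \<otimes> x \<in> X"
  using assms by (auto simp: stabilizer_def)

lemma stabilizer_mult_iff:
  assumes "g \<in> stabilizer G X" "x \<in> carrier G" "X \<subseteq> carrier G"
  shows "g \<otimes> x \<in> X \<longleftrightarrow> x \<in> X"
proof
  assume "g \<otimes> x \<in> X"
  moreover have "inv g \<in> stabilizer G X"
    using stabilizer_subgroup[OF assms(3)] assms(1) by (rule subgroup.m_inv_closed)
  ultimately have "inv g \<otimes> (g \<otimes> x) \<in> X" by (rule stabilizer_mult[rotated])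
  then show "x \<in> X" using assms stabilizer_subset by (auto simp: subset_iff)
qed (use assms stabilizer_mult in auto)

text \<open>A translation is injective, so on a finite set inclusion of the translate is already
  equality.\<close>

lemma stabilizerI:
  assumes "finite X" "X \<subseteq> carrier G" "g \<in> carrier G" "\<And>x. x \<in> X \<Longrightarrow> g \<otimes> x \<in> X"
  shows "g \<in> stabilizer G X"
proof -
  have "(\<otimes>) g ` X \<subseteq> X" using assms by auto
  moreover have "card ((\<otimes>) g ` X) = card X" using card_translate assms by blast
  ultimately have "(\<otimes>) g ` X = X" using assms(1) by (simp add: card_subset_eq)
  then show ?thesis using assms by (simp add: stabilizer_def)
qed

lemma stabilizer_finite:
  assumes "finite X" "X \<subseteq> carrier G" "x \<in> X"
  shows "finite (stabilizer G X)" "card (stabilizer G X) \<le> card X"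
proof -
  have inj: "inj_on (\<lambda>g. g \<otimes> x) (stabilizer G X)"
    using assms stabilizer_subset by (intro inj_onI) (auto simp: subset_iff)
  have im: "(\<lambda>g. g \<otimes> x) ` stabilizer G X \<subseteq> X" using assms(3) stabilizer_mult by blast
  show "finite (stabilizer G X)" using inj im assms(1) finite_imageD finite_subset by blast
  show "card (stabilizer G X) \<le> card X" using inj im assms(1) card_inj_on_le by blast
qed

lemma stabilizer_set_mult_mono:
  assumes "X \<subseteq> carrier G" "Y \<subseteq> carrier G"
  shows "stabilizer G X \<subseteq> stabilizer G (X <#> Y)"
proof
  fix g assume "g \<in> stabilizer G X"
  then show "g \<in> stabilizer G (X <#> Y)"
    using set_mult_translate[OF _ assms, of g] by (simp add: stabilizer_def)
qed

lemma set_mult_stabilizer: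
  assumes "X \<subseteq> carrier G" "X <#> K = X" "K \<subseteq> carrier G" "finite X"
  shows "K \<subseteq> stabilizer G X"
proof
  fix g assume g: "g \<in> K"
  show "g \<in> stabilizer G X"
  proof (rule stabilizerI)
    fix x assume "x \<in> X"
    then have "x \<otimes> g \<in> X" using g assms(2) set_multI[of x X g K] by simp
    moreover have "x \<otimes> g = g \<otimes> x" using \<open>x \<in> X\<close> g assms by (intro m_comm) auto
    ultimately show "g \<otimes> x \<in> X" by simp
  qed (use assms g in auto)
qed

lemma periodic_if_stabilizer:
  assumes "X \<subseteq> carrier G" "g \<in> stabilizer G X" "g \<noteq> \<one>"
  shows "periodic G X"
proof -
  have "X <#> stabilizer G X = X"
  proof
    show "X <#> stabilizer G X \<subseteq> X"
      using assms(1) stabilizer_subset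
      by (auto simp: set_mult_iff) (metis m_comm stabilizer_mult subsetD)
    show "X \<subseteq> X <#> stabilizer G X"
    proof
      fix x assume "x \<in> X"
      then have "x \<otimes> \<one> \<in> X <#> stabilizer G X"
        using subgroup.one_closed[OF stabilizer_subgroup[OF assms(1)]] by (rule set_multI)
      then show "x \<in> X <#> stabilizer G X" using \<open>x \<in> X\<close> assms(1) by (simp add: subset_iff)
    qed
  qed
  then show ?thesis
    using assms stabilizer_subgroup unfolding periodic_def H_periodic_def by blast
qed

lemma coset_fibre:
  assumes "subgroup K G" "X \<subseteq> carrier G" "x \<in> X" "\<And>k x. k \<in> K \<Longrightarrow> x \<in> X \<Longrightarrow> k \<otimes> x \<in> X"
  shows "{y \<in> X. K #> y = K #> x} = (\<lambda>k. k \<otimes> x) ` K"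
proof (intro equalityI subsetI)
  fix y assume y: "y \<in> {y \<in> X. K #> y = K #> x}"
  have "y \<in> K #> y" using y assms(1,2) rcos_self[of y K] by auto
  then have "y \<in> K #> x" using y by simp
  then show "y \<in> (\<lambda>k. k \<otimes> x) ` K" by (auto simp: r_coset_def)
next
  fix y assume "y \<in> (\<lambda>k. k \<otimes> x) ` K"
  then obtain k where k: "k \<in> K" "y = k \<otimes> x" by auto
  then have "y \<in> K #> x" by (auto simp: r_coset_def)
  moreover have "K #> x = K #> y"
    by (rule repr_independence) (use calculation assms in auto)
  ultimately show "y \<in> {y \<in> X. K #> y = K #> x}" using k assms by auto
qed

lemma card_subgroup_invariant:
  assumes "subgroup K G" "finite X" "X \<subseteq> carrier G" "\<And>k x. k \<in> K \<Longrightarrow> x \<in> X \<Longrightarrow> k \<otimes> x \<in> X"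
  shows "card X = card K * card ((\<lambda>x. K #> x) ` X)"
proof (rule card_eq_fibres[OF assms(2)])
  fix y assume "y \<in> (\<lambda>x. K #> x) ` X"
  then obtain x where x: "x \<in> X" "y = K #> x" by auto
  have "card ((\<lambda>k. k \<otimes> x) ` K) = card K"
    using x assms subgroup.mem_carrier[OF assms(1)] by (intro card_image inj_onI) (auto simp: subset_iff)
  then show "card {x \<in> X. K #> x = y} = card K"
    using coset_fibre[OF assms(1,3) x(1) assms(4)] x by simp
qed

lemma card_dvd_invariant:
  assumes "subgroup K G" "finite X" "X \<subseteq> carrier G" "\<And>k x. k \<in> K \<Longrightarrow> x \<in> X \<Longrightarrow> k \<otimes> x \<in> X"
  shows "card K dvd card X"
  using card_subgroup_invariant[OF assms] by simp

subsection \<open>Kneser's theorem\<close>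

text \<open>The group \<open>H1 \<inter> H2\<close> acts freely on pairs by (k x, inv k y). Two
  pairs have the same product exactly when they lie in one orbit, so every fibre of the
  multiplication map has \<open>card (H1 \<inter> H2)\<close> elements.\<close>

lemma card_grid:
  assumes "subgroup H1 G" "subgroup H2 G" "finite H1" "finite H2" "X \<subseteq> H1" "Y \<subseteq> H2" "z \<in> carrier G"
    and inv: "\<And>k x. k \<in> H1 \<inter> H2 \<Longrightarrow> x \<in> X \<Longrightarrow> k \<otimes> x \<in> X"
      "\<And>k y. k \<in> H1 \<inter> H2 \<Longrightarrow> y \<in> Y \<Longrightarrow> k \<otimes> y \<in> Y"
  shows "card X * card Y = card (H1 \<inter> H2) * card ((\<lambda>(x,y). z \<otimes> (x \<otimes> y)) ` (X \<times> Y))"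
proof -
  interpret H1: subgroup H1 G by fact
  interpret H2: subgroup H2 G by fact
  have fin: "finite X" "finite Y" using assms finite_subset by auto
  have "card (X \<times> Y) = card (H1 \<inter> H2) * card ((\<lambda>(x,y). z \<otimes> (x \<otimes> y)) ` (X \<times> Y))"
  proof (rule card_eq_fibres)
    fix w assume "w \<in> (\<lambda>(x,y). z \<otimes> (x \<otimes> y)) ` (X \<times> Y)"
    then obtain x y where xy: "x \<in> X" "y \<in> Y" "w = z \<otimes> (x \<otimes> y)" by auto
    have xc: "x \<in> carrier G" "y \<in> carrier G" using xy assms by auto
    have "{p \<in> X \<times> Y. (case p of (x,y) \<Rightarrow> z \<otimes> (x \<otimes> y)) = w} = (\<lambda>k. (k \<otimes> x, inv k \<otimes> y)) ` (H1 \<inter> H2)"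
      (is "?L = ?R")
    proof
      show "?R \<subseteq> ?L"
      proof
        fix p assume "p \<in> ?R"
        then obtain k where k: "k \<in> H1" "k \<in> H2" "p = (k \<otimes> x, inv k \<otimes> y)" by auto
        have "k \<otimes> x \<in> X" "inv k \<otimes> y \<in> Y" using inv xy k by auto
        moreover have "(k \<otimes> x) \<otimes> (inv k \<otimes> y) = x \<otimes> y"
          using xc k by (simp add: abelian_simps)
        ultimately show "p \<in> ?L" using k xy by simp
      qed
      show "?L \<subseteq> ?R"
      proof
        fix p assume "p \<in> ?L"
        then obtain x' y' where p: "p = (x', y')" "x' \<in> X" "y' \<in> Y" "z \<otimes> (x' \<otimes> y') = z \<otimes> (x \<otimes> y)"
          using xy by auto
        have c: "x' \<in> carrier G" "y' \<in> carrier G" using p assms by auto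
        have e: "x' \<otimes> y' = x \<otimes> y" using p c xc assms by simp
        define k where "k = x' \<otimes> inv x"
        have kk: "k = inv y' \<otimes> y"
        proof -
          have "k = x' \<otimes> y' \<otimes> inv y' \<otimes> inv x" using c xc by (simp add: k_def m_assoc)
          also have "\<dots> = inv y' \<otimes> y" using c xc unfolding e by (simp add: abelian_simps)
          finally show ?thesis .
        qed
        have "k \<in> H1" using p xy assms(5) unfolding k_def by auto
        moreover have "k \<in> H2" using p xy assms(6) unfolding kk by auto
        moreover have "x' = k \<otimes> x" using c xc by (simp add: k_def)
        moreover have "y' = inv k \<otimes> y" using c xc by (simp add: kk inv_mult m_ac)
        ultimately show "p \<in> ?R" using p by auto
      qed
    qed
    moreover have "inj_on (\<lambda>k. (k \<otimes> x, inv k \<otimes> y)) (H1 \<inter> H2)"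
      using xc by (intro inj_onI) auto
    ultimately show "card {p \<in> X \<times> Y. (case p of (x,y) \<Rightarrow> z \<otimes> (x \<otimes> y)) = w} = card (H1 \<inter> H2)"
      by (simp add: card_image)
  qed (use fin in auto)
  then show ?thesis by (simp add: card_cartesian_product)
qed

text \<open>Only z + H1 + H2 matters, for the two stabilizers H1 and H2. There membership in C1 is
  invariant under H1 and membership in C2 under H2, so the set is a grid on which one membership
  depends on the column and the other on the row. The rectangles of cells lying in just one of the
  two sets bound both differences from below.\<close>

lemma kneser_union_aux:
  assumes C: "finite C1" "finite C2" "C1 \<subseteq> carrier G" "C2 \<subseteq> carrier G" "C1 \<noteq> {}" "z \<in> C2" "z \<notin> C1"
    and "card (stabilizer G C1 \<inter> stabilizer G C2) + card (C2 - C1) < card (stabilizer G C1)"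
    and "card (stabilizer G C1 \<inter> stabilizer G C2) + card (C1 - C2) < card (stabilizer G C2)"
  shows "card (stabilizer G C2) < card (stabilizer G C1)"
proof -
  define H1 where "H1 = stabilizer G C1"
  define H2 where "H2 = stabilizer G C2"
  define q where "q = card (H1 \<inter> H2)"
  have sg: "subgroup H1 G" "subgroup H2 G" using C stabilizer_subgroup by (auto simp: H1_def H2_def)
  interpret H1: subgroup H1 G by fact
  interpret H2: subgroup H2 G by fact
  have fin: "finite H1" "finite H2" using stabilizer_finite C by (auto simp: H1_def H2_def)
  have zc: "z \<in> carrier G" using C by auto
  have sgi: "subgroup (H1 \<inter> H2) G" using sg by (rule subgroups_Inter_pair)
  have q0: "q > 0" using fin H1.one_closed H2.one_closed unfolding q_def card_gt_0_iff by blast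
  \<comment> \<open>Coordinates inside C2 and outside C1: the rectangle over \<open>X\<close> and
    \<open>Y\<close> lies in C2 - C1, and that over the complements lies in C1 - C2.\<close>
  define X where "X = {x \<in> H1. z \<otimes> x \<in> C2}"
  define Y where "Y = {y \<in> H2. z \<otimes> y \<notin> C1}"
  have st1: "x \<in> H1 \<Longrightarrow> w \<in> carrier G \<Longrightarrow> x \<otimes> w \<in> C1 \<longleftrightarrow> w \<in> C1" for x w
    using stabilizer_mult_iff C unfolding H1_def by auto
  have st2: "x \<in> H2 \<Longrightarrow> w \<in> carrier G \<Longrightarrow> x \<otimes> w \<in> C2 \<longleftrightarrow> w \<in> C2" for x w
    using stabilizer_mult_iff C unfolding H2_def by auto
  have m1: "z \<otimes> (x \<otimes> y) \<in> C1 \<longleftrightarrow> z \<otimes> y \<in> C1" if "x \<in> H1" "y \<in> H2" for x y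
    using st1[OF that(1), of "z \<otimes> y"] that zc by (simp add: m_ac)
  have m2: "z \<otimes> (x \<otimes> y) \<in> C2 \<longleftrightarrow> z \<otimes> x \<in> C2" if "x \<in> H1" "y \<in> H2" for x y
    using st2[OF that(2), of "z \<otimes> x"] that zc by (simp add: m_ac)
  have invX: "k \<otimes> x \<in> X \<longleftrightarrow> x \<in> X" if "k \<in> H1 \<inter> H2" "x \<in> H1" for k x
    using that st2[of k "z \<otimes> x"] zc by (auto simp: X_def m_ac)
  have invY: "k \<otimes> y \<in> Y \<longleftrightarrow> y \<in> Y" if "k \<in> H1 \<inter> H2" "y \<in> H2" for k y
    using that st1[of k "z \<otimes> y"] zc by (auto simp: Y_def m_ac)
  have finXY: "finite X" "finite Y" using fin by (auto simp: X_def Y_def)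
  have "q dvd card X"
    unfolding q_def by (rule card_dvd_invariant[OF sgi finXY(1)]) (use invX X_def in auto)
  then obtain a where a: "card X = q * a" by auto
  have "q dvd card Y"
    unfolding q_def by (rule card_dvd_invariant[OF sgi finXY(2)]) (use invY Y_def in auto)
  then obtain b where b: "card Y = q * b" by auto
  have "q dvd card H1"
    unfolding q_def by (rule card_dvd_invariant[OF sgi fin(1)]) auto
  then obtain m1' where m1': "card H1 = q * m1'" by auto
  have "q dvd card H2"
    unfolding q_def by (rule card_dvd_invariant[OF sgi fin(2)]) auto
  then obtain m2' where m2': "card H2 = q * m2'" by auto
  have a1: "a \<ge> 1" using a C zc finXY H1.one_closed X_def card_gt_0_iff
    by (metis (mono_tags, lifting) One_nat_def Suc_leI empty_iff mem_Collect_eq mult_0_right neq0_conv r_one)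
  have b1: "b \<ge> 1" using b C zc finXY H2.one_closed Y_def card_gt_0_iff
    by (metis (mono_tags, lifting) One_nat_def Suc_leI empty_iff mem_Collect_eq mult_0_right neq0_conv r_one)
  have "card X \<le> card H1" "card Y \<le> card H2" using fin by (auto simp: X_def Y_def intro!: card_mono)
  then have am: "a \<le> m1'" "b \<le> m2'" using a b m1' m2' q0 by auto
  have "card X * card Y = q * card ((\<lambda>(x,y). z \<otimes> (x \<otimes> y)) ` (X \<times> Y))"
    unfolding q_def by (rule card_grid[OF sg fin]) (use zc invX invY in \<open>auto simp: X_def Y_def\<close>)
  moreover have "card ((\<lambda>(x,y). z \<otimes> (x \<otimes> y)) ` (X \<times> Y)) \<le> card (C2 - C1)"
    using C m1 m2 by (intro card_mono) (auto simp: X_def Y_def)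
  ultimately have "card X * card Y \<le> q * card (C2 - C1)" by simp
  then have d1: "q * (a * b) \<le> card (C2 - C1)" using a b q0 by (simp add: ac_simps)
  have "card (H1 - X) * card (H2 - Y) = q * card ((\<lambda>(x,y). z \<otimes> (x \<otimes> y)) ` ((H1 - X) \<times> (H2 - Y)))"
    unfolding q_def by (rule card_grid[OF sg fin]) (use zc invX invY in auto)
  moreover have "card ((\<lambda>(x,y). z \<otimes> (x \<otimes> y)) ` ((H1 - X) \<times> (H2 - Y))) \<le> card (C1 - C2)"
    using C m1 m2 by (intro card_mono) (auto simp: X_def Y_def)
  ultimately have "card (H1 - X) * card (H2 - Y) \<le> q * card (C1 - C2)" by simp
  moreover have "card (H1 - X) = q * (m1' - a)" "card (H2 - Y) = q * (m2' - b)"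
    using finXY a b m1' m2' by (simp_all add: card_Diff_subset X_def Y_def diff_mult_distrib2)
  ultimately have d2: "q * ((m1' - a) * (m2' - b)) \<le> card (C1 - C2)" using q0 by (simp add: ac_simps)
  have e1: "a * b + 1 < m1'"
  proof -
    have "q * (a * b + 1) < q * m1'" using d1 assms(8) m1' unfolding H1_def[symmetric] H2_def[symmetric] q_def[symmetric] by (simp add: distrib_left)
    then show ?thesis by (simp only: mult_less_cancel1)
  qed
  have e2: "(m1' - a) * (m2' - b) + 1 < m2'"
  proof -
    have "q * ((m1' - a) * (m2' - b) + 1) < q * m2'"
      using d2 assms(9) m2' unfolding H1_def[symmetric] H2_def[symmetric] q_def[symmetric] by (simp add: distrib_left)
    then show ?thesis by (simp only: mult_less_cancel1)
  qed
  have "a < m1'" using e1 b1 by (metis add_lessD1 mult.right_neutral mult_le_mono2 order_le_less_trans)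
  have "m2' < m1'"
  proof (cases "b = m2'")
    case True
    then have "m2' \<le> a * b" using a1 by simp
    then show ?thesis using e1 by linarith
  next
    \<comment> \<open>With a = 1 + a', b = 1 + b', m1' = a + 1 + a'' and m2' = b + 1 + b'' the
      inequalities \<open>e1\<close> and \<open>e2\<close> become b' (1 + a') < a'' and a'' (1 +
      b'') < b', which contradict each other.\<close>
    case False
    obtain a' where a': "a = 1 + a'" using a1 le_Suc_ex by (metis)
    obtain b' where b': "b = 1 + b'" using b1 le_Suc_ex by (metis)
    obtain a'' where a'': "m1' = a + 1 + a''" using \<open>a < m1'\<close> less_imp_add_positive
      by (metis Suc_eq_plus1 add.assoc le_Suc_ex Suc_leI)
    obtain b'' where b'': "m2' = b + 1 + b''" using False am
      by (metis Suc_eq_plus1 add.assoc le_Suc_ex Suc_leI le_neq_implies_less)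
    show ?thesis using e1 e2 unfolding a'' b'' by (simp add: a' b' algebra_simps)
  qed
  then show ?thesis using m1' m2' q0 by (simp add: H1_def H2_def)
qed

lemma stabilizer_Int_Un: "stabilizer G C1 \<inter> stabilizer G C2 \<subseteq> stabilizer G (C1 \<union> C2)"
  by (auto simp: stabilizer_def image_Un)

text \<open>If the bound failed, \<open>kneser_union_aux\<close> would apply to the two sets in
  either order, and each stabilizer would be strictly smaller than the other.\<close>

lemma kneser_union:
  assumes C: "finite C1" "finite C2" "C1 \<subseteq> carrier G" "C2 \<subseteq> carrier G" "C1 \<noteq> {}" "C2 \<noteq> {}"
    and m: "m \<le> card C1 + card (stabilizer G C1)" "m \<le> card C2 + card (stabilizer G C2)"
  shows "m \<le> card (C1 \<union> C2) + card (stabilizer G (C1 \<union> C2))"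
proof (rule ccontr)
  assume neg: "\<not> ?thesis"
  have n1: "\<not> C1 \<subseteq> C2" using neg m by (metis sup.absorb2)
  have n2: "\<not> C2 \<subseteq> C1" using neg m by (metis sup.absorb1)
  obtain c1 c2 where c: "c1 \<in> C1" "c1 \<notin> C2" "c2 \<in> C2" "c2 \<notin> C1" using n1 n2 by auto
  have fs: "finite (stabilizer G (C1 \<union> C2))"
    using C c by (intro stabilizer_finite(1)[of _ c1]) auto
  have "card (stabilizer G C1 \<inter> stabilizer G C2) \<le> card (stabilizer G (C1 \<union> C2))"
    using fs stabilizer_Int_Un by (rule card_mono)
  moreover have "card (C1 \<union> C2) = card C1 + card (C2 - C1)" using C
    by (metis Diff_disjoint Un_Diff_cancel card_Un_disjoint finite_Diff)
  moreover have "card (C1 \<union> C2) = card C2 + card (C1 - C2)" using C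
    by (metis Diff_disjoint Un_Diff_cancel Un_commute card_Un_disjoint finite_Diff)
  ultimately have x: "card (stabilizer G C1 \<inter> stabilizer G C2) + card (C2 - C1) < card (stabilizer G C1)"
    "card (stabilizer G C1 \<inter> stabilizer G C2) + card (C1 - C2) < card (stabilizer G C2)"
    using neg m by linarith+
  have "card (stabilizer G C2) < card (stabilizer G C1)"
    by (rule kneser_union_aux[of C1 C2 c2]) (use C c x in auto)
  moreover have "card (stabilizer G C1) < card (stabilizer G C2)"
    by (rule kneser_union_aux[of C2 C1 c1]) (use C c x in \<open>auto simp: Int_commute\<close>)
  ultimately show False by simp
qed

text \<open>Induction by the Dyson transform: the y in \<open>Y\<close> with e + y outside
  \<open>X\<close> are moved into \<open>X\<close>, which preserves the sum of the sizes and does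
  not enlarge the sumset. For e = x - y0 the point y0 stays in \<open>Y\<close>. If no such
  transform changes anything, the sumset is a translate of \<open>X\<close> stable under all
  differences y - y0, so its stabilizer is at least as large as \<open>Y\<close>.\<close>

lemma kneser_pointed:
  assumes "finite X" "finite Y" "X \<subseteq> carrier G" "Y \<subseteq> carrier G" "x0 \<in> X" "y0 \<in> Y"
  shows "\<exists>C. C \<subseteq> X <#> Y \<and> x0 \<otimes> y0 \<in> C \<and> card X + card Y \<le> card C + card (stabilizer G C)"
  using assms
proof (induction "card Y" arbitrary: X Y rule: less_induct)
  case less
  note p = less.prems
  have c0: "x0 \<in> carrier G" "y0 \<in> carrier G" using p by auto
  show ?case
  proof (cases "\<exists>x\<in>X. \<exists>y\<in>Y. x \<otimes> inv y0 \<otimes> y \<notin> X")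
    case True
    then obtain x y where xy: "x \<in> X" "y \<in> Y" "x \<otimes> inv y0 \<otimes> y \<notin> X" by auto
    define e where "e = x \<otimes> inv y0"
    have ec: "e \<in> carrier G" using xy p by (auto simp: e_def)
    define Y1 where "Y1 = {y \<in> Y. e \<otimes> y \<notin> X}"
    have Y1: "Y1 \<subseteq> Y" "finite Y1" "Y1 \<subseteq> carrier G" using p by (auto simp: Y1_def)
    have y0: "y0 \<in> Y - Y1" using p xy c0 by (auto simp: Y1_def e_def)
    have y1: "y \<in> Y1" using xy by (auto simp: Y1_def e_def)
    define X' where "X' = X \<union> (\<otimes>) e ` Y1"
    have "card (Y - Y1) < card Y" using y1 Y1 p by (intro psubset_card_mono) auto
    then have "\<exists>C. C \<subseteq> X' <#> (Y - Y1) \<and> x0 \<otimes> y0 \<in> C \<and> card X' + card (Y - Y1) \<le> card C + card (stabilizer G C)"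
    proof (rule less.hyps)
      show "X' \<subseteq> carrier G" using p Y1 ec by (auto simp: X'_def)
    qed (use p y0 Y1 in \<open>auto simp: X'_def\<close>)
    then obtain C where C: "C \<subseteq> X' <#> (Y - Y1)" "x0 \<otimes> y0 \<in> C"
      "card X' + card (Y - Y1) \<le> card C + card (stabilizer G C)" by auto
    have "card ((\<otimes>) e ` Y1) = card Y1" using card_translate ec Y1 by blast
    moreover have "X \<inter> (\<otimes>) e ` Y1 = {}" by (auto simp: Y1_def)
    ultimately have "card X' = card X + card Y1"
      unfolding X'_def using p Y1 by (subst card_Un_disjoint) auto
    moreover have "card (Y - Y1) + card Y1 = card Y"
      using Y1 p by (metis card_Diff_subset card_mono le_add_diff_inverse2)
    moreover have "X' <#> (Y - Y1) \<subseteq> X <#> Y"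
    proof
      fix w assume "w \<in> X' <#> (Y - Y1)"
      then obtain u v where w: "w = u \<otimes> v" "u \<in> X'" "v \<in> Y" "e \<otimes> v \<in> X"
        by (auto simp: set_mult_iff Y1_def)
      show "w \<in> X <#> Y"
      proof (cases "u \<in> X")
        case True then show ?thesis using w by (auto simp: set_mult_iff)
      next
        case False
        then obtain y' where y': "y' \<in> Y1" "u = e \<otimes> y'" using w by (auto simp: X'_def)
        then have "w = (e \<otimes> v) \<otimes> y'" using w p Y1 ec by (auto simp: m_ac subset_iff)
        then show ?thesis using w y' Y1 by (auto intro: set_multI)
      qed
    qed
    ultimately show ?thesis using C by (intro exI[of _ C]) auto
  next
    case False
    define C where "C = X <#> Y"
    have CX: "C \<subseteq> (\<otimes>) y0 ` X"
    proof
      fix w assume "w \<in> C"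
      then obtain x y where w: "w = x \<otimes> y" "x \<in> X" "y \<in> Y" by (auto simp: C_def set_mult_iff)
      have c: "x \<in> carrier G" "y \<in> carrier G" using w p by auto
      have "x \<otimes> inv y0 \<otimes> y \<in> X" using False w by auto
      moreover have "w = y0 \<otimes> (x \<otimes> inv y0 \<otimes> y)" using w c c0 by (simp add: abelian_simps)
      ultimately show "w \<in> (\<otimes>) y0 ` X" by blast
    qed
    have XC: "(\<otimes>) y0 ` X \<subseteq> C"
    proof
      fix w assume "w \<in> (\<otimes>) y0 ` X"
      then obtain x where x: "x \<in> X" "w = y0 \<otimes> x" by auto
      then have "w = x \<otimes> y0" using c0 p m_comm by auto
      then show "w \<in> C" using x p by (auto simp: C_def intro: set_multI)
    qed
    have CXe: "C = (\<otimes>) y0 ` X" using CX XC by auto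
    have Cc: "C \<subseteq> carrier G" "finite C" using p c0 CXe by auto
    have mem: "inv y0 \<otimes> y \<in> stabilizer G C" if "y \<in> Y" for y
    proof (rule stabilizerI)
      fix w assume "w \<in> C"
      then obtain x where x: "x \<in> X" "w = y0 \<otimes> x" using CXe by auto
      then have "x \<otimes> inv y0 \<otimes> y \<in> X" using False that by auto
      moreover have "inv y0 \<otimes> y \<otimes> w = y0 \<otimes> (x \<otimes> inv y0 \<otimes> y)"
        using x p that c0 by (auto simp: abelian_simps subset_iff)
      ultimately show "inv y0 \<otimes> y \<otimes> w \<in> C" using CXe by auto
    qed (use Cc that p c0 in auto)
    have "card Y \<le> card (stabilizer G C)"
    proof -
      have "card ((\<otimes>) (inv y0) ` Y) = card Y" using card_translate c0 p by auto
      moreover have "(\<otimes>) (inv y0) ` Y \<subseteq> stabilizer G C" using mem by auto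
      moreover have "finite (stabilizer G C)"
        using Cc p by (intro stabilizer_finite(1)[of _ "x0 \<otimes> y0"]) (auto simp: C_def intro: set_multI)
      ultimately show ?thesis by (metis card_mono)
    qed
    moreover have "card C = card X" unfolding CXe using card_translate c0 p by blast
    ultimately show ?thesis using p by (intro exI[of _ C]) (auto simp: C_def intro: set_multI)
  qed
qed

text \<open>The sets provided by \<open>kneser_pointed\<close> cover the sumset, and their common
  property passes to finite unions by \<open>kneser_union\<close>.\<close>

theorem kneser:
  assumes "finite X" "finite Y" "X \<subseteq> carrier G" "Y \<subseteq> carrier G" "X \<noteq> {}" "Y \<noteq> {}"
  shows "card X + card Y \<le> card (X <#> Y) + card (stabilizer G (X <#> Y))"
proof -
  define F where "F = {C. C \<subseteq> X <#> Y \<and> C \<noteq> {} \<and> card X + card Y \<le> card C + card (stabilizer G C)}"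
  have fin: "finite (X <#> Y)" "X <#> Y \<subseteq> carrier G"
    using assms by (auto intro: finite_set_mult simp: setmult_subset_G)
  have finF: "finite F" using fin by (auto simp: F_def)
  have un: "X <#> Y = \<Union>F"
  proof
    show "X <#> Y \<subseteq> \<Union>F"
    proof
      fix w assume "w \<in> X <#> Y"
      then obtain x y where "x \<in> X" "y \<in> Y" "w = x \<otimes> y" by (auto simp: set_mult_iff)
      then obtain C where "C \<subseteq> X <#> Y" "w \<in> C" "card X + card Y \<le> card C + card (stabilizer G C)"
        using kneser_pointed[OF assms(1-4), of x y] by blast
      then show "w \<in> \<Union>F" unfolding F_def by blast
    qed
  qed (auto simp: F_def)
  have Fne: "F \<noteq> {}" using un assms by (auto simp: set_mult_def)
  have "F' \<noteq> {} \<Longrightarrow> F' \<subseteq> F \<Longrightarrow> \<Union>F' \<in> F" if "finite F'" for F'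
    using that
  proof (induction rule: finite_induct)
    case (insert C F')
    show ?case
    proof (cases "F' = {}")
      case True then show ?thesis using insert by simp
    next
      case False
      then have "\<Union>F' \<in> F" "C \<in> F" using insert by auto
      moreover have "C1 \<union> C2 \<in> F" if "C1 \<in> F" "C2 \<in> F" for C1 C2
      proof -
        have C: "C1 \<subseteq> X <#> Y" "C1 \<noteq> {}" "card X + card Y \<le> card C1 + card (stabilizer G C1)"
          "C2 \<subseteq> X <#> Y" "C2 \<noteq> {}" "card X + card Y \<le> card C2 + card (stabilizer G C2)"
          using that by (auto simp: F_def)
        have "finite C1" "finite C2" "C1 \<subseteq> carrier G" "C2 \<subseteq> carrier G"
          using C(1,4) fin finite_subset by blast+
        then show ?thesis using kneser_union[of C1 C2 "card X + card Y"] C by (simp add: F_def)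
      qed
      ultimately show ?thesis by simp
    qed
  qed simp
  then have "\<Union>F \<in> F" using finF Fne by blast
  then have "X <#> Y \<in> F" unfolding un[symmetric] .
  then show ?thesis by (simp add: F_def)
qed

end

lemma card_2_pointed:
  assumes "card X = 2" "x \<in> X"
  obtains y where "y \<noteq> x" "X = {x, y}"
proof -
  obtain a b where "X = {a, b}" "a \<noteq> b" using assms(1) by (auto simp: card_2_iff)
  then show ?thesis using that[of a] that[of b] assms(2) by (metis insertE insert_commute singletonD)
qed

context comm_group
begin

lemma stabilizer_absorb:
  assumes "X \<subseteq> carrier G"
  shows "X <#> stabilizer G X = X"
proof
  show "X <#> stabilizer G X \<subseteq> X"
  proof
    fix w assume "w \<in> X <#> stabilizer G X"
    then obtain x k where w: "x \<in> X" "k \<in> stabilizer G X" "w = x \<otimes> k" by (auto simp: set_mult_iff)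
    then have "w = k \<otimes> x" using assms stabilizer_subset m_comm by (metis subsetD)
    then show "w \<in> X" using w stabilizer_mult by simp
  qed
  show "X \<subseteq> X <#> stabilizer G X"
  proof
    fix x assume "x \<in> X"
    then have "x \<otimes> \<one> \<in> X <#> stabilizer G X"
      using subgroup.one_closed[OF stabilizer_subgroup[OF assms]] by (rule set_multI)
    then show "x \<in> X <#> stabilizer G X" using \<open>x \<in> X\<close> assms by (simp add: subset_iff)
  qed
qed

lemma subset_set_mult_one:
  assumes "X \<subseteq> carrier G" "\<one> \<in> Y" shows "X \<subseteq> X <#> Y"
proof
  fix x assume "x \<in> X"
  then have "x \<otimes> \<one> \<in> X <#> Y" using assms(2) by (rule set_multI)
  then show "x \<in> X <#> Y" using \<open>x \<in> X\<close> assms(1) by (simp add: subset_iff)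
qed

text \<open>Apply \<open>kneser\<close> to \<open>X <#> K\<close> and \<open>Y <#> K\<close>, which
  have the same sumset as \<open>X\<close> and \<open>Y\<close>.\<close>

theorem kneser_strong:
  assumes "finite X" "finite Y" "X \<subseteq> carrier G" "Y \<subseteq> carrier G" "X \<noteq> {}" "Y \<noteq> {}"
  defines "K \<equiv> stabilizer G (X <#> Y)"
  shows "card (X <#> K) + card (Y <#> K) \<le> card (X <#> Y) + card K"
    and "finite K" "subgroup K G" "X <#> Y <#> K = X <#> Y"
proof -
  have XY: "X <#> Y \<subseteq> carrier G" "finite (X <#> Y)" "X <#> Y \<noteq> {}"
    using assms by (auto simp: setmult_subset_G finite_set_mult) (auto simp: set_mult_def)
  show sg: "subgroup K G" unfolding K_def using XY by (intro stabilizer_subgroup)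
  have Kc: "K \<subseteq> carrier G" using sg by (rule subgroup.subset)
  show finK: "finite K" unfolding K_def using XY stabilizer_finite by blast
  show XYK: "X <#> Y <#> K = X <#> Y" unfolding K_def using XY by (intro stabilizer_absorb)
  have "(X <#> K) <#> (Y <#> K) = X <#> Y <#> K <#> K"
    using assms(3,4) Kc by (metis set_mult_assoc set_mult_comm setmult_subset_G)
  then have eq: "(X <#> K) <#> (Y <#> K) = X <#> Y" using XYK by simp
  show "card (X <#> K) + card (Y <#> K) \<le> card (X <#> Y) + card K"
    using kneser[of "X <#> K" "Y <#> K"] assms finK Kc eq sg
    by (simp add: finite_set_mult setmult_subset_G K_def)
      (metis empty_subsetI set_mult_comm stabilizer_subset subset_set_mult_one subgroup.one_closed subset_empty)
qed

subsection \<open>Sets with a small sumset\<close>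

definition k_sep2 :: "'a set \<Rightarrow> 'a set \<Rightarrow> 'a set \<Rightarrow> bool" where
  "k_sep2 Q B X \<longleftrightarrow> X \<subseteq> Q \<and> finite X \<and> 2 \<le> card X \<and> (infinite Q \<or> card (X <#> B) + 2 \<le> card Q)"

lemma m_inv_image_subset: "X \<subseteq> carrier G \<Longrightarrow> m_inv G ` X \<subseteq> carrier G"
  by auto

lemma m_inv_m_inv_image: "X \<subseteq> carrier G \<Longrightarrow> m_inv G ` m_inv G ` X = X"
  by (auto simp: image_iff subset_iff)

lemma card_m_inv_image: "X \<subseteq> carrier G \<Longrightarrow> card (m_inv G ` X) = card X"
  by (intro card_image inj_onI) (metis inv_inv subsetD)

lemma m_inv_image_set_mult:
  assumes "X \<subseteq> carrier G" "Y \<subseteq> carrier G"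
  shows "m_inv G ` (X <#> Y) = (m_inv G ` X) <#> (m_inv G ` Y)"
proof (intro equalityI subsetI)
  fix w assume "w \<in> m_inv G ` (X <#> Y)"
  then obtain x y where w: "x \<in> X" "y \<in> Y" "w = inv (x \<otimes> y)" by (auto simp: set_mult_iff)
  then have "w = inv x \<otimes> inv y" using assms by (metis inv_mult subsetD)
  then show "w \<in> (m_inv G ` X) <#> (m_inv G ` Y)" using w by (auto intro: set_multI)
next
  fix w assume "w \<in> (m_inv G ` X) <#> (m_inv G ` Y)"
  then obtain x y where w: "x \<in> X" "y \<in> Y" "w = inv x \<otimes> inv y" by (auto simp: set_mult_iff)
  then have "w = inv (x \<otimes> y)" using assms by (metis inv_mult subsetD)
  then show "w \<in> m_inv G ` (X <#> Y)" using w by (auto intro: set_multI)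
qed

lemma m_inv_image_subgroup:
  assumes "subgroup K G" shows "m_inv G ` K = K"
proof -
  have "m_inv G ` K \<subseteq> K" using assms subgroup.m_inv_closed by fastforce
  moreover have "K \<subseteq> m_inv G ` K"
    using m_inv_m_inv_image[of K] calculation subgroup.subset[OF assms] by blast
  ultimately show ?thesis by auto
qed

lemma generate_m_inv:
  assumes "X \<subseteq> carrier G" shows "generate G (m_inv G ` X) = generate G X"
proof -
  have 1: "generate G (m_inv G ` Y) \<subseteq> generate G Y" if "Y \<subseteq> carrier G" for Y
  proof (rule generate_subgroup_incl)
    show "subgroup (generate G Y) G" using that by (rule generate_is_subgroup)
    show "m_inv G ` Y \<subseteq> generate G Y"
      by (auto intro: generate.inv)
  qed
  from 1[OF assms] 1[OF m_inv_image_subset[OF assms]] show ?thesis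
    using m_inv_m_inv_image[OF assms] by auto
qed

text \<open>
  The minimization ranges over \<open>B\<close> and its inverse simultaneously: in a finite group the complement of
  a fragment is a fragment of the inverse set, so the minimal one is no larger than its complement.
\<close>

lemma atom_exists:
  assumes B: "finite B" "B \<subseteq> carrier G" "\<one> \<in> B" and Q: "Q = generate G B"
    and X: "k_sep2 Q B X" "card (X <#> B) + 1 \<le> card X + card B"
  obtains B' M where "B' = B \<or> B' = m_inv G ` B" "k_sep2 Q B' M" "\<one> \<in> M"
    "card (M <#> B') + 1 \<le> card M + card B"
    "\<And>g. g \<in> carrier G \<Longrightarrow> (\<otimes>) g ` M \<noteq> M \<Longrightarrow> card (M \<inter> (\<otimes>) g ` M) \<le> 1"
proof -
  define \<B> where "\<B> = {B, m_inv G ` B}"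
  have sgQ: "subgroup Q G" unfolding Q using B(2) by (rule generate_is_subgroup)
  interpret Q: subgroup Q G by fact
  have BB: "finite B'" "B' \<subseteq> Q" "\<one> \<in> B'" "card B' = card B" "m_inv G ` B' \<in> \<B>" if "B' \<in> \<B>" for B'
    using that B generate.incl[of _ B G] generate.inv[of _ B G] card_m_inv_image m_inv_m_inv_image
    by (auto simp: \<B>_def Q image_iff) (metis inv_one)
  define P where "P = (\<lambda>(B', Y). B' \<in> \<B> \<and> k_sep2 Q B' Y)"
  define bd where "bd = (\<lambda>(B', Y). card (Y <#> B') - card Y)"
  have P0: "P (B, X)" using X by (auto simp: P_def \<B>_def)
  \<comment> \<open>A lexicographic minimum over both sets: the smallest boundary first, and then
    the smallest cardinality.\<close>
  obtain p0 where p0: "P p0" "\<And>p. P p \<Longrightarrow> bd p0 \<le> bd p"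
    using ex_has_least_nat[of P "(B, X)" bd] P0 by auto
  obtain p1 where p1: "P p1 \<and> bd p1 = bd p0" "\<And>p. P p \<and> bd p = bd p0 \<Longrightarrow> card (snd p1) \<le> card (snd p)"
    using ex_has_least_nat[of "\<lambda>p. P p \<and> bd p = bd p0" p0 "\<lambda>p. card (snd p)"] p0 by auto
  obtain B' M0 where p1e: "p1 = (B', M0)" by (cases p1)
  have B': "B' \<in> \<B>" and sep0: "k_sep2 Q B' M0" using p1 p1e by (auto simp: P_def)
  obtain m0 where m0: "m0 \<in> M0" using sep0 by (cases "M0 = {}") (auto simp: k_sep2_def)
  have m0c: "m0 \<in> Q" using m0 sep0 by (auto simp: k_sep2_def)
  define M where "M = (\<otimes>) (inv m0) ` M0"
  have Bc: "B' \<subseteq> carrier G" using BB[OF B'] Q.subset by blast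
  have M0c: "M0 \<subseteq> carrier G" using sep0 Q.subset by (auto simp: k_sep2_def)
  have cge: "card Y \<le> card (Y <#> B1)" if "B1 \<in> \<B>" "finite Y" "Y \<subseteq> Q" for Y B1
    using BB[OF that(1)] that Q.subset by (intro card_set_mult_ge_left) auto
  have bdM: "card (M <#> B') = card (M0 <#> B')" "card M = card M0"
  proof -
    show "card M = card M0" unfolding M_def using m0c M0c by (intro card_translate) auto
    have "M <#> B' = (\<otimes>) (inv m0) ` (M0 <#> B')"
      unfolding M_def using m0c M0c Bc by (intro set_mult_translate) auto
    then show "card (M <#> B') = card (M0 <#> B')"
      using card_translate[of "inv m0" "M0 <#> B'"] m0c M0c Bc by (simp add: setmult_subset_G)
  qed
  have sep: "k_sep2 Q B' M"
    using sep0 m0c bdM unfolding k_sep2_def by (auto simp: M_def)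
  have PM: "P (B', M)" using sep B' by (simp add: P_def)
  have Mprops: "M \<subseteq> Q" "finite M" "2 \<le> card M" using sep by (auto simp: k_sep2_def)
  have Mc: "M \<subseteq> carrier G" using Mprops Q.subset by blast
  have min1: "card (M <#> B') + card Y \<le> card (Y <#> B1) + card M" if "B1 \<in> \<B>" "k_sep2 Q B1 Y" for B1 Y
  proof -
    have "bd (B', M0) \<le> bd (B1, Y)" using p0(2)[of "(B1, Y)"] p1 p1e that by (auto simp: P_def)
    moreover have "card Y \<le> card (Y <#> B1)" using cge that by (auto simp: k_sep2_def)
    moreover have "card M \<le> card (M <#> B')" using cge[OF B'] Mprops by auto
    ultimately show ?thesis using bdM by (auto simp: bd_def)
  qed
  have min2: "card M \<le> card Y" if "B1 \<in> \<B>" "k_sep2 Q B1 Y" "card (Y <#> B1) + card M \<le> card (M <#> B') + card Y" for B1 Y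
  proof -
    have "card Y \<le> card (Y <#> B1)" using cge that by (auto simp: k_sep2_def)
    moreover have "card M \<le> card (M <#> B')" using cge[OF B'] Mprops by auto
    ultimately have "bd (B1, Y) = bd (B', M0)" using that(3) min1[OF that(1,2)] bdM by (auto simp: bd_def)
    then show ?thesis using p1 p1e bdM that by (auto simp: P_def)
  qed
  \<comment> \<open>The complement Y of M + B' satisfies Y - B' \<subseteq> Q - M, so it is
    separating for the inverse set with no larger boundary, and minimality gives card M \<le> card
    Y.\<close>
  have comp: "card (M <#> B') + card M \<le> card Q" if "finite Q"
  proof -
    define Y where "Y = Q - (M <#> B')"
    define B1 where "B1 = m_inv G ` B'"
    have B1: "B1 \<in> \<B>" using BB[OF B'] by (simp add: B1_def)
    have MBQ: "M <#> B' \<subseteq> Q" using Mprops BB[OF B'] by (auto simp: set_mult_iff subset_iff)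
    have cY: "card Y + card (M <#> B') = card Q"
      unfolding Y_def using MBQ that by (metis card_Diff_subset card_mono finite_subset le_add_diff_inverse2)
    have sub: "Y <#> B1 \<subseteq> Q - M"
    proof
      fix w assume "w \<in> Y <#> B1"
      then obtain y b where w: "y \<in> Y" "b \<in> B'" "w = y \<otimes> inv b" by (auto simp: set_mult_iff B1_def)
      have c: "y \<in> carrier G" "b \<in> carrier G" using w Bc Q.subset by (auto simp: Y_def)
      have "w \<in> Q" using w BB[OF B'] by (auto simp: Y_def subset_iff)
      moreover have "w \<notin> M"
      proof
        assume "w \<in> M"
        then have "w \<otimes> b \<in> M <#> B'" using w by (intro set_multI)
        moreover have "w \<otimes> b = y" using w c by simp
        ultimately show False using w by (simp add: Y_def)
      qed
      ultimately show "w \<in> Q - M" by simp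
    qed
    have "card (Y <#> B1) \<le> card (Q - M)" using sub that by (intro card_mono) auto
    then have c1: "card (Y <#> B1) + card M \<le> card Q"
      using Mprops that by (metis card_Diff_subset card_mono le_diff_conv2 finite_subset)
    have "k_sep2 Q B1 Y"
      using cY sep that c1 Mprops unfolding k_sep2_def by (auto simp: Y_def)
    then have "card M \<le> card Y" using min2[OF B1] c1 cY by auto
    then show ?thesis using cY by simp
  qed
  \<comment> \<open>Submodularity for \<open>M\<close> and its translate. An intersection with two
    elements is separating and smaller than \<open>M\<close>, so its boundary is strictly larger;
    then the union has a strictly smaller boundary. By \<open>comp\<close> the union still leaves
    two elements outside its sumset, against minimality.\<close>
  have inter: "card (M \<inter> (\<otimes>) g ` M) \<le> 1" if g: "g \<in> carrier G" "(\<otimes>) g ` M \<noteq> M" for g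
  proof (rule ccontr)
    assume big: "\<not> ?thesis"
    define M' where "M' = (\<otimes>) g ` M"
    define D where "D = M \<inter> M'"
    define U where "U = M \<union> M'"
    have cM': "card M' = card M" unfolding M'_def using g Mc by (intro card_translate) auto
    have finM': "finite M'" using Mprops by (simp add: M'_def)
    have gQ: "g \<in> Q"
    proof -
      have "D \<noteq> {}" using big unfolding D_def M'_def by (metis card.empty zero_le)
      then obtain w where "w \<in> D" by auto
      then obtain m where m: "m \<in> M" "g \<otimes> m \<in> M" by (auto simp: D_def M'_def)
      then have "g = g \<otimes> m \<otimes> inv m" using g Mc by (auto simp: subset_iff)
      then show ?thesis using m Mprops by (metis Q.m_closed Q.m_inv_closed subsetD)
    qed
    have M'Q: "M' \<subseteq> Q" using gQ Mprops by (auto simp: M'_def)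
    have cMB': "card (M' <#> B') = card (M <#> B')"
      unfolding M'_def using set_mult_translate[OF g(1) Mc Bc] card_translate[of g "M <#> B'"] g Mc Bc
      by (simp add: setmult_subset_G)
    have fB: "finite B'" using BB[OF B'] by simp
    have "D \<noteq> M"
    proof
      assume "D = M"
      then have "M \<subseteq> M'" by (auto simp: D_def)
      then show False using cM' finM' g card_subset_eq[of M' M] by (auto simp: M'_def)
    qed
    then have cD: "card D < card M" unfolding D_def using Mprops by (intro psubset_card_mono) auto
    have cDU: "card D + card U = 2 * card M"
      unfolding D_def U_def using card_Un_Int[of M M'] Mprops finM' cM' by simp
    have "D <#> B' \<subseteq> (M <#> B') \<inter> (M' <#> B')"
      unfolding D_def by (intro Int_greatest mono_set_mult) auto
    then have "card (D <#> B') \<le> card ((M <#> B') \<inter> (M' <#> B'))"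
      using Mprops fB by (intro card_mono) (auto intro: finite_set_mult)
    moreover have "U <#> B' = (M <#> B') \<union> (M' <#> B')" by (auto simp: U_def set_mult_def)
    ultimately have sm: "card (D <#> B') + card (U <#> B') \<le> 2 * card (M <#> B')"
      using card_Un_Int[of "M <#> B'" "M' <#> B'"] cMB' Mprops finM' fB by (simp add: finite_set_mult)
    have "D <#> B' \<subseteq> M <#> B'" unfolding D_def by (intro mono_set_mult) auto
    then have "card (D <#> B') \<le> card (M <#> B')"
      using Mprops fB by (intro card_mono) (auto intro: finite_set_mult)
    then have sepD: "k_sep2 Q B' D"
      using sep big unfolding k_sep2_def D_def M'_def by auto
    have bdD: "card (M <#> B') + card D < card (D <#> B') + card M"
      using min2[OF B' sepD] cD by fastforce
    have "k_sep2 Q B' U"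
    proof -
      have "card (U <#> B') + 2 \<le> card Q" if "finite Q"
        using comp[OF that] sm bdD big cD by (simp add: D_def M'_def)
      moreover have "card M \<le> card U" unfolding U_def using Mprops finM' by (intro card_mono) auto
      ultimately show ?thesis using Mprops M'Q finM' by (auto simp: k_sep2_def U_def)
    qed
    then have "card (M <#> B') + card U \<le> card (U <#> B') + card M" using min1[OF B'] by blast
    then show False using bdD sm cDU by linarith
  qed
  have "card (M <#> B') + card X \<le> card (X <#> B) + card M"
    using min1[of B X] X by (auto simp: \<B>_def)
  then have le: "card (M <#> B') + 1 \<le> card M + card B" using X(2) by linarith
  have "\<one> \<in> M" using m0 m0c by (auto simp: M_def image_iff intro!: bexI[of _ m0])
  then show ?thesis using that[of B' M] B' sep le inter by (auto simp: \<B>_def)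
qed

text \<open>L + M contains two cosets of \<open>L\<close>, and it contains \<open>M\<close> together
  with a translate meeting it in at most one point. Adding |L + M| \<ge> 2 |L| and |L + M| \<ge> 2
  |M| - 1 and halving gives the claim; parity absorbs the lost unit.\<close>

lemma atom_no_subgroup:
  assumes M: "finite M" "M \<subseteq> carrier G" "\<one> \<in> M"
    and atom: "\<And>g. g \<in> carrier G \<Longrightarrow> g \<noteq> \<one> \<Longrightarrow> card (M \<inter> (\<otimes>) g ` M) \<le> 1"
    and L: "subgroup L G" "finite L" "2 \<le> card L" "\<not> M \<subseteq> L"
  shows "card L + card M \<le> card (L <#> M)"
proof (rule ccontr)
  assume neg: "\<not> ?thesis"
  interpret L: subgroup L G by fact
  obtain m where m: "m \<in> M" "m \<notin> L" using L by auto
  have mc: "m \<in> carrier G" using m M by auto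
  have "\<exists>x\<in>L. x \<noteq> \<one>"
  proof (rule ccontr)
    assume "\<not> ?thesis"
    then have "L \<subseteq> {\<one>}" by auto
    then have "card L \<le> 1" using card_mono[of "{\<one>}" L] by simp
    then show False using L by simp
  qed
  then obtain x where x: "x \<in> L" "x \<noteq> \<one>" by auto
  have fin: "finite (L <#> M)" using L M by (simp add: finite_set_mult)
  have 1: "L \<subseteq> L <#> M" using M by (intro subset_set_mult_one) auto
  have 2: "(\<otimes>) m ` L \<subseteq> L <#> M"
  proof
    fix w assume "w \<in> (\<otimes>) m ` L"
    then obtain l where l: "l \<in> L" "w = m \<otimes> l" by auto
    then have "w = l \<otimes> m" using mc m_comm by auto
    then show "w \<in> L <#> M" using l m by (auto intro: set_multI)
  qed
  have "L \<inter> (\<otimes>) m ` L = {}"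
  proof -
    have False if "l \<in> L" "m \<otimes> l \<in> L" for l
    proof -
      have "m = m \<otimes> l \<otimes> inv l" using that mc by simp
      then show False using that m by (metis L.m_closed L.m_inv_closed)
    qed
    then show ?thesis by auto
  qed
  then have "card (L \<union> (\<otimes>) m ` L) = 2 * card L"
    using L card_translate[OF mc, of L] L.subset by (simp add: card_Un_disjoint)
  then have 3: "2 * card L \<le> card (L <#> M)"
    using card_mono[OF fin, of "L \<union> (\<otimes>) m ` L"] 1 2 by simp
  have "M \<union> (\<otimes>) x ` M \<subseteq> L <#> M"
    using M x subset_set_mult_one[of M L] set_mult_comm[of M L] L.subset by (auto intro: set_multI)
  then have "card (M \<union> (\<otimes>) x ` M) \<le> card (L <#> M)" using fin by (rule card_mono[rotated])
  moreover have "card (M \<union> (\<otimes>) x ` M) + card (M \<inter> (\<otimes>) x ` M) = 2 * card M"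
    using card_Un_Int[of M "(\<otimes>) x ` M"] M card_translate[of x M] x by simp
  moreover have "card (M \<inter> (\<otimes>) x ` M) \<le> 1" using atom x by auto
  ultimately show False using 3 neg by linarith
qed

text \<open>
  The result is the description of sets with a small sumset by Hamidoune's \<open>2\<close>-atoms: either the
  \<open>2\<close>-atom has two elements, or it generates a subgroup witnessing the second alternative.
\<close>

theorem small_sumset_dichotomy:
  assumes "finite B" "B \<subseteq> carrier G" "\<one> \<in> B" "2 \<le> card B"
    and "k_sep2 (generate G B) B X" "card (X <#> B) + 1 \<le> card X + card B"
  shows "(\<exists>x\<in>carrier G. x \<noteq> \<one> \<and> card B \<le> card (B \<inter> (\<otimes>) x ` B) + 1) \<or>
    (\<exists>L. subgroup L G \<and> finite L \<and> 2 \<le> card L \<and> \<not> B \<subseteq> L \<and> card (L <#> B) + 1 \<le> card L + card B)"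
  using assms
proof (induction "card B" arbitrary: B X rule: less_induct)
  case less
  define Q where "Q = generate G B"
  have sgQ: "subgroup Q G" unfolding Q_def using less.prems by (intro generate_is_subgroup)
  interpret Q: subgroup Q G by fact
  define goal where "goal = (\<lambda>B. (\<exists>x\<in>carrier G. x \<noteq> \<one> \<and> card B \<le> card (B \<inter> (\<otimes>) x ` B) + 1) \<or>
    (\<exists>L. subgroup L G \<and> finite L \<and> 2 \<le> card L \<and> \<not> B \<subseteq> L \<and> card (L <#> B) + 1 \<le> card L + card B))"
  \<comment> \<open>The atom may belong to the inverse set; both alternatives are invariant under
    inversion and so pass back to \<open>B\<close>.\<close>
  have goal_inv: "goal C" if g: "goal (m_inv G ` C)" and C: "C \<subseteq> carrier G" for C
  proof -
    have cI: "card (m_inv G ` C) = card C" using C by (rule card_m_inv_image)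
    from g consider x where "x \<in> carrier G" "x \<noteq> \<one>" "card C \<le> card (m_inv G ` C \<inter> (\<otimes>) x ` m_inv G ` C) + 1"
      | L where "subgroup L G" "finite L" "2 \<le> card L" "\<not> m_inv G ` C \<subseteq> L" "card (L <#> (m_inv G ` C)) + 1 \<le> card L + card C"
      unfolding goal_def cI by blast
    then show ?thesis
    proof cases
      case 1
      have "m_inv G ` C \<inter> (\<otimes>) x ` m_inv G ` C = m_inv G ` (C \<inter> (\<otimes>) (inv x) ` C)"
      proof (intro equalityI subsetI)
        fix w assume "w \<in> m_inv G ` C \<inter> (\<otimes>) x ` m_inv G ` C"
        then obtain c d where w: "c \<in> C" "d \<in> C" "w = inv c" "w = x \<otimes> inv d" by auto
        have cd: "c \<in> carrier G" "d \<in> carrier G" using w C by auto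
        have "c = inv (x \<otimes> inv d)" using w cd 1 by (metis inv_inv)
        then have "c = inv x \<otimes> d" using cd 1 inv_mult[of x "inv d"] by simp
        then show "w \<in> m_inv G ` (C \<inter> (\<otimes>) (inv x) ` C)" using w by blast
      next
        fix w assume "w \<in> m_inv G ` (C \<inter> (\<otimes>) (inv x) ` C)"
        then obtain c d where w: "c \<in> C" "d \<in> C" "c = inv x \<otimes> d" "w = inv c" by auto
        have "d \<in> carrier G" using w C by auto
        then have "w = x \<otimes> inv d" using w 1 inv_mult[of "inv x" d] by simp
        then show "w \<in> m_inv G ` C \<inter> (\<otimes>) x ` m_inv G ` C" using w by blast
      qed
      moreover have "card (m_inv G ` (C \<inter> (\<otimes>) (inv x) ` C)) = card (C \<inter> (\<otimes>) (inv x) ` C)"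
        using C by (intro card_m_inv_image) auto
      ultimately show ?thesis using 1 unfolding goal_def by (intro disjI1 bexI[of _ "inv x"]) auto
    next
      case 2
      have Lc: "L \<subseteq> carrier G" using 2(1) by (rule subgroup.subset)
      have "L <#> (m_inv G ` C) = m_inv G ` (L <#> C)"
        using m_inv_image_set_mult[OF Lc C] m_inv_image_subgroup[OF 2(1)] by simp
      then have "card (L <#> (m_inv G ` C)) = card (L <#> C)"
        using card_m_inv_image[OF setmult_subset_G[OF Lc C]] by simp
      moreover have "\<not> C \<subseteq> L" using 2 by (auto intro: subgroup.m_inv_closed)
      ultimately show ?thesis using 2 unfolding goal_def by (intro disjI2 exI[of _ L]) simp
    qed
  qed
  obtain B' M where BM: "B' = B \<or> B' = m_inv G ` B" "k_sep2 Q B' M" "\<one> \<in> M"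
    "card (M <#> B') + 1 \<le> card M + card B"
    and inter: "\<And>g. g \<in> carrier G \<Longrightarrow> (\<otimes>) g ` M \<noteq> M \<Longrightarrow> card (M \<inter> (\<otimes>) g ` M) \<le> 1"
    using atom_exists[of B Q X] less.prems Q_def by blast
  have B': "finite B'" "B' \<subseteq> carrier G" "\<one> \<in> B'" "card B' = card B" "generate G B' = Q"
    using BM(1) less.prems card_m_inv_image[of B] generate_m_inv[of B] by (auto simp: Q_def image_iff) (metis inv_one)+
  have BQ: "B' \<subseteq> Q" unfolding B'(5)[symmetric] by (auto intro: generate.incl)
  have M: "M \<subseteq> Q" "finite M" "2 \<le> card M" using BM(2) by (auto simp: k_sep2_def)
  have Mc: "M \<subseteq> carrier G" using M Q.subset by blast
  have ext: "M <#> B' \<noteq> Q"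
    using BM(2) finite_set_mult[OF M(2) B'(1)] unfolding k_sep2_def by (metis Suc_n_not_le_n add_2_eq_Suc' le_SucI)
  have MBQ: "M <#> B' \<subseteq> Q" using M BQ by (auto simp: set_mult_iff subset_iff)
  have "goal B'"
  proof (cases "\<exists>g\<in>carrier G. g \<noteq> \<one> \<and> (\<otimes>) g ` M = M")
    case True
    then obtain g where g: "g \<in> carrier G" "g \<noteq> \<one>" "(\<otimes>) g ` M = M" by auto
    \<comment> \<open>For every m in \<open>M\<close>, a period g of \<open>M\<close> puts both m
      and m g into the intersection of \<open>M\<close> with its translate by m. So all these
      translates equal \<open>M\<close>, and \<open>M\<close> is a subgroup.\<close>
    have Mst: "M \<subseteq> stabilizer G M"
    proof
      fix m assume m: "m \<in> M"
      have mc: "m \<in> carrier G" using m Mc by auto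
      show "m \<in> stabilizer G M"
      proof (rule ccontr)
        assume "m \<notin> stabilizer G M"
        then have "card (M \<inter> (\<otimes>) m ` M) \<le> 1" using inter mc by (auto simp: stabilizer_def)
        moreover have "{m, m \<otimes> g} \<subseteq> M \<inter> (\<otimes>) m ` M"
        proof -
          have "g \<in> stabilizer G M" using g by (simp add: stabilizer_def)
          then have "g \<otimes> m \<in> M" "g \<otimes> \<one> \<in> M" using m BM(3) stabilizer_mult by blast+
          then have "m \<otimes> g \<in> M" "g \<in> M" using m_comm[of m g] mc g by auto
          moreover have "m = m \<otimes> \<one>" using mc by simp
          ultimately show ?thesis using m BM(3) by blast
        qed
        then have "card {m, m \<otimes> g} \<le> card (M \<inter> (\<otimes>) m ` M)" using M by (intro card_mono) auto
        moreover have "m \<noteq> m \<otimes> g" using mc g by simp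
        ultimately show False by simp
      qed
    qed
    have "stabilizer G M \<subseteq> M"
    proof
      fix x assume "x \<in> stabilizer G M"
      then have "x \<otimes> \<one> \<in> M" "x \<in> carrier G" using BM(3) stabilizer_mult stabilizer_subset by blast+
      then show "x \<in> M" by simp
    qed
    then have sgM: "subgroup M G" using Mst stabilizer_subgroup[OF Mc] by simp
    moreover have "\<not> B' \<subseteq> M"
    proof
      assume BsM: "B' \<subseteq> M"
      then have "Q \<subseteq> M" using generate_subgroup_incl[OF BsM sgM] B'(5) by simp
      moreover have "M \<subseteq> M <#> B'" using subset_set_mult_one Mc B' by simp
      ultimately show False using ext MBQ by blast
    qed
    ultimately show ?thesis unfolding goal_def using M BM(4) B'(4) by (intro disjI2 exI[of _ M]) simp
  next
    case False
    then have atom: "card (M \<inter> (\<otimes>) g ` M) \<le> 1" if "g \<in> carrier G" "g \<noteq> \<one>" for g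
      using that inter by blast
    show ?thesis
    proof (cases "card M = 2")
      case True
      then obtain m where m: "m \<noteq> \<one>" "M = {\<one>, m}" using BM(3) by (metis card_2_pointed)
      have mc: "m \<in> carrier G" using m Mc by auto
      have "M <#> B' = B' \<union> (\<otimes>) m ` B'"
        unfolding m(2) using translate_one[OF B'(2)] by (auto simp: set_mult_def)
      moreover have "card (B' \<union> (\<otimes>) m ` B') + card (B' \<inter> (\<otimes>) m ` B') = 2 * card B'"
        using card_Un_Int[of B' "(\<otimes>) m ` B'"] B' card_translate[OF mc B'(2)] by simp
      ultimately have "card B' \<le> card (B' \<inter> (\<otimes>) m ` B') + 1" using BM(4) True B'(4) by simp
      then show ?thesis unfolding goal_def using m mc by blast
    next
      case M3: False
      then have M3: "3 \<le> card M" using M by simp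
      have no_sub: "card L + card M \<le> card (L <#> M)"
        if "subgroup L G" "finite L" "2 \<le> card L" "\<not> M \<subseteq> L" for L
        using atom_no_subgroup[of M L] M Mc BM(3) atom that by blast
      define N where "N = generate G M"
      have sgN: "subgroup N G" unfolding N_def using Mc by (rule generate_is_subgroup)
      interpret N: subgroup N G by fact
      have MN: "M \<subseteq> N" unfolding N_def by (auto intro: generate.incl)
      have NQ: "N \<subseteq> Q" unfolding N_def using M(1) sgQ by (rule generate_subgroup_incl)
      \<comment> \<open>From here \<open>M\<close> and B' exchange roles, \<open>M\<close> being the
        fixed summand. If the sum of Z and \<open>M\<close> loses two or more, Kneser's theorem
        yields a period K with |K + M| < |K| + |M|; by \<open>no_sub\<close> this K contains
        \<open>M\<close>, hence all of \<open>N\<close>.\<close>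
      have kn: "N \<subseteq> stabilizer G (Z <#> M) \<or> card Z + card M \<le> card (Z <#> M) + 1"
        if Z: "finite Z" "Z \<subseteq> carrier G" "Z \<noteq> {}" for Z
      proof (rule ccontr)
        assume neg: "\<not> ?thesis"
        define K where "K = stabilizer G (Z <#> M)"
        have Mne: "M \<noteq> {}" using BM(3) by auto
        note K = kneser_strong[OF Z(1) M(2) Z(2) Mc Z(3) Mne, folded K_def]
        interpret K: subgroup K G by (rule K(3))
        have "card Z \<le> card (Z <#> K)"
          using card_set_mult_ge_left[of Z K] Z K K.subset K.one_closed by blast
        then have le: "card (M <#> K) + 2 \<le> card K + card M" using K(1) neg by linarith
        have e: "M <#> K = K <#> M" using set_mult_comm Mc K.subset by blast
        have "\<not> M \<subseteq> K"
        proof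
          assume "M \<subseteq> K"
          then have "N \<subseteq> K" unfolding N_def using K(3) by (rule generate_subgroup_incl)
          then show False using neg by (simp add: K_def)
        qed
        moreover have "2 \<le> card K"
        proof -
          have "card M \<le> card (M <#> K)"
            using card_set_mult_ge_left[of M K] M Mc K K.subset K.one_closed by blast
          then show ?thesis using le by linarith
        qed
        ultimately show False using no_sub[OF K(3,2)] le e by simp
      qed
      have MBfin: "finite (M <#> B')" using M B' by (simp add: finite_set_mult)
      have MBc: "M <#> B' = B' <#> M" using set_mult_comm Mc B' by blast
      have out: "goal B'" if "finite N" "\<not> B' \<subseteq> N" "card (N <#> B') + 1 \<le> card N + card B'"
      proof -
        have "card M \<le> card N" using MN that(1) by (rule card_mono[rotated])
        then show ?thesis unfolding goal_def using that sgN M3 by (intro disjI2 exI[of _ N]) simp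
      qed
      have Nstab: "Z <#> M = Z <#> N" if Z: "finite Z" "Z \<subseteq> carrier G" "N \<subseteq> stabilizer G (Z <#> M)" for Z
      proof
        show "Z <#> M \<subseteq> Z <#> N" by (rule mono_set_mult[OF order_refl MN])
        show "Z <#> N \<subseteq> Z <#> M"
        proof
          fix w assume "w \<in> Z <#> N"
          then obtain z n where w: "z \<in> Z" "n \<in> N" "w = z \<otimes> n" by (auto simp: set_mult_iff)
          have "z \<otimes> \<one> \<in> Z <#> M" using w BM(3) by (intro set_multI)
          then have "n \<otimes> (z \<otimes> \<one>) \<in> Z <#> M" using Z w stabilizer_mult by blast
          moreover have "n \<otimes> (z \<otimes> \<one>) = w" using w Z m_comm by auto
          ultimately show "w \<in> Z <#> M" by simp
        qed
      qed
      show ?thesis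
      \<comment> \<open>Split B' along the cosets of \<open>N\<close>. Either every part plus
        \<open>M\<close> is a union of cosets of \<open>N\<close>, and \<open>N\<close> itself is
        the subgroup sought, or some part already gains card M - 1.\<close>
      proof (cases "\<exists>b0\<in>B'. \<not> N \<subseteq> stabilizer G ({b \<in> B'. inv b0 \<otimes> b \<in> N} <#> M)")
        case False
        have "B' <#> M = B' <#> N"
        proof
          show "B' <#> M \<subseteq> B' <#> N" by (rule mono_set_mult[OF order_refl MN])
          show "B' <#> N \<subseteq> B' <#> M"
          proof
            fix w assume "w \<in> B' <#> N"
            then obtain b n where w: "b \<in> B'" "n \<in> N" "w = b \<otimes> n" by (auto simp: set_mult_iff)
            define Z where "Z = {b' \<in> B'. inv b \<otimes> b' \<in> N}"
            have bc: "b \<in> carrier G" using w B' by auto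
            have "Z <#> M = Z <#> N" using False w B' unfolding Z_def by (intro Nstab) auto
            moreover have "b \<in> Z" using w bc by (simp add: Z_def)
            ultimately have "w \<in> Z <#> M" using w by (auto intro: set_multI)
            then show "w \<in> B' <#> M" by (auto simp: Z_def set_mult_iff)
          qed
        qed
        then have e: "M <#> B' = N <#> B'" using MBc set_mult_comm[of B' N] B' N.subset by simp
        have "finite N"
          using e MBfin subset_set_mult_one[of N B'] N.subset B' finite_subset by metis
        moreover have "\<not> B' \<subseteq> N"
        proof
          assume s: "B' \<subseteq> N"
          then have "Q \<subseteq> N" using generate_subgroup_incl[OF s sgN] B'(5) by simp
          moreover have "N \<subseteq> N <#> B'" using subset_set_mult_one N.subset B' by simp
          ultimately show False using ext MBQ e by blast
        qed
        moreover have "card M \<le> card N" using MN \<open>finite N\<close> by (rule card_mono[rotated])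
        ultimately show ?thesis using out e BM(4) B'(4) by simp
      next
        case True
        then obtain b0 where b0: "b0 \<in> B'" "\<not> N \<subseteq> stabilizer G ({b \<in> B'. inv b0 \<otimes> b \<in> N} <#> M)" by auto
        define Z where "Z = {b \<in> B'. inv b0 \<otimes> b \<in> N}"
        define W where "W = B' - Z"
        have b0c: "b0 \<in> carrier G" using b0 B' by auto
        have b0Z: "b0 \<in> Z" using b0 b0c by (simp add: Z_def)
        have ZW: "finite Z" "finite W" "Z \<subseteq> carrier G" "W \<subseteq> carrier G" "Z \<union> W = B'" "Z \<inter> W = {}"
          using B' by (auto simp: Z_def W_def)
        have cZW: "card Z + card W = card B'" using ZW by (metis card_Un_disjoint)
        have cZ: "card Z + card M \<le> card (Z <#> M) + 1" using kn[OF ZW(1,3)] b0 b0Z by (auto simp: Z_def)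
        have inN: "inv b0 \<otimes> w \<in> N \<longleftrightarrow> inv b0 \<otimes> u \<in> N"
          if "w = u \<otimes> n" "n \<in> N" "u \<in> carrier G" for u w n
        proof -
          have nc: "n \<in> carrier G" using that by simp
          have e: "inv b0 \<otimes> w = (inv b0 \<otimes> u) \<otimes> n" using that nc b0c by (simp add: m_assoc)
          show ?thesis
          proof
            assume "inv b0 \<otimes> w \<in> N"
            moreover have "inv b0 \<otimes> u = (inv b0 \<otimes> w) \<otimes> inv n" using e that nc b0c by simp
            ultimately show "inv b0 \<otimes> u \<in> N" using that by (metis N.m_closed N.m_inv_closed)
          next
            assume "inv b0 \<otimes> u \<in> N" then show "inv b0 \<otimes> w \<in> N" unfolding e using that by simp
          qed
        qed
        have dj: "(Z <#> N) \<inter> (W <#> N) = {}"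
        proof -
          have "inv b0 \<otimes> w \<in> N" if "w \<in> Z <#> N" for w
            using that inN ZW(3) by (auto simp: set_mult_iff Z_def)
          moreover have "inv b0 \<otimes> w \<notin> N" if w: "w \<in> W <#> N" for w
          proof -
            obtain u n where "u \<in> W" "n \<in> N" "w = u \<otimes> n" using w by (auto simp: set_mult_iff)
            then show ?thesis using inN[of w u n] ZW(4) by (auto simp: W_def Z_def)
          qed
          ultimately show ?thesis by auto
        qed
        have sub: "Z <#> M \<subseteq> Z <#> N" "W <#> M \<subseteq> W <#> N" by (rule mono_set_mult[OF order_refl MN])+
        have un: "B' <#> M = (Z <#> M) \<union> (W <#> M)" unfolding ZW(5)[symmetric] by (auto simp: set_mult_def)
        have "card (B' <#> M) = card (Z <#> M) + card (W <#> M)"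
          unfolding un using dj sub ZW M by (intro card_Un_disjoint finite_set_mult) auto
        then have WM: "card (W <#> M) \<le> card W" using BM(4) B'(4) cZ cZW MBc by simp
        show ?thesis
        proof (cases "W = {}")
          case False
          have WN: "W <#> M = W <#> N"
            using kn[OF ZW(2,4) False] WM M3 ZW by (intro Nstab) auto
          then have "finite (W <#> N)" using ZW M by (metis finite_set_mult)
          moreover obtain w0 where w0: "w0 \<in> W" using False by auto
          have "(\<otimes>) w0 ` N \<subseteq> W <#> N" using w0 by (auto intro: set_multI)
          ultimately have "finite ((\<otimes>) w0 ` N)" by (rule rev_finite_subset)
          moreover have "inj_on ((\<otimes>) w0) N" using w0 ZW by (intro inj_onI) auto
          ultimately have finN: "finite N" by (rule finite_imageD)
          have "Z <#> N \<subseteq> (\<otimes>) b0 ` N"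
          proof
            fix w assume "w \<in> Z <#> N"
            then have "inv b0 \<otimes> w \<in> N" "w \<in> carrier G"
              using inN ZW(3) by (auto simp: set_mult_iff Z_def)
            then show "w \<in> (\<otimes>) b0 ` N" using translate_inv_iff[OF b0c N.subset] by simp
          qed
          then have "card (Z <#> N) \<le> card N"
            using finN by (metis card_image_le card_mono finite_imageI le_trans)
          moreover have "B' <#> N = (Z <#> N) \<union> (W <#> N)" unfolding ZW(5)[symmetric] by (auto simp: set_mult_def)
          then have "card (B' <#> N) \<le> card (Z <#> N) + card (W <#> N)" by (simp add: card_Un_le)
          moreover have "card Z \<ge> 1" using b0Z ZW by (metis One_nat_def Suc_leI card_gt_0_iff empty_iff)
          moreover have "\<not> B' \<subseteq> N"
          proof
            assume s: "B' \<subseteq> N"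
            then have "w0 \<in> Z" using w0 b0 by (auto simp: Z_def W_def)
            then show False using w0 by (simp add: W_def)
          qed
          ultimately show ?thesis
            using out finN WM WN cZW set_mult_comm[of B' N] B' N.subset by simp
        next
          \<comment> \<open>Now B' lies in one coset of \<open>N\<close>, which is \<open>N\<close>
            since \<one> is in B'; so \<open>N\<close> = \<open>Q\<close>. The induction is applied
            to \<open>M\<close> with B' as the separating set, and neither alternative is possible
            for \<open>M\<close>. The required card M < card B comes from two or three translates of
            \<open>M\<close> that meet pairwise in at most one point.\<close>
          case True
          have "inv b0 \<otimes> \<one> \<in> N" using True B'(3) by (auto simp: W_def Z_def)
          then have "inv b0 \<in> N" using b0c by simp
          then have b0N: "b0 \<in> N" using b0c by (metis N.m_inv_closed inv_inv)
          have BN: "B' \<subseteq> N"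
          proof
            fix b assume "b \<in> B'"
            then have "inv b0 \<otimes> b \<in> N" "b \<in> carrier G" using True B' by (auto simp: W_def Z_def)
            then show "b \<in> N" using b0N b0c inv_cancel(1)[of b0 b] by (metis N.m_closed)
          qed
          then have "Q \<subseteq> N" using generate_subgroup_incl[OF BN sgN] B'(5) by simp
          then have NQe: "N = Q" using NQ by auto
          have cB3: "card M < card B"
          proof (cases "card B = 2")
            case False
            then have "3 \<le> card B'" using less.prems B' by simp
            then obtain b c where bc: "b \<in> B'" "c \<in> B'" "b \<noteq> \<one>" "c \<noteq> \<one>" "b \<noteq> c"
            proof -
              have c2: "2 \<le> card (B' - {\<one>})" using \<open>3 \<le> card B'\<close> B' by simp
              then have "B' - {\<one>} \<noteq> {}" by (metis card.empty not_numeral_le_zero)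
              then obtain b where b: "b \<in> B' - {\<one>}" by blast
              have "1 \<le> card (B' - {\<one>} - {b})" using b c2 by simp
              then have "B' - {\<one>} - {b} \<noteq> {}" by (metis card.empty not_one_le_zero)
              then obtain c where "c \<in> B' - {\<one>} - {b}" by blast
              then show ?thesis using that[of b c] b by blast
            qed
            have bcc: "b \<in> carrier G" "c \<in> carrier G" using bc B' by auto
            define Mb where "Mb = (\<otimes>) b ` M"
            define Mc' where "Mc' = (\<otimes>) c ` M"
            have fM: "finite Mb" "finite Mc'" "card Mb = card M" "card Mc' = card M"
              using M bcc Mc card_translate by (auto simp: Mb_def Mc'_def)
            have "Mb \<inter> Mc' = (\<otimes>) b ` (M \<inter> (\<otimes>) (inv b \<otimes> c) ` M)"
            proof -
              have "Mc' = (\<otimes>) b ` (\<otimes>) (inv b \<otimes> c) ` M"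
                unfolding Mc'_def using translate_translate[of b "inv b \<otimes> c" M] bcc Mc by simp
              moreover have "inj_on ((\<otimes>) b) (carrier G)" using bcc by (intro inj_onI) auto
              moreover have "(\<otimes>) (inv b \<otimes> c) ` M \<subseteq> carrier G" using bcc Mc by auto
              ultimately show ?thesis unfolding Mb_def using Mc by (metis inj_on_image_Int)
            qed
            then have i1: "card (Mb \<inter> Mc') \<le> card (M \<inter> (\<otimes>) (inv b \<otimes> c) ` M)"
              using M by (simp add: card_image_le)
            have "inv b \<otimes> c \<noteq> \<one>"
            proof
              assume "inv b \<otimes> c = \<one>"
              then have "b \<otimes> (inv b \<otimes> c) = b" using bcc by simp
              then show False using bc bcc by simp
            qed
            then have i1': "card (Mb \<inter> Mc') \<le> 1" using i1 atom[of "inv b \<otimes> c"] bcc by simp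
            have i2: "card (M \<inter> Mb) \<le> 1" "card (M \<inter> Mc') \<le> 1"
              using atom bc bcc by (auto simp: Mb_def Mc'_def)
            have "card (M \<union> Mb) + card (M \<inter> Mb) = 2 * card M"
              using card_Un_Int[of M Mb] M fM by simp
            moreover have "card (M \<union> Mb \<union> Mc') + card ((M \<union> Mb) \<inter> Mc') = card (M \<union> Mb) + card M"
              using card_Un_Int[of "M \<union> Mb" Mc'] M fM by simp
            moreover have "(M \<union> Mb) \<inter> Mc' = (M \<inter> Mc') \<union> (Mb \<inter> Mc')" by auto
            then have "card ((M \<union> Mb) \<inter> Mc') \<le> card (M \<inter> Mc') + card (Mb \<inter> Mc')"
              by (simp add: card_Un_le)
            moreover have "M \<union> Mb \<union> Mc' \<subseteq> B' <#> M"
            proof -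
              have "M \<subseteq> B' <#> M" using subset_set_mult_one[OF Mc B'(3)] MBc by simp
              then show ?thesis using bc by (auto simp: Mb_def Mc'_def intro: set_multI)
            qed
            then have "card (M \<union> Mb \<union> Mc') \<le> card (B' <#> M)"
              using MBfin MBc by (intro card_mono) auto
            ultimately show ?thesis using i1' i2 BM(4)[unfolded MBc] M3 by linarith
          next
            case True
            then obtain b where b: "b \<noteq> \<one>" "B' = {\<one>, b}" using B'(3,4) by (metis card_2_pointed)
            have bc: "b \<in> carrier G" using b B' by auto
            have "M \<union> (\<otimes>) b ` M \<subseteq> B' <#> M"
              unfolding b(2) using translate_one[OF Mc] by (auto simp: set_mult_def)
            then have "card (M \<union> (\<otimes>) b ` M) \<le> card (B' <#> M)" using MBfin MBc by (intro card_mono) auto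
            moreover have "card (M \<union> (\<otimes>) b ` M) + card (M \<inter> (\<otimes>) b ` M) = 2 * card M"
              using card_Un_Int[of M "(\<otimes>) b ` M"] M card_translate[OF bc Mc] by simp
            moreover have "card (M \<inter> (\<otimes>) b ` M) \<le> 1" using atom b bc by blast
            ultimately show ?thesis using BM(4) MBc True M3 by simp
          qed
          have "k_sep2 (generate G M) M B'"
            using BM(2) BN B' less.prems MBc NQe unfolding k_sep2_def N_def[symmetric] by simp
          moreover have "card (B' <#> M) + 1 \<le> card B' + card M" using BM(4) MBc B' by simp
          ultimately have "(\<exists>x\<in>carrier G. x \<noteq> \<one> \<and> card M \<le> card (M \<inter> (\<otimes>) x ` M) + 1) \<or>
            (\<exists>L. subgroup L G \<and> finite L \<and> 2 \<le> card L \<and> \<not> M \<subseteq> L \<and> card (L <#> M) + 1 \<le> card L + card M)"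
            using less.hyps[of M B'] cB3 M Mc BM(3) by blast
          then show ?thesis using atom no_sub M3 by fastforce
        qed
      qed
    qed
  qed
  then have "goal B" using BM(1) goal_inv[of B] less.prems by auto
  then show ?case by (simp add: goal_def)
qed

end

lemma card_Diff_Int: "finite X \<Longrightarrow> card (X - Y) + card (X \<inter> Y) = card X"
  by (metis Diff_disjoint Int_Diff_Un Int_Diff_disjoint card_Un_disjoint finite_Diff finite_Int inf_commute sup_commute)

context comm_group
begin

subsection \<open>Progressions\<close>

text \<open>Start at the one point of \<open>X\<close> outside x + X and add x until
  \<open>X\<close> is left. The only exit is then used up, so the remainder of \<open>X\<close> is
  invariant under x; as x generates the group, the remainder is empty.\<close>

lemma progression_of_boundary:
  assumes X: "finite X" "X \<subseteq> carrier G" and x: "x \<in> carrier G" "generate G {x} = carrier G"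
    and bd: "card ((\<otimes>) x ` X - X) = 1"
  obtains q where "q \<in> carrier G" "X = (\<lambda>i. q \<otimes> x [^] i) ` {..<card X}" "inj_on (\<lambda>i. q \<otimes> x [^] i) {..<card X}"
proof -
  define Y where "Y = (\<otimes>) x ` X"
  have inv_gen: "Z = {} \<or> Z = carrier G" if Z: "finite Z" "Z \<subseteq> carrier G" "\<And>z. z \<in> Z \<Longrightarrow> x \<otimes> z \<in> Z" for Z
  proof -
    have "x \<in> stabilizer G Z" using Z x by (intro stabilizerI)
    then have st: "carrier G \<subseteq> stabilizer G Z"
      using generate_subgroup_incl[of "{x}" "stabilizer G Z"] stabilizer_subgroup[OF Z(2)] x(2) by simp
    have "w \<in> Z" if "z \<in> Z" "w \<in> carrier G" for z w
    proof -
      have zc: "z \<in> carrier G" using that Z by auto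
      have "w \<otimes> inv z \<in> stabilizer G Z" using st that zc by auto
      then have "w \<otimes> inv z \<otimes> z \<in> Z" using that stabilizer_mult by blast
      then show ?thesis using that zc by simp
    qed
    then show ?thesis using Z by blast
  qed
  have cY: "card Y = card X" unfolding Y_def using x X by (intro card_translate) auto
  have finY: "finite Y" using X by (simp add: Y_def)
  have "card (X - Y) = card (Y - X)"
    using card_Diff_Int[OF X(1), of Y] card_Diff_Int[OF finY, of X] cY by (simp add: Int_commute)
  then have "card (X - Y) = 1" using bd by (simp add: Y_def)
  then obtain q where q: "X - Y = {q}" by (metis card_1_singletonE)
  obtain e where e: "Y - X = {e}" using bd unfolding Y_def by (metis card_1_singletonE)
  have qc: "q \<in> carrier G" "q \<in> X" using q X by auto
  have ex: "\<exists>i::nat. q \<otimes> x [^] i \<notin> X"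
  proof (rule ccontr)
    assume "\<not> ?thesis"
    then have all: "q \<otimes> x [^] (i::nat) \<in> X" for i by auto
    define Z where "Z = range (\<lambda>i::nat. q \<otimes> x [^] i)"
    have "finite Z" using all X by (auto simp: Z_def intro: finite_subset)
    moreover have "x \<otimes> z \<in> Z" if z: "z \<in> Z" for z
    proof -
      obtain i where "z = q \<otimes> x [^] (i::nat)" using z by (auto simp: Z_def)
      then have "x \<otimes> z = q \<otimes> x [^] Suc i" using x qc by (simp add: m_ac)
      then show ?thesis unfolding Z_def by (rule range_eqI)
    qed
    ultimately have "Z = carrier G" using inv_gen[of Z] qc x by (auto simp: Z_def)
    moreover have "Z \<subseteq> X" using all by (auto simp: Z_def)
    ultimately have "X = carrier G" using X by auto
    then have "Y - X = {}" using x X by (auto simp: Y_def)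
    then show False using e by simp
  qed
  define k where "k = (LEAST i. q \<otimes> x [^] (i::nat) \<notin> X)"
  have k: "q \<otimes> x [^] k \<notin> X" using ex unfolding k_def by (rule LeastI_ex)
  have lt: "q \<otimes> x [^] i \<in> X" if "i < k" for i using that not_less_Least unfolding k_def by blast
  have k0: "k \<noteq> 0" using k qc by (metis nat_pow_0 r_one)
  then obtain k' where k': "k = Suc k'" using not0_implies_Suc by auto
  define p where "p = q \<otimes> x [^] k'"
  have pX: "p \<in> X" using lt k' by (simp add: p_def)
  have xp: "x \<otimes> p \<notin> X"
    using k x qc by (simp add: p_def k' m_ac)
  have ep: "x \<otimes> p = e" using e pX xp by (auto simp: Y_def)
  define Z where "Z = (\<lambda>i. q \<otimes> x [^] i) ` {..<k}"
  have ZX: "Z \<subseteq> X" using lt by (auto simp: Z_def)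
  have "X - Z = {} \<or> X - Z = carrier G"
  proof (rule inv_gen)
    fix z assume z: "z \<in> X - Z"
    have zc: "z \<in> carrier G" using z X by auto
    have "z \<noteq> p" using z k' by (auto simp: p_def Z_def)
    then have "x \<otimes> z \<noteq> e" using ep[symmetric] zc x X pX by auto
    then have in1: "x \<otimes> z \<in> X" using z e by (auto simp: Y_def)
    moreover have "x \<otimes> z \<notin> Z"
    proof
      assume "x \<otimes> z \<in> Z"
      then obtain i where i: "i < k" "x \<otimes> z = q \<otimes> x [^] i" by (auto simp: Z_def)
      show False
      proof (cases i)
        case 0
        then have "q = x \<otimes> z" using i qc by simp
        then have "q \<in> Y" using z by (auto simp: Y_def)
        then show False using q by auto
      next
        case (Suc j)
        then have "x \<otimes> z = x \<otimes> (q \<otimes> x [^] j)" using i qc x by (simp add: m_ac)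
        then have "z = q \<otimes> x [^] j" using zc x qc by simp
        then show False using z Suc i by (auto simp: Z_def)
      qed
    qed
    ultimately show "x \<otimes> z \<in> X - Z" by simp
  qed (use X in auto)
  moreover have "q \<in> Z" using k0 qc by (auto simp: Z_def image_iff intro!: bexI[of _ 0])
  ultimately have XZ: "X = Z" using qc ZX by auto
  have inj: "inj_on (\<lambda>i. q \<otimes> x [^] i) {..<k}"
  proof -
    have False if "a < b" "b < k" "q \<otimes> x [^] a = q \<otimes> x [^] b" for a b
    proof -
      have xe: "x [^] a = x [^] b" using that qc x by simp
      have "k = b + (k - b)" using that by simp
      then have "q \<otimes> x [^] k = q \<otimes> (x [^] b \<otimes> x [^] (k - b))" using x by (metis nat_pow_mult)
      also have "\<dots> = q \<otimes> x [^] (a + (k - b))" using x xe by (metis nat_pow_mult)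
      finally have "q \<otimes> x [^] k \<in> X" using lt that by auto
      then show False using k by simp
    qed
    then show ?thesis by (intro inj_onI) (metis lessThan_iff linorder_neqE_nat)
  qed
  then have "card X = k" by (simp add: XZ Z_def card_image)
  then show ?thesis using that qc XZ inj by (simp add: Z_def)
qed

text \<open>Let L be generated by x, and p the point at which \<open>A\<close> is left under x. The
  part of \<open>A\<close> outside p + L is invariant under L; were it nonempty, L + A would be this
  part and one more coset, too small for \<open>ns\<close>. So \<open>A\<close> lies in one coset of
  L, which is L because \<one> is in \<open>A\<close>, and L is everything.\<close>

lemma boundary_generates:
  assumes A: "finite A" "A \<subseteq> carrier G" "\<one> \<in> A" "generate G A = carrier G" "A \<noteq> carrier G"
    and ns: "\<And>L. subgroup L G \<Longrightarrow> finite L \<Longrightarrow> 2 \<le> card L \<Longrightarrow> \<not> A \<subseteq> L \<Longrightarrow> card L + card A \<le> card (L <#> A)"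
    and x: "x \<in> carrier G" "x \<noteq> \<one>" "card A \<le> card (A \<inter> (\<otimes>) x ` A) + 1"
  shows "generate G {x} = carrier G" "card ((\<otimes>) x ` A - A) = 1"
proof -
  define L where "L = generate G {x}"
  have sg: "subgroup L G" unfolding L_def using x by (intro generate_is_subgroup) auto
  interpret L: subgroup L G by fact
  have xL: "x \<in> L" unfolding L_def by (auto intro: generate.incl)
  have cL: "2 \<le> card L" if "finite L"
  proof -
    have "card {\<one>, x} \<le> card L" using that xL by (intro card_mono) auto
    then show ?thesis using x(2) by simp
  qed
  have AL: "A \<subseteq> L \<Longrightarrow> L = carrier G" using generate_subgroup_incl[of A L] sg A(4) L.subset by blast
  have stL: "L \<subseteq> stabilizer G Z" if "finite Z" "Z \<subseteq> carrier G" "\<And>z. z \<in> Z \<Longrightarrow> x \<otimes> z \<in> Z" for Z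
    unfolding L_def
    using stabilizerI[OF that(1,2) x(1)] that stabilizer_subgroup[OF that(2)]
    by (intro generate_subgroup_incl) auto
  have c1: "card ((\<otimes>) x ` A - A) \<le> 1"
  proof -
    have "card ((\<otimes>) x ` A - A) + card ((\<otimes>) x ` A \<inter> A) = card ((\<otimes>) x ` A)"
      using A(1) by (intro card_Diff_Int) auto
    then show ?thesis using x card_translate[OF x(1) A(2)] by (simp add: Int_commute)
  qed
  have c2: "(\<otimes>) x ` A - A \<noteq> {}"
  proof
    assume "(\<otimes>) x ` A - A = {}"
    then have st: "L \<subseteq> stabilizer G A" using A by (intro stL) auto
    have finL: "finite L" using st stabilizer_finite[OF A(1,2,3)] finite_subset by blast
    have "L <#> A \<subseteq> A"
    proof
      fix w assume "w \<in> L <#> A"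
      then obtain l a where "l \<in> L" "a \<in> A" "w = l \<otimes> a" by (auto simp: set_mult_iff)
      then show "w \<in> A" using st stabilizer_mult by blast
    qed
    then have "card (L <#> A) \<le> card A" using A by (intro card_mono)
    then have "A \<subseteq> L" using ns[OF sg finL cL[OF finL]] cL[OF finL] by linarith
    then have "L = carrier G" by (rule AL)
    then have "carrier G \<subseteq> A"
      using st stabilizer_mult[of _ A \<one>] A(3) by (metis r_one subsetD subsetI)
    then show False using A by auto
  qed
  show bd: "card ((\<otimes>) x ` A - A) = 1" using c1 c2 A(1) by (metis card_0_eq finite_Diff finite_imageI le_antisym less_one not_le_imp_less)
  then obtain e where e: "(\<otimes>) x ` A - A = {e}" by (metis card_1_singletonE)
  then obtain p where p: "p \<in> A" "e = x \<otimes> p" by auto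
  have pc: "p \<in> carrier G" using p A by auto
  define W where "W = {a \<in> A. inv p \<otimes> a \<notin> L}"
  have W: "finite W" "W \<subseteq> carrier G" using A by (auto simp: W_def)
  have stW: "L \<subseteq> stabilizer G W"
  proof (rule stL[OF W])
    fix z assume z: "z \<in> W"
    have zc: "z \<in> carrier G" "z \<in> A" using z A by (auto simp: W_def)
    have "z \<noteq> p" using z pc by (auto simp: W_def)
    then have "x \<otimes> z \<noteq> e" using p zc pc x by simp
    then have "x \<otimes> z \<in> A" using e zc by auto
    moreover have "inv p \<otimes> (x \<otimes> z) \<notin> L"
    proof
      assume "inv p \<otimes> (x \<otimes> z) \<in> L"
      moreover have "inv p \<otimes> z = inv x \<otimes> (inv p \<otimes> (x \<otimes> z))" using pc zc x by (simp add: abelian_simps)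
      ultimately have "inv p \<otimes> z \<in> L" using xL by simp
      then show False using z by (simp add: W_def)
    qed
    ultimately show "x \<otimes> z \<in> W" by (simp add: W_def)
  qed
  have "W = {}"
  proof (rule ccontr)
    assume "W \<noteq> {}"
    then obtain w where w: "w \<in> W" by auto
    have finL: "finite L" using stW stabilizer_finite[OF W w] finite_subset by blast
    have "L <#> A \<subseteq> W \<union> (\<otimes>) p ` L"
    proof
      fix v assume "v \<in> L <#> A"
      then obtain l a where v: "l \<in> L" "a \<in> A" "v = l \<otimes> a" by (auto simp: set_mult_iff)
      have ac: "a \<in> carrier G" using v A by auto
      show "v \<in> W \<union> (\<otimes>) p ` L"
      proof (cases "a \<in> W")
        case True then show ?thesis using v stW stabilizer_mult by blast
      next
        case False
        then have "inv p \<otimes> a \<in> L" using v by (simp add: W_def)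
        then have "l \<otimes> (inv p \<otimes> a) \<in> L" using v by simp
        moreover have "v = p \<otimes> (l \<otimes> (inv p \<otimes> a))" using v ac pc by (simp add: abelian_simps)
        ultimately show ?thesis by blast
      qed
    qed
    then have "card (L <#> A) \<le> card (W \<union> (\<otimes>) p ` L)" using W finL by (intro card_mono) auto
    also have "\<dots> \<le> card W + card L" using card_Un_le[of W "(\<otimes>) p ` L"] card_translate[OF pc L.subset] by simp
    finally have le: "card (L <#> A) \<le> card W + card L" .
    have "p \<notin> W" using pc by (simp add: W_def)
    then have "card W < card A" using p A by (intro psubset_card_mono) (auto simp: W_def)
    then have "A \<subseteq> L" using ns[OF sg finL cL[OF finL]] le by linarith
    then have "inv p \<otimes> w \<in> L" using w p by (auto simp: W_def)
    then show False using w by (simp add: W_def)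
  qed
  then have all: "inv p \<otimes> a \<in> L" if "a \<in> A" for a using that by (auto simp: W_def)
  have "inv p \<in> L" using all[OF A(3)] pc by simp
  then have pL: "p \<in> L" using pc by (metis L.m_inv_closed inv_inv)
  have "A \<subseteq> L"
  proof
    fix a assume a: "a \<in> A"
    then have "p \<otimes> (inv p \<otimes> a) \<in> L" using all pL by simp
    then show "a \<in> L" using a A pc by (simp add: subset_iff)
  qed
  then show "generate G {x} = carrier G" using AL by (simp add: L_def)
qed

text \<open>Every translate of \<open>X\<close> by an element of \<open>Y\<close> has the size of
  the whole sumset, so all these translates coincide.\<close>

lemma diff_stabilizes:
  assumes X: "finite X" "X \<subseteq> carrier G" and Y: "finite Y" "Y \<subseteq> carrier G"
    and c: "card (X <#> Y) = card X" and y: "y \<in> Y" "y' \<in> Y"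
  shows "inv y \<otimes> y' \<in> stabilizer G X"
proof -
  have yc: "y \<in> carrier G" "y' \<in> carrier G" using y Y by auto
  have tr: "(\<otimes>) v ` X = X <#> Y" if v: "v \<in> Y" for v
  proof (rule card_subset_eq[OF finite_set_mult[OF X(1) Y(1)]])
    show "(\<otimes>) v ` X \<subseteq> X <#> Y" unfolding set_mult_comm[OF X(2) Y(2)] using v by (auto intro: set_multI)
    show "card ((\<otimes>) v ` X) = card (X <#> Y)" using card_translate[of v X] v Y X c by auto
  qed
  have "(\<otimes>) (inv y \<otimes> y') ` X = (\<otimes>) (inv y) ` (\<otimes>) y' ` X" using translate_translate yc X by simp
  also have "\<dots> = (\<otimes>) (inv y) ` (\<otimes>) y ` X" by (simp only: tr[OF y(1)] tr[OF y(2)])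
  also have "\<dots> = X" using translate_translate[of "inv y" y X] yc X by (simp add: translate_one)
  finally show ?thesis using yc by (simp add: stabilizer_def)
qed

lemma card_le_stabilizer:
  assumes X: "finite X" "X \<subseteq> carrier G" "X \<noteq> {}" and Y: "finite Y" "Y \<subseteq> carrier G"
    and c: "card (X <#> Y) = card X"
  shows "card Y \<le> card (stabilizer G X)"
proof (cases "Y = {}")
  case False
  then obtain y where y: "y \<in> Y" by auto
  then have yc: "inv y \<in> carrier G" using Y by auto
  obtain z where "z \<in> X" using X by auto
  then have "finite (stabilizer G X)" using stabilizer_finite X by blast
  moreover have "(\<otimes>) (inv y) ` Y \<subseteq> stabilizer G X" using diff_stabilizes[OF X(1,2) Y c y] by auto
  ultimately have "card ((\<otimes>) (inv y) ` Y) \<le> card (stabilizer G X)" by (rule card_mono)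
  then show ?thesis using card_translate[OF yc Y(2)] by simp
qed simp

end

lemma (in comm_group) inj_on_mult:
  assumes "X \<subseteq> carrier G" "b \<in> carrier G"
  shows "inj_on (\<lambda>a. a \<otimes> b) X" "inj_on (\<lambda>a. b \<otimes> a) X" "inj_on (\<lambda>a. b \<otimes> inv a) X"
  using assms by (auto intro!: inj_onI simp: subset_iff) (metis inv_inv)

text \<open>Layer-cake summation: the value f x is counted once for each level v from 1 to f
  x.\<close>

lemma sum_eq_layers:
  assumes "finite X" "\<And>x. x \<in> X \<Longrightarrow> f x \<le> (h::nat)"
  shows "(\<Sum>x\<in>X. f x) = (\<Sum>v\<in>{1..h}. card {x \<in> X. v \<le> f x})"
proof -
  have "(\<Sum>v\<in>{1..h}. card {x \<in> X. v \<le> f x}) = (\<Sum>v\<in>{1..h}. \<Sum>x\<in>X. if v \<le> f x then 1 else 0)"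
    using assms(1) by (intro sum.cong refl) (simp add: sum.If_cases Int_def)
  also have "\<dots> = (\<Sum>x\<in>X. \<Sum>v\<in>{1..h}. if v \<le> f x then 1 else 0)" by (rule sum.swap)
  also have "\<dots> = (\<Sum>x\<in>X. f x)"
  proof (rule sum.cong[OF refl])
    fix x assume "x \<in> X"
    then have "{1..h} \<inter> {v. v \<le> f x} = {1..f x}" using assms(2) by fastforce
    then show "(\<Sum>v\<in>{1..h}. if v \<le> f x then 1 else 0) = f x" by (simp add: sum.If_cases)
  qed
  finally show ?thesis by simp
qed

definition fib :: "('a \<Rightarrow> 'c) \<Rightarrow> 'a set \<Rightarrow> 'c \<Rightarrow> 'a set" where
  "fib \<phi> X a = {x \<in> X. \<phi> x = a}"

lemma card_eq_sum_fib:
  assumes "finite X" "finite I" "\<phi> ` X \<subseteq> I"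
  shows "card X = (\<Sum>a\<in>I. card (fib \<phi> X a))"
proof -
  have "card X = (\<Sum>a\<in>\<phi> ` X. card (fib \<phi> X a))"
    using sum.image_gen[OF assms(1), of "\<lambda>_. 1::nat" \<phi>] by (simp add: fib_def)
  also have "\<dots> = (\<Sum>a\<in>I. card (fib \<phi> X a))"
  proof (rule sum.mono_neutral_left[OF assms(2,3)])
    show "\<forall>a\<in>I - \<phi> ` X. card (fib \<phi> X a) = 0"
    proof
      fix a assume "a \<in> I - \<phi> ` X"
      then have "fib \<phi> X a = {}" by (auto simp: fib_def)
      then show "card (fib \<phi> X a) = 0" by simp
    qed
  qed
  finally show ?thesis .
qed

subsection \<open>Pairs projecting to the quotient\<close>

text \<open>The quotient is kept abstract, as a surjection whose fibres all have \<open>h\<close>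
  elements; \<open>coset_projection\<close> supplies the instance with
  \<open>G Mod H\<close>.\<close>

locale finite_fibres = comm_group G + Q: comm_group Q
  for G :: "('a, 'b) monoid_scheme" (structure) and Q :: "('c, 'd) monoid_scheme" +
  fixes \<phi> :: "'a \<Rightarrow> 'c" and h :: nat
  assumes hom: "\<phi> \<in> hom G Q" and onto: "\<phi> ` carrier G = carrier Q"
    and card_fibre: "\<And>q. q \<in> carrier Q \<Longrightarrow> card {x \<in> carrier G. \<phi> x = q} = h"
    and h2: "2 \<le> h"
begin

lemma \<phi>_closed [simp]: "x \<in> carrier G \<Longrightarrow> \<phi> x \<in> carrier Q"
  using hom by (auto simp: hom_def)

lemma \<phi>_mult [simp]: "x \<in> carrier G \<Longrightarrow> y \<in> carrier G \<Longrightarrow> \<phi> (x \<otimes> y) = \<phi> x \<otimes>\<^bsub>Q\<^esub> \<phi> y"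
  using hom by (auto simp: hom_def)

lemma \<phi>_one [simp]: "\<phi> \<one> = \<one>\<^bsub>Q\<^esub>"
  using hom_one[OF hom] Q.is_group is_group by simp

lemma \<phi>_inv [simp]: "x \<in> carrier G \<Longrightarrow> \<phi> (inv x) = inv\<^bsub>Q\<^esub> (\<phi> x)"
proof -
  interpret group_hom G Q \<phi> by unfold_locales (rule hom)
  show "x \<in> carrier G \<Longrightarrow> \<phi> (inv x) = inv\<^bsub>Q\<^esub> (\<phi> x)" by simp
qed

lemma \<phi>_set_mult: "X \<subseteq> carrier G \<Longrightarrow> Y \<subseteq> carrier G \<Longrightarrow> \<phi> ` (X <#> Y) = \<phi> ` X <#>\<^bsub>Q\<^esub> \<phi> ` Y"
  by (force simp: set_mult_def subset_iff image_iff)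

lemma finite_fibre: "q \<in> carrier Q \<Longrightarrow> finite {x \<in> carrier G. \<phi> x = q}"
  using card_fibre[of q] h2 by (metis card.infinite not_numeral_le_zero)

lemma fib_le: "X \<subseteq> carrier G \<Longrightarrow> q \<in> carrier Q \<Longrightarrow> card (fib \<phi> X q) \<le> h"
  unfolding card_fibre[of q, symmetric] by (intro card_mono finite_fibre) (auto simp: fib_def)

lemma fib_full: "X \<subseteq> carrier G \<Longrightarrow> q \<in> carrier Q \<Longrightarrow> card (fib \<phi> X q) = h \<Longrightarrow> fib \<phi> X q = {x \<in> carrier G. \<phi> x = q}"
  using finite_fibre[of q] card_fibre[of q] by (intro card_subset_eq) (auto simp: fib_def)

definition "pre U = {x \<in> carrier G. \<phi> x \<in> U}"

lemma card_pre:
  assumes "finite U" "U \<subseteq> carrier Q"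
  shows "finite (pre U)" "card (pre U) = h * card U"
proof -
  have e: "pre U = (\<Union>q\<in>U. {x \<in> carrier G. \<phi> x = q})" by (auto simp: pre_def)
  show fin: "finite (pre U)" unfolding e using assms finite_fibre by blast
  have im: "\<phi> ` pre U = U"
  proof (intro equalityI subsetI)
    fix q assume q: "q \<in> U"
    then have "q \<in> \<phi> ` carrier G" using assms(2) onto by auto
    then show "q \<in> \<phi> ` pre U" using q by (auto simp: pre_def)
  qed (auto simp: pre_def)
  have "card (pre U) = h * card (\<phi> ` pre U)"
  proof (rule card_eq_fibres[OF fin])
    fix y assume "y \<in> \<phi> ` pre U"
    then have y: "y \<in> U" unfolding im .
    then have "{x \<in> pre U. \<phi> x = y} = {x \<in> carrier G. \<phi> x = y}" by (auto simp: pre_def)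
    then show "card {x \<in> pre U. \<phi> x = y} = h" using y assms card_fibre by auto
  qed
  then show "card (pre U) = h * card U" by (simp add: im)
qed

lemma pre_set_mult:
  assumes "U \<subseteq> carrier Q" and S: "S \<subseteq> carrier G"
  shows "pre U <#> S = pre (U <#>\<^bsub>Q\<^esub> \<phi> ` S)"
proof (intro equalityI subsetI)
  fix x assume "x \<in> pre U <#> S"
  then obtain v y where "v \<in> carrier G" "\<phi> v \<in> U" "y \<in> S" "x = v \<otimes> y" by (auto simp: set_mult_iff pre_def)
  then show "x \<in> pre (U <#>\<^bsub>Q\<^esub> \<phi> ` S)" using S Q.set_multI[of "\<phi> v" U "\<phi> y" "\<phi> ` S"] by (auto simp: pre_def)
next
  fix x assume "x \<in> pre (U <#>\<^bsub>Q\<^esub> \<phi> ` S)"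
  then obtain q y where x: "x \<in> carrier G" "q \<in> U" "y \<in> S" "\<phi> x = q \<otimes>\<^bsub>Q\<^esub> \<phi> y"
    by (auto simp: pre_def Q.set_mult_iff)
  have c: "y \<in> carrier G" "q \<in> carrier Q" using x assms by auto
  have "\<phi> (x \<otimes> inv y) = q" using x c by simp
  then have "x \<otimes> inv y \<in> pre U" using x c by (simp add: pre_def)
  then have "x \<otimes> inv y \<otimes> y \<in> pre U <#> S" using x(3) by (rule set_multI)
  then show "x \<in> pre U <#> S" using x c by simp
qed

lemma finite_Q: "finite (carrier G) \<Longrightarrow> finite (carrier Q)"
  using onto finite_imageI by metis

lemma order_G: "finite (carrier G) \<Longrightarrow> order G = h * card (carrier Q)"
  using card_pre(2)[OF finite_Q order_refl] by (auto simp: order_def pre_def cong: conj_cong)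

lemma infinite_Q: "infinite (carrier G) \<Longrightarrow> infinite (carrier Q)"
proof
  assume "infinite (carrier G)" "finite (carrier Q)"
  moreover have "pre (carrier Q) = carrier G" by (auto simp: pre_def)
  ultimately show False using card_pre(1)[of "carrier Q"] by simp
qed

end

text \<open>
  \<open>\<phi>\<close> is the projection of \<open>G\<close> onto the quotient \<open>Q\<close> by a subgroup of order \<open>h\<close>. The image of \<open>S\<close>
  has \<open>u + 1\<close> elements, and \<open>g\<close> is the excess of \<open>card (S <#> T) - card T\<close> over its least possible
  value \<open>u * h\<close>.
\<close>

locale critical_pair = finite_fibres G Q \<phi> h
  for G :: "('a, 'b) monoid_scheme" (structure) and Q :: "('c, 'd) monoid_scheme"
    and \<phi> :: "'a \<Rightarrow> 'c" and S T :: "'a set" and h u g \<mu> :: nat +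
  assumes u1: "1 \<le> u"
    and S: "S \<subseteq> carrier G" "finite S" and T: "T \<subseteq> carrier G" "finite T"
    and S_one: "\<one> \<in> S"
    and A_gen: "generate Q (\<phi> ` S) = carrier Q"
    and A_card: "card (\<phi> ` S) = u + 1"
    and S_card: "card S = u * h + g + \<mu>" and S3: "3 \<le> card S" and gmu: "g + \<mu> < h" "\<mu> \<le> 1"
    and ST_card: "card (S <#> T) = card T + u * h + g"
    and T4: "4 - 2 * \<mu> \<le> card T" and ST_le: "card S \<le> card T"
    and aper: "aperiodic G (S <#> T)"
    and ST_ext: "infinite (carrier G) \<or> card (S <#> T) + 2 \<le> order G"
    and size: "infinite (carrier G) \<or> 3 * card (S <#> T) \<le> 2 * order G + 2 * \<mu>"
    and frag: "\<And>X. X \<subseteq> carrier G \<Longrightarrow> finite X \<Longrightarrow> 2 \<le> card X \<Longrightarrow>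
      infinite (carrier G) \<or> card (X <#> S) + 2 \<le> order G \<Longrightarrow> card X + u * h \<le> card (X <#> S)"
    and no_larger: "\<And>L. subgroup L Q \<Longrightarrow> finite L \<Longrightarrow> 2 \<le> card L \<Longrightarrow> L <#>\<^bsub>Q\<^esub> (\<phi> ` S) \<noteq> carrier Q \<Longrightarrow>
      card L + u < card (L <#>\<^bsub>Q\<^esub> (\<phi> ` S))"
begin

abbreviation "A \<equiv> \<phi> ` S"
abbreviation "B \<equiv> \<phi> ` T"
definition "C = A <#>\<^bsub>Q\<^esub> B"
definition "s a = card (fib \<phi> S a)"
definition "t b = card (fib \<phi> T b)"
definition "\<sigma> c = card (fib \<phi> (S <#> T) c)"

lemma A_props: "finite A" "A \<subseteq> carrier Q" "\<one>\<^bsub>Q\<^esub> \<in> A" "A \<noteq> {}"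
  using S S_one \<phi>_one by (auto simp: image_iff intro!: bexI[of _ \<one>])

lemma T_ne: "T \<noteq> {}" using ST_le S3 by auto

lemma B_props: "finite B" "B \<subseteq> carrier Q" "B \<noteq> {}"
  using T T_ne by auto

lemma ST_props: "finite (S <#> T)" "S <#> T \<subseteq> carrier G"
  using S T by (auto simp: finite_set_mult setmult_subset_G)

lemma TS: "T <#> S = S <#> T"
  using set_mult_comm S T by auto

lemma C_props: "finite C" "C \<subseteq> carrier Q" "\<phi> ` (S <#> T) = C"
  using A_props B_props S T by (auto simp: C_def Q.finite_set_mult Q.setmult_subset_G \<phi>_set_mult)

lemma s_le: "a \<in> carrier Q \<Longrightarrow> s a \<le> h" using fib_le S by (simp add: s_def)
lemma t_le: "b \<in> carrier Q \<Longrightarrow> t b \<le> h" using fib_le T by (simp add: t_def)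
lemma \<sigma>_le: "c \<in> carrier Q \<Longrightarrow> \<sigma> c \<le> h" using fib_le ST_props by (simp add: \<sigma>_def)

lemma s_pos: "a \<in> A \<Longrightarrow> 1 \<le> s a"
proof -
  assume "a \<in> A"
  then have "fib \<phi> S a \<noteq> {}" by (auto simp: fib_def)
  moreover have "finite (fib \<phi> S a)" using S by (simp add: fib_def)
  ultimately show "1 \<le> s a" by (simp add: s_def Suc_leI card_gt_0_iff)
qed

lemma t_pos: "b \<in> B \<Longrightarrow> 1 \<le> t b"
proof -
  assume "b \<in> B"
  then have "fib \<phi> T b \<noteq> {}" by (auto simp: fib_def)
  moreover have "finite (fib \<phi> T b)" using T by (simp add: fib_def)
  ultimately show "1 \<le> t b" by (simp add: t_def Suc_leI card_gt_0_iff)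
qed

lemma sum_s: "(\<Sum>a\<in>A. s a) = u * h + g + \<mu>"
  using card_eq_sum_fib[OF S(2) A_props(1), of \<phi>] S_card by (simp add: s_def)

lemma sum_t: "(\<Sum>b\<in>B. t b) = card T"
  using card_eq_sum_fib[OF T(2) B_props(1), of \<phi>] by (simp add: t_def)

lemma sum_\<sigma>: "(\<Sum>c\<in>C. \<sigma> c) = card T + u * h + g"
  using card_eq_sum_fib[OF ST_props(1) C_props(1), of \<phi>] C_props(3) ST_card by (simp add: \<sigma>_def)

lemma fib_mult_subset:
  "X \<subseteq> carrier G \<Longrightarrow> Y \<subseteq> carrier G \<Longrightarrow> fib \<phi> X a <#> fib \<phi> Y b \<subseteq> fib \<phi> (X <#> Y) (a \<otimes>\<^bsub>Q\<^esub> b)"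
  by (force simp: fib_def set_mult_iff subset_iff)

definition m where "m a b = card (fib \<phi> S a <#> fib \<phi> T b)"

lemma m_le_\<sigma>: "m a b \<le> \<sigma> (a \<otimes>\<^bsub>Q\<^esub> b)"
  unfolding m_def \<sigma>_def using ST_props(1) fib_mult_subset[OF S(1) T(1)]
  by (intro card_mono) (auto simp: fib_def)

lemma s_le_m: "b \<in> B \<Longrightarrow> s a \<le> m a b"
  unfolding s_def m_def using S T t_pos[of b]
  by (intro card_set_mult_ge_left) (auto simp: fib_def t_def)

lemma t_le_m: "a \<in> A \<Longrightarrow> t b \<le> m a b"
  unfolding t_def m_def using S T s_pos[of a]
  by (intro card_set_mult_ge_right) (auto simp: fib_def s_def)

lemma s_le_\<sigma>: "b \<in> B \<Longrightarrow> s a \<le> \<sigma> (a \<otimes>\<^bsub>Q\<^esub> b)" using s_le_m m_le_\<sigma> le_trans by blast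
lemma t_le_\<sigma>: "a \<in> A \<Longrightarrow> t b \<le> \<sigma> (a \<otimes>\<^bsub>Q\<^esub> b)" using t_le_m m_le_\<sigma> le_trans by blast

text \<open>Pigeonhole: for x over a + b, the set x minus the fibre of S and the fibre of T lie in
  the same coset of \<open>h\<close> elements and together have more than \<open>h\<close> elements,
  so they meet.\<close>

lemma m_full:
  assumes a: "a \<in> A" and b: "b \<in> B" and gt: "h < s a + t b"
  shows "m a b = h"
proof -
  have ac: "a \<in> carrier Q" "b \<in> carrier Q" using a b A_props B_props by auto
  have ab: "a \<otimes>\<^bsub>Q\<^esub> b \<in> carrier Q" using ac by simp
  have fc: "fib \<phi> S a \<subseteq> carrier G" "fib \<phi> T b \<subseteq> carrier G" "finite (fib \<phi> S a)" "finite (fib \<phi> T b)"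
    using S T by (auto simp: fib_def)
  have "{x \<in> carrier G. \<phi> x = a \<otimes>\<^bsub>Q\<^esub> b} \<subseteq> fib \<phi> S a <#> fib \<phi> T b"
  proof
    fix x assume "x \<in> {x \<in> carrier G. \<phi> x = a \<otimes>\<^bsub>Q\<^esub> b}"
    then have x: "x \<in> carrier G" "\<phi> x = a \<otimes>\<^bsub>Q\<^esub> b" by auto
    define R where "R = (\<lambda>y. x \<otimes> inv y) ` fib \<phi> S a"
    have "card R = s a"
      unfolding R_def s_def using fc(1) x(1) by (intro card_image inj_on_mult)
    have Rsub: "R \<subseteq> {x \<in> carrier G. \<phi> x = b}"
      using x S ac by (auto simp: R_def fib_def subset_iff) (simp add: Q.abelian_simps)
    have Tsub: "fib \<phi> T b \<subseteq> {x \<in> carrier G. \<phi> x = b}" using T by (auto simp: fib_def)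
    have "card (R \<union> fib \<phi> T b) \<le> h"
      unfolding card_fibre[OF ac(2), symmetric] using Rsub Tsub finite_fibre[OF ac(2)] by (intro card_mono) auto
    moreover have "card (R \<union> fib \<phi> T b) + card (R \<inter> fib \<phi> T b) = s a + t b"
      using card_Un_Int[of R "fib \<phi> T b"] fc \<open>card R = s a\<close> by (simp add: R_def t_def)
    ultimately have "R \<inter> fib \<phi> T b \<noteq> {}" using gt by (metis add_0_right card.empty not_le)
    then obtain y where y: "y \<in> fib \<phi> S a" "x \<otimes> inv y \<in> fib \<phi> T b" by (auto simp: R_def)
    have "y \<in> carrier G" using y fc by auto
    then have "x = y \<otimes> (x \<otimes> inv y)" using x by (simp add: abelian_simps)
    then show "x \<in> fib \<phi> S a <#> fib \<phi> T b" using y set_multI by metis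
  qed
  moreover have "fib \<phi> S a <#> fib \<phi> T b \<subseteq> fib \<phi> (S <#> T) (a \<otimes>\<^bsub>Q\<^esub> b)"
    using fib_mult_subset S T by blast
  then have "fib \<phi> S a <#> fib \<phi> T b \<subseteq> {x \<in> carrier G. \<phi> x = a \<otimes>\<^bsub>Q\<^esub> b}"
    using ST_props by (auto simp: fib_def)
  ultimately show ?thesis using card_fibre[OF ab] by (simp add: m_def subset_antisym)
qed

lemma \<sigma>_full: "a \<in> A \<Longrightarrow> b \<in> B \<Longrightarrow> h < s a + t b \<Longrightarrow> \<sigma> (a \<otimes>\<^bsub>Q\<^esub> b) = h"
  using m_full[of a b] m_le_\<sigma>[of a b] \<sigma>_le[of "a \<otimes>\<^bsub>Q\<^esub> b"] A_props B_props
  by (metis Q.m_closed le_antisym subsetD)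

lemma not_full: "a \<in> A \<Longrightarrow> b \<in> B \<Longrightarrow> \<sigma> (a \<otimes>\<^bsub>Q\<^esub> b) < h \<Longrightarrow> s a + t b \<le> h"
  using \<sigma>_full by (metis nat_less_le not_le)

text \<open>If all layers were full, a nontrivial element of the kernel of \<open>\<phi>\<close>
  would be a period of \<open>S <#> T\<close>.\<close>

lemma exists_not_full: "\<exists>c\<in>C. \<sigma> c < h"
proof (rule ccontr)
  assume "\<not> ?thesis"
  then have full: "\<sigma> c = h" if "c \<in> C" for c using \<sigma>_le C_props that by (metis le_neq_implies_less subsetD)
  have "\<exists>k. k \<in> carrier G \<and> \<phi> k = \<one>\<^bsub>Q\<^esub> \<and> k \<noteq> \<one>"
  proof (rule ccontr)
    assume "\<not> ?thesis"
    then have "{x \<in> carrier G. \<phi> x = \<one>\<^bsub>Q\<^esub>} \<subseteq> {\<one>}" by auto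
    then have "card {x \<in> carrier G. \<phi> x = \<one>\<^bsub>Q\<^esub>} \<le> 1" using card_mono[of "{\<one>}"] by fastforce
    then show False using card_fibre[of "\<one>\<^bsub>Q\<^esub>"] h2 by simp
  qed
  then obtain k where k: "k \<in> carrier G" "\<phi> k = \<one>\<^bsub>Q\<^esub>" "k \<noteq> \<one>" by auto
  have "k \<in> stabilizer G (S <#> T)"
  proof (rule stabilizerI[OF ST_props k(1)])
    fix x assume x: "x \<in> S <#> T"
    have xc: "x \<in> carrier G" using x ST_props by auto
    have "\<phi> x \<in> C" using x C_props by auto
    then have "fib \<phi> (S <#> T) (\<phi> x) = {y \<in> carrier G. \<phi> y = \<phi> x}"
      using full ST_props xc by (intro fib_full) (auto simp: \<sigma>_def)
    moreover have "k \<otimes> x \<in> {y \<in> carrier G. \<phi> y = \<phi> x}" using k xc by simp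
    ultimately show "k \<otimes> x \<in> S <#> T" by (auto simp: fib_def)
  qed
  then show False using periodic_if_stabilizer[OF ST_props(2)] k aper by blast
qed

subsection \<open>Column inequalities and double counting\<close>

text \<open>The only columns that can fall short of u h + t b: the fragment inequality says nothing
  about a one-point fibre, and here the sumset over the column is a translate of S.\<close>

definition exact where
  "exact b \<longleftrightarrow> t b = 1 \<and> g = 0 \<and> \<mu> = 0 \<and> (\<forall>a\<in>A. \<sigma> (a \<otimes>\<^bsub>Q\<^esub> b) = s a)"

lemma subset_frag:
  assumes "X \<subseteq> T" "2 \<le> card X"
  shows "card X + u * h \<le> card (X <#> S)"
proof (rule frag)
  show "X \<subseteq> carrier G" "finite X" using assms T finite_subset by auto
  have "X <#> S \<subseteq> S <#> T" using mono_set_mult[OF assms(1) order_refl, of G S] TS by simp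
  then have "card (X <#> S) \<le> card (S <#> T)" using ST_props by (intro card_mono)
  then show "infinite (carrier G) \<or> card (X <#> S) + 2 \<le> order G" using ST_ext by auto
qed (use assms in auto)

lemma sum_m:
  assumes "b \<in> carrier Q"
  shows "(\<Sum>a\<in>A. m a b) = card (fib \<phi> T b <#> S)"
proof -
  have fc: "fib \<phi> T b \<subseteq> carrier G" "finite (fib \<phi> T b)" using T by (auto simp: fib_def)
  have fin: "finite (fib \<phi> T b <#> S)" using fc S by (simp add: finite_set_mult)
  have im: "\<phi> ` (fib \<phi> T b <#> S) \<subseteq> (\<lambda>a. a \<otimes>\<^bsub>Q\<^esub> b) ` A"
    using S T by (force simp: set_mult_iff fib_def subset_iff Q.m_comm)
  have inj: "inj_on (\<lambda>a. a \<otimes>\<^bsub>Q\<^esub> b) A" using A_props(2) assms by (rule Q.inj_on_mult)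
  have "card (fib \<phi> T b <#> S) = (\<Sum>c\<in>(\<lambda>a. a \<otimes>\<^bsub>Q\<^esub> b) ` A. card (fib \<phi> (fib \<phi> T b <#> S) c))"
    using fin A_props im by (intro card_eq_sum_fib) auto
  also have "\<dots> = (\<Sum>a\<in>A. card (fib \<phi> (fib \<phi> T b <#> S) (a \<otimes>\<^bsub>Q\<^esub> b)))"
    using inj by (simp add: sum.reindex)
  also have "\<dots> = (\<Sum>a\<in>A. m a b)"
  proof (rule sum.cong[OF refl])
    fix a assume a: "a \<in> A"
    have ac: "a \<in> carrier Q" using a A_props by auto
    have "fib \<phi> (fib \<phi> T b <#> S) (a \<otimes>\<^bsub>Q\<^esub> b) = fib \<phi> S a <#> fib \<phi> T b"
    proof (intro equalityI subsetI)
      fix x assume "x \<in> fib \<phi> (fib \<phi> T b <#> S) (a \<otimes>\<^bsub>Q\<^esub> b)"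
      then obtain v y where x: "v \<in> T" "\<phi> v = b" "y \<in> S" "x = v \<otimes> y" "\<phi> x = a \<otimes>\<^bsub>Q\<^esub> b"
        by (auto simp: fib_def set_mult_iff)
      have c: "v \<in> carrier G" "y \<in> carrier G" using x S T by auto
      have "b \<otimes>\<^bsub>Q\<^esub> \<phi> y = b \<otimes>\<^bsub>Q\<^esub> a" using x c ac assms by (simp add: Q.m_comm)
      then have "\<phi> y = a" using c ac assms by simp
      moreover have "x = y \<otimes> v" using x c m_comm by simp
      ultimately show "x \<in> fib \<phi> S a <#> fib \<phi> T b" using x by (auto simp: fib_def set_mult_iff)
    next
      fix x assume "x \<in> fib \<phi> S a <#> fib \<phi> T b"
      then obtain v y where x: "v \<in> T" "\<phi> v = b" "y \<in> S" "\<phi> y = a" "x = y \<otimes> v"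
        by (auto simp: fib_def set_mult_iff)
      have c: "v \<in> carrier G" "y \<in> carrier G" using x S T by auto
      have "x = v \<otimes> y" "\<phi> x = a \<otimes>\<^bsub>Q\<^esub> b" using x c m_comm[of y v] \<phi>_mult[of y v] by auto
      then show "x \<in> fib \<phi> (fib \<phi> T b <#> S) (a \<otimes>\<^bsub>Q\<^esub> b)" using x by (auto simp: fib_def set_mult_iff)
    qed
    then show "card (fib \<phi> (fib \<phi> T b <#> S) (a \<otimes>\<^bsub>Q\<^esub> b)) = m a b" by (simp add: m_def)
  qed
  finally show ?thesis by simp
qed

text \<open>A fibre of T with two points is a subset to which the fragment inequality applies. For a
  single point the fibres of S alone suffice when g + \<mu> is positive.\<close>

lemma sum_m_ge:
  assumes b: "b \<in> B" and "2 \<le> t b \<or> 1 \<le> g + \<mu>"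
  shows "u * h + t b \<le> (\<Sum>a\<in>A. m a b)"
proof (cases "2 \<le> t b")
  case True
  then show ?thesis
    using subset_frag[of "fib \<phi> T b"] sum_m[of b] b B_props by (auto simp: t_def fib_def)
next
  case False
  then have "t b = 1" using t_pos[OF b] by simp
  moreover have "(\<Sum>a\<in>A. s a) \<le> (\<Sum>a\<in>A. m a b)" using s_le_m b by (intro sum_mono) auto
  ultimately show ?thesis using sum_s False assms(2) by simp
qed

lemma column:
  assumes b: "b \<in> B"
  shows "u * h + t b \<le> (\<Sum>a\<in>A. \<sigma> (a \<otimes>\<^bsub>Q\<^esub> b)) \<or> exact b \<and> (\<Sum>a\<in>A. \<sigma> (a \<otimes>\<^bsub>Q\<^esub> b)) = u * h"
proof (cases "2 \<le> t b \<or> 1 \<le> g + \<mu>")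
  case True
  have "(\<Sum>a\<in>A. m a b) \<le> (\<Sum>a\<in>A. \<sigma> (a \<otimes>\<^bsub>Q\<^esub> b))" using m_le_\<sigma> by (intro sum_mono) auto
  then show ?thesis using sum_m_ge[OF b True] by simp
next
  case False
  then have t1: "t b = 1" "g = 0" "\<mu> = 0" using t_pos[OF b] by auto
  have le: "(\<Sum>a\<in>A. s a) \<le> (\<Sum>a\<in>A. \<sigma> (a \<otimes>\<^bsub>Q\<^esub> b))" using s_le_\<sigma> b by (intro sum_mono) auto
  show ?thesis
  proof (cases "u * h + 1 \<le> (\<Sum>a\<in>A. \<sigma> (a \<otimes>\<^bsub>Q\<^esub> b))")
    case False
    then have eq: "(\<Sum>a\<in>A. s a) = (\<Sum>a\<in>A. \<sigma> (a \<otimes>\<^bsub>Q\<^esub> b))" using le sum_s t1 by simp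
    then have "\<forall>a\<in>A. s a = \<sigma> (a \<otimes>\<^bsub>Q\<^esub> b)"
      using sum_mono_inv[OF eq] s_le_\<sigma> b A_props by blast
    then have "exact b" unfolding exact_def using t1 by auto
    then show ?thesis using eq sum_s t1 by simp
  qed (use t1 in simp)
qed

definition "P = {b \<in> B. exact b}"

lemma P_ne: "P \<noteq> {} \<Longrightarrow> g = 0 \<and> \<mu> = 0" by (auto simp: P_def exact_def)

text \<open>The number of representations of c in A + B, counted by the summand in B.\<close>

definition r where "r c = card {b \<in> B. c \<otimes>\<^bsub>Q\<^esub> inv\<^bsub>Q\<^esub> b \<in> A}"

lemma sum_reps: "(\<Sum>b\<in>B. \<Sum>a\<in>A. f (a \<otimes>\<^bsub>Q\<^esub> b)) = (\<Sum>c\<in>C. r c * (f c :: nat))"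
proof -
  have "(\<Sum>b\<in>B. \<Sum>a\<in>A. f (a \<otimes>\<^bsub>Q\<^esub> b)) = (\<Sum>b\<in>B. \<Sum>c\<in>C. if c \<otimes>\<^bsub>Q\<^esub> inv\<^bsub>Q\<^esub> b \<in> A then f c else 0)"
  proof (rule sum.cong[OF refl])
    fix b assume b: "b \<in> B"
    have bc: "b \<in> carrier Q" using b B_props by auto
    have "(\<Sum>c\<in>C. if c \<otimes>\<^bsub>Q\<^esub> inv\<^bsub>Q\<^esub> b \<in> A then f c else 0) = sum f {c \<in> C. c \<otimes>\<^bsub>Q\<^esub> inv\<^bsub>Q\<^esub> b \<in> A}"
      using C_props by (simp add: sum.If_cases Int_def)
    also have "{c \<in> C. c \<otimes>\<^bsub>Q\<^esub> inv\<^bsub>Q\<^esub> b \<in> A} = (\<lambda>a. a \<otimes>\<^bsub>Q\<^esub> b) ` A"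
    proof (intro equalityI subsetI)
      fix c assume c: "c \<in> {c \<in> C. c \<otimes>\<^bsub>Q\<^esub> inv\<^bsub>Q\<^esub> b \<in> A}"
      then have "c \<in> carrier Q" using C_props by auto
      then have "c = c \<otimes>\<^bsub>Q\<^esub> inv\<^bsub>Q\<^esub> b \<otimes>\<^bsub>Q\<^esub> b" using bc by simp
      then show "c \<in> (\<lambda>a. a \<otimes>\<^bsub>Q\<^esub> b) ` A" using c by blast
    next
      fix c assume "c \<in> (\<lambda>a. a \<otimes>\<^bsub>Q\<^esub> b) ` A"
      then obtain a where a: "a \<in> A" "c = a \<otimes>\<^bsub>Q\<^esub> b" by auto
      then have "a \<in> carrier Q" using A_props by auto
      then show "c \<in> {c \<in> C. c \<otimes>\<^bsub>Q\<^esub> inv\<^bsub>Q\<^esub> b \<in> A}"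
        using a b bc Q.set_multI[of a A b B] by (simp add: C_def)
    qed
    also have "sum f ((\<lambda>a. a \<otimes>\<^bsub>Q\<^esub> b) ` A) = (\<Sum>a\<in>A. f (a \<otimes>\<^bsub>Q\<^esub> b))"
      using Q.inj_on_mult(1)[OF A_props(2) bc] by (simp add: sum.reindex)
    finally show "(\<Sum>a\<in>A. f (a \<otimes>\<^bsub>Q\<^esub> b)) = (\<Sum>c\<in>C. if c \<otimes>\<^bsub>Q\<^esub> inv\<^bsub>Q\<^esub> b \<in> A then f c else 0)" by simp
  qed
  also have "\<dots> = (\<Sum>c\<in>C. \<Sum>b\<in>B. if c \<otimes>\<^bsub>Q\<^esub> inv\<^bsub>Q\<^esub> b \<in> A then f c else 0)" by (rule sum.swap)
  also have "\<dots> = (\<Sum>c\<in>C. r c * f c)"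
    using B_props by (intro sum.cong refl) (simp add: sum.If_cases Int_def r_def)
  finally show ?thesis .
qed

lemma sum_r: "(\<Sum>c\<in>C. r c) = card B * (u + 1)"
  using sum_reps[of "\<lambda>_. 1"] A_card by simp

definition d where "d c = h - \<sigma> c"

lemma d_\<sigma>: "c \<in> carrier Q \<Longrightarrow> d c + \<sigma> c = h" using \<sigma>_le by (simp add: d_def)

lemma sum_d: "(\<Sum>c\<in>C. d c) + card T + u * h + g = card C * h"
proof -
  have "(\<Sum>c\<in>C. d c) + (\<Sum>c\<in>C. \<sigma> c) = (\<Sum>c\<in>C. h)"
    unfolding sum.distrib[symmetric] using d_\<sigma> C_props by (intro sum.cong) auto
  then show ?thesis using sum_\<sigma> by simp
qed

text \<open>\<open>column\<close> is summed over all of B. Each exact column falls short by one,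
  which is the term \<open>card P\<close>; \<open>sum_r\<close> converts sizes into
  deficiencies.\<close>

lemma sum_rd: "(\<Sum>c\<in>C. r c * d c) + card T \<le> card B * h + card P"
proof -
  have "card B * (u * h) + card T = (\<Sum>b\<in>B. u * h + t b)" by (simp add: sum.distrib sum_t)
  also have "\<dots> \<le> (\<Sum>b\<in>B. (\<Sum>a\<in>A. \<sigma> (a \<otimes>\<^bsub>Q\<^esub> b)) + (if exact b then 1 else 0))"
    using column by (intro sum_mono) (fastforce simp: exact_def)
  also have "\<dots> = (\<Sum>c\<in>C. r c * \<sigma> c) + card P"
    using B_props by (simp add: sum.distrib sum_reps sum.If_cases P_def Int_def)
  finally have 1: "card B * (u * h) + card T \<le> (\<Sum>c\<in>C. r c * \<sigma> c) + card P" .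
  have "(\<Sum>c\<in>C. r c * d c) + (\<Sum>c\<in>C. r c * \<sigma> c) = (\<Sum>c\<in>C. r c * h)"
    unfolding sum.distrib[symmetric] distrib_left[symmetric] using d_\<sigma> C_props by (intro sum.cong) auto
  also have "\<dots> = card B * (u + 1) * h" using sum_r by (simp add: sum_distrib_right[symmetric])
  finally show ?thesis using 1 by (simp add: algebra_simps)
qed

subsection \<open>Consequences in the quotient\<close>

text \<open>The fragment inequality for the full preimage of U, divided by \<open>h\<close>.\<close>

lemma expand:
  assumes "finite U" "U \<subseteq> carrier Q" "U \<noteq> {}"
  shows "U <#>\<^bsub>Q\<^esub> A = carrier Q \<or> card U + u \<le> card (U <#>\<^bsub>Q\<^esub> A)"
proof (rule disjCI)
  assume neg: "\<not> card U + u \<le> card (U <#>\<^bsub>Q\<^esub> A)"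
  show "U <#>\<^bsub>Q\<^esub> A = carrier Q"
  proof (rule ccontr)
    assume ne: "U <#>\<^bsub>Q\<^esub> A \<noteq> carrier Q"
    have UA: "finite (U <#>\<^bsub>Q\<^esub> A)" "U <#>\<^bsub>Q\<^esub> A \<subseteq> carrier Q"
      using assms A_props by (auto simp: Q.finite_set_mult Q.setmult_subset_G)
    have "card U \<ge> 1" using assms by (simp add: Suc_leI card_gt_0_iff)
    have "h * 1 \<le> h * card U" using \<open>card U \<ge> 1\<close> by (intro mult_le_mono2)
    then have c2: "2 \<le> card (pre U)" using card_pre(2)[OF assms(1,2)] h2 by linarith
    have ext: "infinite (carrier G) \<or> card (pre U <#> S) + 2 \<le> order G"
    proof (rule disjCI)
      assume small: "\<not> card (pre U <#> S) + 2 \<le> order G"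
      show "infinite (carrier G)"
      proof
        assume fin: "finite (carrier G)"
        have "card (U <#>\<^bsub>Q\<^esub> A) < card (carrier Q)"
          using UA ne finite_Q[OF fin] by (intro psubset_card_mono) auto
        then have "h * (card (U <#>\<^bsub>Q\<^esub> A) + 1) \<le> h * card (carrier Q)" by (intro mult_le_mono2) simp
        then show False using small order_G[OF fin] card_pre(2)[OF UA] pre_set_mult[OF assms(2) S(1)] h2 by simp
      qed
    qed
    have "card (pre U) + u * h \<le> card (pre U <#> S)"
      using card_pre(1)[OF assms(1,2)] c2 ext by (intro frag) (auto simp: pre_def)
    then have "h * card U + u * h \<le> h * card (U <#>\<^bsub>Q\<^esub> A)"
      using card_pre(2)[OF assms(1,2)] card_pre(2)[OF UA] pre_set_mult[OF assms(2) S(1)] by simp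
    then have "h * (card U + u) \<le> h * card (U <#>\<^bsub>Q\<^esub> A)" by (simp add: algebra_simps)
    then show False using neg h2 by simp
  qed
qed

lemma C_comm: "C = B <#>\<^bsub>Q\<^esub> A" using Q.set_mult_comm A_props B_props by (simp add: C_def)

lemma C_ge: "C = carrier Q \<or> card B + u \<le> card C"
  using expand[OF B_props] C_comm by simp

text \<open>Twice the first inequality is the size hypothesis combined with |S| \<le> |T|, except
  for an excess of \<mu> \<le> 1, which parity removes. The other two then follow from |S| \<le>
  |T|.\<close>

lemma size_bound:
  assumes "finite (carrier G)"
  shows "card T + 2 * (u * h) + 2 * g \<le> h * card (carrier Q)"
    and "3 * (u * h) + 3 * g + \<mu> \<le> h * card (carrier Q)"
    and "3 * u \<le> card (carrier Q)"
proof -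
  define n where "n = h * card (carrier Q)"
  have 1: "3 * (card T + u * h + g) \<le> 2 * n + 2 * \<mu>"
    using size ST_card order_G[OF assms] assms by (simp add: n_def)
  have 2: "u * h + g + \<mu> \<le> card T" using ST_le S_card by simp
  have ar: "3 * (t + a + g) \<le> 2 * n + 2 * \<mu> \<Longrightarrow> a + g + \<mu> \<le> t \<Longrightarrow> \<mu> \<le> 1 \<Longrightarrow> t + 2 * a + 2 * g \<le> n"
    for t a n :: nat by (cases "\<mu> = 0") auto
  show "card T + 2 * (u * h) + 2 * g \<le> h * card (carrier Q)"
    using ar[OF 1 2 gmu(2)] unfolding n_def .
  then show 3: "3 * (u * h) + 3 * g + \<mu> \<le> h * card (carrier Q)" using 2 by linarith
  have "h * (3 * u) = 3 * (u * h)" by simp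
  then have "h * (3 * u) \<le> h * card (carrier Q)" using 3 by linarith
  then show "3 * u \<le> card (carrier Q)" using h2 by simp
qed

lemma A_ne: "A \<noteq> carrier Q"
proof
  assume e: "A = carrier Q"
  then have "finite (carrier G)" using infinite_Q A_props by auto
  then have "3 * u \<le> u + 1" using size_bound(3) A_card e by simp
  then show False using u1 by simp
qed

text \<open>\<open>no_larger\<close> settles the case L + A \<noteq> Q. If L + A = Q were too small,
  then |Q| \<le> |L| + u, while L is proper and so |Q| \<ge> 2 |L|; this gives |Q| \<le> 2 u,
  against |Q| \<ge> 3 u.\<close>

lemma no_subgroup:
  assumes L: "subgroup L Q" "finite L" "2 \<le> card L" "\<not> A \<subseteq> L"
  shows "card L + card A \<le> card (L <#>\<^bsub>Q\<^esub> A)"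
proof (rule ccontr)
  assume neg: "\<not> ?thesis"
  interpret L: subgroup L Q by fact
  have e: "L <#>\<^bsub>Q\<^esub> A = carrier Q" using no_larger[OF L(1,2,3)] neg A_card by linarith
  have fQ: "finite (carrier Q)" using e L A_props Q.finite_set_mult by metis
  then have fG: "finite (carrier G)" using infinite_Q by blast
  have "card L * card (rcosets\<^bsub>Q\<^esub> L) = card (carrier Q)"
    using Q.lagrange_finite[OF fQ L(1)] by (simp add: order_def mult.commute)
  moreover have "L \<noteq> carrier Q" using L A_props by auto
  then have "card L < card (carrier Q)" using L.subset fQ by (intro psubset_card_mono) auto
  ultimately have "card (rcosets\<^bsub>Q\<^esub> L) \<noteq> 1" "card (rcosets\<^bsub>Q\<^esub> L) \<noteq> 0" by (auto intro!: gr0I)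
  then have "2 \<le> card (rcosets\<^bsub>Q\<^esub> L)" by simp
  then have "card L * 2 \<le> card (carrier Q)" using \<open>card L * _ = _\<close> by (metis mult_le_mono2)
  moreover have "card (carrier Q) \<le> card L + u" using neg e A_card by simp
  ultimately show False using size_bound(3)[OF fG] L(3) u1 by linarith
qed

text \<open>Hall's theorem is avoided by comparing, for each \<open>v\<close>, the sets of \<open>c\<close> with \<open>v \<le> \<sigma> c\<close>.\<close>

lemma C_le: "card C \<le> card B + u"
proof (rule ccontr)
  assume neg: "\<not> ?thesis"
  then have big: "card B + u + 1 \<le> card C" by simp
  define Cv where "Cv = (\<lambda>v. {c \<in> C. v \<le> \<sigma> c})"
  define Bv where "Bv = (\<lambda>v. {b \<in> B. v \<le> t b})"
  have sumC: "(\<Sum>v\<in>{1..h}. card (Cv v)) = card T + u * h + g"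
    unfolding Cv_def sum_\<sigma>[symmetric]
    using \<sigma>_le C_props by (intro sum_eq_layers[symmetric]) auto
  have sumB: "(\<Sum>v\<in>{1..h}. card (Bv v)) = card T"
    unfolding Bv_def sum_t[symmetric]
    using t_le B_props by (intro sum_eq_layers[symmetric]) auto
  have finC: "finite (Cv v)" for v using C_props by (simp add: Cv_def)
  show False
  proof (cases "(\<exists>b\<in>B. 2 \<le> t b) \<or> 1 \<le> g + \<mu>")
    case True
    \<comment> \<open>The comparison uses the column of a largest fibre of T, at b0, and a row z
      with a smallest fibre of S.\<close>
    have "Max (t ` B) \<in> t ` B" using B_props by (intro Max_in) auto
    then obtain b0 where b0: "b0 \<in> B" "t b0 = Max (t ` B)" by (metis (no_types, lifting) imageE)
    have mx: "t b \<le> t b0" if "b \<in> B" for b using b0 B_props that by simp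
    have "Min (s ` A) \<in> s ` A" using A_props by (intro Min_in) auto
    then obtain z where z: "z \<in> A" "s z = Min (s ` A)" by (metis (no_types, lifting) imageE)
    have mn: "s z \<le> s a" if "a \<in> A" for a using z A_props that by simp
    have b0c: "b0 \<in> carrier Q" "z \<in> carrier Q" using b0 z A_props B_props by auto
    have sm: "u * h + t b0 \<le> (\<Sum>a\<in>A. m a b0)"
      using True mx b0 by (intro sum_m_ge) (auto intro: order_trans)
    define Mv where "Mv = (\<lambda>v. {a \<in> A. v \<le> m a b0})"
    have mh: "m a b0 \<le> h" if "a \<in> A" for a
      using m_le_\<sigma>[of a b0] \<sigma>_le that A_props b0c by (meson Q.m_closed order_trans subsetD)
    have sumM: "(\<Sum>v\<in>{1..h}. card (Mv v)) = (\<Sum>a\<in>A. m a b0)"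
      unfolding Mv_def
      using mh A_props by (intro sum_eq_layers[symmetric]) auto
    have CvC: "Cv v = C" if "v \<le> s z" for v
    proof -
      have "v \<le> \<sigma> c" if c: "c \<in> C" for c
      proof -
        obtain a b where "a \<in> A" "b \<in> B" "c = a \<otimes>\<^bsub>Q\<^esub> b" using c by (auto simp: C_def Q.set_mult_iff)
        then show ?thesis using mn[of a] s_le_\<sigma>[of b a] \<open>v \<le> s z\<close> by simp
      qed
      then show ?thesis by (auto simp: Cv_def)
    qed
    \<comment> \<open>Summed over v this gives s z \<le> g. At the levels v \<le> s z all of C is
      counted, and there the assumed excess of C yields the additional unit.\<close>
    have key: "card (Bv v) + card (Mv v) + (if v \<le> s z then 1 else 0) \<le> card (Cv v) + (if v \<le> t b0 then 1 else 0)"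
      if v: "v \<in> {1..h}" for v
    proof -
      have MvA: "card (Mv v) \<le> u + 1" using A_card A_props card_mono[of A "Mv v"] by (auto simp: Mv_def)
      have BvB: "card (Bv v) \<le> card B" using B_props by (intro card_mono) (auto simp: Bv_def)
      show ?thesis
      proof (cases "v \<le> t b0")
        case vt: True
        show ?thesis
        proof (cases "v \<le> s z")
          case True then show ?thesis using CvC big MvA BvB vt by simp
        next
          case False
          have "b0 \<in> Bv v" using b0 vt by (simp add: Bv_def)
          then have ne: "finite (Bv v)" "Bv v \<subseteq> carrier Q" "Bv v \<noteq> {}" using B_props by (auto simp: Bv_def)
          have sub: "Bv v <#>\<^bsub>Q\<^esub> A \<subseteq> Cv v"
          proof
            fix c assume "c \<in> Bv v <#>\<^bsub>Q\<^esub> A"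
            then obtain a b where ab: "a \<in> A" "b \<in> B" "v \<le> t b" "c = b \<otimes>\<^bsub>Q\<^esub> a" by (auto simp: Bv_def Q.set_mult_iff)
            then have e: "c = a \<otimes>\<^bsub>Q\<^esub> b" using A_props B_props by (metis Q.m_comm subsetD)
            then have "c \<in> C" using ab unfolding C_def by (auto intro: Q.set_multI)
            then show "c \<in> Cv v" using ab t_le_\<sigma>[of a b] e by (simp add: Cv_def)
          qed
          then have le: "card (Bv v <#>\<^bsub>Q\<^esub> A) \<le> card (Cv v)" using finC by (intro card_mono)
          from expand[OF ne] have "card (Bv v) + u \<le> card (Cv v)"
          proof
            assume "Bv v <#>\<^bsub>Q\<^esub> A = carrier Q"
            then have "Cv v = C" using sub C_props by (auto simp: Cv_def)
            then show ?thesis using big BvB by simp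
          qed (use le in simp)
          then show ?thesis using False vt MvA by simp
        qed
      next
        case vt: False
        then have "Bv v = {}" unfolding Bv_def using mx order_trans by blast
        moreover have "card (Mv v) \<le> card (Cv v)"
        proof -
          have "(\<lambda>a. a \<otimes>\<^bsub>Q\<^esub> b0) ` Mv v \<subseteq> Cv v"
          proof
            fix c assume "c \<in> (\<lambda>a. a \<otimes>\<^bsub>Q\<^esub> b0) ` Mv v"
            then obtain a where a: "a \<in> A" "v \<le> m a b0" "c = a \<otimes>\<^bsub>Q\<^esub> b0" by (auto simp: Mv_def)
            then have "c \<in> C" using b0 unfolding C_def by (auto intro: Q.set_multI)
            then show "c \<in> Cv v" using a m_le_\<sigma>[of a b0] by (simp add: Cv_def)
          qed
          moreover have "inj_on (\<lambda>a. a \<otimes>\<^bsub>Q\<^esub> b0) (Mv v)"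
            using A_props b0c by (intro Q.inj_on_mult) (auto simp: Mv_def)
          ultimately show ?thesis using finC by (metis card_inj_on_le)
        qed
        moreover have "1 \<le> card B" using B_props by (simp add: Suc_le_eq card_gt_0_iff)
        ultimately show ?thesis using vt MvA big CvC[of v] by (cases "v \<le> s z") auto
      qed
    qed
    have cnt: "(\<Sum>v\<in>{1..h}. if v \<le> k then 1 else 0) = k" if "k \<le> h" for k :: nat
    proof -
      have "{1..h} \<inter> {v. v \<le> k} = {1..k}" using that by auto
      then show ?thesis by (simp add: sum.If_cases)
    qed
    have "(\<Sum>v\<in>{1..h}. card (Bv v) + card (Mv v) + (if v \<le> s z then 1 else 0))
        \<le> (\<Sum>v\<in>{1..h}. card (Cv v) + (if v \<le> t b0 then 1 else 0))"
      using key by (rule sum_mono)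
    then have szg: "s z \<le> g"
      using sumB sumM sumC sm cnt[of "s z"] cnt[of "t b0"] s_le[of z] t_le[of b0] b0c
      by (simp add: sum.distrib)
    \<comment> \<open>Since s z \<le> g, the other u rows must fill their cosets to reach the total
      u h + g + \<mu>.\<close>
    have others: "s a = h" if a: "a \<in> A" "a \<noteq> z" for a
    proof (rule ccontr)
      assume "s a \<noteq> h"
      then have "s a < h" using s_le a A_props by (metis le_neq_implies_less subsetD)
      then have "(\<Sum>a\<in>A - {z}. s a) < (\<Sum>a\<in>A - {z}. h)"
        using a A_props s_le by (intro sum_strict_mono_ex1) auto
      moreover have "(\<Sum>a\<in>A. s a) = s z + (\<Sum>a\<in>A - {z}. s a)" using z A_props by (simp add: sum.remove)
      moreover have "(\<Sum>a\<in>A - {z}. h) = u * h" using A_card A_props z by simp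
      ultimately show False using szg sum_s by linarith
    qed
    \<comment> \<open>Everything over F is full, and outside F each layer is at least as large as a
      fibre of T. So the extra element of C costs one more coset than |S + T| allows.\<close>
    define F where "F = (A - {z}) <#>\<^bsub>Q\<^esub> B"
    define R where "R = {b \<in> B. z \<otimes>\<^bsub>Q\<^esub> b \<notin> F}"
    have FC: "F \<subseteq> C" unfolding F_def C_def by (intro mono_set_mult) auto
    have Ff: "\<sigma> c = h" if c: "c \<in> F" for c
    proof -
      obtain a b where ab: "a \<in> A" "a \<noteq> z" "b \<in> B" "c = a \<otimes>\<^bsub>Q\<^esub> b" using c by (auto simp: F_def Q.set_mult_iff)
      have "h < s a + t b" using others[OF ab(1,2)] t_pos[OF ab(3)] by simp
      then show ?thesis using \<sigma>_full ab by simp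
    qed
    have CF: "C - F = (\<lambda>b. z \<otimes>\<^bsub>Q\<^esub> b) ` R"
    proof (intro equalityI subsetI)
      fix c assume c: "c \<in> C - F"
      then obtain a b where ab: "a \<in> A" "b \<in> B" "c = a \<otimes>\<^bsub>Q\<^esub> b" by (auto simp: C_def Q.set_mult_iff)
      then have "a = z" using c by (auto simp: F_def intro: Q.set_multI)
      then show "c \<in> (\<lambda>b. z \<otimes>\<^bsub>Q\<^esub> b) ` R" using ab c by (auto simp: R_def)
    qed (use z in \<open>auto simp: R_def C_def intro: Q.set_multI\<close>)
    have inj: "inj_on (\<lambda>b. z \<otimes>\<^bsub>Q\<^esub> b) R" using B_props b0c by (intro Q.inj_on_mult) (auto simp: R_def)
    have fR: "finite R" "R \<subseteq> B" using B_props by (auto simp: R_def)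
    have "card (C - F) = card R" unfolding CF using inj by (rule card_image)
    then have cF: "card F + card R = card C" using FC C_props
      by (metis card_Diff_subset card_mono finite_subset le_add_diff_inverse)
    have "(\<Sum>c\<in>C. \<sigma> c) = (\<Sum>c\<in>F. \<sigma> c) + (\<Sum>c\<in>C - F. \<sigma> c)"
      using FC C_props by (metis add.commute sum.subset_diff)
    moreover have "(\<Sum>c\<in>F. \<sigma> c) = card F * h" using Ff by simp
    moreover have "(\<Sum>c\<in>C - F. \<sigma> c) = (\<Sum>b\<in>R. \<sigma> (z \<otimes>\<^bsub>Q\<^esub> b))" unfolding CF using inj by (simp add: sum.reindex)
    moreover have "(\<Sum>b\<in>R. t b) \<le> (\<Sum>b\<in>R. \<sigma> (z \<otimes>\<^bsub>Q\<^esub> b))" using t_le_\<sigma> z by (intro sum_mono) auto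
    moreover have "(\<Sum>b\<in>B. t b) = (\<Sum>b\<in>R. t b) + (\<Sum>b\<in>B - R. t b)"
      using fR B_props by (metis add.commute sum.subset_diff)
    moreover have "(\<Sum>b\<in>B - R. t b) \<le> (\<Sum>b\<in>B - R. h)" using t_le B_props by (intro sum_mono) auto
    moreover have "card (B - R) + card R = card B"
      using fR B_props by (metis card_Diff_subset card_mono le_add_diff_inverse2)
    moreover have "(card (B - R) + u + 1) * h \<le> card F * h"
      using cF big \<open>card (B - R) + card R = card B\<close> by (intro mult_le_mono1) linarith
    ultimately show False using sum_\<sigma> sum_t gmu by (simp add: algebra_simps)
  next
    \<comment> \<open>All fibres of T are points, so |T| = |B|. The levels 1 and 2 alone give |C| +
      |B| \<le> |B| + u h, while |C| > |B| + u and |B| \<ge> |S| = u h.\<close>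
    case False
    then have t1: "t b = 1" if "b \<in> B" for b
      using t_pos[OF that] that by (metis One_nat_def Suc_1 le_antisym not_less_eq_eq)
    have g0: "g = 0" "\<mu> = 0" using False by auto
    have cTB: "card T = card B" using sum_t t1 by simp
    have "\<exists>a\<in>A. 2 \<le> s a"
    proof (rule ccontr)
      assume "\<not> ?thesis"
      then have "(\<Sum>a\<in>A. s a) \<le> (\<Sum>a\<in>A. 1)" by (intro sum_mono) auto
      then have "u * h \<le> u + 1" "3 \<le> u + 1" using sum_s A_card g0 S_card S3 by auto
      moreover have "u * 2 \<le> u * h" using h2 by simp
      ultimately show False by simp
    qed
    then obtain a where a: "a \<in> A" "2 \<le> s a" by auto
    have "(\<lambda>b. a \<otimes>\<^bsub>Q\<^esub> b) ` B \<subseteq> Cv 2"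
    proof
      fix c assume "c \<in> (\<lambda>b. a \<otimes>\<^bsub>Q\<^esub> b) ` B"
      then obtain b where b: "b \<in> B" "c = a \<otimes>\<^bsub>Q\<^esub> b" by auto
      then have "c \<in> C" using a by (auto simp: C_def intro: Q.set_multI)
      then show "c \<in> Cv 2" using s_le_\<sigma>[of b a] b a by (simp add: Cv_def)
    qed
    moreover have "inj_on (\<lambda>b. a \<otimes>\<^bsub>Q\<^esub> b) B" using B_props A_props a by (intro Q.inj_on_mult) auto
    ultimately have c2: "card B \<le> card (Cv 2)" using finC by (metis card_inj_on_le)
    have "Cv 1 = C"
    proof -
      have "1 \<le> \<sigma> c" if c: "c \<in> C" for c
      proof -
        obtain a b where "a \<in> A" "b \<in> B" "c = a \<otimes>\<^bsub>Q\<^esub> b" using c by (auto simp: C_def Q.set_mult_iff)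
        then show ?thesis using s_pos[of a] s_le_\<sigma>[of b a] by simp
      qed
      then show ?thesis by (auto simp: Cv_def)
    qed
    moreover have "(\<Sum>v\<in>{1,2}. card (Cv v)) \<le> (\<Sum>v\<in>{1..h}. card (Cv v))"
      using h2 by (intro sum_mono2) auto
    ultimately have "card C + card (Cv 2) \<le> card T + u * h + g" using sumC by simp
    then show False using c2 big cTB g0 ST_le S_card u1 by simp
  qed
qed

section \<open>Fibres of S, T and S + T, and their stabilizers\<close>

abbreviation "Sa \<equiv> fib \<phi> S"
abbreviation "Tb \<equiv> fib \<phi> T"
abbreviation "Zc \<equiv> fib \<phi> (S <#> T)"

lemma fibs: "Sa a \<subseteq> carrier G" "finite (Sa a)" "Tb b \<subseteq> carrier G" "finite (Tb b)" "Zc c \<subseteq> carrier G" "finite (Zc c)"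
  using S T ST_props by (auto simp: fib_def)

lemma fibD: "x \<in> fib \<phi> X a \<Longrightarrow> \<phi> x = a" "x \<in> fib \<phi> X a \<Longrightarrow> x \<in> X"
  by (auto simp: fib_def)

lemma Sa_ne: "a \<in> A \<Longrightarrow> Sa a \<noteq> {}" by (auto simp: fib_def)
lemma Tb_ne: "b \<in> B \<Longrightarrow> Tb b \<noteq> {}" by (auto simp: fib_def)

lemma ST_subset_Zc: "Sa a <#> Tb b \<subseteq> Zc (a \<otimes>\<^bsub>Q\<^esub> b)"
  using fib_mult_subset S T by blast

lemma translate_subset_Zc: "v \<in> Tb b \<Longrightarrow> (\<otimes>) v ` Sa a \<subseteq> Zc (a \<otimes>\<^bsub>Q\<^esub> b)"
proof
  fix x assume v: "v \<in> Tb b" and "x \<in> (\<otimes>) v ` Sa a"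
  then obtain y where y: "y \<in> Sa a" "x = v \<otimes> y" by auto
  then have "x = y \<otimes> v" using v fibs m_comm by (metis subsetD)
  then show "x \<in> Zc (a \<otimes>\<^bsub>Q\<^esub> b)" using ST_subset_Zc y v set_multI by blast
qed

lemma translate_eq_Zc:
  assumes "v \<in> Tb b" "\<sigma> (a \<otimes>\<^bsub>Q\<^esub> b) = s a"
  shows "(\<otimes>) v ` Sa a = Zc (a \<otimes>\<^bsub>Q\<^esub> b)"
proof (rule card_subset_eq[OF fibs(6) translate_subset_Zc[OF assms(1)]])
  have "v \<in> carrier G" using assms fibs by blast
  then show "card ((\<otimes>) v ` Sa a) = card (Zc (a \<otimes>\<^bsub>Q\<^esub> b))"
    using card_translate fibs(1) assms by (simp add: \<sigma>_def s_def)
qed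

lemma no_stabilizer: "k \<in> stabilizer G (S <#> T) \<Longrightarrow> k = \<one>"
  using periodic_if_stabilizer[OF ST_props(2)] aper by blast

lemma no_stabilizer_factor:
  "k \<in> stabilizer G S \<Longrightarrow> k = \<one>" "k \<in> stabilizer G T \<Longrightarrow> k = \<one>"
  using stabilizer_set_mult_mono[OF S(1) T(1)] stabilizer_set_mult_mono[OF T(1) S(1)] TS no_stabilizer by auto

text \<open>A common translation carrying every \<open>S <#> T\<close>-fibre to the next one would be a period.\<close>

lemma equal_layers:
  assumes B: "B = carrier Q" and a: "a0 \<in> A" "a1 \<in> A" "a0 \<noteq> a1"
    and eq: "\<And>c. c \<in> carrier Q \<Longrightarrow> \<sigma> c = s a0" "\<And>c. c \<in> carrier Q \<Longrightarrow> \<sigma> c = s a1"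
  shows False
proof -
  have ac: "a0 \<in> carrier Q" "a1 \<in> carrier Q" using a A_props by auto
  have Zeq: "(\<otimes>) v ` Sa a' = Zc c" if "v \<in> Tb (inv\<^bsub>Q\<^esub> a' \<otimes>\<^bsub>Q\<^esub> c)" "a' = a0 \<or> a' = a1" "c \<in> carrier Q" for v a' c
  proof -
    have "a' \<otimes>\<^bsub>Q\<^esub> (inv\<^bsub>Q\<^esub> a' \<otimes>\<^bsub>Q\<^esub> c) = c" "s a' = \<sigma> c" using that eq[OF that(3)] ac by auto
    then show ?thesis using translate_eq_Zc[OF that(1), of a'] by simp
  qed
  have ex: "\<exists>v. v \<in> Tb q" if "q \<in> carrier Q" for q using Tb_ne[of q] that B by auto
  obtain v0 v1 where v: "v0 \<in> Tb (inv\<^bsub>Q\<^esub> a0)" "v1 \<in> Tb (inv\<^bsub>Q\<^esub> a1)" using ex ac by (meson Q.inv_closed)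
  have vc: "v0 \<in> carrier G" "v1 \<in> carrier G" using v fibs by blast+
  have e01: "(\<otimes>) v0 ` Sa a0 = (\<otimes>) v1 ` Sa a1"
    using Zeq[of v0 a0 "\<one>\<^bsub>Q\<^esub>"] Zeq[of v1 a1 "\<one>\<^bsub>Q\<^esub>"] v ac by simp
  define k where "k = inv v1 \<otimes> v0"
  have kc: "k \<in> carrier G" using vc by (simp add: k_def)
  have k1: "(\<otimes>) k ` Sa a0 = Sa a1"
  proof -
    have "(\<otimes>) k ` Sa a0 = (\<otimes>) (inv v1) ` (\<otimes>) v0 ` Sa a0"
      unfolding k_def using translate_translate[of "inv v1" v0 "Sa a0"] vc fibs by simp
    also have "\<dots> = Sa a1" unfolding e01 using translate_translate[of "inv v1" v1 "Sa a1"] vc fibs by (simp add: translate_one)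
    finally show ?thesis .
  qed
  have "k \<in> stabilizer G (S <#> T)"
  proof (rule stabilizerI[OF ST_props kc])
    fix x assume x: "x \<in> S <#> T"
    have xc: "x \<in> carrier G" using x ST_props by auto
    define c where "c = \<phi> x"
    have cc: "c \<in> carrier Q" using xc by (simp add: c_def)
    obtain v where v: "v \<in> Tb (inv\<^bsub>Q\<^esub> a0 \<otimes>\<^bsub>Q\<^esub> c)" using ex cc ac by (meson Q.inv_closed Q.m_closed)
    have vc: "v \<in> carrier G" using v fibs by blast
    have "x \<in> Zc c" using x by (simp add: fib_def c_def)
    then have "x \<in> (\<otimes>) v ` Sa a0" using Zeq[OF v _ cc] by simp
    then obtain y where y: "y \<in> Sa a0" "x = v \<otimes> y" by auto
    have yc: "y \<in> carrier G" using y fibs by blast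
    have "k \<otimes> x = v \<otimes> (k \<otimes> y)" using y kc vc yc by (simp add: m_ac)
    moreover have "k \<otimes> y \<in> Sa a1" using y k1 by auto
    ultimately have "k \<otimes> x \<in> Zc (a1 \<otimes>\<^bsub>Q\<^esub> (inv\<^bsub>Q\<^esub> a0 \<otimes>\<^bsub>Q\<^esub> c))" using translate_subset_Zc[OF v, of a1] by auto
    then show "k \<otimes> x \<in> S <#> T" by (simp add: fib_def)
  qed
  then have "k = \<one>" by (rule no_stabilizer)
  then have "Sa a0 = Sa a1" using k1 fibs by (simp add: translate_one)
  then show False using Sa_ne[OF a(1)] a(3) by (auto simp: fib_def)
qed

definition "N = {x \<in> carrier G. \<phi> x = \<one>\<^bsub>Q\<^esub>}"

lemma N_subgroup: "subgroup N G"
  by (rule subgroupI) (auto simp: N_def intro!: exI[of _ \<one>])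

lemma N_card: "card N = h" "finite N"
  using card_fibre finite_fibre by (auto simp: N_def)

lemma stabilizer_fibre:
  assumes Z: "Z \<subseteq> carrier G" "Z \<noteq> {}" "finite Z" "\<And>z. z \<in> Z \<Longrightarrow> \<phi> z = c"
  shows "stabilizer G Z \<subseteq> N" "card (stabilizer G Z) dvd card Z" "card (stabilizer G Z) dvd h"
proof -
  have sg: "subgroup (stabilizer G Z) G" using Z(1) by (rule stabilizer_subgroup)
  show sub: "stabilizer G Z \<subseteq> N"
  proof
    fix k assume k: "k \<in> stabilizer G Z"
    obtain z where z: "z \<in> Z" using Z by auto
    have c: "k \<in> carrier G" "z \<in> carrier G" using k z Z stabilizer_subset by auto
    have "\<phi> (k \<otimes> z) = c" "\<phi> z = c" using Z(4) z k stabilizer_mult by auto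
    then have "\<phi> k = \<one>\<^bsub>Q\<^esub>" using c Q.r_cancel_one[of "\<phi> z" "\<phi> k"] by fastforce
    then show "k \<in> N" using c by (simp add: N_def)
  qed
  show "card (stabilizer G Z) dvd card Z"
    by (rule card_dvd_invariant[OF sg Z(3,1)]) (rule stabilizer_mult)
  have "card (stabilizer G Z) dvd card N"
  proof (rule card_dvd_invariant[OF sg N_card(2)])
    show "k \<otimes> x \<in> N" if "k \<in> stabilizer G Z" "x \<in> N" for k x
      using that sub by (auto simp: N_def subset_iff)
  qed (auto simp: N_def)
  then show "card (stabilizer G Z) dvd h" by (simp add: N_card)
qed

text \<open>Inclusion-exclusion in Q for B and c - A; the elements of their intersection are
  representations of c.\<close>

lemma sum_reps_ge:
  assumes fin: "finite (carrier Q)" and c: "c \<in> carrier Q"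
  shows "u + 1 + card B \<le> r c + card (carrier Q)"
proof -
  define D where "D = (\<lambda>a. c \<otimes>\<^bsub>Q\<^esub> inv\<^bsub>Q\<^esub> a) ` A"
  have cD: "card D = u + 1" unfolding D_def
    using Q.inj_on_mult(3)[OF A_props(2) c] A_card by (simp add: card_image)
  have D: "D \<subseteq> carrier Q" "finite D" using A_props c by (auto simp: D_def)
  have "B \<inter> D \<subseteq> {b \<in> B. c \<otimes>\<^bsub>Q\<^esub> inv\<^bsub>Q\<^esub> b \<in> A}"
  proof
    fix b assume "b \<in> B \<inter> D"
    then obtain a where a: "b \<in> B" "a \<in> A" "b = c \<otimes>\<^bsub>Q\<^esub> inv\<^bsub>Q\<^esub> a" unfolding D_def by blast
    have "a \<in> carrier Q" using a A_props by auto
    then have "c \<otimes>\<^bsub>Q\<^esub> inv\<^bsub>Q\<^esub> b = a" using a c by (simp add: Q.abelian_simps)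
    then show "b \<in> {b \<in> B. c \<otimes>\<^bsub>Q\<^esub> inv\<^bsub>Q\<^esub> b \<in> A}" using a by simp
  qed
  then have "card (B \<inter> D) \<le> r c" unfolding r_def using B_props by (intro card_mono) auto
  moreover have "card (B \<union> D) + card (B \<inter> D) = card B + card D"
    using card_Un_Int[of B D] B_props D by simp
  moreover have "card (B \<union> D) \<le> card (carrier Q)" using fin B_props D by (intro card_mono) auto
  ultimately show ?thesis using cD by linarith
qed

lemma rep_exists:
  assumes "c \<in> carrier Q" "b \<in> B" "2 \<le> r c"
  obtains b' where "b' \<in> B" "b' \<noteq> b" "c \<otimes>\<^bsub>Q\<^esub> inv\<^bsub>Q\<^esub> b' \<in> A"
proof -
  have "\<not> {b \<in> B. c \<otimes>\<^bsub>Q\<^esub> inv\<^bsub>Q\<^esub> b \<in> A} \<subseteq> {b}"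
    using assms(3) card_mono[of "{b}" "{b \<in> B. c \<otimes>\<^bsub>Q\<^esub> inv\<^bsub>Q\<^esub> b \<in> A}"] by (auto simp: r_def)
  then show ?thesis using that by blast
qed

lemma A_two:
  assumes "u = 1"
  obtains a0 a1 where "A = {a0, a1}" "a0 \<noteq> a1" "a0 \<in> carrier Q" "a1 \<in> carrier Q" "generate Q {a1 \<otimes>\<^bsub>Q\<^esub> inv\<^bsub>Q\<^esub> a0} = carrier Q"
proof -
  have "card A = 2" using A_card assms by simp
  then obtain a1 where a1: "a1 \<noteq> \<one>\<^bsub>Q\<^esub>" "A = {\<one>\<^bsub>Q\<^esub>, a1}" using A_props(3) by (metis card_2_pointed)
  have c: "a1 \<in> carrier Q" using a1 A_props by auto
  have "generate Q A \<subseteq> generate Q {a1}"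
  proof (rule Q.generate_subgroup_incl)
    show "subgroup (generate Q {a1}) Q" using c by (intro Q.generate_is_subgroup) auto
    show "A \<subseteq> generate Q {a1}" unfolding a1(2) by (auto intro: generate.incl generate.one)
  qed
  moreover have "generate Q {a1} \<subseteq> carrier Q" using c by (intro Q.generate_incl) auto
  ultimately have "generate Q {a1} = carrier Q" using A_gen by auto
  then show ?thesis using that[of "\<one>\<^bsub>Q\<^esub>" a1] a1 c by simp
qed

text \<open>K lies over the neutral element of Q, so the fibres of K + S are the sets
  \<open>Sa a <#> K\<close>, and the fragment inequality for K splits into this sum.\<close>

lemma frag_N:
  assumes K: "subgroup K G" "K \<subseteq> N" "2 \<le> card K"
  shows "card K + u * h \<le> (\<Sum>a\<in>A. card (Sa a <#> K))"
proof -
  have Kf: "finite K" "K \<subseteq> carrier G" using K N_card finite_subset subgroup.subset by blast+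
  have Kp: "\<phi> k = \<one>\<^bsub>Q\<^esub>" if "k \<in> K" for k using that K by (auto simp: N_def)
  have ex: "infinite (carrier G) \<or> card (K <#> S) + 2 \<le> order G"
  proof (rule disjCI)
    assume small: "\<not> card (K <#> S) + 2 \<le> order G"
    show "infinite (carrier G)"
    proof
      assume fin: "finite (carrier G)"
      have sub: "K <#> S \<subseteq> pre A" using S Kf Kp by (auto simp: set_mult_iff pre_def subset_iff)
      have "card (K <#> S) \<le> h * card A" using card_mono[OF card_pre(1) sub] card_pre(2) A_props by simp
      moreover have "card A < card (carrier Q)"
        using A_ne A_props finite_Q[OF fin] by (intro psubset_card_mono) auto
      then have "h * (card A + 1) \<le> h * card (carrier Q)" by (intro mult_le_mono2) simp
      ultimately show False using small order_G[OF fin] h2 by simp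
    qed
  qed
  have "card K + u * h \<le> card (K <#> S)" using Kf K ex by (intro frag)
  also have "\<dots> = (\<Sum>a\<in>A. card (fib \<phi> (K <#> S) a))"
  proof (rule card_eq_sum_fib)
    show "\<phi> ` (K <#> S) \<subseteq> A" using S Kf Kp by (auto simp: set_mult_iff subset_iff)
  qed (use Kf S A_props in \<open>auto simp: finite_set_mult\<close>)
  also have "\<dots> = (\<Sum>a\<in>A. card (Sa a <#> K))"
  proof (rule sum.cong[OF refl])
    fix a assume "a \<in> A"
    have "fib \<phi> (K <#> S) a = Sa a <#> K"
    proof (intro equalityI subsetI)
      fix x assume "x \<in> fib \<phi> (K <#> S) a"
      then obtain k y where x: "k \<in> K" "y \<in> S" "x = k \<otimes> y" "\<phi> x = a" by (auto simp: fib_def set_mult_iff)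
      then have c: "k \<in> carrier G" "y \<in> carrier G" using Kf S by auto
      then have "\<phi> y = a" "x = y \<otimes> k" using x Kp m_comm by auto
      then show "x \<in> Sa a <#> K" using x by (auto simp: fib_def set_mult_iff)
    next
      fix x assume "x \<in> Sa a <#> K"
      then obtain k y where x: "k \<in> K" "y \<in> S" "x = y \<otimes> k" "\<phi> y = a" by (auto simp: fib_def set_mult_iff)
      then have c: "k \<in> carrier G" "y \<in> carrier G" using Kf S by auto
      then have "\<phi> x = a" "x = k \<otimes> y" using x Kp m_comm by auto
      then show "x \<in> fib \<phi> (K <#> S) a" using x by (auto simp: fib_def set_mult_iff)
    qed
    then show "card (fib \<phi> (K <#> S) a) = card (Sa a <#> K)" by simp
  qed
  finally show ?thesis .
qed

text \<open>By \<open>diff_stabilizes\<close>, the difference of two points of the fibre of T is a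
  period of the fibre of S.\<close>

lemma nontrivial_stabilizer:
  assumes "a \<in> A" "m a b = s a" "2 \<le> t b"
  obtains k where "k \<in> stabilizer G (Sa a)" "k \<noteq> \<one>"
proof -
  obtain v w where vw: "v \<in> Tb b" "w \<in> Tb b" "v \<noteq> w"
  proof -
    have "\<not> Tb b \<subseteq> {v}" for v using assms(3) card_mono[of "{v}" "Tb b"] by (auto simp: t_def)
    then show ?thesis using that by (metis insertI1 singletonD subsetI)
  qed
  have c: "v \<in> carrier G" "w \<in> carrier G" using vw fibs by blast+
  have "inv v \<otimes> w \<in> stabilizer G (Sa a)"
    using diff_stabilizes[OF fibs(2,1,4,3) _ vw(1,2)] assms(2) by (simp add: m_def s_def)
  moreover have "inv v \<otimes> w \<noteq> \<one>" using vw c by (metis inv_closed inv_inv inv_equality m_comm)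
  ultimately show ?thesis using that by blast
qed

text \<open>The order of the stabilizer divides both \<open>h\<close> and h - 1.\<close>

lemma coprime_stabilizer:
  assumes "Z \<subseteq> carrier G" "\<And>z. z \<in> Z \<Longrightarrow> \<phi> z = c" "card Z + 1 = h" "k \<in> stabilizer G Z"
  shows "k = \<one>"
proof -
  have Z: "finite Z" "Z \<noteq> {}" using assms(3) h2 by (auto intro: card_ge_0_finite)
  have "card (stabilizer G Z) dvd card Z" "card (stabilizer G Z) dvd h"
    using stabilizer_fibre[OF assms(1) Z(2,1) assms(2)] by auto
  then have "card (stabilizer G Z) dvd 1" using assms(3) by (metis dvd_add_right_iff)
  then have "card (stabilizer G Z) = 1" by simp
  then obtain w where "stabilizer G Z = {w}" by (metis card_1_singletonE)
  moreover have "\<one> \<in> stabilizer G Z" using stabilizer_subgroup[OF assms(1)] by (rule subgroup.one_closed)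
  ultimately show ?thesis using assms(4) by auto
qed

end

lemma (in comm_group) generator_square:
  assumes e: "e \<in> carrier G" "generate G {e} = carrier G" and c: "3 \<le> card (carrier G)"
  shows "e \<otimes> e \<noteq> \<one>"
proof
  assume e2: "e \<otimes> e = \<one>"
  have "subgroup {\<one>, e} G"
  proof (rule subgroupI)
    fix x assume "x \<in> {\<one>, e}"
    then show "inv x \<in> {\<one>, e}" using inv_equality[OF e2 e(1) e(1)] by auto
  qed (use e e2 in auto)
  then have "carrier G \<subseteq> {\<one>, e}" using generate_subgroup_incl[of "{e}" "{\<one>, e}"] e(2) by simp
  then have "card (carrier G) \<le> card {\<one>, e}" by (intro card_mono) auto
  then show False using c card_insert_le_m1[of 2 "{e}" \<one>] by simp
qed

context critical_pair
begin

definition "D = (\<Sum>c\<in>C. d c)"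

lemma D_eq: "D + card T + u * h + g = card C * h"
  using sum_d by (simp add: D_def)

lemma D_le_if:
  assumes "\<And>c. c \<in> C \<Longrightarrow> d c \<le> k" shows "D \<le> card C * k"
  unfolding D_def using sum_mono[of C d "\<lambda>_. k"] assms by simp

lemma d_le_row: "a \<in> A \<Longrightarrow> b \<in> B \<Longrightarrow> d (a \<otimes>\<^bsub>Q\<^esub> b) \<le> h - s a"
  using s_le_\<sigma>[of b a] by (simp add: d_def)

text \<open>All of a + B has deficiency zero, and every other element of C has deficiency at most h
  - 1.\<close>

lemma full_row_bound:
  assumes a: "a \<in> A" "s a = h"
  shows "D + card B * (h - 1) \<le> card C * (h - 1)"
proof -
  define F where "F = (\<lambda>b. a \<otimes>\<^bsub>Q\<^esub> b) ` B"
  have ac: "a \<in> carrier Q" using a A_props by auto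
  have F: "F \<subseteq> C" "card F = card B"
    using a Q.inj_on_mult(2)[OF B_props(2) ac] unfolding F_def C_def
    by (auto intro: Q.set_multI simp: card_image)
  have F0: "d c = 0" if c: "c \<in> F" for c
  proof -
    obtain b where b: "b \<in> B" "c = a \<otimes>\<^bsub>Q\<^esub> b" using c by (auto simp: F_def)
    show ?thesis using \<sigma>_full[OF a(1) b(1)] t_pos[OF b(1)] a b by (simp add: d_def)
  qed
  have dC: "d c \<le> h - 1" if c: "c \<in> C" for c
  proof -
    obtain a' b where "a' \<in> A" "b \<in> B" "c = a' \<otimes>\<^bsub>Q\<^esub> b" using c by (auto simp: C_def Q.set_mult_iff)
    then show ?thesis using d_le_row[of a' b] s_pos[of a'] by simp
  qed
  have "D = (\<Sum>c\<in>C - F. d c)" unfolding D_def using F C_props F0 by (intro sum.mono_neutral_right) auto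
  also have "\<dots> \<le> card (C - F) * (h - 1)" using sum_bounded_above[of "C - F" d "h - 1"] dC by simp
  finally have "D \<le> card (C - F) * (h - 1)" .
  moreover have "card (C - F) + card B = card C"
    using F C_props by (metis card_Diff_subset card_mono finite_subset le_add_diff_inverse2)
  ultimately show ?thesis by (metis add_le_mono1 distrib_right)
qed

end

subsection \<open>Small sumsets in the quotient: the exceptional pair\<close>

text \<open>Here C = Q, and \<open>k\<close> is the amount by which |A| + |B| - 1 exceeds |Q|; every
  element of Q then has at least k + 1 representations.\<close>

locale overfull_pair = critical_pair +
  fixes n k :: nat
  assumes n_def: "n = card (carrier Q)" and over: "card C < card B + u" and k_def: "card B + u = n + k"
begin

lemma C_all: "C = carrier Q" using C_ge over by auto

lemma fin: "finite (carrier Q)" "finite (carrier G)"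
  using C_all C_props infinite_Q by auto

lemma card_C: "card C = n" by (simp add: C_all n_def)

lemma k_pos: "1 \<le> k" using over k_def card_C by simp

lemma B_le: "card B \<le> n" using B_props fin by (simp add: n_def card_mono)

lemma k_le: "k \<le> u" using B_le k_def by simp

lemma r_ge: "c \<in> carrier Q \<Longrightarrow> k + 1 \<le> r c"
  using sum_reps_ge[OF fin(1), of c] k_def by (simp add: n_def)

lemma nh: "D + card T + u * h + g = n * h" using D_eq card_C by simp

text \<open>Since every element has k + 1 representations, the weighted sum in \<open>sum_rd\<close>
  is at least (k + 1) D; one copy of D is eliminated by \<open>nh\<close>.\<close>

lemma dc: "k * D \<le> k * h + g + card P"
proof -
  have "(k + 1) * D \<le> (\<Sum>c\<in>C. r c * d c)"
    unfolding D_def sum_distrib_left using r_ge C_props by (intro sum_mono mult_le_mono1) auto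
  then have "k * D + D + card T \<le> card B * h + card P" using sum_rd by simp
  moreover have "card B * h + u * h = n * h + k * h" using k_def by (metis distrib_right)
  ultimately show ?thesis using nh by linarith
qed

text \<open>The last inequality is n h \<le> 3 D + 2 \<mu> with the summand 2 u h + 2 g added on
  both sides.\<close>

lemma bounds: "u * h + g \<le> D" "3 * (u * h) + 3 * g + \<mu> \<le> n * h" "3 * u \<le> n"
  "n * h + 2 * (u * h) + 2 * g \<le> 3 * D + 2 * (u * h) + 2 * g + 2 * \<mu>"
proof -
  show "3 * (u * h) + 3 * g + \<mu> \<le> n * h" "3 * u \<le> n"
    using size_bound[OF fin(2)] by (simp_all add: n_def mult.commute)
  have "card T + 2 * (u * h) + 2 * g \<le> n * h" using size_bound(1)[OF fin(2)] by (simp add: n_def mult.commute)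
  then show "u * h + g \<le> D" using nh by linarith
  have "3 * card (S <#> T) \<le> 2 * (n * h) + 2 * \<mu>"
    using size fin order_G by (simp add: n_def mult.commute)
  then show "n * h + 2 * (u * h) + 2 * g \<le> 3 * D + 2 * (u * h) + 2 * g + 2 * \<mu>"
    using nh ST_card by linarith
qed

lemma n3: "3 \<le> n" using bounds(3) u1 by linarith

text \<open>A full row would give D \<le> (u - k) (h - 1) < u h, below the lower bound for
  D.\<close>

lemma no_full_row: "a \<in> A \<Longrightarrow> s a + 1 \<le> h"
proof (rule ccontr)
  assume a: "a \<in> A" "\<not> s a + 1 \<le> h"
  then have "s a = h" using s_le[of a] A_props by (metis Suc_eq_plus1 le_antisym not_less_eq_eq subsetD)
  then have le: "D + card B * (h - 1) \<le> n * (h - 1)" using full_row_bound[OF a(1)] card_C by simp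
  have "card B + (u - k) = n" using k_def k_le by simp
  then have "n * (h - 1) = card B * (h - 1) + (u - k) * (h - 1)" by (metis distrib_right)
  then have "D \<le> (u - k) * (h - 1)" using le by simp
  moreover have "(u - k) * (h - 1) < u * h"
  proof -
    have "(u - k) * (h - 1) \<le> u * (h - 1)" by (intro mult_le_mono1) simp
    also have "\<dots> < u * h" using u1 h2 by simp
    finally show ?thesis .
  qed
  ultimately show False using bounds(1) by simp
qed

text \<open>k (u h + g) \<le> k D \<le> k h + g leaves only u = 1.\<close>

lemma u_one_if_no_exact:
  assumes "P = {}"
  shows "u = 1"
proof (rule ccontr)
  assume "u \<noteq> 1"
  then have u2: "2 \<le> u" using u1 by simp
  have "k * (u * h + g) \<le> k * D" using bounds(1) by (intro mult_le_mono2)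
  moreover have "k * D \<le> k * h + g" using dc unfolding assms by simp
  ultimately have "k * (u * h + g) \<le> k * h + g" by (rule le_trans)
  moreover have "k * (2 * h) \<le> k * (u * h)" using u2 by simp
  moreover have "1 * g \<le> k * g" "1 * h \<le> k * h" using k_pos by (intro mult_le_mono1; simp)+
  ultimately show False using h2 unfolding distrib_left mult.left_commute[of k 2] by linarith
qed

subsection \<open>Exact columns\<close>

lemma exact_counts:
  assumes "P \<noteq> {}"
  shows "g = 0" "\<mu> = 0" "card T + card P * (h - 1) \<le> card B * h" "card P * (h - 1) \<le> D + k * h"
proof -
  show gm: "g = 0" "\<mu> = 0" using P_ne[OF assms] by auto
  have PB: "P \<subseteq> B" by (auto simp: P_def)
  have "card T = (\<Sum>b\<in>P. t b) + (\<Sum>b\<in>B - P. t b)"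
    using sum_t PB B_props by (metis add.commute sum.subset_diff)
  moreover have "(\<Sum>b\<in>P. t b) = card P" by (simp add: P_def exact_def)
  moreover have "(\<Sum>b\<in>B - P. t b) \<le> card (B - P) * h"
    using sum_bounded_above[of "B - P" t h] t_le B_props by auto
  moreover have "card (B - P) + card P = card B"
    using PB B_props by (metis card_Diff_subset card_mono finite_subset le_add_diff_inverse2)
  then have "card (B - P) * h + card P * h = card B * h" by (metis distrib_right)
  moreover have "card P * (h - 1) + card P = card P * h" using h2 by (metis Suc_1 Suc_le_D diff_Suc_1 mult_Suc_right add.commute)
  ultimately show 1: "card T + card P * (h - 1) \<le> card B * h" by linarith
  have "card B * h + u * h = n * h + k * h" using k_def by (metis distrib_right)
  then show "card P * (h - 1) \<le> D + k * h" using 1 nh gm by linarith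
qed

text \<open>For u \<ge> 2 the number p of exact columns is bounded below by \<open>dc\<close>,
  because D \<ge> u h, and above by \<open>exact_counts\<close>. The two bounds leave only u = 2
  with h = 3 or 4; the three rows then exclude h = 4, and for h = 3 all layers are equal.\<close>

lemma exact_u_one:
  assumes P: "P \<noteq> {}"
  shows "u = 1"
proof (rule ccontr)
  assume "u \<noteq> 1"
  then have u2: "2 \<le> u" using u1 by simp
  note gm = exact_counts(1,2)[OF P]
  define p where "p = card P"
  \<comment> \<open>No row is full, so u h \<le> (u + 1) (h - 1), that is, h > u.\<close>
  have "(\<Sum>a\<in>A. s a) \<le> (u + 1) * (h - 1)"
    using sum_bounded_above[of A s "h - 1"] no_full_row A_card by fastforce
  then have "u * h \<le> (u + 1) * (h - 1)" using sum_s gm by simp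
  moreover have "(u + 1) * (h - 1) + u + 1 = (u + 1) * h" using h2 by (cases h) auto
  ultimately have hu: "u + 1 \<le> h" by simp
  obtain h' where h': "h = h' + 1" "u \<le> h'" using hu by (metis add.commute add_le_cancel_left le_Suc_ex add_diff_cancel_right' le_diff_conv le_add_diff_inverse2 Suc_eq_plus1 le_add2 order_trans)
  have "k * (u * h) \<le> k * D" using bounds(1) gm by (intro mult_le_mono2) simp
  then have 1: "k * (u * h) \<le> k * h + p" using dc unfolding p_def gm(1) by linarith
  have 2: "k * (p * h') \<le> k * (D + k * h)" using exact_counts(4)[OF P] h' by (intro mult_le_mono2) (simp add: p_def)
  have 3: "k * (p * h') \<le> k * h + p + k * (k * h)" using 2 dc gm by (simp add: p_def distrib_left)
  obtain v where v: "u = v + 2" using u2 by (metis add.commute le_Suc_ex)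
  have 4: "k * ((v + 1) * h) \<le> p" using 1 v by (simp add: algebra_simps)
  have kh: "1 \<le> k * h'" using k_pos h' u2 by simp
  then obtain w where w: "k * h' = w + 1" by (metis add.commute le_Suc_ex)
  have "k * (p * h') = p * w + p" using w by (metis distrib_left mult.left_commute mult.right_neutral)
  moreover have "k * h * (k + 1) = k * (k * h) + k * h" by simp
  ultimately have 5: "p * w \<le> k * h * (k + 1)" using 3 by linarith
  have "k * ((v + 1) * h) * w \<le> k * h * (k + 1)" using mult_le_mono1[OF 4, of w] 5 by linarith
  then have "(k * h) * ((v + 1) * w) \<le> (k * h) * (k + 1)" by (simp add: algebra_simps)
  moreover have "0 < k * h" using k_pos h2 by simp
  ultimately have 6: "(v + 1) * w \<le> k + 1" by (rule mult_left_le_imp_le)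
  have 7: "(v + 1) * (k * h') \<le> k + v + 2" using 6 unfolding w by (simp add: algebra_simps)
  have v0: "v = 0"
  proof (rule ccontr)
    assume "v \<noteq> 0"
    have "(v + 1) * (k * (v + 2)) \<le> (v + 1) * (k * h')" using h' v by (intro mult_le_mono2) simp
    then have "(v + 1) * (k * (v + 2)) \<le> k + v + 2" using 7 by simp
    moreover have "k * (v + 2) * 2 \<le> k * (v + 2) * (v + 1)" using \<open>v \<noteq> 0\<close> by (intro mult_le_mono2) simp
    moreover have "v + 2 \<le> k * (v + 2)" using mult_le_mono1[OF k_pos, of "v + 2"] by simp
    moreover have "k * 3 \<le> k * (v + 2)" using \<open>v \<noteq> 0\<close> by (intro mult_le_mono2) simp
    moreover have "(v + 1) * (k * (v + 2)) = k * (v + 2) * (v + 1)" by simp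
    ultimately show False using k_pos by linarith
  qed
  then have u_2: "u = 2" using v by simp
  have h34: "h = 3 \<or> h = 4"
  proof -
    have "k * h' \<le> k + 2" using 7 v0 by simp
    moreover have "k * 4 \<le> k * h'" if "4 \<le> h'" using that by simp
    ultimately have "h' < 4" using k_pos by fastforce
    then show ?thesis using h' u_2 by auto
  qed
  have "Min (s ` A) \<in> s ` A" using A_props by (intro Min_in) auto
  then obtain z where z: "z \<in> A" "s z = Min (s ` A)" by (metis (no_types, lifting) imageE)
  have mn: "s z \<le> s a" if "a \<in> A" for a using z A_props that by simp
  obtain b where b: "b \<in> B" "exact b" using P by (auto simp: P_def)
  have zc: "z \<in> carrier Q" "b \<in> carrier Q" using z b A_props B_props by auto
  have "2 \<le> r (z \<otimes>\<^bsub>Q\<^esub> b)" using r_ge[of "z \<otimes>\<^bsub>Q\<^esub> b"] zc k_pos by simp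
  then obtain b' where b': "b' \<in> B" "b' \<noteq> b" "z \<otimes>\<^bsub>Q\<^esub> b \<otimes>\<^bsub>Q\<^esub> inv\<^bsub>Q\<^esub> b' \<in> A"
    using rep_exists[of "z \<otimes>\<^bsub>Q\<^esub> b" b] zc b by auto
  \<comment> \<open>z + b has a second representation. Over an exact column its layer has size s z,
    so the other row is no larger and, z being minimal, has the same size.\<close>
  define a' where "a' = z \<otimes>\<^bsub>Q\<^esub> b \<otimes>\<^bsub>Q\<^esub> inv\<^bsub>Q\<^esub> b'"
  have b'c: "b' \<in> carrier Q" using b' B_props by auto
  have e: "a' \<otimes>\<^bsub>Q\<^esub> b' = z \<otimes>\<^bsub>Q\<^esub> b" using zc b'c by (simp add: a'_def)
  have a': "a' \<in> A" using b' by (simp add: a'_def)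
  have "a' \<noteq> z"
  proof
    assume "a' = z" then show False using e b' zc b'c by simp
  qed
  have "\<sigma> (z \<otimes>\<^bsub>Q\<^esub> b) = s z" using b z(1) unfolding exact_def by blast
  then have "s a' \<le> s z" using s_le_\<sigma>[OF b'(1), of a'] unfolding e by linarith
  then have sz: "s a' = s z" using mn[OF a'] by simp
  have "card (A - {z, a'}) = 1" using A_card u_2 a' z \<open>a' \<noteq> z\<close> A_props by simp
  then obtain x where x: "A - {z, a'} = {x}" by (metis card_1_singletonE)
  then have Ae: "A = {z, a', x}" "x \<noteq> z" "x \<noteq> a'" using z a' by auto
  have "(\<Sum>a\<in>A. s a) = s z + s a' + s x" unfolding Ae(1) using Ae \<open>a' \<noteq> z\<close> by simp
  then have sum3: "2 * s z + s x = 2 * h" using sum_s gm u_2 sz by simp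
  have sx: "s x + 1 \<le> h" "s z \<le> s x" using no_full_row[of x] mn[of x] Ae by auto
  \<comment> \<open>With no full row and s z \<le> s x, the equation 2 s z + s x = 2 h has no
    solution for h = 4, and only 2, 2, 2 for h = 3.\<close>
  have h3: "h = 3" using h34 sum3 sx by arith
  have s2: "s a = 2" if "a \<in> A" for a
  proof -
    have "s x = 2" "s z = 2" using sum3 sx h3 by arith+
    then show ?thesis using that sz unfolding Ae(1) by auto
  qed
  have d1: "d c \<le> 1" if c: "c \<in> C" for c
  proof -
    obtain a b where "a \<in> A" "b \<in> B" "c = a \<otimes>\<^bsub>Q\<^esub> b" using c by (auto simp: C_def Q.set_mult_iff)
    then show ?thesis using d_le_row[of a b] s2[of a] h3 by simp
  qed
  \<comment> \<open>D \<le> n and n h \<le> 3 D with h = 3 make every deficiency equal to 1.\<close>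
  have Dn: "D \<le> n" using D_le_if[of 1] d1 card_C by simp
  have Dn': "D = n" using bounds(4) gm h3 Dn by simp
  have dd: "d c = 1" if "c \<in> C" for c
  proof (rule ccontr)
    assume "d c \<noteq> 1"
    then have "(\<Sum>c\<in>C. d c) < (\<Sum>c\<in>C. 1)" using d1 that C_props
      by (intro sum_strict_mono_ex1) (auto simp: le_eq_less_or_eq intro!: bexI[of _ c])
    then show False using Dn' card_C by (simp add: D_def)
  qed
  have \<sigma>2: "\<sigma> c = 2" if "c \<in> carrier Q" for c using dd[of c] d_\<sigma>[of c] that C_all h3 by simp
  have "t b \<le> 1" if b: "b \<in> B" for b
    using not_full[OF z(1) b] \<sigma>2[of "z \<otimes>\<^bsub>Q\<^esub> b"] s2[OF z(1)] zc b B_props h3 by auto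
  then have "card T \<le> card B" using sum_mono[of B t "\<lambda>_. 1"] sum_t by simp
  then have "card B = n" using nh Dn' B_le bounds(3) gm u_2 h3 by simp
  then have Ball: "B = carrier Q" using B_props fin by (simp add: n_def card_subset_eq)
  show False using equal_layers[OF Ball z(1) a'] \<open>a' \<noteq> z\<close> \<sigma>2 s2 z a' by metis
qed

lemma unit_case:
  assumes "u = 1"
  shows "k = 1" "B = carrier Q" "card B = n"
proof -
  show k1: "k = 1" using k_le k_pos assms by simp
  show cB: "card B = n" using k_def k1 assms by simp
  show "B = carrier Q" using cB B_props fin by (simp add: n_def card_subset_eq)
qed

text \<open>With u = 1 an exact column forces both rows to have h / 2 elements, and it spreads: the
  fibres of T at the neighbouring columns are points too, for otherwise S would be periodic.
  Counting then leaves no exact columns or only exact ones, and the latter contradicts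
  \<open>equal_layers\<close>.\<close>

lemma no_exact: "P = {}"
proof (rule ccontr)
  assume P: "P \<noteq> {}"
  have u: "u = 1" using exact_u_one[OF P] .
  note uc = unit_case[OF u]
  note gm = exact_counts(1,2)[OF P]
  obtain a0 a1 where A: "A = {a0, a1}" "a0 \<noteq> a1" "a0 \<in> carrier Q" "a1 \<in> carrier Q"
    and gen: "generate Q {a1 \<otimes>\<^bsub>Q\<^esub> inv\<^bsub>Q\<^esub> a0} = carrier Q" using A_two[OF u] .
  define e where "e = a1 \<otimes>\<^bsub>Q\<^esub> inv\<^bsub>Q\<^esub> a0"
  have ec: "e \<in> carrier Q" using A by (simp add: e_def)
  have a1e: "a1 = e \<otimes>\<^bsub>Q\<^esub> a0" using A by (simp add: e_def)
  have hh: "s a0 + s a1 = h" using sum_s u gm A by simp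
  have h3: "3 \<le> h" using S3 S_card u gm by simp
  have e1: "e \<noteq> \<one>\<^bsub>Q\<^esub>" using a1e A by auto
  have e2: "e \<otimes>\<^bsub>Q\<^esub> e \<noteq> \<one>\<^bsub>Q\<^esub>"
    using Q.generator_square[OF ec] gen n3 by (simp add: e_def n_def)
  have inQ: "b \<in> B \<longleftrightarrow> b \<in> carrier Q" for b using uc by simp
  have P': "b \<in> P \<longleftrightarrow> b \<in> carrier Q \<and> exact b" for b using inQ by (auto simp: P_def)
  have eqs: "a1 \<otimes>\<^bsub>Q\<^esub> b = a0 \<otimes>\<^bsub>Q\<^esub> (e \<otimes>\<^bsub>Q\<^esub> b)" "a0 \<otimes>\<^bsub>Q\<^esub> b = a1 \<otimes>\<^bsub>Q\<^esub> (inv\<^bsub>Q\<^esub> e \<otimes>\<^bsub>Q\<^esub> b)" if "b \<in> carrier Q" for b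
    using that A ec unfolding a1e by (simp_all add: Q.abelian_simps)
  have ss: "s a0 = s a1"
  proof -
    obtain b where b: "b \<in> P" using P by auto
    have bc: "b \<in> carrier Q" using b P' by simp
    have x: "\<sigma> (a0 \<otimes>\<^bsub>Q\<^esub> b) = s a0" "\<sigma> (a1 \<otimes>\<^bsub>Q\<^esub> b) = s a1" using b A by (auto simp: P_def exact_def)
    have "s a1 \<le> s a0" using s_le_\<sigma>[of "inv\<^bsub>Q\<^esub> e \<otimes>\<^bsub>Q\<^esub> b" a1] x eqs(2)[OF bc] inQ ec bc by simp
    moreover have "s a0 \<le> s a1" using s_le_\<sigma>[of "e \<otimes>\<^bsub>Q\<^esub> b" a0] x eqs(1)[OF bc] inQ ec bc by simp
    ultimately show ?thesis by simp
  qed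
  have h4: "4 \<le> h" using hh ss h3 by presburger
  have single: "t b' = 1" if b: "b \<in> P" and a: "a \<in> A" "a' \<in> A" "b' \<in> carrier Q" "a' \<otimes>\<^bsub>Q\<^esub> b' = a \<otimes>\<^bsub>Q\<^esub> b" for b b' a a'
  proof (rule ccontr)
    assume "t b' \<noteq> 1"
    then have t2: "2 \<le> t b'" using t_pos[of b'] inQ a by simp
    have bc: "b \<in> carrier Q" using b P' by simp
    have sa: "s a = s a'" using a ss A by auto
    have \<sigma>: "\<sigma> (a \<otimes>\<^bsub>Q\<^esub> b) = s a" using b a by (auto simp: P_def exact_def)
    have "m a' b' \<le> s a'" using m_le_\<sigma>[of a' b'] \<sigma> sa a by simp
    then have mm: "m a' b' = s a'" using s_le_m[of b' a'] inQ a by simp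
    obtain k where k: "k \<in> stabilizer G (Sa a')" "k \<noteq> \<one>"
      using nontrivial_stabilizer[OF a(2) mm t2] by auto
    have kc: "k \<in> carrier G" using k stabilizer_subset by auto
    have "k \<in> stabilizer G S"
    proof (rule stabilizerI[OF S(2,1) kc])
      fix y assume y: "y \<in> S"
      have "s a'' = s a'" if "a'' \<in> A" for a'' using that a ss A by auto
      have st: "k \<in> stabilizer G (Sa a)"
      proof -
        obtain v w where vw: "v \<in> Tb b" "w \<in> Tb b'"
          using Tb_ne[of b] Tb_ne[of b'] inQ a(3) bc by fastforce
        have c: "v \<in> carrier G" "w \<in> carrier G" using vw fibs by blast+
        have "(\<otimes>) v ` Sa a = Zc (a \<otimes>\<^bsub>Q\<^esub> b)" using translate_eq_Zc[OF vw(1) \<sigma>] .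
        moreover have "(\<otimes>) w ` Sa a' = Zc (a' \<otimes>\<^bsub>Q\<^esub> b')" using translate_eq_Zc[OF vw(2), of a'] \<sigma> sa a by simp
        ultimately have vwe: "(\<otimes>) v ` Sa a = (\<otimes>) w ` Sa a'" using a by simp
        have "Sa a = (\<otimes>) (inv v \<otimes> w) ` Sa a'"
          using translate_translate[of "inv v" v "Sa a"] translate_translate[of "inv v" w "Sa a'"] vwe c fibs
          by (simp add: translate_one)
        then have "(\<otimes>) k ` Sa a = (\<otimes>) (inv v \<otimes> w) ` (\<otimes>) k ` Sa a'"
          using translate_translate[of k "inv v \<otimes> w" "Sa a'"] translate_translate[of "inv v \<otimes> w" k "Sa a'"] c kc fibs
          by (simp add: m_comm)
        also have "\<dots> = Sa a" using k \<open>Sa a = _\<close> by (simp add: stabilizer_def)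
        finally show ?thesis using kc by (simp add: stabilizer_def)
      qed
      show "k \<otimes> y \<in> S"
      proof (cases "a = a'")
        case False
        then have "\<phi> y = a \<or> \<phi> y = a'" using y a A by auto
        then have "y \<in> Sa a \<or> y \<in> Sa a'" using y by (auto simp: fib_def)
        then have "k \<otimes> y \<in> Sa a \<or> k \<otimes> y \<in> Sa a'" using st k stabilizer_mult by blast
        then show ?thesis by (auto simp: fib_def)
      next
        case True
        then have "b' = b" using a bc A_props by auto
        then show ?thesis using t2 b by (simp add: P_def exact_def)
      qed
    qed
    then show False using no_stabilizer_factor k by blast
  qed
  define p where "p = card P"
  have D1: "D \<le> h + p" using dc uc gm by (simp add: p_def)
  have D2: "n * h \<le> 3 * D" using bounds(4) gm by simp
  have le: "n * h \<le> 3 * h + 3 * p" using D1 D2 by simp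
  show False
  proof (cases "\<exists>b\<in>carrier Q. t b \<noteq> 1")
    \<comment> \<open>A column with a larger fibre rules out itself and its two neighbours, so p
      \<le> n - 3; with n h \<le> 3 h + 3 p and h \<ge> 4 this leaves n = 3 and p = 0.\<close>
    case True
    then obtain b where b: "b \<in> carrier Q" "t b \<noteq> 1" by auto
    have ne: "b \<notin> P" "e \<otimes>\<^bsub>Q\<^esub> b \<notin> P" "inv\<^bsub>Q\<^esub> e \<otimes>\<^bsub>Q\<^esub> b \<notin> P"
    proof -
      show "b \<notin> P" using b by (auto simp: P_def exact_def)
      show "e \<otimes>\<^bsub>Q\<^esub> b \<notin> P" using single[of "e \<otimes>\<^bsub>Q\<^esub> b" a0 a1 b] b eqs[OF b(1)] A by auto
      show "inv\<^bsub>Q\<^esub> e \<otimes>\<^bsub>Q\<^esub> b \<notin> P" using single[of "inv\<^bsub>Q\<^esub> e \<otimes>\<^bsub>Q\<^esub> b" a1 a0 b] b eqs[OF b(1)] A by auto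
    qed
    have "b \<noteq> e \<otimes>\<^bsub>Q\<^esub> b" using e1 ec b by (metis Q.r_cancel_one')
    moreover have "b \<noteq> inv\<^bsub>Q\<^esub> e \<otimes>\<^bsub>Q\<^esub> b" using e1 ec b by (metis Q.inv_closed Q.inv_eq_1_iff Q.r_cancel_one')
    moreover have "e \<otimes>\<^bsub>Q\<^esub> b \<noteq> inv\<^bsub>Q\<^esub> e \<otimes>\<^bsub>Q\<^esub> b"
    proof
      assume "e \<otimes>\<^bsub>Q\<^esub> b = inv\<^bsub>Q\<^esub> e \<otimes>\<^bsub>Q\<^esub> b"
      then have "e = inv\<^bsub>Q\<^esub> e" using ec b by simp
      then have "e \<otimes>\<^bsub>Q\<^esub> e = \<one>\<^bsub>Q\<^esub>" using ec Q.r_inv by metis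
      then show False using e2 by simp
    qed
    ultimately have c3: "card {b, e \<otimes>\<^bsub>Q\<^esub> b, inv\<^bsub>Q\<^esub> e \<otimes>\<^bsub>Q\<^esub> b} = 3" by simp
    have "card (P \<union> {b, e \<otimes>\<^bsub>Q\<^esub> b, inv\<^bsub>Q\<^esub> e \<otimes>\<^bsub>Q\<^esub> b}) \<le> n"
      unfolding n_def using fin P' ec b by (intro card_mono) auto
    moreover have "card (P \<union> {b, e \<otimes>\<^bsub>Q\<^esub> b, inv\<^bsub>Q\<^esub> e \<otimes>\<^bsub>Q\<^esub> b}) = p + 3"
      unfolding p_def c3[symmetric] using ne P' fin by (intro card_Un_disjoint) (auto intro: finite_subset[of P "carrier Q"])
    ultimately have pn: "p + 3 \<le> n" by simp
    obtain n' where n': "n = n' + 3" using n3 by (metis add.commute le_Suc_ex)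
    obtain h' where h': "h = h' + 4" using h4 by (metis add.commute le_Suc_ex)
    have "n' * h \<le> 3 * p" using le unfolding n' by (simp add: distrib_right)
    then have "n' * h \<le> 3 * n'" using pn n' by linarith
    then have "n' = 0" unfolding h' distrib_left by linarith
    then have "p = 0" using pn n' by simp
    then show False using P fin P' p_def by (metis card_0_eq finite_subset subsetI)
  next
    \<comment> \<open>All fibres of T are points. n h \<le> 2 h + n + p with p \<le> n gives (n - 2)
      (h - 2) \<le> 4, and n, h \<ge> 4 force n = h = 4 and p = n.\<close>
    case False
    then have tn: "card T = n" using sum_t uc by (simp add: n_def)
    have "n * h \<le> 2 * h + n + p" using nh D1 tn u gm by simp
    moreover have pn: "p \<le> n" unfolding p_def n_def using fin P' by (intro card_mono) auto
    moreover have n4: "4 \<le> n" using T4 gm tn by simp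
    obtain n' where n': "n = n' + 4" using n4 by (metis add.commute le_Suc_ex)
    obtain h' where h': "h = h' + 4" using h4 by (metis add.commute le_Suc_ex)
    ultimately have "n' = 0" "h' = 0" unfolding n' h' by (simp_all add: algebra_simps)
    then have "p = n" using \<open>n * h \<le> 2 * h + n + p\<close> pn n' h' by simp
    then have "P = carrier Q" using P' fin by (metis card_subset_eq n_def p_def subsetI)
    then have ex: "exact b" if "b \<in> carrier Q" for b using that P' by blast
    have "\<sigma> c = s a0" if c: "c \<in> carrier Q" for c
    proof -
      have "exact (inv\<^bsub>Q\<^esub> a0 \<otimes>\<^bsub>Q\<^esub> c)" using c A by (intro ex) simp
      then have "\<sigma> (a0 \<otimes>\<^bsub>Q\<^esub> (inv\<^bsub>Q\<^esub> a0 \<otimes>\<^bsub>Q\<^esub> c)) = s a0" using A by (simp add: exact_def)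
      then show ?thesis using c A by simp
    qed
    then show False using equal_layers[OF uc(2), of a0 a1] A ss by auto
  qed
qed

end

section \<open>Equality in Kneser's theorem, and progressions of three terms\<close>

context comm_group
begin

text \<open>Adjoining \<tau> to \<open>Y\<close> would not change the sumset, against Kneser's
  theorem with a trivial stabilizer and equality for \<open>X\<close> and \<open>Y\<close>.\<close>

lemma kneser_absorb:
  assumes "finite X" "finite Y" "X \<subseteq> carrier G" "Y \<subseteq> carrier G" "X \<noteq> {}"
    and st: "stabilizer G (X <#> Y) = {\<one>}" and eq: "card (X <#> Y) + 1 = card X + card Y"
    and \<tau>: "\<tau> \<in> carrier G" "(\<otimes>) \<tau> ` X \<subseteq> X <#> Y"
  shows "\<tau> \<in> Y"
proof (rule ccontr)
  assume n: "\<tau> \<notin> Y"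
  have "X <#> insert \<tau> Y = X <#> Y"
  proof
    show "X <#> insert \<tau> Y \<subseteq> X <#> Y"
    proof
      fix w assume "w \<in> X <#> insert \<tau> Y"
      then obtain x y where w: "x \<in> X" "y \<in> insert \<tau> Y" "w = x \<otimes> y" by (auto simp: set_mult_iff)
      show "w \<in> X <#> Y"
      proof (cases "y = \<tau>")
        case True
        then have "w = \<tau> \<otimes> x" using w assms \<tau> m_comm by auto
        then show ?thesis using w \<tau> by auto
      next
        case False then show ?thesis using w by (auto intro: set_multI)
      qed
    qed
    show "X <#> Y \<subseteq> X <#> insert \<tau> Y" by (rule mono_set_mult) auto
  qed
  moreover have "card X + card (insert \<tau> Y) \<le> card (X <#> insert \<tau> Y) + card (stabilizer G (X <#> insert \<tau> Y))"
    using assms by (intro kneser) auto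
  ultimately show False using st eq n assms(2) by simp
qed

text \<open>Two points of \<open>X\<close> arise from points of \<open>X\<close> by adding d; if
  these two steps were not consecutive, \<open>X\<close> would contain four points.\<close>

lemma three_term_progression:
  assumes X: "X \<subseteq> carrier G" "card X = 3" and d: "d \<in> carrier G" "d \<noteq> \<one>" "d \<otimes> d \<noteq> \<one>"
    and i: "card (X \<inter> (\<otimes>) d ` X) = 2"
  obtains p where "p \<in> carrier G" "X = {p, d \<otimes> p, d \<otimes> (d \<otimes> p)}"
proof -
  have fX: "finite X" using X by (simp add: card_ge_0_finite)
  obtain y1 y2 where y: "X \<inter> (\<otimes>) d ` X = {y1, y2}" "y1 \<noteq> y2" using i by (auto simp: card_2_iff)
  have "y1 \<in> X \<inter> (\<otimes>) d ` X" "y2 \<in> X \<inter> (\<otimes>) d ` X" unfolding y(1) by auto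
  then obtain p1 p2 where p: "p1 \<in> X" "p2 \<in> X" "d \<otimes> p1 \<in> X" "d \<otimes> p2 \<in> X" "p1 \<noteq> p2" using y(2) by blast
  note found = that
  have main: thesis if q: "q \<in> X" "d \<otimes> q \<in> X" "d \<otimes> (d \<otimes> q) \<in> X" for q
  proof -
    have qc: "q \<in> carrier G" using q X by auto
    have "q \<noteq> d \<otimes> q" "d \<otimes> q \<noteq> d \<otimes> (d \<otimes> q)" using d qc by auto
    moreover have "q \<noteq> d \<otimes> (d \<otimes> q)"
    proof
      assume "q = d \<otimes> (d \<otimes> q)"
      then have "(d \<otimes> d) \<otimes> q = q" using d qc by (simp add: m_assoc)
      then show False using d qc by simp
    qed
    ultimately have "card {q, d \<otimes> q, d \<otimes> (d \<otimes> q)} = 3" by simp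
    then have "X = {q, d \<otimes> q, d \<otimes> (d \<otimes> q)}" using X(2) q fX by (metis card_subset_eq empty_subsetI insert_subset)
    then show thesis using found qc by blast
  qed
  show thesis
  proof (cases "d \<otimes> p1 = p2 \<or> d \<otimes> p2 = p1")
    case True then show ?thesis using main p by metis
  next
    case False
    have pc: "p1 \<in> carrier G" "p2 \<in> carrier G" using p X by auto
    have "card {p1, p2, d \<otimes> p1, d \<otimes> p2} = 4" using False p pc d by auto
    moreover have "card {p1, p2, d \<otimes> p1, d \<otimes> p2} \<le> card X" using p fX by (intro card_mono) auto
    ultimately show ?thesis using X by simp
  qed
qed

end

section \<open>Three cosets: the group of order 12\<close>

locale triple_pair = critical_pair +
  fixes a0 a1 e
  assumes A2: "A = {a0, a1}" "a0 \<in> carrier Q" "a1 = e \<otimes>\<^bsub>Q\<^esub> a0"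
    and e: "e \<in> carrier Q" "e \<noteq> \<one>\<^bsub>Q\<^esub>" "e \<otimes>\<^bsub>Q\<^esub> (e \<otimes>\<^bsub>Q\<^esub> e) = \<one>\<^bsub>Q\<^esub>"
    and B_all: "B = carrier Q" and Q3: "card (carrier Q) = 3"
    and params: "u = 1" "g = 0" "\<mu> = 0" "card T = h" "4 \<le> h"
    and col: "\<And>b. b \<in> carrier Q \<Longrightarrow> \<sigma> (a0 \<otimes>\<^bsub>Q\<^esub> b) + \<sigma> (a1 \<otimes>\<^bsub>Q\<^esub> b) = h + t b"
begin

definition "f b = \<sigma> (a0 \<otimes>\<^bsub>Q\<^esub> b)"
abbreviation "E b \<equiv> e \<otimes>\<^bsub>Q\<^esub> b"

lemma a1c: "a1 \<in> carrier Q" "a0 \<noteq> a1" "a0 \<in> A" "a1 \<in> A"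
  using A2 e by auto

lemma a1b: "b \<in> carrier Q \<Longrightarrow> a1 \<otimes>\<^bsub>Q\<^esub> b = a0 \<otimes>\<^bsub>Q\<^esub> E b"
  using A2 e by (simp add: Q.m_ac)

lemma E3: "b \<in> carrier Q \<Longrightarrow> E (E (E b)) = b"
  using e Q.m_assoc[of "e" "e \<otimes>\<^bsub>Q\<^esub> e" b] by (simp add: Q.m_assoc)

lemma Q_elems:
  assumes b: "b \<in> carrier Q"
  shows "carrier Q = {b, E b, E (E b)}" "b \<noteq> E b" "E b \<noteq> E (E b)" "b \<noteq> E (E b)"
proof -
  have ne: "c \<noteq> E c" if "c \<in> carrier Q" for c using that e by auto
  show d: "b \<noteq> E b" "E b \<noteq> E (E b)" using ne b e by auto
  show d3: "b \<noteq> E (E b)" using ne[of "E (E b)"] E3[OF b] b e by metis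
  have "card {b, E b, E (E b)} = 3" using d d3 by simp
  then have c3: "card {b, E b, E (E b)} = 3" .
  show "carrier Q = {b, E b, E (E b)}"
  proof -
    have "finite (carrier Q)" using Q3 by (simp add: card_ge_0_finite)
    then have "{b, E b, E (E b)} = carrier Q" using c3 Q3 b e by (intro card_subset_eq) auto
    then show ?thesis by simp
  qed
qed

lemma sum_Q:
  fixes w :: "'c \<Rightarrow> nat"
  assumes b: "b \<in> carrier Q"
  shows "(\<Sum>c\<in>carrier Q. w c) = w b + w (E b) + w (E (E b))"
proof -
  show ?thesis unfolding Q_elems(1)[OF b] using Q_elems(2-4)[OF b] by simp
qed

lemma sum_t3: "b \<in> carrier Q \<Longrightarrow> t b + t (E b) + t (E (E b)) = h"
  using sum_t B_all sum_Q[of b t] params by simp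

lemma s_sum: "s a0 + s a1 = h"
  using sum_s A2(1) a1c params by simp

lemma f_sum: "b \<in> carrier Q \<Longrightarrow> f b + f (E b) = h + t b"
  using col[of b] a1b[of b] by (simp add: f_def)

text \<open>The column equations \<open>f_sum\<close> form a cyclic system of length three, solvable
  because the three fibres of T have \<open>h\<close> elements together.\<close>

lemma f_eq: "b \<in> carrier Q \<Longrightarrow> f (E (E b)) + t b = h"
  using f_sum[of b] f_sum[of "E b"] f_sum[of "E (E b)"] E3[of b] sum_t3[of b] e by simp

lemma f_eq': "b \<in> carrier Q \<Longrightarrow> f b + t (E b) = h"
  using f_eq[of "E b"] E3[of b] e by simp

lemma tb: "b \<in> carrier Q \<Longrightarrow> 1 \<le> t b" using t_pos B_all by simp

lemma s_le_f: "b \<in> carrier Q \<Longrightarrow> s a0 \<le> f b" "b \<in> carrier Q \<Longrightarrow> s a1 \<le> f (E b)"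
  using s_le_\<sigma>[of b a0] s_le_\<sigma>[of b a1] B_all a1b[of b] by (simp_all add: f_def)

text \<open>The fragment inequality and the column equation leave no slack between \<open>m\<close>
  and \<open>\<sigma>\<close>.\<close>

lemma m_eq:
  assumes "b \<in> carrier Q" "2 \<le> t b"
  shows "m a0 b = f b" "m a1 b = f (E b)"
proof -
  have "h + t b \<le> m a0 b + m a1 b" using sum_m_ge[of b] assms B_all params A2(1) a1c by simp
  moreover have "m a0 b \<le> f b" "m a1 b \<le> f (E b)"
    using m_le_\<sigma>[of a0 b] m_le_\<sigma>[of a1 b] a1b[OF assms(1)] by (simp_all add: f_def)
  ultimately show "m a0 b = f b" "m a1 b = f (E b)" using f_sum[OF assms(1)] by simp_all
qed

lemma Z_eq:
  assumes "b \<in> carrier Q" "2 \<le> t b"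
  shows "Sa a0 <#> Tb b = Zc (a0 \<otimes>\<^bsub>Q\<^esub> b)" "Sa a1 <#> Tb b = Zc (a0 \<otimes>\<^bsub>Q\<^esub> E b)"
proof -
  show "Sa a0 <#> Tb b = Zc (a0 \<otimes>\<^bsub>Q\<^esub> b)"
    using m_eq(1)[OF assms] by (intro card_subset_eq fibs ST_subset_Zc) (simp add: m_def f_def \<sigma>_def)
  show "Sa a1 <#> Tb b = Zc (a0 \<otimes>\<^bsub>Q\<^esub> E b)"
    using m_eq(2)[OF assms] ST_subset_Zc[of a1 b] a1b[OF assms(1)]
    by (intro card_subset_eq fibs) (simp_all add: m_def f_def \<sigma>_def)
qed

lemma ST_split: "b \<in> carrier Q \<Longrightarrow> S <#> T = Zc (a0 \<otimes>\<^bsub>Q\<^esub> b) \<union> Zc (a0 \<otimes>\<^bsub>Q\<^esub> E b) \<union> Zc (a0 \<otimes>\<^bsub>Q\<^esub> E (E b))"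
proof
  assume b: "b \<in> carrier Q"
  show "S <#> T \<subseteq> Zc (a0 \<otimes>\<^bsub>Q\<^esub> b) \<union> Zc (a0 \<otimes>\<^bsub>Q\<^esub> E b) \<union> Zc (a0 \<otimes>\<^bsub>Q\<^esub> E (E b))"
  proof
    fix x assume x: "x \<in> S <#> T"
    then have "inv\<^bsub>Q\<^esub> a0 \<otimes>\<^bsub>Q\<^esub> \<phi> x \<in> carrier Q" using ST_props A2 by auto
    then have "inv\<^bsub>Q\<^esub> a0 \<otimes>\<^bsub>Q\<^esub> \<phi> x \<in> {b, E b, E (E b)}" unfolding Q_elems(1)[OF b] .
    moreover have "\<phi> x = a0 \<otimes>\<^bsub>Q\<^esub> (inv\<^bsub>Q\<^esub> a0 \<otimes>\<^bsub>Q\<^esub> \<phi> x)" using x ST_props A2 by auto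
    ultimately show "x \<in> Zc (a0 \<otimes>\<^bsub>Q\<^esub> b) \<union> Zc (a0 \<otimes>\<^bsub>Q\<^esub> E b) \<union> Zc (a0 \<otimes>\<^bsub>Q\<^esub> E (E b))"
      using x by (auto simp: fib_def)
  qed
qed (auto simp: fib_def)

text \<open>The layer is the sum of the fibres over a0 and b, and also of those over a1 and E (E b).
  If its period K were nontrivial, Kneser's inequality for both sums together with
  \<open>frag_N\<close> would force t (E b) = |K| and make both fibres of T periodic under K; then
  all three layers would be, and so S + T.\<close>

lemma stabilizer_Z_trivial:
  assumes b: "b \<in> carrier Q" and t2: "2 \<le> t b" "2 \<le> t (E (E b))"
  shows "stabilizer G (Zc (a0 \<otimes>\<^bsub>Q\<^esub> b)) = {\<one>}" "t (E b) \<le> 2"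
    "s a0 + t b \<le> f b + 1" "s a1 + t (E (E b)) \<le> f b + 1"
proof -
  define b' where "b' = E (E b)"
  have b'c: "b' \<in> carrier Q" using b e by (simp add: b'_def)
  have Eb': "E b' = b" using E3[OF b] by (simp add: b'_def)
  define Z where "Z = Zc (a0 \<otimes>\<^bsub>Q\<^esub> b)"
  define K where "K = stabilizer G Z"
  have Z1: "Sa a0 <#> Tb b = Z" using Z_eq(1)[OF b t2(1)] by (simp add: Z_def)
  have Z2: "Sa a1 <#> Tb b' = Z" using Z_eq(2)[OF b'c] t2(2) Eb' by (simp add: Z_def b'_def)
  have ne: "Sa a0 \<noteq> {}" "Sa a1 \<noteq> {}" "Tb b \<noteq> {}" "Tb b' \<noteq> {}"
    using Sa_ne a1c Tb_ne b b'c B_all by auto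
  note k1 = kneser_strong[OF fibs(2) fibs(4) fibs(1) fibs(3) ne(1,3), unfolded Z1, folded K_def]
  note k2 = kneser_strong[OF fibs(2) fibs(4) fibs(1) fibs(3) ne(2,4), unfolded Z2, folded K_def]
  have Zc: "Z \<subseteq> carrier G" "finite Z" "Z \<noteq> {}" "\<And>z. z \<in> Z \<Longrightarrow> \<phi> z = a0 \<otimes>\<^bsub>Q\<^esub> b"
  proof -
    show "Z \<subseteq> carrier G" "finite Z" using fibs by (simp_all add: Z_def)
    show "Z \<noteq> {}" unfolding Z1[symmetric] set_mult_def using ne by auto
    show "\<phi> z = a0 \<otimes>\<^bsub>Q\<^esub> b" if "z \<in> Z" for z using that by (simp add: Z_def fib_def)
  qed
  have K: "K \<subseteq> N" "card K dvd card Z" "card K dvd h"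
    unfolding K_def using stabilizer_fibre[OF Zc(1,3,2,4)] by auto
  have cZ: "card Z = f b" by (simp add: Z_def f_def \<sigma>_def)
  have K1: "\<one> \<in> K" using k1(3) by (rule subgroup.one_closed)
  have Kc: "K \<subseteq> carrier G" using k1(3) by (rule subgroup.subset)
  have ge: "card X \<le> card (X <#> K)" if "X \<subseteq> carrier G" "finite X" for X
    using card_set_mult_ge_left[OF that(1) Kc _ that(2) k1(2)] K1 by auto
  have le1: "card (Sa a0 <#> K) + card (Tb b <#> K) \<le> f b + card K" using k1(1) cZ by simp
  have le2: "card (Sa a1 <#> K) + card (Tb b' <#> K) \<le> f b + card K" using k2(1) cZ by simp
  have tK: "t b \<le> card (Tb b <#> K)" "t b' \<le> card (Tb b' <#> K)"
    using ge fibs by (simp_all add: t_def)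
  have sK: "s a0 \<le> card (Sa a0 <#> K)" "s a1 \<le> card (Sa a1 <#> K)"
    using ge fibs by (simp_all add: s_def)
  have fh: "f b + t (E b) = h" using f_eq'[OF b] .
  have t3: "t b + t (E b) + t b' = h" using sum_t3[OF b] by (simp add: b'_def)
  have "card K < 2"
  proof (rule ccontr)
    assume "\<not> card K < 2"
    then have c2: "2 \<le> card K" by simp
    have fr: "card K + h \<le> card (Sa a0 <#> K) + card (Sa a1 <#> K)"
      using frag_N[OF k1(3) K(1) c2] params A2(1) a1c by simp
    have "t (E b) \<le> card K" using fr le1 le2 tK fh t3 by linarith
    moreover have "card K dvd t (E b)" using K(2,3) cZ fh by (metis dvd_add_right_iff)
    then have "card K \<le> t (E b)" using tb[of "E b"] b e by (intro dvd_imp_le) auto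
    ultimately have "card (Tb b <#> K) = t b" "card (Tb b' <#> K) = t b'"
      using fr le1 le2 tK fh t3 by linarith+
    then have eq: "Tb b <#> K = Tb b" "Tb b' <#> K = Tb b'"
      using card_subset_eq[OF finite_set_mult[OF fibs(4) k1(2)] subset_set_mult_one[OF fibs(3) K1], symmetric]
      unfolding t_def by metis+
    obtain k where k: "k \<in> K" "k \<noteq> \<one>"
    proof -
      have "\<not> K \<subseteq> {\<one>}" using c2 card_mono[of "{\<one>}" K] by auto
      then show ?thesis using that by auto
    qed
    have "k \<in> stabilizer G (Tb b)" "k \<in> stabilizer G (Tb b')"
      using set_mult_stabilizer[OF fibs(3) eq(1) Kc fibs(4)] set_mult_stabilizer[OF fibs(3) eq(2) Kc fibs(4)] k by auto
    then have "k \<in> stabilizer G (Tb b <#> Sa a1)" "k \<in> stabilizer G (Tb b' <#> Sa a0)"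
      by (auto intro: subsetD[OF stabilizer_set_mult_mono[OF fibs(3) fibs(1)]])
    then have "k \<in> stabilizer G (Zc (a0 \<otimes>\<^bsub>Q\<^esub> E b))" "k \<in> stabilizer G (Zc (a0 \<otimes>\<^bsub>Q\<^esub> E (E b)))"
      using Z_eq(2)[OF b t2(1)] Z_eq(1)[OF b'c] t2(2) set_mult_comm[OF fibs(1,3)] by (simp_all add: b'_def)
    moreover have "k \<in> stabilizer G (Zc (a0 \<otimes>\<^bsub>Q\<^esub> b))" using k by (simp add: K_def Z_def)
    ultimately have "k \<in> stabilizer G (Zc (a0 \<otimes>\<^bsub>Q\<^esub> b) \<union> Zc (a0 \<otimes>\<^bsub>Q\<^esub> E b) \<union> Zc (a0 \<otimes>\<^bsub>Q\<^esub> E (E b)))"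
      by (intro subsetD[OF stabilizer_Int_Un] IntI)
    then have "k \<in> stabilizer G (S <#> T)" unfolding ST_split[OF b, symmetric] .
    then show False using no_stabilizer k by blast
  qed
  moreover have "card K \<noteq> 0" using K1 k1(2) by auto
  ultimately have cK: "card K = 1" by simp
  then have "K = {\<one>}" using K1 by (metis card_1_singletonE singletonD)
  then show "stabilizer G (Zc (a0 \<otimes>\<^bsub>Q\<^esub> b)) = {\<one>}" by (simp add: K_def Z_def)
  show x: "s a0 + t b \<le> f b + 1" using le1 tK sK cK by linarith
  show y: "s a1 + t (E (E b)) \<le> f b + 1" using le2 tK sK cK unfolding b'_def by linarith
  show "t (E b) \<le> 2" using x y s_sum fh t3 unfolding b'_def by linarith
qed

text \<open>If no fibre of T is a point, all have two points, so h = 6, the fibres of S have three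
  and the layers four elements. Both fibres of S are then progressions with the same difference,
  hence translates of each other, and by \<open>kneser_absorb\<close> the translation carries T into
  itself.\<close>

lemma exists_single: "\<exists>b\<in>carrier Q. t b = 1"
proof (rule ccontr)
  assume "\<not> ?thesis"
  then have t2: "2 \<le> t b" if "b \<in> carrier Q" for b using tb[OF that] that by (metis One_nat_def Suc_1 Suc_leI le_neq_implies_less)
  have Ec: "E b \<in> carrier Q" if "b \<in> carrier Q" for b using that e by simp
  note st = stabilizer_Z_trivial[OF _ t2 t2[OF Ec[OF Ec]]]
  have teq: "t b = 2" if b: "b \<in> carrier Q" for b
    using st(2)[of "E (E b)"] t2[OF b] E3[OF b] Ec b by fastforce
  have h6: "h = 6" using sum_t3[of "\<one>\<^bsub>Q\<^esub>"] teq e by simp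
  have f4: "f b = 4" if b: "b \<in> carrier Q" for b using f_eq'[OF b] teq h6 b e by simp
  have s3: "s a0 = 3" "s a1 = 3" using st(3,4)[of "\<one>\<^bsub>Q\<^esub>"] f4 teq s_sum h6 e by simp_all
  have stZ: "stabilizer G (Zc (a0 \<otimes>\<^bsub>Q\<^esub> b)) = {\<one>}" if "b \<in> carrier Q" for b using st(1) that by blast
  have o: "\<one>\<^bsub>Q\<^esub> \<in> carrier Q" by simp
  obtain x y where xy: "Tb \<one>\<^bsub>Q\<^esub> = {x, y}" "x \<noteq> y" using teq[OF o] by (auto simp: t_def card_2_iff)
  have c: "x \<in> carrier G" "y \<in> carrier G" using xy fibs(3)[of "\<one>\<^bsub>Q\<^esub>"] by auto
  define dd where "dd = y \<otimes> inv x"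
  have dc: "dd \<in> carrier G" "y = dd \<otimes> x" using c by (simp_all add: dd_def)
  have d1: "dd \<noteq> \<one>" using dc c xy by auto
  \<comment> \<open>A difference of order two would stabilize the two-point fibre of T, and thus a
    layer.\<close>
  have d2: "dd \<otimes> dd \<noteq> \<one>"
  proof
    assume q: "dd \<otimes> dd = \<one>"
    have "dd \<in> stabilizer G (Tb \<one>\<^bsub>Q\<^esub>)"
    proof (rule stabilizerI)
      have "dd \<otimes> y = x" using dc c q m_assoc[of dd dd x] by simp
      then show "dd \<otimes> z \<in> Tb \<one>\<^bsub>Q\<^esub>" if "z \<in> Tb \<one>\<^bsub>Q\<^esub>" for z using that dc xy by auto
    qed (use fibs dc in auto)
    then have "dd \<in> stabilizer G (Zc (a0 \<otimes>\<^bsub>Q\<^esub> \<one>\<^bsub>Q\<^esub>))"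
      using stabilizer_set_mult_mono[OF fibs(3) fibs(1), of "\<one>\<^bsub>Q\<^esub>" a0] Z_eq(1)[OF o t2[OF o]]
        set_mult_comm[OF fibs(1,3)] by auto
    then show False using stZ[OF o] d1 by simp
  qed
  have prog: "\<exists>p. p \<in> carrier G \<and> Sa a = {p, dd \<otimes> p, dd \<otimes> (dd \<otimes> p)}" if a: "a \<in> A" for a
  proof -
    have cS: "card (Sa a) = 3" using a s3 A2(1) by (auto simp: s_def)
    have "m a \<one>\<^bsub>Q\<^esub> = 4" using a m_eq[OF o t2[OF o]] f4 A2(1) e by auto
    moreover have "Sa a <#> Tb \<one>\<^bsub>Q\<^esub> = (\<otimes>) x ` (Sa a \<union> (\<otimes>) dd ` Sa a)"
    proof -
      have "Tb \<one>\<^bsub>Q\<^esub> <#> Sa a = (\<otimes>) x ` Sa a \<union> (\<otimes>) y ` Sa a" unfolding xy by (auto simp: set_mult_def)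
      moreover have "(\<otimes>) y ` Sa a = (\<otimes>) x ` (\<otimes>) dd ` Sa a"
        using translate_translate[of x dd "Sa a"] c dc fibs(1) m_comm by simp
      ultimately show ?thesis using set_mult_comm[OF fibs(1,3)] by (simp add: image_Un)
    qed
    ultimately have "card (Sa a \<union> (\<otimes>) dd ` Sa a) = 4"
      using card_translate[of x "Sa a \<union> (\<otimes>) dd ` Sa a"] c dc fibs(1)
      by (simp add: m_def) (metis (no_types, lifting) Un_least image_subset_iff m_closed subsetD)
    moreover have "card (Sa a \<union> (\<otimes>) dd ` Sa a) + card (Sa a \<inter> (\<otimes>) dd ` Sa a) = 6"
      using card_Un_Int[of "Sa a" "(\<otimes>) dd ` Sa a"] fibs card_translate[OF dc(1) fibs(1)] cS by simp
    ultimately have "card (Sa a \<inter> (\<otimes>) dd ` Sa a) = 2" by simp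
    then obtain p where "p \<in> carrier G" "Sa a = {p, dd \<otimes> p, dd \<otimes> (dd \<otimes> p)}"
      using three_term_progression[OF fibs(1) cS dc(1) d1 d2] by blast
    then show ?thesis by blast
  qed
  obtain p p' where p: "p \<in> carrier G" "Sa a0 = {p, dd \<otimes> p, dd \<otimes> (dd \<otimes> p)}"
    "p' \<in> carrier G" "Sa a1 = {p', dd \<otimes> p', dd \<otimes> (dd \<otimes> p')}" using prog a1c by meson
  define k where "k = p' \<otimes> inv p"
  have kc: "k \<in> carrier G" using p by (simp add: k_def)
  have "k \<otimes> p = p'" using p by (simp add: k_def)
  then have "k \<otimes> (dd \<otimes> p) = dd \<otimes> p'" "k \<otimes> (dd \<otimes> (dd \<otimes> p)) = dd \<otimes> (dd \<otimes> p')"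
    using m_lcomm[of k dd] p kc dc by simp_all
  then have kS: "(\<otimes>) k ` Sa a0 = Sa a1" unfolding p using \<open>k \<otimes> p = p'\<close> by simp
  have pk: "\<phi> k = e"
  proof -
    have "p' \<in> Sa a1" "p \<in> Sa a0" using p by auto
    then have "\<phi> p' = e \<otimes>\<^bsub>Q\<^esub> a0" "\<phi> p = a0" using A2 by (auto simp: fib_def)
    then show ?thesis using p A2 e by (simp add: k_def)
  qed
  have "k \<in> stabilizer G T"
  proof (rule stabilizerI[OF T(2,1) kc])
    fix v assume v: "v \<in> T"
    define b where "b = \<phi> v"
    have vb: "v \<in> Tb b" "v \<in> carrier G" using v T by (auto simp: b_def fib_def)
    have bc: "b \<in> carrier Q" using vb by (simp add: b_def)
    have "(\<otimes>) (k \<otimes> v) ` Sa a0 = (\<otimes>) v ` Sa a1"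
      using translate_translate[of v k "Sa a0"] vb kc fibs kS m_comm by simp
    also have "\<dots> \<subseteq> Zc (a0 \<otimes>\<^bsub>Q\<^esub> E b)" using translate_subset_Zc[OF vb(1), of a1] a1b[OF bc] by simp
    finally have sub: "(\<otimes>) (k \<otimes> v) ` Sa a0 \<subseteq> Sa a0 <#> Tb (E b)"
      using Z_eq(1)[OF Ec[OF bc] t2[OF Ec[OF bc]]] by simp
    have "k \<otimes> v \<in> Tb (E b)"
    proof (rule kneser_absorb[OF fibs(2,4,1,3) Sa_ne[OF a1c(3)] _ _ _ sub])
      show "stabilizer G (Sa a0 <#> Tb (E b)) = {\<one>}"
        using stZ[OF Ec[OF bc]] Z_eq(1)[OF Ec[OF bc] t2[OF Ec[OF bc]]] by simp
      show "card (Sa a0 <#> Tb (E b)) + 1 = card (Sa a0) + card (Tb (E b))"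
        using m_eq(1)[OF Ec[OF bc] t2[OF Ec[OF bc]]] f4 teq s3 Ec bc by (simp add: m_def s_def t_def)
    qed (use kc vb in auto)
    then show "k \<otimes> v \<in> T" by (simp add: fib_def)
  qed
  then have "k = \<one>" using no_stabilizer_factor by blast
  then show False using pk e by simp
qed

text \<open>The one-point fibre makes one layer have h - 1 elements, and such a layer has no period.
  The inequalities for the two rows leave a total slack of one, so in some column a layer is no
  larger than the fibre of S. That fibre then has a period, by \<open>nontrivial_stabilizer\<close>,
  which passes to the layer of h - 1 elements.\<close>

lemma two_singles:
  assumes b: "b \<in> carrier Q" "t b = 1"
  shows "t (E b) = 1 \<or> t (E (E b)) = 1"
proof (rule ccontr)
  assume "\<not> ?thesis"
  define c1 where "c1 = E b"
  define c2 where "c2 = E (E b)"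
  have c: "c1 \<in> carrier Q" "c2 \<in> carrier Q" "E c1 = c2" "E c2 = b" using b e E3 by (simp_all add: c1_def c2_def)
  have t2: "2 \<le> t c1" "2 \<le> t c2" using \<open>\<not> _\<close> tb[OF c(1)] tb[OF c(2)] unfolding c1_def c2_def by linarith+
  have ts: "t c1 + t c2 + 1 = h" using sum_t3[OF b(1)] b by (simp add: c1_def c2_def)
  have f: "f c1 + t c2 = h" "f c2 + 1 = h" "f b + t c1 = h"
    using f_eq'[OF c(1)] f_eq'[OF c(2)] f_eq'[OF b(1)] c b by (simp_all add: c1_def)
  have m: "m a0 c1 = f c1" "m a1 c1 = f c2" "m a0 c2 = f c2" "m a1 c2 = f b"
    using m_eq[OF c(1) t2(1)] m_eq[OF c(2) t2(2)] c by auto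
  have triv: "stabilizer G (Sa a <#> Tb c') = {\<one>}" if "a \<in> A" "c' \<in> carrier Q" "m a c' = f c2" for a c'
  proof -
    have sub: "Sa a <#> Tb c' \<subseteq> carrier G" using fibs by (intro setmult_subset_G)
    have "k = \<one>" if "k \<in> stabilizer G (Sa a <#> Tb c')" for k
    proof (rule coprime_stabilizer[OF sub _ _ that])
      show "\<phi> z = a \<otimes>\<^bsub>Q\<^esub> c'" if "z \<in> Sa a <#> Tb c'" for z
        using that ST_subset_Zc[of a c'] by (auto simp: fib_def)
      show "card (Sa a <#> Tb c') + 1 = h" using \<open>m a c' = f c2\<close> f by (simp add: m_def)
    qed
    moreover have "\<one> \<in> stabilizer G (Sa a <#> Tb c')"
      using stabilizer_subgroup[OF sub] by (rule subgroup.one_closed)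
    ultimately show ?thesis by blast
  qed
  have kn: "s a + t c' \<le> f c2 + 1" if "a \<in> A" "c' \<in> carrier Q" "m a c' = f c2" for a c'
    using kneser[OF fibs(2,4,1,3) Sa_ne[OF that(1)] Tb_ne[of c']] triv[OF that] that B_all
    by (simp add: m_def s_def t_def)
  have k1: "s a1 + t c1 \<le> f c2 + 1" "s a0 + t c2 \<le> f c2 + 1"
    using kn[OF a1c(4) c(1) m(2)] kn[OF a1c(3) c(2) m(3)] by auto
  have k2: "s a0 \<le> f c1" "s a1 \<le> f b" using s_le_f(1)[OF c(1)] s_le_f(2)[OF c(2)] c by auto
  have no: False if a: "a \<in> A" and eq: "m a c' = s a" and t: "2 \<le> t c'" "c'' \<in> carrier Q" "m a c'' = f c2" for a c' c''
  proof -
    obtain k where k: "k \<in> stabilizer G (Sa a)" "k \<noteq> \<one>" using nontrivial_stabilizer[OF a eq t(1)] .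
    then have "k \<in> stabilizer G (Sa a <#> Tb c'')" using stabilizer_set_mult_mono[OF fibs(1,3)] by auto
    then show False using triv[OF a t(2,3)] k by simp
  qed
  have "t c2 + 1 = s a1 \<or> t c1 + 1 = s a0" using k1 k2 f ts s_sum by linarith
  then show False
  proof
    assume "t c2 + 1 = s a1"
    then have "m a1 c2 = s a1" using m f ts by simp
    then show False using no[OF a1c(4) _ t2(2) c(1) m(2)] by simp
  next
    assume "t c1 + 1 = s a0"
    then have "m a0 c1 = s a0" using m f ts by simp
    then show False using no[OF a1c(3) _ t2(1) c(2) m(3)] by simp
  qed
qed

text \<open>Two one-point fibres leave h - 2 elements for the third, and some layer has only two
  elements. This caps both fibres of S at two, so h = 4.\<close>

lemma exists_nonsingle:
  obtains b where "b \<in> carrier Q" "t b = 2" "t (E b) = 1" "t (E (E b)) = 1" "h = 4" "s a0 = 2" "s a1 = 2"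
proof -
  obtain b0 where b0: "b0 \<in> carrier Q" "t b0 = 1" using exists_single by auto
  have "\<exists>b. b \<in> carrier Q \<and> t (E b) = 1 \<and> t (E (E b)) = 1"
  proof (cases "t (E b0) = 1")
    case True
    then show ?thesis using b0 E3 e by (intro exI[of _ "E (E b0)"]) simp
  next
    case False
    then have "t (E (E b0)) = 1" using two_singles[OF b0] by simp
    then show ?thesis using b0 E3 e by (intro exI[of _ "E b0"]) simp
  qed
  then obtain b where b: "b \<in> carrier Q" "t (E b) = 1" "t (E (E b)) = 1" by auto
  have tb2: "t b + 2 = h" using sum_t3[OF b(1)] b by simp
  have f2: "f (E (E b)) = 2" using f_eq[OF b(1)] tb2 by simp
  have "s a0 \<le> 2" "s a1 \<le> 2" using s_le_f(1)[of "E (E b)"] s_le_f(2)[of "E b"] f2 b e by simp_all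
  then have "h = 4" "s a0 = 2" "s a1 = 2" using s_sum params by linarith+
  then show ?thesis using that b tb2 by simp
qed

text \<open>The set of \<one> and k will be a 2-fragment of the translates of T. Here k is the
  difference of the two one-point fibres t1 and t2; it carries one fibre of S to the other. With T =
  {w, w', t1, t2} it maps w to t1, t1 to t2, and t2 back into {w, w'}, so only the image of w' can
  leave T, and it does, as T has no period.\<close>

lemma shift:
  obtains k where "k \<in> carrier G" "card (T \<union> (\<otimes>) k ` T) = 5"
    "h = 4" "\<And>b. b \<in> carrier Q \<Longrightarrow> t b = 2 \<Longrightarrow> stabilizer G (Tb b) = {\<one>}"
    "\<exists>b\<in>carrier Q. t b = 2"
proof -
  obtain b where b: "b \<in> carrier Q" "t b = 2" "t (E b) = 1" "t (E (E b)) = 1" and h4: "h = 4" and s2: "s a0 = 2" "s a1 = 2"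
    by (rule exists_nonsingle)
  have Ec: "E b \<in> carrier Q" "E (E b) \<in> carrier Q" using b e by auto
  obtain t1 where t1: "Tb (E b) = {t1}" using b by (metis card_1_singletonE t_def)
  obtain t2 where t2: "Tb (E (E b)) = {t2}" using b by (metis card_1_singletonE t_def)
  have c: "t1 \<in> carrier G" "t2 \<in> carrier G" using t1 t2 fibs(3)[of "E b"] fibs(3)[of "E (E b)"] by auto
  have f: "f (E (E b)) = 2" "f b = 3" "f (E b) = 3"
    using f_eq[OF b(1)] f_eq'[OF b(1)] f_eq'[OF Ec(1)] b h4 by simp_all
  have z1: "(\<otimes>) t2 ` Sa a0 = Zc (a0 \<otimes>\<^bsub>Q\<^esub> E (E b))"
    using t2 f s2 by (intro translate_eq_Zc) (auto simp: f_def)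
  have z2: "(\<otimes>) t1 ` Sa a1 = Zc (a1 \<otimes>\<^bsub>Q\<^esub> E b)"
    using t1 f s2 a1b[OF Ec(1)] by (intro translate_eq_Zc) (auto simp: f_def)
  have z: "(\<otimes>) t2 ` Sa a0 = (\<otimes>) t1 ` Sa a1" using z1 z2 a1b[OF Ec(1)] by simp
  define k where "k = inv t1 \<otimes> t2"
  have kc: "k \<in> carrier G" using c by (simp add: k_def)
  have kS: "(\<otimes>) k ` Sa a0 = Sa a1"
  proof -
    have "(\<otimes>) k ` Sa a0 = (\<otimes>) (inv t1) ` (\<otimes>) t2 ` Sa a0"
      unfolding k_def using translate_translate[of "inv t1" t2 "Sa a0"] c fibs by simp
    also have "\<dots> = Sa a1" unfolding z using translate_translate[of "inv t1" t1 "Sa a1"] c fibs by (simp add: translate_one)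
    finally show ?thesis .
  qed
  have kt: "k \<otimes> t1 = t2" using c by (simp add: k_def abelian_simps)
  have b2: "2 \<le> t b" using b by simp
  have Z0: "Sa a0 <#> Tb b = Zc (a0 \<otimes>\<^bsub>Q\<^esub> b)" "Sa a1 <#> Tb b = Zc (a0 \<otimes>\<^bsub>Q\<^esub> E b)" using Z_eq[OF b(1) b2] by auto
  have sub: "Sa a0 <#> Tb b \<subseteq> carrier G" using fibs by (intro setmult_subset_G)
  have c3: "card (Sa a0 <#> Tb b) = 3" using m_eq(1)[OF b(1) b2] f by (simp add: m_def)
  have st: "stabilizer G (Sa a0 <#> Tb b) = {\<one>}"
  proof -
    have "x = \<one>" if "x \<in> stabilizer G (Sa a0 <#> Tb b)" for x
    proof (rule coprime_stabilizer[OF sub _ _ that])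
      show "\<phi> z = a0 \<otimes>\<^bsub>Q\<^esub> b" if "z \<in> Sa a0 <#> Tb b" for z
        using that ST_subset_Zc[of a0 b] by (auto simp: fib_def)
    qed (use c3 h4 in simp)
    moreover have "\<one> \<in> stabilizer G (Sa a0 <#> Tb b)"
      using stabilizer_subgroup[OF sub] by (rule subgroup.one_closed)
    ultimately show ?thesis by blast
  qed
  have absorb: "\<tau> \<in> Tb b" if "\<tau> \<in> carrier G" "(\<otimes>) \<tau> ` Sa a0 \<subseteq> Sa a0 <#> Tb b" for \<tau>
    using kneser_absorb[OF fibs(2,4,1,3) Sa_ne[OF a1c(3)] st _ that] c3 s2 b by (simp add: s_def t_def)
  have in1: "k \<otimes> t2 \<in> Tb b"
  proof (rule absorb)
    have "(\<otimes>) (k \<otimes> t2) ` Sa a0 = (\<otimes>) t2 ` Sa a1"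
      using translate_translate[of t2 k "Sa a0"] kc c fibs kS m_comm by simp
    also have "\<dots> \<subseteq> Zc (a1 \<otimes>\<^bsub>Q\<^esub> E (E b))" using t2 by (intro translate_subset_Zc) simp
    also have "a1 \<otimes>\<^bsub>Q\<^esub> E (E b) = a0 \<otimes>\<^bsub>Q\<^esub> b" using a1b[OF Ec(2)] E3[OF b(1)] by simp
    finally show "(\<otimes>) (k \<otimes> t2) ` Sa a0 \<subseteq> Sa a0 <#> Tb b" using Z0 by simp
  qed (use kc c in simp)
  have in2: "inv k \<otimes> t1 \<in> Tb b"
  proof (rule absorb)
    have "(\<otimes>) t1 ` Sa a0 \<subseteq> Zc (a0 \<otimes>\<^bsub>Q\<^esub> E b)" using t1 by (intro translate_subset_Zc) simp
    also have "\<dots> = Sa a1 <#> Tb b" using Z0 by simp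
    also have "\<dots> = (\<otimes>) k ` (Sa a0 <#> Tb b)"
      unfolding kS[symmetric] using set_mult_translate[OF kc fibs(1,3)] .
    finally have "(\<otimes>) (inv k) ` (\<otimes>) t1 ` Sa a0 \<subseteq> (\<otimes>) (inv k) ` (\<otimes>) k ` (Sa a0 <#> Tb b)" by (rule image_mono)
    then show "(\<otimes>) (inv k \<otimes> t1) ` Sa a0 \<subseteq> Sa a0 <#> Tb b"
      using translate_translate[of "inv k" t1 "Sa a0"] translate_translate[of "inv k" k "Sa a0 <#> Tb b"] kc c fibs sub
      by (simp add: translate_one)
  qed (use kc c in simp)
  define w where "w = inv k \<otimes> t1"
  have cw: "card (Tb b) = 2" using b by (simp add: t_def)
  obtain w' where w': "w' \<noteq> w" "Tb b = {w, w'}" using card_2_pointed[OF cw] in2 by (metis w_def)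
  have wc: "w \<in> carrier G" "w' \<in> carrier G" using w' fibs(3)[of b] by auto
  have kw: "k \<otimes> w = t1" using kc c by (simp add: w_def)
  have T_eq: "T = {w, w', t1, t2}"
  proof -
    have "T = Tb b \<union> Tb (E b) \<union> Tb (E (E b))"
    proof
      show "T \<subseteq> Tb b \<union> Tb (E b) \<union> Tb (E (E b))"
      proof
        fix x assume x: "x \<in> T"
        then have "\<phi> x \<in> carrier Q" using T by auto
        then have "\<phi> x \<in> {b, E b, E (E b)}" unfolding Q_elems(1)[OF b(1)] .
        then show "x \<in> Tb b \<union> Tb (E b) \<union> Tb (E (E b))" using x by (auto simp: fib_def)
      qed
    qed (auto simp: fib_def)
    then show ?thesis using w' t1 t2 by auto
  qed
  have kT: "(\<otimes>) k ` T = {t1, k \<otimes> w', t2, k \<otimes> t2}" unfolding T_eq using kw kt by simp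
  have "k \<otimes> w' \<notin> T"
  proof
    assume "k \<otimes> w' \<in> T"
    then have "k \<in> stabilizer G T"
      using kw kt in1 w' T_eq kc by (intro stabilizerI[OF T(2,1)]) auto
    then have "k = \<one>" using no_stabilizer_factor by blast
    then have "t1 = t2" using kt c by simp
    then have "t1 \<in> Tb (E b)" "t1 \<in> Tb (E (E b))" using t1 t2 by auto
    then show False using Q_elems(3)[OF b(1)] by (auto simp: fib_def)
  qed
  moreover have kt2: "k \<otimes> t2 \<in> {w, w'}" using in1 unfolding w'(2) .
  then have "T \<union> (\<otimes>) k ` T = insert (k \<otimes> w') T" unfolding kT unfolding T_eq by blast
  ultimately have c5: "card (T \<union> (\<otimes>) k ` T) = 5" using T params h4 by simp
  have trivst: "stabilizer G (Tb b') = {\<one>}" if b': "b' \<in> carrier Q" "t b' = 2" for b'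
  proof -
    note b'(2)
    moreover have "b' \<in> {b, E b, E (E b)}" using b'(1) unfolding Q_elems(1)[OF b(1)] .
    ultimately have "b' = b" using b by auto
    have "x = \<one>" if "x \<in> stabilizer G (Tb b)" for x
    proof -
      have "x \<in> stabilizer G (Tb b <#> Sa a0)" using that stabilizer_set_mult_mono[OF fibs(3,1)] by auto
      then show ?thesis using st set_mult_comm[OF fibs(1,3)] by auto
    qed
    moreover have "\<one> \<in> stabilizer G (Tb b)" using stabilizer_subgroup[OF fibs(3)] by (rule subgroup.one_closed)
    ultimately show ?thesis unfolding \<open>b' = b\<close> by blast
  qed
  show ?thesis
    by (rule that[OF kc c5 h4]) (use trivst b in auto)
qed

lemma order_12: "order G = 12" "finite (carrier G)" "h = 4"
proof -
  show fG: "finite (carrier G)" using infinite_Q Q3 by (metis card.infinite zero_neq_numeral)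
  show "h = 4" using shift by blast
  then show "order G = 12" using order_G[OF fG] Q3 by simp
qed

text \<open>The lower bound for the boundary that \<open>shift\<close> attains. If it failed,
  Kneser's theorem would give a period K with |T + K| \<le> |K| + 2. If T + K has two or more
  cosets, then |K| \<le> 2 and T is itself periodic. If it is one coset, K maps onto Q; its part in
  the kernel has order 2, which makes the two-point fibre of T periodic, or order 4, and then K is
  the whole group and nothing is left outside the sumset.\<close>

lemma T_expands:
  assumes X: "X \<subseteq> carrier G" "finite X" "X \<noteq> {}" "card (X <#> T) + 2 \<le> 12"
  shows "card X + 3 \<le> card (X <#> T)"
proof (rule ccontr)
  assume neg: "\<not> ?thesis"
  define K where "K = stabilizer G (X <#> T)"
  note kn = kneser_strong[OF X(2) T(2) X(1) T(1) X(3) T_ne, folded K_def]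
  interpret K: subgroup K G by (rule kn(3))
  have XT: "X <#> T \<subseteq> carrier G" using X T by (intro setmult_subset_G)
  have "card X \<le> card (X <#> K)" using card_set_mult_ge_left[OF X(1) K.subset _ X(2) kn(2)] K.one_closed by blast
  then have le: "card (T <#> K) \<le> card K + 2" using kn(1) neg by linarith
  have TK: "T <#> K \<subseteq> carrier G" "finite (T <#> K)" using T K.subset kn(2) by (auto simp: setmult_subset_G finite_set_mult)
  have TTK: "T \<subseteq> T <#> K" using subset_set_mult_one[OF T(1) K.one_closed] .
  then have t4: "4 \<le> card (T <#> K)" using card_mono[OF TK(2) TTK] params order_12 by simp
  have inv: "k \<otimes> x \<in> T <#> K" if kx: "k \<in> K" "x \<in> T <#> K" for k x
  proof -
    obtain v l where v: "v \<in> T" "l \<in> K" "x = v \<otimes> l" using kx(2) by (auto simp: set_mult_iff)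
    have "k \<otimes> x = v \<otimes> (k \<otimes> l)" using v kx T by (auto simp: m_lcomm subset_iff)
    then show ?thesis using v kx by (auto intro: set_multI)
  qed
  have "card K dvd card (T <#> K)" using card_dvd_invariant[OF kn(3) TK(2,1)] inv by blast
  then obtain j where j: "card (T <#> K) = card K * j" by auto
  obtain v0 where v0: "v0 \<in> T" using T_ne by auto
  have v0c: "v0 \<in> carrier G" using v0 T by auto
  show False
  proof (cases "j = 1")
    case False
    have "j \<noteq> 0" using j t4 by (intro notI) simp
    then have "2 \<le> j" using False by simp
    then have "card K * 2 \<le> card K * j" by (rule mult_le_mono2)
    then have "card K \<le> 2" using le j by linarith
    then have "card K = 2" "card (T <#> K) = 4" using t4 le by linarith+
    then have "T = T <#> K" using card_subset_eq[OF TK(2) TTK] params order_12 by simp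
    then have "K \<subseteq> stabilizer G T" using set_mult_stabilizer[OF T(1) _ K.subset T(2)] by simp
    then have "K \<subseteq> {\<one>}" using no_stabilizer_factor by blast
    then have "card K \<le> card {\<one>}" by (intro card_mono) auto
    then show False using \<open>card K = 2\<close> by simp
  next
    case True
    have "(\<otimes>) v0 ` K \<subseteq> T <#> K" using v0 by (auto intro: set_multI)
    moreover have "card ((\<otimes>) v0 ` K) = card K" using v0c K.subset by (rule card_translate)
    ultimately have TKe: "T <#> K = (\<otimes>) v0 ` K" using True j TK(2) by (metis card_subset_eq mult.right_neutral)
    have diff_aux: "\<exists>l\<in>K. v = v0 \<otimes> l" if "v \<in> T" for v
      using subsetD[OF TTK that] unfolding TKe by blast
    have diff: "inv v \<otimes> v' \<in> K" if vv: "v \<in> T" "v' \<in> T" for v v'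
    proof -
      obtain l l' where l: "l \<in> K" "v = v0 \<otimes> l" "l' \<in> K" "v' = v0 \<otimes> l'" using diff_aux[OF vv(1)] diff_aux[OF vv(2)] by blast
      have "inv v \<otimes> v' = inv l \<otimes> l'" using l v0c by (simp add: abelian_simps)
      then show ?thesis using l by simp
    qed
    have onto_K: "\<exists>k\<in>K. \<phi> k = q" if "q \<in> carrier Q" for q
    proof -
      have "\<phi> v0 \<otimes>\<^bsub>Q\<^esub> q \<in> B" using B_all that v0c by simp
      then obtain v where v: "v \<in> T" "\<phi> v = \<phi> v0 \<otimes>\<^bsub>Q\<^esub> q" by auto
      have "\<phi> (inv v0 \<otimes> v) = q" using v v0c T that by (auto simp: subset_iff)
      then show ?thesis using diff[OF v0 v(1)] by blast
    qed
    obtain b where b: "b \<in> carrier Q" "t b = 2" using shift by blast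
    obtain w w' where w: "Tb b = {w, w'}" "w \<noteq> w'" using b by (auto simp: t_def card_2_iff)
    have st: "stabilizer G (Tb b) = {\<one>}" using shift b by metis
    have wT: "w \<in> T" "w' \<in> T" "\<phi> w = b" "\<phi> w' = b" using w by (auto simp: fib_def)
    have wc: "w \<in> carrier G" "w' \<in> carrier G" using wT T by auto
    define \<delta> where "\<delta> = inv w \<otimes> w'"
    have dc: "\<delta> \<in> carrier G" "w' = \<delta> \<otimes> w" using wc by (simp_all add: \<delta>_def abelian_simps)
    have dK: "\<delta> \<in> K \<inter> N" using diff[OF wT(1,2)] wc wT b by (simp add: \<delta>_def N_def)
    have d1: "\<delta> \<noteq> \<one>" using dc w wc by auto
    define K0 where "K0 = K \<inter> N"
    have sg0: "subgroup K0 G" unfolding K0_def using kn(3) N_subgroup by (rule subgroups_Inter_pair)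
    interpret K0: subgroup K0 G by (rule sg0)
    have "card K0 dvd card N"
    proof (rule card_dvd_invariant[OF sg0 N_card(2)])
      show "k \<otimes> x \<in> N" if "k \<in> K0" "x \<in> N" for k x
        using that subgroup.m_closed[OF N_subgroup] by (auto simp: K0_def)
    qed (auto simp: N_def)
    then have "card K0 dvd 4" using N_card order_12 by simp
    then have "card K0 \<le> 4" "card K0 \<noteq> 3" by (auto intro: dvd_imp_le)
    moreover have "card {\<one>, \<delta>} \<le> card K0"
      using dK kn(2) K0.one_closed by (intro card_mono) (auto simp: K0_def)
    then have "2 \<le> card K0" using d1 by simp
    ultimately consider "card K0 = 2" | "card K0 = 4" by linarith
    then show False
    proof cases
      case 1
      have "K0 = {\<one>, \<delta>}"
        using 1 dK d1 K0.one_closed kn(2) card_subset_eq[of K0 "{\<one>, \<delta>}"] by (auto simp: K0_def)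
      moreover have "\<delta> \<otimes> \<delta> \<in> K0" using dK K0.m_closed[of \<delta> \<delta>] by (simp add: K0_def)
      moreover have "\<delta> \<otimes> \<delta> \<noteq> \<delta>" using d1 dc by simp
      ultimately have "\<delta> \<otimes> \<delta> = \<one>" by auto
      then have "\<delta> \<otimes> w' = w" using dc wc m_assoc[of \<delta> \<delta> w] by simp
      then have "\<delta> \<in> stabilizer G (Tb b)"
        using dc w wc fibs by (intro stabilizerI) auto
      then show False using st d1 by simp
    next
      case 2
      then have "K0 = N" using N_card order_12 card_subset_eq[of N K0] by (simp add: K0_def)
      then have NK: "N \<subseteq> K" by (auto simp: K0_def)
      have "carrier G \<subseteq> X <#> T"
      proof
        fix x assume x: "x \<in> carrier G"
        obtain x0 where x0: "x0 \<in> X" using X by auto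
        define y where "y = x0 \<otimes> v0"
        have y: "y \<in> X <#> T" "y \<in> carrier G" using x0 v0 X T by (auto simp: y_def intro: set_multI)
        define l where "l = x \<otimes> inv y"
        have lc: "l \<in> carrier G" using x y by (simp add: l_def)
        obtain k where k: "k \<in> K" "\<phi> k = \<phi> l" using onto_K lc \<phi>_closed by blast
        have "inv k \<otimes> l \<in> N" using k lc by (simp add: N_def)
        then have "k \<otimes> (inv k \<otimes> l) \<in> K" using NK k by blast
        then have "l \<in> K" using k lc by simp
        then have "l \<otimes> y \<in> X <#> T" using y stabilizer_mult unfolding K_def by blast
        then show "x \<in> X <#> T" using x y by (simp add: l_def)
      qed
      then have "X <#> T = carrier G" using XT by auto
      then show False using X(4) order_12 by (simp add: order_def)
    qed
  qed
qed

end

section \<open>Boundaries with respect to translation by a generator\<close>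

context comm_group
begin

lemma translate_carrier:
  assumes "x \<in> carrier G" shows "(\<lambda>y. x \<otimes> y) ` carrier G = carrier G"
proof
  show "carrier G \<subseteq> (\<otimes>) x ` carrier G"
  proof
    fix y assume "y \<in> carrier G"
    then have "y = x \<otimes> (inv x \<otimes> y)" "inv x \<otimes> y \<in> carrier G" using assms by auto
    then show "y \<in> (\<otimes>) x ` carrier G" by blast
  qed
qed (use assms in auto)

lemma translate_not_subset:
  assumes X: "finite X" "X \<subseteq> carrier G" "X \<noteq> {}" "X \<noteq> carrier G" and x: "x \<in> carrier G" "generate G {x} = carrier G"
  shows "(\<otimes>) x ` X - X \<noteq> {}"
proof
  assume "(\<otimes>) x ` X - X = {}"
  then have "x \<in> stabilizer G X" using X x by (intro stabilizerI) auto
  then have st: "carrier G \<subseteq> stabilizer G X"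
    using generate_subgroup_incl[of "{x}" "stabilizer G X"] stabilizer_subgroup[OF X(2)] x(2) by simp
  obtain z where z: "z \<in> X" using X by auto
  have "carrier G \<subseteq> X"
  proof
    fix w assume w: "w \<in> carrier G"
    have zc: "z \<in> carrier G" using z X by auto
    have "w \<otimes> inv z \<in> stabilizer G X" using st w zc by auto
    then have "w \<otimes> inv z \<otimes> z \<in> X" using z stabilizer_mult by blast
    then show "w \<in> X" using w zc by simp
  qed
  then show False using X by auto
qed

lemma card_boundary:
  assumes "finite X" "X \<subseteq> carrier G" "x \<in> carrier G"
  shows "card ((\<otimes>) x ` X - X) + card (X \<inter> (\<otimes>) x ` X) = card X"
  using card_Diff_Int[of "(\<otimes>) x ` X" X] card_translate[OF assms(3,2)] assms(1) by (simp add: Int_commute)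

text \<open>A translation moves as many points into \<open>X\<close> as out of it.\<close>

lemma boundary_complement:
  assumes "finite (carrier G)" "X \<subseteq> carrier G" "x \<in> carrier G"
  shows "card ((\<otimes>) x ` (carrier G - X) - (carrier G - X)) = card ((\<otimes>) x ` X - X)"
proof -
  have fX: "finite X" using assms finite_subset by blast
  have "(\<otimes>) x ` (carrier G - X) = carrier G - (\<otimes>) x ` X"
    using inj_on_image_set_diff[of "(\<otimes>) x" "carrier G" "carrier G" X] translate_carrier[OF assms(3)]
      inj_on_mult(2)[OF order_refl assms(3)] assms(2) by simp
  moreover have "(carrier G - (\<otimes>) x ` X) - (carrier G - X) = X - (\<otimes>) x ` X" using assms(2) by auto
  moreover have "card (X - (\<otimes>) x ` X) + card (X \<inter> (\<otimes>) x ` X) = card X" using fX by (rule card_Diff_Int)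
  ultimately show ?thesis using card_boundary[OF fX assms(2,3)] by simp
qed

text \<open>The reflection turns the pairs a, x + a inside \<open>X\<close> into such pairs inside
  \<open>Y\<close>, in the opposite order.\<close>

lemma boundary_inverse:
  assumes X: "finite X" "X \<subseteq> carrier G" and x: "x \<in> carrier G" and c: "c \<in> carrier G"
  defines "Y \<equiv> (\<lambda>a. c \<otimes> inv a) ` X"
  shows "card ((\<otimes>) x ` Y - Y) = card ((\<otimes>) x ` X - X)"
proof -
  have inj: "inj_on (\<lambda>a. c \<otimes> inv a) X" using inj_on_mult(3)[OF X(2) c] .
  have Y: "finite Y" "Y \<subseteq> carrier G" "card Y = card X" using X c inj by (auto simp: Y_def card_image)
  have 1: "Y \<inter> (\<otimes>) x ` Y = (\<lambda>a. c \<otimes> inv a) ` {a \<in> X. x \<otimes> a \<in> X}"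
  proof (intro equalityI subsetI)
    fix w assume "w \<in> Y \<inter> (\<otimes>) x ` Y"
    then obtain a a' where w: "a \<in> X" "a' \<in> X" "w = c \<otimes> inv a" "w = x \<otimes> (c \<otimes> inv a')"
      unfolding Y_def by blast
    have ac: "a \<in> carrier G" "a' \<in> carrier G" using w X by auto
    have "c \<otimes> inv a \<otimes> inv c \<otimes> a \<otimes> a' = x \<otimes> (c \<otimes> inv a') \<otimes> inv c \<otimes> a \<otimes> a'" using w by simp
    then have "a' = x \<otimes> a" using ac c x by (simp add: abelian_simps)
    then show "w \<in> (\<lambda>a. c \<otimes> inv a) ` {a \<in> X. x \<otimes> a \<in> X}" using w by auto
  next
    fix w assume "w \<in> (\<lambda>a. c \<otimes> inv a) ` {a \<in> X. x \<otimes> a \<in> X}"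
    then obtain a where a: "a \<in> X" "x \<otimes> a \<in> X" "w = c \<otimes> inv a" by auto
    have ac: "a \<in> carrier G" using a X by auto
    have "w = x \<otimes> (c \<otimes> inv (x \<otimes> a))" using a ac c x by (simp add: abelian_simps)
    then show "w \<in> Y \<inter> (\<otimes>) x ` Y" using a unfolding Y_def by blast
  qed
  have "inj_on (\<lambda>a. c \<otimes> inv a) {a \<in> X. x \<otimes> a \<in> X}" using inj by (rule inj_on_subset) auto
  then have 2: "card (Y \<inter> (\<otimes>) x ` Y) = card {a \<in> X. x \<otimes> a \<in> X}" unfolding 1 by (rule card_image)
  have "X \<inter> (\<otimes>) x ` X = (\<otimes>) x ` {a \<in> X. x \<otimes> a \<in> X}" by auto
  moreover have "card ((\<otimes>) x ` {a \<in> X. x \<otimes> a \<in> X}) = card {a \<in> X. x \<otimes> a \<in> X}"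
    using x X by (intro card_translate) auto
  ultimately show ?thesis using card_boundary[OF Y(1,2) x] card_boundary[OF X x] Y(3) 2 by simp
qed

text \<open>Adjoining the powers of a generator one at a time enlarges a proper subset at every step.\<close>

lemma boundary_of_sumset:
  assumes X: "finite X" "X \<subseteq> carrier G" "X \<noteq> {}" and x: "x \<in> carrier G" "generate G {x} = carrier G"
    and q: "q \<in> carrier G" and Y: "Y = (\<lambda>i::nat. q \<otimes> x [^] i) ` {..u}"
    and u: "1 \<le> u" and card: "card (X <#> Y) = card X + u" and ne: "X <#> Y \<noteq> carrier G"
  shows "card ((\<otimes>) x ` X - X) = 1"
proof -
  define W where "W = (\<lambda>j::nat. X <#> ((\<lambda>i::nat. x [^] i) ` {..j}))"
  have pc: "(\<lambda>i::nat. x [^] i) ` {..j} \<subseteq> carrier G" for j using x by auto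
  have Wf: "finite (W j)" "W j \<subseteq> carrier G" for j
    using X pc by (auto simp: W_def finite_set_mult setmult_subset_G)
  have W0: "W 0 = X"
    unfolding W_def using X(2) by (auto simp: set_mult_def subset_iff)
  have Wx: "W (Suc j) = W j \<union> (\<otimes>) x ` W j" for j
  proof
    show "W (Suc j) \<subseteq> W j \<union> (\<otimes>) x ` W j"
    proof
      fix w assume "w \<in> W (Suc j)"
      then obtain y i where w: "y \<in> X" "i \<le> Suc j" "w = y \<otimes> x [^] i" by (auto simp: W_def set_mult_iff)
      show "w \<in> W j \<union> (\<otimes>) x ` W j"
      proof (cases "i \<le> j")
        case True then show ?thesis using w by (auto simp: W_def set_mult_iff)
      next
        case False
        then have "i = Suc j" using w by simp
        then have "w = x \<otimes> (y \<otimes> x [^] j)" using w X x by (auto simp: subset_iff m_ac)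
        moreover have "y \<otimes> x [^] j \<in> W j" using w by (auto simp: W_def set_mult_iff)
        ultimately show ?thesis by blast
      qed
    qed
    show "W j \<union> (\<otimes>) x ` W j \<subseteq> W (Suc j)"
    proof
      fix w assume "w \<in> W j \<union> (\<otimes>) x ` W j"
      then obtain y i where w: "y \<in> X" "i \<le> j" "w = y \<otimes> x [^] i \<or> w = x \<otimes> (y \<otimes> x [^] i)"
        by (auto simp: W_def set_mult_iff)
      have "x \<otimes> (y \<otimes> x [^] i) = y \<otimes> x [^] Suc i" using w X x by (auto simp: subset_iff m_ac)
      then have "\<exists>i'\<le>Suc j. w = y \<otimes> x [^] i'" using w by (metis Suc_le_mono le_Suc_eq)
      then show "w \<in> W (Suc j)" using w by (auto simp: W_def set_mult_iff)
    qed
  qed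
  have cW: "card (W (Suc j)) = card (W j) + card ((\<otimes>) x ` W j - W j)" for j
    unfolding Wx using Wf[of j] card_Un_disjoint[of "W j" "(\<otimes>) x ` W j - W j"] by simp
  have "X <#> Y = (\<otimes>) q ` W u"
  proof -
    have "Y = (\<otimes>) q ` (\<lambda>i::nat. x [^] i) ` {..u}" unfolding Y by auto
    then have "Y <#> X = (\<otimes>) q ` (((\<lambda>i::nat. x [^] i) ` {..u}) <#> X)"
      using set_mult_translate[OF q pc X(2)] by simp
    moreover have "Y \<subseteq> carrier G" unfolding Y using q x by auto
    ultimately show ?thesis using set_mult_comm[OF X(2)] pc by (simp add: W_def)
  qed
  then have cu: "card (W u) = card X + u" "W u \<noteq> carrier G"
    using card ne card_translate[OF q Wf(2)] translate_carrier[OF q] by auto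
  have grow: "card (W j) + i \<le> card (W (j + i))" if "j + i \<le> u" for i j
    using that
  proof (induction i)
    case (Suc i)
    have "W (j + i) \<noteq> carrier G"
    proof
      assume e: "W (j + i) = carrier G"
      have "W (j + i) \<subseteq> W u" unfolding W_def using Suc.prems by (intro mono_set_mult image_mono) auto
      then show False using e cu Wf[of u] by auto
    qed
    moreover have "W (j + i) \<noteq> {}"
      using X(3) unfolding W_def set_mult_def by auto
    ultimately have "(\<otimes>) x ` W (j + i) - W (j + i) \<noteq> {}" using Wf x by (intro translate_not_subset) auto
    then have "1 \<le> card ((\<otimes>) x ` W (j + i) - W (j + i))" using Wf by (simp add: Suc_le_eq card_gt_0_iff)
    then show ?case using Suc cW[of "j + i"] by simp
  qed simp
  have "card (W 1) + (u - 1) \<le> card (W u)" using grow[of 1 "u - 1"] u by simp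
  then have "card (W 1) \<le> card X + 1" using cu u by simp
  moreover have "card (W 0) + 1 \<le> card (W 1)" using grow[of 0 1] u by simp
  ultimately show ?thesis using cW[of 0] W0 by simp
qed

end

context overfull_pair
begin

text \<open>Without exact columns u = k = 1 and D = h + g, so n h exceeds 3 h + 3 g by at most 2
  \<mu>, and n is 3, 4 or 5. The bounds D \<le> n (h - s a) for the two rows exclude 5; for n = 4
  they hold with equality, which \<open>equal_layers\<close> forbids. The case n = 3 is that of
  \<open>triple_pair\<close>.\<close>

theorem exceptional:
  shows "\<mu> = 0" "order G = 12" "card S = 4" "card T = 4"
    "\<exists>k\<in>carrier G. card (T \<union> (\<otimes>) k ` T) = 5"
    "\<And>X. X \<subseteq> carrier G \<Longrightarrow> finite X \<Longrightarrow> X \<noteq> {} \<Longrightarrow> card (X <#> T) + 2 \<le> 12 \<Longrightarrow> card X + 3 \<le> card (X <#> T)"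
proof -
  have u: "u = 1" using u_one_if_no_exact[OF no_exact] .
  note uc = unit_case[OF u]
  obtain a0 a1 where A: "A = {a0, a1}" "a0 \<noteq> a1" "a0 \<in> carrier Q" "a1 \<in> carrier Q"
    and gen: "generate Q {a1 \<otimes>\<^bsub>Q\<^esub> inv\<^bsub>Q\<^esub> a0} = carrier Q" using A_two[OF u] .
  have Dhg: "D = h + g" using dc no_exact uc(1) bounds(1) u by simp
  have b2: "3 * h + 3 * g + \<mu> \<le> n * h" "n * h \<le> 3 * h + 3 * g + 2 * \<mu>"
    using bounds(2,4) Dhg u by simp_all
  have ss: "s a0 + s a1 = h + g + \<mu>" using sum_s u A by simp
  have sle: "s a0 \<le> h" "s a1 \<le> h" using s_le A by auto
  have row: "d c \<le> h - s a" if "a \<in> A" "c \<in> carrier Q" for a c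
  proof -
    have ac: "a \<in> carrier Q" using that A by auto
    have "inv\<^bsub>Q\<^esub> a \<otimes>\<^bsub>Q\<^esub> c \<in> B" using uc(2) ac that by simp
    then show ?thesis using d_le_row[OF that(1), of "inv\<^bsub>Q\<^esub> a \<otimes>\<^bsub>Q\<^esub> c"] ac that by simp
  qed
  have rowD: "D \<le> n * (h - s a0)" "D \<le> n * (h - s a1)"
    using D_le_if[of "h - s a0"] D_le_if[of "h - s a1"] row A C_all card_C by auto
  have n5: "n \<le> 5"
  proof (rule ccontr)
    assume "\<not> n \<le> 5"
    then have "6 * h \<le> n * h" by (intro mult_le_mono1) simp
    then show False using b2 gmu by linarith
  qed
  have "n \<noteq> 5"
  proof
    assume "n = 5" then show False using b2 rowD Dhg ss sle gmu by simp
  qed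
  moreover have "n \<noteq> 4"
  proof
    assume n: "n = 4"
    then have eq: "D = 4 * (h - s a0)" "D = 4 * (h - s a1)" using b2 rowD Dhg ss sle by simp_all
    have \<sigma>: "\<sigma> c = s a0" if c: "c \<in> carrier Q" for c
    proof -
      have "d c = h - s a0"
      proof (rule ccontr)
        assume ne: "d c \<noteq> h - s a0"
        have "(\<Sum>c\<in>C. d c) < (\<Sum>c\<in>C. h - s a0)"
          using row[of a0] A C_all C_props c ne
          by (intro sum_strict_mono_ex1) (auto simp: le_less intro!: bexI[of _ c])
        then show False using eq n card_C by (simp add: D_def)
      qed
      then show ?thesis using d_\<sigma>[OF c] sle by simp
    qed
    have "s a0 = s a1" using eq sle by simp
    then show False using equal_layers[OF uc(2), of a0 a1] A \<sigma> by auto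
  qed
  ultimately have n: "n = 3" using n5 n3 by simp
  have gm: "g = 0" "\<mu> = 0" using b2 n by simp_all
  have Th: "card T = h" using nh Dhg n gm u by simp
  have S_h: "card S = h" using S_card u gm by simp
  have h4: "4 \<le> h" using T4 gm Th by simp
  \<comment> \<open>The inequality holds in each column and the totals over Q agree, so every column
    has equality.\<close>
  have col: "\<sigma> (a0 \<otimes>\<^bsub>Q\<^esub> b) + \<sigma> (a1 \<otimes>\<^bsub>Q\<^esub> b) = h + t b" if b: "b \<in> carrier Q" for b
  proof -
    have le: "h + t b \<le> \<sigma> (a0 \<otimes>\<^bsub>Q\<^esub> b) + \<sigma> (a1 \<otimes>\<^bsub>Q\<^esub> b)" if "b \<in> carrier Q" for b
    proof -
      have "b \<in> B" "\<not> exact b" using that uc(2) no_exact by (auto simp: P_def)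
      then show ?thesis using column[of b] u A by simp
    qed
    have tr: "(\<Sum>b\<in>carrier Q. \<sigma> (a \<otimes>\<^bsub>Q\<^esub> b)) = (\<Sum>c\<in>carrier Q. \<sigma> c)" if "a \<in> carrier Q" for a
      using sum.reindex[OF Q.inj_on_mult(2)[OF order_refl that], of \<sigma>] Q.translate_carrier[OF that] by simp
    have "(\<Sum>c\<in>carrier Q. \<sigma> c) = 2 * h" using sum_\<sigma> C_all Th u gm by simp
    then have "(\<Sum>b\<in>carrier Q. \<sigma> (a0 \<otimes>\<^bsub>Q\<^esub> b) + \<sigma> (a1 \<otimes>\<^bsub>Q\<^esub> b)) = 4 * h"
      using tr A by (simp add: sum.distrib)
    moreover have "(\<Sum>b\<in>carrier Q. h + t b) = 4 * h"
      using sum_t uc(2) Th n by (simp add: sum.distrib n_def)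
    ultimately have "(\<Sum>b\<in>carrier Q. h + t b) = (\<Sum>b\<in>carrier Q. \<sigma> (a0 \<otimes>\<^bsub>Q\<^esub> b) + \<sigma> (a1 \<otimes>\<^bsub>Q\<^esub> b))" by simp
    from sum_mono_inv[OF this le b fin(1)] show ?thesis by simp
  qed
  define e where "e = a1 \<otimes>\<^bsub>Q\<^esub> inv\<^bsub>Q\<^esub> a0"
  have ec: "e \<in> carrier Q" using A by (simp add: e_def)
  have a1e: "a1 = e \<otimes>\<^bsub>Q\<^esub> a0" using A by (simp add: e_def)
  have e3: "e \<otimes>\<^bsub>Q\<^esub> (e \<otimes>\<^bsub>Q\<^esub> e) = \<one>\<^bsub>Q\<^esub>"
  proof -
    have e2: "e \<otimes>\<^bsub>Q\<^esub> e \<noteq> \<one>\<^bsub>Q\<^esub>" using Q.generator_square[OF ec] gen n by (simp add: e_def n_def)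
    then have e1: "e \<noteq> \<one>\<^bsub>Q\<^esub>" by auto
    have "e \<noteq> e \<otimes>\<^bsub>Q\<^esub> e" using e1 ec by simp
    then have "card {\<one>\<^bsub>Q\<^esub>, e, e \<otimes>\<^bsub>Q\<^esub> e} = 3" using e1 e2 by auto
    then have "{\<one>\<^bsub>Q\<^esub>, e, e \<otimes>\<^bsub>Q\<^esub> e} = carrier Q"
      using ec fin n by (intro card_subset_eq) (auto simp: n_def)
    then have "e \<otimes>\<^bsub>Q\<^esub> (e \<otimes>\<^bsub>Q\<^esub> e) \<in> {\<one>\<^bsub>Q\<^esub>, e, e \<otimes>\<^bsub>Q\<^esub> e}" using ec by simp
    then show ?thesis using e1 e2 ec by auto
  qed
  interpret triple: triple_pair G Q \<phi> S T h u g \<mu> a0 a1 e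
    by unfold_locales
      (use A a1e ec e3 uc n u gm Th h4 col in \<open>auto simp: n_def\<close>)
  show "\<mu> = 0" using gm by simp
  show "order G = 12" by (rule triple.order_12)
  show "card S = 4" "card T = 4" using S_h Th triple.order_12 by simp_all
  show "\<exists>k\<in>carrier G. card (T \<union> (\<otimes>) k ` T) = 5" using triple.shift by blast
  show "card X + 3 \<le> card (X <#> T)"
    if "X \<subseteq> carrier G" "finite X" "X \<noteq> {}" "card (X <#> T) + 2 \<le> 12" for X
    using triple.T_expands that by blast
qed

end

context critical_pair
begin

text \<open>Otherwise T lies in one fibre; as |T| \<ge> |S| \<ge> h it is the whole fibre, hence
  periodic.\<close>

lemma B2: "2 \<le> card B"
proof (rule ccontr)
  assume "\<not> 2 \<le> card B"
  moreover have "card B \<noteq> 0" using B_props by simp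
  ultimately have "card B = 1" by simp
  then obtain b where b: "B = {b}" by (metis card_1_singletonE)
  have bc: "b \<in> carrier Q" using b B_props by auto
  have T_eq: "T = Tb b" using b by (auto simp: fib_def)
  have "u * h + g + \<mu> \<le> card T" using ST_le S_card by simp
  moreover have "1 * h \<le> u * h" using u1 by (intro mult_le_mono1)
  moreover have "card T \<le> h" using t_le[OF bc] sum_t b by simp
  ultimately have "card T = h" by linarith
  then have "t b = h" using sum_t b by simp
  then have full: "T = {x \<in> carrier G. \<phi> x = b}" using fib_full[OF T(1) bc] T_eq by (simp add: t_def)
  have "2 \<le> card N" using N_card h2 by simp
  then have "\<not> N \<subseteq> {\<one>}" using card_mono[of "{\<one>}" N] by auto
  then obtain k where k: "k \<in> N" "k \<noteq> \<one>" by auto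
  have "k \<in> stabilizer G T"
    using k bc by (intro stabilizerI[OF T(2,1)]) (auto simp: full N_def)
  then show False using no_stabilizer_factor k by blast
qed

lemma A_boundary:
  assumes x: "x \<in> carrier Q" "x \<noteq> \<one>\<^bsub>Q\<^esub>" "u \<le> card (A \<inter> (\<lambda>y. x \<otimes>\<^bsub>Q\<^esub> y) ` A)"
  shows "generate Q {x} = carrier Q" "card ((\<lambda>y. x \<otimes>\<^bsub>Q\<^esub> y) ` A - A) = 1"
  using Q.boundary_generates[OF A_props(1,2,3) A_gen A_ne no_subgroup x(1,2)] x(3) A_card by auto

lemma r_eq:
  assumes c: "c \<in> carrier Q"
  shows "r c = card {a \<in> A. c \<otimes>\<^bsub>Q\<^esub> inv\<^bsub>Q\<^esub> a \<in> B}"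
proof -
  have "{b \<in> B. c \<otimes>\<^bsub>Q\<^esub> inv\<^bsub>Q\<^esub> b \<in> A} = (\<lambda>a. c \<otimes>\<^bsub>Q\<^esub> inv\<^bsub>Q\<^esub> a) ` {a \<in> A. c \<otimes>\<^bsub>Q\<^esub> inv\<^bsub>Q\<^esub> a \<in> B}"
  proof (intro equalityI subsetI)
    fix b assume b: "b \<in> {b \<in> B. c \<otimes>\<^bsub>Q\<^esub> inv\<^bsub>Q\<^esub> b \<in> A}"
    then have "b \<in> carrier Q" using B_props by blast
    then have "b = c \<otimes>\<^bsub>Q\<^esub> inv\<^bsub>Q\<^esub> (c \<otimes>\<^bsub>Q\<^esub> inv\<^bsub>Q\<^esub> b)" using c by (simp add: Q.abelian_simps)
    then show "b \<in> (\<lambda>a. c \<otimes>\<^bsub>Q\<^esub> inv\<^bsub>Q\<^esub> a) ` {a \<in> A. c \<otimes>\<^bsub>Q\<^esub> inv\<^bsub>Q\<^esub> a \<in> B}" using b by auto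
  next
    fix b assume "b \<in> (\<lambda>a. c \<otimes>\<^bsub>Q\<^esub> inv\<^bsub>Q\<^esub> a) ` {a \<in> A. c \<otimes>\<^bsub>Q\<^esub> inv\<^bsub>Q\<^esub> a \<in> B}"
    then obtain a where a: "a \<in> A" "c \<otimes>\<^bsub>Q\<^esub> inv\<^bsub>Q\<^esub> a \<in> B" "b = c \<otimes>\<^bsub>Q\<^esub> inv\<^bsub>Q\<^esub> a" by blast
    have "a \<in> carrier Q" using a(1) A_props by blast
    then have "c \<otimes>\<^bsub>Q\<^esub> inv\<^bsub>Q\<^esub> b = a" using c a by (simp add: Q.abelian_simps)
    then show "b \<in> {b \<in> B. c \<otimes>\<^bsub>Q\<^esub> inv\<^bsub>Q\<^esub> b \<in> A}" using a by simp
  qed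
  moreover have "inj_on (\<lambda>a. c \<otimes>\<^bsub>Q\<^esub> inv\<^bsub>Q\<^esub> a) {a \<in> A. c \<otimes>\<^bsub>Q\<^esub> inv\<^bsub>Q\<^esub> a \<in> B}"
    using A_props c by (intro Q.inj_on_mult) auto
  ultimately show ?thesis by (simp add: r_def card_image)
qed

lemma r_pos: "c \<in> C \<Longrightarrow> 1 \<le> r c"
proof -
  assume c: "c \<in> C"
  then obtain a b where ab: "a \<in> A" "b \<in> B" "c = a \<otimes>\<^bsub>Q\<^esub> b" by (auto simp: C_def Q.set_mult_iff)
  have "a \<in> carrier Q" "b \<in> carrier Q" using ab A_props B_props by blast+
  then have "b \<in> {b \<in> B. c \<otimes>\<^bsub>Q\<^esub> inv\<^bsub>Q\<^esub> b \<in> A}" using ab by simp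
  then have "card {b} \<le> r c" unfolding r_def using B_props by (intro card_mono) auto
  then show "1 \<le> r c" by simp
qed

end

subsection \<open>Both projections are progressions with the same difference\<close>

locale tight_pair = critical_pair +
  assumes tight: "card C = card B + u"
begin

lemma D_tight: "D + card T + g = card B * h"
  using D_eq tight by (simp add: algebra_simps)

text \<open>Since |C| = |B| + u, the unweighted sum D is |B| h - |T| - g; subtracting it in
  \<open>sum_rd\<close> leaves this bound. So a deficient element with several representations is
  expensive.\<close>

lemma dc_tight: "(\<Sum>c\<in>C. (r c - 1) * d c) \<le> g + card P"
proof -
  have "(\<Sum>c\<in>C. (r c - 1) * d c) + D = (\<Sum>c\<in>C. r c * d c)"
    unfolding D_def sum.distrib[symmetric] using r_pos
    by (intro sum.cong refl) (metis add.commute le_add_diff_inverse mult.commute mult_Suc_right One_nat_def plus_1_eq_Suc)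
  then show ?thesis using sum_rd D_tight by linarith
qed

lemma D_ge:
  assumes "finite (carrier G)"
  shows "u * h + g + card C * h \<le> D + card (carrier Q) * h"
  using size_bound(1)[OF assms] D_eq by (simp add: mult.commute)

text \<open>For g = 0, D is the number of points that T lacks in the cosets it meets, and an exact
  column lacks h - 1 of them.\<close>

lemma exact_ge:
  assumes "P \<noteq> {}"
  shows "card P * (h - 1) \<le> D"
proof -
  have PB: "P \<subseteq> B" by (auto simp: P_def)
  have "card T = (\<Sum>b\<in>P. t b) + (\<Sum>b\<in>B - P. t b)"
    using sum_t PB B_props by (metis add.commute sum.subset_diff)
  moreover have "(\<Sum>b\<in>P. t b) = card P" by (simp add: P_def exact_def)
  moreover have "(\<Sum>b\<in>B - P. t b) \<le> card (B - P) * h"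
    using sum_bounded_above[of "B - P" t h] t_le B_props by auto
  moreover have "card (B - P) + card P = card B"
    using PB B_props by (metis card_Diff_subset card_mono finite_subset le_add_diff_inverse2)
  then have "card (B - P) * h + card P * h = card B * h" by (metis distrib_right)
  moreover have "card P * (h - 1) + card P = card P * h" using h2 by (metis Suc_1 Suc_le_D diff_Suc_1 mult_Suc_right add.commute)
  ultimately show ?thesis using D_tight P_ne[OF assms] by linarith
qed

lemma h2_full_row:
  assumes "h = 2" "P \<noteq> {}" "2 \<le> u"
  obtains v where "v \<in> A" "s v = 2" "D \<le> u"
proof -
  have gm: "g = 0" "\<mu> = 0" using P_ne[OF assms(2)] by auto
  have "\<exists>v\<in>A. s v = 2"
  proof (rule ccontr)
    assume "\<not> ?thesis"
    then have "s a \<le> 1" if "a \<in> A" for a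
      using s_le[of a] A_props that assms(1) by (metis One_nat_def Suc_1 le_SucE subsetD)
    then have "(\<Sum>a\<in>A. s a) \<le> (\<Sum>a\<in>A. 1)" by (intro sum_mono) auto
    then show False using sum_s A_card assms gm by simp
  qed
  then obtain v where v: "v \<in> A" "s v = 2" by auto
  then have "D + card B \<le> card C" using full_row_bound[OF v(1)] assms(1) by simp
  then show ?thesis using that v tight by simp
qed

lemma u_one:
  assumes u: "u = 1"
  shows "\<exists>x\<in>carrier Q. generate Q {x} = carrier Q \<and> card ((\<lambda>y. x \<otimes>\<^bsub>Q\<^esub> y) ` A - A) = 1 \<and> card ((\<lambda>y. x \<otimes>\<^bsub>Q\<^esub> y) ` B - B) = 1"
proof -
  obtain a0 a1 where A: "A = {a0, a1}" "a0 \<noteq> a1" "a0 \<in> carrier Q" "a1 \<in> carrier Q"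
    and gen: "generate Q {a1 \<otimes>\<^bsub>Q\<^esub> inv\<^bsub>Q\<^esub> a0} = carrier Q" using A_two[OF u] .
  define x where "x = a1 \<otimes>\<^bsub>Q\<^esub> inv\<^bsub>Q\<^esub> a0"
  have xc: "x \<in> carrier Q" "x \<otimes>\<^bsub>Q\<^esub> a0 = a1" using A by (simp_all add: x_def)
  have x1: "x \<noteq> \<one>\<^bsub>Q\<^esub>" using xc A by auto
  have "a1 \<in> A \<inter> (\<lambda>y. x \<otimes>\<^bsub>Q\<^esub> y) ` A" using A xc by (auto simp: image_iff)
  then have "1 \<le> card (A \<inter> (\<lambda>y. x \<otimes>\<^bsub>Q\<^esub> y) ` A)" using A_props(1) by (simp add: Suc_le_eq card_gt_0_iff) blast
  then have xA: "generate Q {x} = carrier Q" "card ((\<lambda>y. x \<otimes>\<^bsub>Q\<^esub> y) ` A - A) = 1"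
    using A_boundary xc x1 u by auto
  have "C = (\<lambda>y. a0 \<otimes>\<^bsub>Q\<^esub> y) ` (B \<union> (\<lambda>y. x \<otimes>\<^bsub>Q\<^esub> y) ` B)"
  proof -
    have "C = (\<lambda>y. a0 \<otimes>\<^bsub>Q\<^esub> y) ` B \<union> (\<lambda>y. a1 \<otimes>\<^bsub>Q\<^esub> y) ` B" unfolding C_def A(1) by (auto simp: set_mult_def)
    moreover have "(\<lambda>y. a1 \<otimes>\<^bsub>Q\<^esub> y) ` B = (\<lambda>y. a0 \<otimes>\<^bsub>Q\<^esub> y) ` (\<lambda>y. x \<otimes>\<^bsub>Q\<^esub> y) ` B"
      using Q.translate_translate[OF A(3) xc(1) B_props(2)] xc A by (simp add: Q.m_comm)
    ultimately show ?thesis by (simp add: image_Un)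
  qed
  moreover have "B \<union> (\<lambda>y. x \<otimes>\<^bsub>Q\<^esub> y) ` B \<subseteq> carrier Q" using B_props xc by auto
  ultimately have "card (B \<union> (\<lambda>y. x \<otimes>\<^bsub>Q\<^esub> y) ` B) = card B + 1"
    using Q.card_translate[OF A(3)] tight u by simp
  moreover have "card (B \<union> (\<lambda>y. x \<otimes>\<^bsub>Q\<^esub> y) ` B) = card B + card ((\<lambda>y. x \<otimes>\<^bsub>Q\<^esub> y) ` B - B)"
    using card_Un_disjoint[of B "(\<lambda>y. x \<otimes>\<^bsub>Q\<^esub> y) ` B - B"] B_props by simp
  ultimately show ?thesis using xA xc by auto
qed

text \<open>\<open>no_subgroup\<close> excludes the second alternative of
  \<open>small_sumset_dichotomy\<close>, so A is a progression; then |A + B| = |B| + u leaves B a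
  boundary of one point, by \<open>boundary_of_sumset\<close>.\<close>

lemma far_from_Q:
  assumes "infinite (carrier Q) \<or> card C + 2 \<le> card (carrier Q)"
  shows "\<exists>x\<in>carrier Q. generate Q {x} = carrier Q \<and> card ((\<lambda>y. x \<otimes>\<^bsub>Q\<^esub> y) ` A - A) = 1 \<and> card ((\<lambda>y. x \<otimes>\<^bsub>Q\<^esub> y) ` B - B) = 1"
proof -
  have "Q.k_sep2 (generate Q A) A B"
    unfolding Q.k_sep2_def A_gen using B_props B2 assms C_comm by simp
  moreover have "card (B <#>\<^bsub>Q\<^esub> A) + 1 \<le> card B + card A" using tight C_comm A_card by simp
  ultimately have "(\<exists>x\<in>carrier Q. x \<noteq> \<one>\<^bsub>Q\<^esub> \<and> card A \<le> card (A \<inter> (\<lambda>y. x \<otimes>\<^bsub>Q\<^esub> y) ` A) + 1) \<or>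
    (\<exists>L. subgroup L Q \<and> finite L \<and> 2 \<le> card L \<and> \<not> A \<subseteq> L \<and> card (L <#>\<^bsub>Q\<^esub> A) + 1 \<le> card L + card A)"
    using A_props A_card u1 by (intro Q.small_sumset_dichotomy) auto
  moreover have "\<not> (\<exists>L. subgroup L Q \<and> finite L \<and> 2 \<le> card L \<and> \<not> A \<subseteq> L \<and> card (L <#>\<^bsub>Q\<^esub> A) + 1 \<le> card L + card A)"
    using no_subgroup by fastforce
  ultimately obtain x where x: "x \<in> carrier Q" "x \<noteq> \<one>\<^bsub>Q\<^esub>" "u \<le> card (A \<inter> (\<lambda>y. x \<otimes>\<^bsub>Q\<^esub> y) ` A)"
    using A_card by auto
  note xA = A_boundary[OF x]
  obtain q where q: "q \<in> carrier Q" "A = (\<lambda>i::nat. q \<otimes>\<^bsub>Q\<^esub> x [^]\<^bsub>Q\<^esub> i) ` {..<card A}"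
    "inj_on (\<lambda>i::nat. q \<otimes>\<^bsub>Q\<^esub> x [^]\<^bsub>Q\<^esub> i) {..<card A}"
    by (rule Q.progression_of_boundary[OF A_props(1,2) x(1) xA])
  have "{..<card A} = {..u}" using A_card by auto
  then have qA: "A = (\<lambda>i::nat. q \<otimes>\<^bsub>Q\<^esub> x [^]\<^bsub>Q\<^esub> i) ` {..u}" using q(2) by metis
  have "B <#>\<^bsub>Q\<^esub> A \<noteq> carrier Q" using assms C_comm C_props by auto
  then have "card ((\<lambda>y. x \<otimes>\<^bsub>Q\<^esub> y) ` B - B) = 1"
    using tight C_comm by (intro Q.boundary_of_sumset[OF B_props x(1) xA(1) q(1) qA u1]) auto
  then show ?thesis using x xA by blast
qed

text \<open>With c0 the missing element, c0 - A is the complement of B. Hence any c with a single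
  representation gives u elements of A that stay in A when shifted back by c - c0, and B inherits
  its boundary from this reflection of A.\<close>

lemma missing_one:
  assumes fin: "finite (carrier Q)" and cC: "card C + 1 = card (carrier Q)" and u2: "2 \<le> u"
  shows "\<exists>x\<in>carrier Q. generate Q {x} = carrier Q \<and> card ((\<lambda>y. x \<otimes>\<^bsub>Q\<^esub> y) ` A - A) = 1 \<and> card ((\<lambda>y. x \<otimes>\<^bsub>Q\<^esub> y) ` B - B) = 1"
proof -
  have fG: "finite (carrier G)" using fin infinite_Q by blast
  have "card (carrier Q - C) = 1" using cC C_props fin by (simp add: card_Diff_subset)
  then obtain c0 where c0: "carrier Q - C = {c0}" by (metis card_1_singletonE)
  have c0c: "c0 \<in> carrier Q" "c0 \<notin> C" using c0 by auto
  define B' where "B' = (\<lambda>a. c0 \<otimes>\<^bsub>Q\<^esub> inv\<^bsub>Q\<^esub> a) ` A"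
  have B': "B' \<subseteq> carrier Q" "card B' = u + 1"
    using A_props c0c Q.inj_on_mult(3)[OF A_props(2) c0c(1)] A_card by (auto simp: B'_def card_image)
  have "B' \<inter> B = {}"
  proof -
    have False if "a \<in> A" "c0 \<otimes>\<^bsub>Q\<^esub> inv\<^bsub>Q\<^esub> a \<in> B" for a
    proof -
      have "a \<in> carrier Q" using that(1) A_props by blast
      then have "c0 = a \<otimes>\<^bsub>Q\<^esub> (c0 \<otimes>\<^bsub>Q\<^esub> inv\<^bsub>Q\<^esub> a)" using c0c by (simp add: Q.abelian_simps)
      then have "c0 \<in> C" unfolding C_def using that Q.set_multI by metis
      then show False using c0c by simp
    qed
    then show ?thesis unfolding B'_def by blast
  qed
  then have sub: "B' \<subseteq> carrier Q - B" using B' by auto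
  have "card (carrier Q - B) = u + 1" using tight cC B_props fin by (simp add: card_Diff_subset)
  then have B'e: "B' = carrier Q - B" using sub B' fin by (intro card_subset_eq) auto
  show ?thesis
  proof (cases "\<exists>c\<in>C. r c = 1")
    case True
    then obtain c where c: "c \<in> C" "r c = 1" by auto
    have cc: "c \<in> carrier Q" using c C_props by blast
    define x where "x = c \<otimes>\<^bsub>Q\<^esub> inv\<^bsub>Q\<^esub> c0"
    have xc: "x \<in> carrier Q" "x \<otimes>\<^bsub>Q\<^esub> c0 = c" using cc c0c by (simp_all add: x_def)
    have x1: "x \<noteq> \<one>\<^bsub>Q\<^esub>" using xc c c0c by auto
    have "A - {a \<in> A. c \<otimes>\<^bsub>Q\<^esub> inv\<^bsub>Q\<^esub> a \<in> B} \<subseteq> A \<inter> (\<lambda>y. x \<otimes>\<^bsub>Q\<^esub> y) ` A"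
    proof
      fix a assume a: "a \<in> A - {a \<in> A. c \<otimes>\<^bsub>Q\<^esub> inv\<^bsub>Q\<^esub> a \<in> B}"
      have ac: "a \<in> carrier Q" using a A_props by blast
      have "c \<otimes>\<^bsub>Q\<^esub> inv\<^bsub>Q\<^esub> a \<in> B'" unfolding B'e using a ac cc by auto
      then obtain a' where a': "a' \<in> A" "c \<otimes>\<^bsub>Q\<^esub> inv\<^bsub>Q\<^esub> a = c0 \<otimes>\<^bsub>Q\<^esub> inv\<^bsub>Q\<^esub> a'" unfolding B'_def by blast
      have a'c: "a' \<in> carrier Q" using a' A_props by blast
      have "c \<otimes>\<^bsub>Q\<^esub> inv\<^bsub>Q\<^esub> a \<otimes>\<^bsub>Q\<^esub> a \<otimes>\<^bsub>Q\<^esub> a' \<otimes>\<^bsub>Q\<^esub> inv\<^bsub>Q\<^esub> c0 = c0 \<otimes>\<^bsub>Q\<^esub> inv\<^bsub>Q\<^esub> a' \<otimes>\<^bsub>Q\<^esub> a \<otimes>\<^bsub>Q\<^esub> a' \<otimes>\<^bsub>Q\<^esub> inv\<^bsub>Q\<^esub> c0"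
        using a' by simp
      then have "a = x \<otimes>\<^bsub>Q\<^esub> a'" using ac a'c cc c0c unfolding x_def by (simp add: Q.abelian_simps)
      then show "a \<in> A \<inter> (\<lambda>y. x \<otimes>\<^bsub>Q\<^esub> y) ` A" using a a' by blast
    qed
    then have "card (A - {a \<in> A. c \<otimes>\<^bsub>Q\<^esub> inv\<^bsub>Q\<^esub> a \<in> B}) \<le> card (A \<inter> (\<lambda>y. x \<otimes>\<^bsub>Q\<^esub> y) ` A)"
      using A_props by (intro card_mono) auto
    moreover have "card (A - {a \<in> A. c \<otimes>\<^bsub>Q\<^esub> inv\<^bsub>Q\<^esub> a \<in> B}) = u"
      using r_eq[OF cc] c A_card A_props by (simp add: card_Diff_subset)
    ultimately have xA: "generate Q {x} = carrier Q" "card ((\<lambda>y. x \<otimes>\<^bsub>Q\<^esub> y) ` A - A) = 1"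
      using A_boundary[OF xc(1) x1] by auto
    have "card ((\<lambda>y. x \<otimes>\<^bsub>Q\<^esub> y) ` B' - B') = 1"
      unfolding B'_def using Q.boundary_inverse[OF A_props(1,2) xc(1) c0c(1)] xA by simp
    then have "card ((\<lambda>y. x \<otimes>\<^bsub>Q\<^esub> y) ` B - B) = 1"
      unfolding B'e using Q.boundary_complement[OF fin B_props(2) xc(1)] by simp
    then show ?thesis using xA xc by blast
  next
    \<comment> \<open>If every element has two representations, D \<le> g + |P|, while D \<ge> (u -
      1) h + g. This forces h = u = |P| = 2, so S has one full row v and two one-point rows y, z.
      Both exact columns have the same two deficient sums, whence y - z has order two and generates
      a subgroup against \<open>no_subgroup\<close>.\<close>
    case False
    then have r2: "2 \<le> r c" if "c \<in> C" for c using r_pos[OF that] that by (metis One_nat_def Suc_1 Suc_leI le_neq_implies_less)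
    have "D \<le> (\<Sum>c\<in>C. (r c - 1) * d c)"
      unfolding D_def
    proof (rule sum_mono)
      fix c assume "c \<in> C"
      then have "1 * d c \<le> (r c - 1) * d c" using r2[of c] by (intro mult_le_mono1) simp
      then show "d c \<le> (r c - 1) * d c" by simp
    qed
    then have D1: "D \<le> g + card P" using dc_tight by simp
    have D2: "u * h + g \<le> D + h" using D_ge[OF fG] cC[symmetric] by (simp add: algebra_simps)
    have "2 * h \<le> u * h" using u2 by (intro mult_le_mono1)
    have "P \<noteq> {}"
    proof
      assume "P = {}"
      then have "card P = 0" by simp
      then show False using D1 D2 \<open>2 * h \<le> u * h\<close> h2 by linarith
    qed
    then have gm: "g = 0" "\<mu> = 0" using P_ne by auto
    define p where "p = card P"
    have p0: "p \<noteq> 0" using \<open>P \<noteq> {}\<close> B_props by (simp add: p_def P_def)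
    have pD0: "p * (h - 1) \<le> D" using exact_ge[OF \<open>P \<noteq> {}\<close>] unfolding p_def .
    have D1': "D \<le> p" using D1 gm unfolding p_def by linarith
    have pD: "p * (h - 1) \<le> p" using pD0 D1' by linarith
    then have h2e: "h = 2" using p0 h2 by (cases "h - 1") auto
    have Dp: "D = p" using pD0 D1' unfolding h2e by simp
    obtain v where v: "v \<in> A" "s v = 2" "D \<le> u" using h2_full_row[OF h2e \<open>P \<noteq> {}\<close> u2] .
    have u2e: "u = 2" "p = 2" using v(3) Dp D2 h2e gm u2 by simp_all
    have "card (A - {v}) = 2" using A_card u2e v A_props by simp
    then obtain y z where yz: "A - {v} = {y, z}" "y \<noteq> z" by (auto simp: card_2_iff)
    have Ae: "A = {v, y, z}" "v \<noteq> y" "v \<noteq> z" using yz v by auto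
    have Ac: "v \<in> carrier Q" "y \<in> carrier Q" "z \<in> carrier Q" using Ae A_props(2) by auto
    have yzA: "y \<in> A" "z \<in> A" using Ae by auto
    have "(\<Sum>a\<in>A. s a) = s v + s y + s z" unfolding Ae(1) using Ae yz by simp
    then have s1: "s y = 1" "s z = 1" using sum_s gm u2e h2e v s_pos[OF yzA(1)] s_pos[OF yzA(2)] by simp_all
    define E where "E = {c \<in> C. 1 \<le> d c}"
    have "card E \<le> D"
    proof -
      have "card E = (\<Sum>c\<in>E. 1)" by simp
      also have "\<dots> \<le> (\<Sum>c\<in>E. d c)" by (intro sum_mono) (simp add: E_def)
      also have "\<dots> \<le> D" unfolding D_def using C_props by (intro sum_mono2) (auto simp: E_def)
      finally show ?thesis .
    qed
    then have E2: "card E \<le> 2" using Dp u2e by simp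
    have Epair: "E = {y \<otimes>\<^bsub>Q\<^esub> i, z \<otimes>\<^bsub>Q\<^esub> i}" if i: "i \<in> P" for i
    proof -
      have ib: "i \<in> B" "exact i" using i by (auto simp: P_def)
      have ic: "i \<in> carrier Q" using ib B_props by blast
      have \<sigma>: "\<sigma> (y \<otimes>\<^bsub>Q\<^esub> i) = 1" "\<sigma> (z \<otimes>\<^bsub>Q\<^esub> i) = 1" using ib yzA s1 unfolding exact_def by auto
      have inC: "y \<otimes>\<^bsub>Q\<^esub> i \<in> C" "z \<otimes>\<^bsub>Q\<^esub> i \<in> C" unfolding C_def using ib yzA by (auto intro: Q.set_multI)
      have "{y \<otimes>\<^bsub>Q\<^esub> i, z \<otimes>\<^bsub>Q\<^esub> i} \<subseteq> E" using \<sigma> inC h2 by (auto simp: E_def d_def)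
      moreover have "card {y \<otimes>\<^bsub>Q\<^esub> i, z \<otimes>\<^bsub>Q\<^esub> i} = 2" using yz(2) Ac ic by simp
      moreover have "finite E" using C_props by (simp add: E_def)
      ultimately show ?thesis using E2 by (metis card_seteq)
    qed
    obtain i j where ij: "P = {i, j}" "i \<noteq> j" using u2e by (auto simp: p_def card_2_iff)
    have ijc: "i \<in> carrier Q" "j \<in> carrier Q" using ij(1) B_props(2) unfolding P_def by blast+
    have "{y \<otimes>\<^bsub>Q\<^esub> i, z \<otimes>\<^bsub>Q\<^esub> i} = {y \<otimes>\<^bsub>Q\<^esub> j, z \<otimes>\<^bsub>Q\<^esub> j}" using Epair[of i] Epair[of j] ij(1) by auto
    moreover have "y \<otimes>\<^bsub>Q\<^esub> i \<noteq> y \<otimes>\<^bsub>Q\<^esub> j" using ij ijc Ac by simp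
    ultimately have e1: "y \<otimes>\<^bsub>Q\<^esub> i = z \<otimes>\<^bsub>Q\<^esub> j" "z \<otimes>\<^bsub>Q\<^esub> i = y \<otimes>\<^bsub>Q\<^esub> j" by (auto simp: doubleton_eq_iff)
    define w where "w = y \<otimes>\<^bsub>Q\<^esub> inv\<^bsub>Q\<^esub> z"
    have wc: "w \<in> carrier Q" "w \<otimes>\<^bsub>Q\<^esub> z = y" using Ac by (simp_all add: w_def)
    have wy: "w \<otimes>\<^bsub>Q\<^esub> y = z"
    proof -
      have "w \<otimes>\<^bsub>Q\<^esub> y \<otimes>\<^bsub>Q\<^esub> j = w \<otimes>\<^bsub>Q\<^esub> (z \<otimes>\<^bsub>Q\<^esub> i)" using e1 wc Ac ijc by (simp add: Q.m_assoc)
      also have "\<dots> = (w \<otimes>\<^bsub>Q\<^esub> z) \<otimes>\<^bsub>Q\<^esub> i" using wc(1) Ac ijc by (simp add: Q.m_assoc)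
      also have "\<dots> = z \<otimes>\<^bsub>Q\<^esub> j" unfolding wc(2) using e1 by simp
      finally show ?thesis using wc(1) Ac ijc by simp
    qed
    have w2: "w \<otimes>\<^bsub>Q\<^esub> w = \<one>\<^bsub>Q\<^esub>"
    proof -
      have "(w \<otimes>\<^bsub>Q\<^esub> w) \<otimes>\<^bsub>Q\<^esub> z = z" using wy wc Ac Q.m_assoc[of w w z] by simp
      then show ?thesis using wc(1) Ac by simp
    qed
    have w1: "w \<noteq> \<one>\<^bsub>Q\<^esub>" using wc yz(2) Ac by auto
    define L where "L = {\<one>\<^bsub>Q\<^esub>, w}"
    have sgL: "subgroup L Q"
    proof (rule Q.subgroupI)
      fix x assume "x \<in> L"
      then show "inv\<^bsub>Q\<^esub> x \<in> L" using Q.inv_equality[OF w2 wc(1) wc(1)] by (auto simp: L_def)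
    qed (use wc(1) w2 in \<open>auto simp: L_def\<close>)
    have cL: "card L = 2" "finite L" using w1 by (auto simp: L_def)
    have "\<not> A \<subseteq> L" using card_mono[OF cL(2), of A] cL A_card u2e by auto
    then have "card L + card A \<le> card (L <#>\<^bsub>Q\<^esub> A)" using no_subgroup[OF sgL cL(2)] cL by simp
    moreover have "L <#>\<^bsub>Q\<^esub> A \<subseteq> {v, w \<otimes>\<^bsub>Q\<^esub> v, y, z}"
      unfolding L_def Ae(1) using Ac wc wy by (auto simp: set_mult_def)
    then have "card (L <#>\<^bsub>Q\<^esub> A) \<le> card {v, w \<otimes>\<^bsub>Q\<^esub> v, y, z}" by (intro card_mono) auto
    moreover have "card {v, w \<otimes>\<^bsub>Q\<^esub> v, y, z} \<le> 4" by (simp add: card_insert_if)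
    ultimately show ?thesis using cL A_card u2e by simp
  qed
qed

text \<open>The complement of B has u elements, and if c has a single representation, c minus this
  complement lies in A. Two such elements c, c' give u elements of A whose translates by c' - c lie
  again in A. With at most one such element the weighted bound contradicts D \<ge> u h + g.\<close>

lemma missing_none:
  assumes fin: "finite (carrier Q)" and cC: "C = carrier Q" and u2: "2 \<le> u"
  shows "\<exists>x\<in>carrier Q. generate Q {x} = carrier Q \<and> card ((\<lambda>y. x \<otimes>\<^bsub>Q\<^esub> y) ` A - A) = 1 \<and> card ((\<lambda>y. x \<otimes>\<^bsub>Q\<^esub> y) ` B - B) = 1"
proof -
  have fG: "finite (carrier G)" using fin infinite_Q by blast
  define B' where "B' = carrier Q - B"
  have B': "B' \<subseteq> carrier Q" "finite B'" using fin by (auto simp: B'_def)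
  have cB': "card B' = u" unfolding B'_def using tight cC B_props fin by (simp add: card_Diff_subset)
  define C1 where "C1 = {c \<in> C. r c = 1}"
  have C1in: "b \<in> B' \<Longrightarrow> c \<otimes>\<^bsub>Q\<^esub> inv\<^bsub>Q\<^esub> b \<in> A" if c: "c \<in> C1" for c b
  proof -
    assume b: "b \<in> B'"
    have cc: "c \<in> carrier Q" using c C_props by (auto simp: C1_def)
    define A' where "A' = A - {a \<in> A. c \<otimes>\<^bsub>Q\<^esub> inv\<^bsub>Q\<^esub> a \<in> B}"
    have "card A' = u" using r_eq[OF cc] c A_card A_props by (simp add: A'_def C1_def card_Diff_subset)
    moreover have "inj_on (\<lambda>a. c \<otimes>\<^bsub>Q\<^esub> inv\<^bsub>Q\<^esub> a) A'" using A_props cc by (intro Q.inj_on_mult) (auto simp: A'_def)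
    ultimately have "card ((\<lambda>a. c \<otimes>\<^bsub>Q\<^esub> inv\<^bsub>Q\<^esub> a) ` A') = card B'" using cB' by (simp add: card_image)
    moreover have "(\<lambda>a. c \<otimes>\<^bsub>Q\<^esub> inv\<^bsub>Q\<^esub> a) ` A' \<subseteq> B'"
    proof
      fix w assume "w \<in> (\<lambda>a. c \<otimes>\<^bsub>Q\<^esub> inv\<^bsub>Q\<^esub> a) ` A'"
      then obtain a where a: "a \<in> A'" "w = c \<otimes>\<^bsub>Q\<^esub> inv\<^bsub>Q\<^esub> a" by blast
      then have "a \<in> carrier Q" using A_props unfolding A'_def by blast
      then show "w \<in> B'" using a cc by (auto simp: A'_def B'_def)
    qed
    ultimately have "(\<lambda>a. c \<otimes>\<^bsub>Q\<^esub> inv\<^bsub>Q\<^esub> a) ` A' = B'" using B' by (intro card_subset_eq)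
    then obtain a where a: "a \<in> A'" "b = c \<otimes>\<^bsub>Q\<^esub> inv\<^bsub>Q\<^esub> a" using b by blast
    have aA: "a \<in> A" using a by (simp add: A'_def)
    have "a \<in> carrier Q" using aA A_props by blast
    then have "c \<otimes>\<^bsub>Q\<^esub> inv\<^bsub>Q\<^esub> b = a" using a cc by (simp add: Q.abelian_simps)
    then show "c \<otimes>\<^bsub>Q\<^esub> inv\<^bsub>Q\<^esub> b \<in> A" using aA by simp
  qed
  show ?thesis
  proof (cases "\<exists>c\<in>C1. \<exists>c'\<in>C1. c \<noteq> c'")
    case True
    then obtain c c' where c: "c \<in> C1" "c' \<in> C1" "c \<noteq> c'" by blast
    have cc: "c \<in> carrier Q" "c' \<in> carrier Q" using c C_props by (auto simp: C1_def)
    define x where "x = c' \<otimes>\<^bsub>Q\<^esub> inv\<^bsub>Q\<^esub> c"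
    have xc: "x \<in> carrier Q" "x \<otimes>\<^bsub>Q\<^esub> c = c'" using cc by (simp_all add: x_def)
    have x1: "x \<noteq> \<one>\<^bsub>Q\<^esub>" using xc c cc by auto
    define D0 where "D0 = (\<lambda>b. c \<otimes>\<^bsub>Q\<^esub> inv\<^bsub>Q\<^esub> b) ` B'"
    have D0A: "D0 \<subseteq> A" unfolding D0_def using C1in[OF c(1)] by blast
    have xD0A: "(\<lambda>y. x \<otimes>\<^bsub>Q\<^esub> y) ` D0 \<subseteq> A"
    proof
      fix w assume "w \<in> (\<lambda>y. x \<otimes>\<^bsub>Q\<^esub> y) ` D0"
      then obtain b where b: "b \<in> B'" "w = x \<otimes>\<^bsub>Q\<^esub> (c \<otimes>\<^bsub>Q\<^esub> inv\<^bsub>Q\<^esub> b)" by (auto simp: D0_def)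
      have "b \<in> carrier Q" using b B' by auto
      then have "w = c' \<otimes>\<^bsub>Q\<^esub> inv\<^bsub>Q\<^esub> b" using b xc cc Q.m_assoc[of x c "inv\<^bsub>Q\<^esub> b"] by simp
      then show "w \<in> A" using C1in[OF c(2)] b by simp
    qed
    have cD0: "card D0 = u" "D0 \<subseteq> carrier Q" "finite D0"
    proof -
      show "card D0 = u" unfolding D0_def using Q.inj_on_mult(3)[OF B'(1) cc(1)] cB' by (simp add: card_image)
      show "D0 \<subseteq> carrier Q" "finite D0" using D0A A_props finite_subset by blast+
    qed
    have cxD0: "card ((\<lambda>y. x \<otimes>\<^bsub>Q\<^esub> y) ` D0) = u" using Q.card_translate[OF xc(1) cD0(2)] cD0 by simp
    have "(\<lambda>y. x \<otimes>\<^bsub>Q\<^esub> y) ` D0 \<subseteq> A \<inter> (\<lambda>y. x \<otimes>\<^bsub>Q\<^esub> y) ` A" using xD0A D0A by blast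
    then have "u \<le> card (A \<inter> (\<lambda>y. x \<otimes>\<^bsub>Q\<^esub> y) ` A)"
      using card_mono[of "A \<inter> (\<lambda>y. x \<otimes>\<^bsub>Q\<^esub> y) ` A" "(\<lambda>y. x \<otimes>\<^bsub>Q\<^esub> y) ` D0"] cxD0 A_props by simp
    note xA = A_boundary[OF xc(1) x1 this]
    have "(\<lambda>y. x \<otimes>\<^bsub>Q\<^esub> y) ` D0 - D0 \<subseteq> A - D0" using xD0A by blast
    then have "card ((\<lambda>y. x \<otimes>\<^bsub>Q\<^esub> y) ` D0 - D0) \<le> card (A - D0)" using A_props by (intro card_mono) auto
    also have "card (A - D0) = 1" using D0A A_card cD0 by (simp add: card_Diff_subset)
    finally have le: "card ((\<lambda>y. x \<otimes>\<^bsub>Q\<^esub> y) ` D0 - D0) \<le> 1" .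
    have "D0 \<noteq> {}" using cD0 u1 by auto
    moreover have "D0 \<noteq> carrier Q" using D0A A_ne A_props by blast
    ultimately have "(\<lambda>y. x \<otimes>\<^bsub>Q\<^esub> y) ` D0 - D0 \<noteq> {}"
      using cD0 xc xA by (intro Q.translate_not_subset) auto
    then have "card ((\<lambda>y. x \<otimes>\<^bsub>Q\<^esub> y) ` D0 - D0) \<noteq> 0" using cD0 by simp
    then have D01: "card ((\<lambda>y. x \<otimes>\<^bsub>Q\<^esub> y) ` D0 - D0) = 1" using le by simp
    have "card ((\<lambda>y. x \<otimes>\<^bsub>Q\<^esub> y) ` B' - B') = 1"
      using Q.boundary_inverse[OF B'(2,1) xc(1) cc(1)] D01 by (simp add: D0_def)
    then have "card ((\<lambda>y. x \<otimes>\<^bsub>Q\<^esub> y) ` B - B) = 1"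
      unfolding B'_def using Q.boundary_complement[OF fin B_props(2) xc(1)] by simp
    then show ?thesis using xA xc by blast
  next
    case False
    have sumC1: "(\<Sum>c\<in>C1. d c) \<le> h - 1"
    proof (cases "C1 = {}")
      case C1: False
      then obtain c where c: "C1 = {c}" using False by blast
      then have "c \<in> C" by (auto simp: C1_def)
      then obtain a b where ab: "a \<in> A" "b \<in> B" "c = a \<otimes>\<^bsub>Q\<^esub> b" by (auto simp: C_def Q.set_mult_iff)
      then have "d c \<le> h - 1" using d_le_row[of a b] s_pos[of a] by simp
      then show ?thesis using c by simp
    qed simp
    have "D = (\<Sum>c\<in>C1. d c) + (\<Sum>c\<in>C - C1. d c)"
      unfolding D_def using C_props by (metis (no_types, lifting) C1_def add.commute mem_Collect_eq subsetI sum.subset_diff)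
    moreover have "(\<Sum>c\<in>C - C1. d c) \<le> (\<Sum>c\<in>C - C1. (r c - 1) * d c)"
    proof (rule sum_mono)
      fix c assume "c \<in> C - C1"
      then have "1 \<le> r c" "r c \<noteq> 1" using r_pos[of c] by (auto simp: C1_def)
      then have "2 \<le> r c" by linarith
      then have "1 * d c \<le> (r c - 1) * d c" by (intro mult_le_mono1) simp
      then show "d c \<le> (r c - 1) * d c" by simp
    qed
    moreover have "(\<Sum>c\<in>C - C1. (r c - 1) * d c) \<le> (\<Sum>c\<in>C. (r c - 1) * d c)"
      using C_props by (intro sum_mono2) auto
    ultimately have D1: "D \<le> g + card P + (h - 1)" using sumC1 dc_tight by linarith
    have D2: "u * h + g \<le> D" using D_ge[OF fG] cC by simp
    have "2 * h \<le> u * h" using u2 by (intro mult_le_mono1)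
    have "P \<noteq> {}"
    proof
      assume "P = {}"
      then have "card P = 0" by simp
      then show False using D1 D2 \<open>2 * h \<le> u * h\<close> h2 by linarith
    qed
    then have gm: "g = 0" "\<mu> = 0" using P_ne by auto
    define p where "p = card P"
    have pD: "p * (h - 1) \<le> D" using exact_ge[OF \<open>P \<noteq> {}\<close>] by (simp add: p_def)
    have D1': "D \<le> p + (h - 1)" using D1 gm unfolding p_def by linarith
    have p_ge: "h + 1 \<le> p" using D1' D2 \<open>2 * h \<le> u * h\<close> h2 by linarith
    have h2e: "h = 2"
    proof (rule ccontr)
      assume "h \<noteq> 2"
      then obtain h' where h': "h = h' + 3" using h2 by (metis add.commute le_Suc_ex le_antisym not_less_eq_eq numeral_2_eq_2 numeral_3_eq_3)
      have "p * (h' + 2) \<le> p + (h' + 2)" using pD D1' unfolding h' by simp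
      then have "p * (h' + 1) \<le> h' + 2" by (simp add: distrib_left)
      moreover have "4 * (h' + 1) \<le> p * (h' + 1)" using p_ge h' by (intro mult_le_mono1) simp
      ultimately show False by simp
    qed
    obtain v where v: "D \<le> u" using h2_full_row[OF h2e \<open>P \<noteq> {}\<close> u2] by blast
    then show ?thesis using D2 h2e u1 by simp
  qed
qed

theorem same_difference:
  "\<exists>x\<in>carrier Q. generate Q {x} = carrier Q \<and> card ((\<lambda>y. x \<otimes>\<^bsub>Q\<^esub> y) ` A - A) = 1 \<and> card ((\<lambda>y. x \<otimes>\<^bsub>Q\<^esub> y) ` B - B) = 1"
proof (cases "infinite (carrier Q) \<or> card C + 2 \<le> card (carrier Q)")
  case True then show ?thesis by (rule far_from_Q)
next
  case False
  then have fin: "finite (carrier Q)" and lt: "card (carrier Q) < card C + 2" by auto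
  have le: "card C \<le> card (carrier Q)" using fin C_props by (intro card_mono)
  show ?thesis
  proof (cases "u = 1")
    case True then show ?thesis by (rule u_one)
  next
    case False
    then have u2: "2 \<le> u" using u1 by simp
    show ?thesis
    proof (cases "card C = card (carrier Q)")
      case True
      then have "C = carrier Q" using fin C_props by (intro card_subset_eq)
      then show ?thesis using missing_none fin u2 by simp
    next
      case False
      then have "card C + 1 = card (carrier Q)" using le lt by simp
      then show ?thesis using missing_one fin u2 by simp
    qed
  qed
qed

end

section \<open>Layers of S + T along the progressions\<close>

text \<open>The path follows row 0 up to column i0, traverses that column, and continues along row
  u, whence the shift \<open>i + u\<close> in the last sum.\<close>

lemma sum_path:
  fixes f :: "nat \<Rightarrow> nat"
  assumes "i0 \<le> w"
  shows "(\<Sum>k\<le>u + w. f k) = (\<Sum>k<i0. f k) + (\<Sum>j\<le>u. f (i0 + j)) + (\<Sum>i\<in>{i0<..w}. f (i + u))"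
proof -
  have e: "{..u + w} = {..<i0} \<union> {i0..i0 + u} \<union> {i0 + u<..u + w}" using assms by auto
  have "(\<Sum>k\<le>u + w. f k) = (\<Sum>k<i0. f k) + (\<Sum>k\<in>{i0..i0 + u}. f k) + (\<Sum>k\<in>{i0 + u<..u + w}. f k)"
    unfolding e by (subst sum.union_disjoint; (simp | auto)?)+
  moreover have "(\<Sum>k\<in>{i0..i0 + u}. f k) = (\<Sum>j\<le>u. f (i0 + j))"
    by (rule sum.reindex_bij_witness[of _ "\<lambda>j. i0 + j" "\<lambda>k. k - i0"]) auto
  moreover have "(\<Sum>k\<in>{i0 + u<..u + w}. f k) = (\<Sum>i\<in>{i0<..w}. f (i + u))"
    by (rule sum.reindex_bij_witness[of _ "\<lambda>i. i + u" "\<lambda>k. k - u"]) auto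
  ultimately show ?thesis by simp
qed

locale progression_pair = critical_pair +
  fixes x a0 b0 and w :: nat
  assumes xab: "x \<in> carrier Q" "a0 \<in> carrier Q" "b0 \<in> carrier Q" and w1: "1 \<le> w"
    and A_prog: "A = (\<lambda>j. a0 \<otimes>\<^bsub>Q\<^esub> x [^]\<^bsub>Q\<^esub> j) ` {..u}"
    and B_prog: "B = (\<lambda>i. b0 \<otimes>\<^bsub>Q\<^esub> x [^]\<^bsub>Q\<^esub> i) ` {..w}" and B_card: "card B = w + 1"
    and C_card: "card C = u + w + 1"
begin

definition "aj j = a0 \<otimes>\<^bsub>Q\<^esub> x [^]\<^bsub>Q\<^esub> (j::nat)"
definition "bi i = b0 \<otimes>\<^bsub>Q\<^esub> x [^]\<^bsub>Q\<^esub> (i::nat)"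
definition "ck k = (a0 \<otimes>\<^bsub>Q\<^esub> b0) \<otimes>\<^bsub>Q\<^esub> x [^]\<^bsub>Q\<^esub> (k::nat)"
definition "sj j = s (aj j)"
definition "ti i = t (bi i)"
definition "sk k = \<sigma> (ck k)"
definition "mm j i = m (aj j) (bi i)"

lemma closed [simp]: "aj j \<in> carrier Q" "bi i \<in> carrier Q" "ck k \<in> carrier Q"
  using xab by (auto simp: aj_def bi_def ck_def)

lemma A_img: "A = aj ` {..u}" and B_img: "B = bi ` {..w}"
  using A_prog B_prog by (auto simp: aj_def bi_def)

lemma mem [simp]: "j \<le> u \<Longrightarrow> aj j \<in> A" "i \<le> w \<Longrightarrow> bi i \<in> B"
  unfolding A_img B_img by auto

lemma ab: "aj j \<otimes>\<^bsub>Q\<^esub> bi i = ck (i + j)"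
proof -
  have "x [^]\<^bsub>Q\<^esub> j \<otimes>\<^bsub>Q\<^esub> x [^]\<^bsub>Q\<^esub> i = x [^]\<^bsub>Q\<^esub> (i + j)" using xab Q.nat_pow_mult[of x j i] by (simp add: add.commute)
  moreover have "aj j \<otimes>\<^bsub>Q\<^esub> bi i = (a0 \<otimes>\<^bsub>Q\<^esub> b0) \<otimes>\<^bsub>Q\<^esub> (x [^]\<^bsub>Q\<^esub> j \<otimes>\<^bsub>Q\<^esub> x [^]\<^bsub>Q\<^esub> i)"
    using xab by (simp add: aj_def bi_def Q.m_ac)
  ultimately show ?thesis by (simp add: ck_def)
qed

lemma inj_a: "inj_on aj {..u}" and inj_b: "inj_on bi {..w}"
  using A_card B_card unfolding A_img B_img by (auto intro!: eq_card_imp_inj_on)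

lemma C_img: "C = ck ` {..u + w}"
proof (intro equalityI subsetI)
  fix c assume "c \<in> C"
  then obtain a b where "a \<in> A" "b \<in> B" "c = a \<otimes>\<^bsub>Q\<^esub> b" by (auto simp: C_def Q.set_mult_iff)
  then obtain j i where "j \<le> u" "i \<le> w" "c = aj j \<otimes>\<^bsub>Q\<^esub> bi i" unfolding A_img B_img by auto
  then show "c \<in> ck ` {..u + w}" using ab by auto
next
  fix c assume "c \<in> ck ` {..u + w}"
  then obtain k where k: "k \<le> u + w" "c = ck k" by auto
  define j where "j = min u k"
  have j: "j \<le> u" "k - j \<le> w" "(k - j) + j = k" using k by (auto simp: j_def)
  then have "aj j \<otimes>\<^bsub>Q\<^esub> bi (k - j) = c" using ab k by simp
  then show "c \<in> C" unfolding C_def using j mem Q.set_multI by metis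
qed

lemma inj_c: "inj_on ck {..u + w}"
  using C_card unfolding C_img by (intro eq_card_imp_inj_on) auto

lemma sum_sj: "(\<Sum>j\<le>u. sj j) = u * h + g + \<mu>"
  using sum_s sum.reindex[OF inj_a, of s] unfolding A_img[symmetric] by (simp add: sj_def o_def)

lemma sum_ti: "(\<Sum>i\<le>w. ti i) = card T"
  using sum_t sum.reindex[OF inj_b, of t] unfolding B_img[symmetric] by (simp add: ti_def o_def)

lemma sum_sk: "(\<Sum>k\<le>u + w. sk k) = card T + u * h + g"
  using sum_\<sigma> sum.reindex[OF inj_c, of \<sigma>] unfolding C_img[symmetric] by (simp add: sk_def o_def)

lemma sum_mm: "i \<le> w \<Longrightarrow> 2 \<le> ti i \<or> 1 \<le> g + \<mu> \<Longrightarrow> u * h + ti i \<le> (\<Sum>j\<le>u. mm j i)"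
  using sum_m_ge[of "bi i"] sum.reindex[OF inj_a, of "\<lambda>a. m a (bi i)"] unfolding A_img[symmetric]
  by (simp add: ti_def mm_def o_def)

lemma basic:
  "sj j \<le> h" "ti i \<le> h" "sk k \<le> h" "j \<le> u \<Longrightarrow> 1 \<le> sj j" "i \<le> w \<Longrightarrow> 1 \<le> ti i"
  "mm j i \<le> sk (i + j)" "i \<le> w \<Longrightarrow> sj j \<le> mm j i" "j \<le> u \<Longrightarrow> ti i \<le> mm j i"
  "i \<le> w \<Longrightarrow> sj j \<le> sk (i + j)" "j \<le> u \<Longrightarrow> ti i \<le> sk (i + j)"
  using s_le t_le \<sigma>_le s_pos[of "aj j"] t_pos[of "bi i"] m_le_\<sigma>[of "aj j" "bi i"]
    s_le_m[of "bi i" "aj j"] t_le_m[of "aj j" "bi i"] s_le_\<sigma>[of "bi i" "aj j"] t_le_\<sigma>[of "aj j" "bi i"]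
  by (auto simp: sj_def ti_def sk_def mm_def ab)

lemma full: "j \<le> u \<Longrightarrow> i \<le> w \<Longrightarrow> h < sj j + ti i \<Longrightarrow> sk (i + j) = h"
  using \<sigma>_full[of "aj j" "bi i"] by (simp add: sj_def ti_def sk_def ab)

lemma not_full_le: "j \<le> u \<Longrightarrow> i \<le> w \<Longrightarrow> sk (i + j) < h \<Longrightarrow> sj j + ti i \<le> h"
  using full by (metis nat_less_le not_le)

text \<open>The other u - 1 rows have at most \<open>h\<close> elements each.\<close>

lemma pair_eq:
  assumes "j \<le> u" "j' \<le> u" "j \<noteq> j'"
  shows "h + g + \<mu> \<le> sj j + sj j'"
    and "sj j + sj j' \<le> h + g + \<mu> \<Longrightarrow> j'' \<le> u \<Longrightarrow> j'' \<noteq> j \<Longrightarrow> j'' \<noteq> j' \<Longrightarrow> sj j'' = h"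
proof -
  define R where "R = {..u} - {j} - {j'}"
  have "(\<Sum>j\<le>u. sj j) = sj j + (sj j' + (\<Sum>j\<in>R. sj j))"
    unfolding R_def using assms by (simp add: sum.remove[of _ j] sum.remove[of _ j'])
  moreover have cR: "card R + 1 = u" "finite R" using assms by (auto simp: R_def)
  moreover have "(\<Sum>j\<in>R. sj j) \<le> card R * h" using sum_bounded_above[of R sj h] basic by simp
  moreover have "card R * h + h = u * h" using cR by (metis add.commute mult_Suc Suc_eq_plus1)
  ultimately show le: "h + g + \<mu> \<le> sj j + sj j'" using sum_sj by linarith
  show "sj j'' = h" if "sj j + sj j' \<le> h + g + \<mu>" "j'' \<le> u" "j'' \<noteq> j" "j'' \<noteq> j'"
  proof (rule ccontr)
    assume "sj j'' \<noteq> h"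
    then have "sj j'' < h" using basic(1)[of j''] by simp
    then have "(\<Sum>j\<in>R. sj j) < (\<Sum>j\<in>R. h)"
      using cR basic that by (intro sum_strict_mono_ex1) (auto simp: R_def)
    then show False using \<open>(\<Sum>j\<le>u. sj j) = _\<close> sum_sj \<open>card R * h + h = u * h\<close> that(1) by simp
  qed
qed

text \<open>Along the path of \<open>sum_path\<close> every fibre of T except that at i0 is paired
  with a layer at least as large. The identity records the total slack; its use is that the middle
  sum nearly exhausts the right-hand side.\<close>

lemma column_path:
  assumes "i0 \<le> w"
  shows "(\<Sum>i<i0. sk i - ti i) + (\<Sum>j\<le>u. sk (i0 + j)) + (\<Sum>i\<in>{i0<..w}. sk (i + u) - ti i) = u * h + g + ti i0"
proof -
  have "(\<Sum>i\<le>w. ti i) = (\<Sum>i<i0. ti i) + ti i0 + (\<Sum>i\<in>{i0<..w}. ti i)"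
    using sum_path[OF assms, of ti 0] by simp
  moreover have "(\<Sum>i<i0. sk i - ti i) + (\<Sum>i<i0. ti i) = (\<Sum>i<i0. sk i)"
    unfolding sum.distrib[symmetric] using basic(10)[of 0] by (intro sum.cong) auto
  moreover have "(\<Sum>i\<in>{i0<..w}. sk (i + u) - ti i) + (\<Sum>i\<in>{i0<..w}. ti i) = (\<Sum>i\<in>{i0<..w}. sk (i + u))"
    unfolding sum.distrib[symmetric] using basic(10)[of u] by (intro sum.cong) auto
  ultimately show ?thesis using sum_path[OF assms, of sk u] sum_sk sum_ti by linarith
qed

lemma column_ge:
  assumes "i0 \<le> w"
  shows "u * h + g + \<mu> \<le> (\<Sum>j\<le>u. sk (i0 + j))"
    and "2 \<le> ti i0 \<or> 1 \<le> g + \<mu> \<Longrightarrow> u * h + ti i0 \<le> (\<Sum>j\<le>u. sk (i0 + j))"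
proof -
  have "(\<Sum>j\<le>u. sj j) \<le> (\<Sum>j\<le>u. sk (i0 + j))" using basic(9) assms by (intro sum_mono) auto
  then show "u * h + g + \<mu> \<le> (\<Sum>j\<le>u. sk (i0 + j))" using sum_sj by simp
  have "(\<Sum>j\<le>u. mm j i0) \<le> (\<Sum>j\<le>u. sk (i0 + j))" using basic(6) by (intro sum_mono) auto
  then show "2 \<le> ti i0 \<or> 1 \<le> g + \<mu> \<Longrightarrow> u * h + ti i0 \<le> (\<Sum>j\<le>u. sk (i0 + j))"
    using sum_mm[OF assms] by simp
qed

lemma row_path:
  assumes "j0 \<le> u"
  shows "(\<Sum>i\<le>w. sk (j0 + i)) + \<mu> \<le> card T + sj j0"
proof -
  have "(\<Sum>k\<le>u + w. sk k) = (\<Sum>k<j0. sk k) + (\<Sum>i\<le>w. sk (j0 + i)) + (\<Sum>j\<in>{j0<..u}. sk (j + w))"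
    using sum_path[OF assms, of sk w] by (simp add: add.commute)
  moreover have "(\<Sum>j<j0. sj j) \<le> (\<Sum>k<j0. sk k)" using basic(9)[of 0] by (intro sum_mono) auto
  moreover have "(\<Sum>j\<in>{j0<..u}. sj j) \<le> (\<Sum>j\<in>{j0<..u}. sk (j + w))"
    using basic(9)[of w] by (intro sum_mono) (auto simp: add.commute)
  moreover have "(\<Sum>j\<le>u. sj j) = (\<Sum>j<j0. sj j) + sj j0 + (\<Sum>j\<in>{j0<..u}. sj j)"
    using sum_path[OF assms, of sj 0] by simp
  ultimately show ?thesis using sum_sj sum_sk by linarith
qed

lemma row_excess:
  assumes "j0 \<le> u"
  shows "(\<Sum>i\<le>w. sk (j0 + i) - ti i) + \<mu> \<le> sj j0"
proof -
  have "(\<Sum>i\<le>w. sk (j0 + i) - ti i) + (\<Sum>i\<le>w. ti i) = (\<Sum>i\<le>w. sk (j0 + i))"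
    unfolding sum.distrib[symmetric] using basic(10)[OF assms] by (intro sum.cong) (auto simp: add.commute)
  then show ?thesis using row_path[OF assms] sum_ti by linarith
qed

text \<open>Both progressions read backwards are again data of this kind, so every statement about
  one end yields the one about the other. S and T are not exchanged.\<close>

lemma reversed: "progression_pair G Q \<phi> S T h u g \<mu> (inv\<^bsub>Q\<^esub> x) (aj u) (bi w) w"
proof -
  have p: "y \<otimes>\<^bsub>Q\<^esub> x [^]\<^bsub>Q\<^esub> k \<otimes>\<^bsub>Q\<^esub> (inv\<^bsub>Q\<^esub> x) [^]\<^bsub>Q\<^esub> j = y \<otimes>\<^bsub>Q\<^esub> x [^]\<^bsub>Q\<^esub> (k - j)" if "j \<le> k" "y \<in> carrier Q" for j k :: nat and y
  proof -
    have "x [^]\<^bsub>Q\<^esub> k = x [^]\<^bsub>Q\<^esub> (k - j) \<otimes>\<^bsub>Q\<^esub> x [^]\<^bsub>Q\<^esub> j" using xab that by (simp add: Q.nat_pow_mult)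
    then show ?thesis using that xab by (simp add: Q.nat_pow_inv Q.m_assoc)
  qed
  have img: "(\<lambda>j. y \<otimes>\<^bsub>Q\<^esub> x [^]\<^bsub>Q\<^esub> k \<otimes>\<^bsub>Q\<^esub> (inv\<^bsub>Q\<^esub> x) [^]\<^bsub>Q\<^esub> j) ` {..k} = (\<lambda>j. y \<otimes>\<^bsub>Q\<^esub> x [^]\<^bsub>Q\<^esub> j) ` {..k}" if "y \<in> carrier Q" for y and k :: nat
  proof -
    have "(\<lambda>j. y \<otimes>\<^bsub>Q\<^esub> x [^]\<^bsub>Q\<^esub> k \<otimes>\<^bsub>Q\<^esub> (inv\<^bsub>Q\<^esub> x) [^]\<^bsub>Q\<^esub> j) ` {..k} = (\<lambda>j. y \<otimes>\<^bsub>Q\<^esub> x [^]\<^bsub>Q\<^esub> (k - j)) ` {..k}"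
      using p that by (intro image_cong) auto
    also have "\<dots> = (\<lambda>j. y \<otimes>\<^bsub>Q\<^esub> x [^]\<^bsub>Q\<^esub> j) ` (\<lambda>j. k - j) ` {..k}" by (simp add: image_image)
    also have "(\<lambda>j. k - j) ` {..k} = {..k}"
    proof (intro equalityI subsetI)
      fix j assume "j \<in> {..k}"
      then have "j = k - (k - j)" "k - j \<in> {..k}" by auto
      then show "j \<in> (\<lambda>j. k - j) ` {..k}" by blast
    qed auto
    finally show ?thesis .
  qed
  show ?thesis
  proof (unfold_locales)
    show "A = (\<lambda>j. aj u \<otimes>\<^bsub>Q\<^esub> (inv\<^bsub>Q\<^esub> x) [^]\<^bsub>Q\<^esub> j) ` {..u}" unfolding aj_def img[OF xab(2)] by (rule A_prog)
    show "B = (\<lambda>i. bi w \<otimes>\<^bsub>Q\<^esub> (inv\<^bsub>Q\<^esub> x) [^]\<^bsub>Q\<^esub> i) ` {..w}" unfolding bi_def img[OF xab(3)] by (rule B_prog)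
  qed (use xab w1 B_card C_card in auto)
qed

lemma reversed_eq:
  assumes "j \<le> k"
  shows "k = u \<Longrightarrow> progression_pair.aj Q (inv\<^bsub>Q\<^esub> x) (aj u) j = aj (k - j)"
    "k = w \<Longrightarrow> progression_pair.bi Q (inv\<^bsub>Q\<^esub> x) (bi w) j = bi (k - j)"
    "k = u + w \<Longrightarrow> progression_pair.ck Q (inv\<^bsub>Q\<^esub> x) (aj u) (bi w) j = ck (k - j)"
proof -
  interpret rev: progression_pair G Q \<phi> S T h u g \<mu> "inv\<^bsub>Q\<^esub> x" "aj u" "bi w" w by (rule reversed)
  have p: "y \<otimes>\<^bsub>Q\<^esub> x [^]\<^bsub>Q\<^esub> k \<otimes>\<^bsub>Q\<^esub> (inv\<^bsub>Q\<^esub> x) [^]\<^bsub>Q\<^esub> j = y \<otimes>\<^bsub>Q\<^esub> x [^]\<^bsub>Q\<^esub> (k - j)" if "y \<in> carrier Q" for y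
  proof -
    have "x [^]\<^bsub>Q\<^esub> k = x [^]\<^bsub>Q\<^esub> (k - j) \<otimes>\<^bsub>Q\<^esub> x [^]\<^bsub>Q\<^esub> j" using xab assms by (simp add: Q.nat_pow_mult)
    then show ?thesis using that xab by (simp add: Q.nat_pow_inv Q.m_assoc)
  qed
  show "k = u \<Longrightarrow> rev.aj j = aj (k - j)" unfolding rev.aj_def using p[OF xab(2)] by (simp add: aj_def)
  show "k = w \<Longrightarrow> rev.bi j = bi (k - j)" unfolding rev.bi_def using p[OF xab(3)] by (simp add: bi_def)
  have "aj u \<otimes>\<^bsub>Q\<^esub> bi w = (a0 \<otimes>\<^bsub>Q\<^esub> b0) \<otimes>\<^bsub>Q\<^esub> x [^]\<^bsub>Q\<^esub> (u + w)" using ab[of u w] by (simp add: ck_def add.commute)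
  then show "k = u + w \<Longrightarrow> rev.ck j = ck (k - j)" unfolding rev.ck_def using p[of "a0 \<otimes>\<^bsub>Q\<^esub> b0"] xab by (simp add: ck_def)
qed

subsection \<open>The shapes of the solutions\<close>

text \<open>Alternative (iii) in terms of fibre sizes: \<open>\<nu>\<close> is the total number of
  points missing before the last fibre, and (w + 1) h is |T + H|.\<close>

definition periodic_shape where
  "periodic_shape \<longleftrightarrow> (\<exists>\<nu>. \<nu> \<le> 1 - \<mu> \<and>
     ((\<forall>j<u. sj j = h) \<and> (\<Sum>i<w. h - ti i) = \<nu> \<or> (\<forall>i<w. ti i = h) \<and> (\<Sum>j<u. h - sj j) = \<nu>) \<and>
     mm u w + \<nu> + \<mu> = sj u + ti w \<and> (w + 1) * h + \<mu> \<le> card T + h)"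

text \<open>Alternative (ii) in terms of fibres: |S| = u h and |T| = w h say that each set lacks
  exactly \<open>h\<close> points in the cosets it meets.\<close>

definition essential_shape where
  "essential_shape \<longleftrightarrow> \<mu> = 0 \<and> card S = u * h \<and> card T = w * h \<and>
     ((h = 2 \<and> sj 0 = 1 \<and> sj u = 1 \<and> ti 0 = 1 \<and> ti w = 1) \<or>
      (sj u = 1 \<and> ti w = 1 \<and> sj (u - 1) + 1 = h \<and> ti (w - 1) + 1 = h \<and>
        Tb (bi (w - 1)) <#> Sa (aj u) = Tb (bi w) <#> Sa (aj (u - 1))) \<or>
      (\<exists>K0 K1. subgroup K0 G \<and> subgroup K1 G \<and> card K0 = 2 \<and> card K1 = 2 \<and> N = K0 <#> K1 \<and> K0 \<inter> K1 = {\<one>} \<and>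
        (\<exists>y\<in>carrier G. Sa (aj 0) = (\<lambda>z. y \<otimes> z) ` K0) \<and> (\<exists>y\<in>carrier G. Tb (bi 0) = (\<lambda>z. y \<otimes> z) ` K0) \<and>
        (\<exists>y\<in>carrier G. Sa (aj u) = (\<lambda>z. y \<otimes> z) ` K1) \<and> (\<exists>y\<in>carrier G. Tb (bi w) = (\<lambda>z. y \<otimes> z) ` K1)))"

lemma ZC: "S <#> T = (\<Union>k\<le>u + w. Zc (ck k))"
proof (intro equalityI subsetI)
  fix z assume z: "z \<in> S <#> T"
  then have "\<phi> z \<in> C" using C_props by auto
  then obtain k where "k \<le> u + w" "\<phi> z = ck k" unfolding C_img by auto
  then show "z \<in> (\<Union>k\<le>u + w. Zc (ck k))" using z by (auto simp: fib_def)
qed (auto simp: fib_def)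

lemma full_layer_stable:
  assumes "k \<in> N" "sk j = h" "z \<in> Zc (ck j)"
  shows "k \<otimes> z \<in> Zc (ck j)"
proof -
  have "Zc (ck j) = {x \<in> carrier G. \<phi> x = ck j}"
    using assms(2) ST_props by (intro fib_full) (auto simp: sk_def \<sigma>_def)
  then show ?thesis using assms(1,3) by (auto simp: N_def)
qed

text \<open>An element of the kernel maps every full layer to itself, so only the other layers have
  to be tested for a period.\<close>

lemma layer_stabilizer:
  assumes k: "k \<in> N" and st: "\<And>j. j \<le> u + w \<Longrightarrow> sk j < h \<Longrightarrow> k \<in> stabilizer G (Zc (ck j))"
  shows "k = \<one>"
proof (rule no_stabilizer)
  show "k \<in> stabilizer G (S <#> T)"
  proof (rule stabilizerI[OF ST_props])
    show "k \<in> carrier G" using k by (simp add: N_def)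
    fix z assume "z \<in> S <#> T"
    then obtain j where j: "j \<le> u + w" "z \<in> Zc (ck j)" using subsetD[OF equalityD1[OF ZC]] by (metis UN_E atMost_iff)
    have "k \<otimes> z \<in> Zc (ck j)"
    proof (cases "sk j < h")
      case True then show ?thesis using st[OF j(1)] j(2) stabilizer_mult by blast
    next
      case False
      then have "sk j = h" using basic(3)[of j] by simp
      then show ?thesis using full_layer_stable k j by blast
    qed
    then show "k \<otimes> z \<in> S <#> T" by (simp add: fib_def)
  qed
qed

text \<open>The last layer is the sum of just two fibres, and a period of it would be one of S + T,
  so by Kneser's theorem it loses at most one. Counting shows that the loss is \<mu> plus the number
  of points missing from the earlier fibres of S and T; hence at most one point is missing
  altogether.\<close>

lemma one_end_layer:
  assumes full: "\<And>k. k < u + w \<Longrightarrow> sk k = h"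
  shows periodic_shape
proof -
  define Z where "Z = Sa (aj u) <#> Tb (bi w)"
  have ne: "Sa (aj u) \<noteq> {}" "Tb (bi w) \<noteq> {}" using Sa_ne Tb_ne by auto
  have Zck: "Z \<subseteq> Zc (ck (u + w))" using ST_subset_Zc[of "aj u" "bi w"] ab[of u w] by (simp add: Z_def add.commute)
  have nf: "sk (u + w) < h"
  proof -
    obtain c where "c \<in> C" "\<sigma> c < h" using exists_not_full by auto
    then obtain k where "k \<le> u + w" "sk k < h" unfolding C_img by (auto simp: sk_def)
    then show ?thesis using full by (metis le_neq_implies_less less_irrefl)
  qed
  have Zeq: "Zc (ck (u + w)) = Z"
  proof
    show "Zc (ck (u + w)) \<subseteq> Z"
    proof
      fix z assume "z \<in> Zc (ck (u + w))"
      then have z: "z \<in> S <#> T" "\<phi> z = ck (u + w)" by (auto simp: fib_def)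
      then obtain y v where yv: "y \<in> S" "v \<in> T" "z = y \<otimes> v" by (auto simp: set_mult_iff)
      obtain j i where ji: "j \<le> u" "i \<le> w" "\<phi> y = aj j" "\<phi> v = bi i"
        using yv A_img B_img by (metis (no_types, lifting) atMost_iff imageE imageI)
      have "ck (i + j) = ck (u + w)" using z yv ji S T ab[of j i] by (auto simp: subset_iff)
      then have "i + j = u + w" using inj_c ji by (auto dest!: inj_onD)
      then have "j = u" "i = w" using ji by auto
      then show "z \<in> Z" using yv ji by (auto simp: Z_def fib_def intro: set_multI)
    qed
  qed (rule Zck)
  have Zc: "Z \<subseteq> carrier G" "finite Z" "Z \<noteq> {}"
    using fibs ne by (auto simp: Z_def setmult_subset_G finite_set_mult) (auto simp: set_mult_def)
  have stN: "stabilizer G Z \<subseteq> N"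
    using Zck by (intro stabilizer_fibre(1)[OF Zc(1,3,2), of "ck (u + w)"]) (auto simp: fib_def)
  have "stabilizer G Z \<subseteq> {\<one>}"
  proof
    fix k assume k: "k \<in> stabilizer G Z"
    have "k = \<one>"
    proof (rule layer_stabilizer)
      show "k \<in> N" using k stN by auto
      fix j assume "j \<le> u + w" "sk j < h"
      then have "j = u + w" using full by (metis le_neq_implies_less less_irrefl)
      then show "k \<in> stabilizer G (Zc (ck j))" using k Zeq by simp
    qed
    then show "k \<in> {\<one>}" by simp
  qed
  then have "card (stabilizer G Z) \<le> card {\<one>}" by (intro card_mono) auto
  then have kn: "sj u + ti w \<le> mm u w + 1"
    using kneser[OF fibs(2,4,1,3) ne, folded Z_def] by (simp add: Z_def sj_def ti_def mm_def s_def t_def m_def)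
  have skm: "sk (u + w) = mm u w" by (simp add: sk_def \<sigma>_def Zeq Z_def mm_def m_def)
  have 1: "(\<Sum>k\<le>u + w. sk k) = (u + w) * h + sk (u + w)"
  proof -
    have "{..u + w} = insert (u + w) {..<u + w}" by auto
    then show ?thesis using full by simp
  qed
  have 2: "(\<Sum>j<u. h - sj j) + (\<Sum>j\<le>u. sj j) = u * h + sj u"
  proof -
    have "{..u} = insert u {..<u}" by auto
    moreover have "(\<Sum>j<u. h - sj j) + (\<Sum>j<u. sj j) = (\<Sum>j<u. h)"
      unfolding sum.distrib[symmetric] using basic by (intro sum.cong) auto
    ultimately show ?thesis by simp
  qed
  have 3: "(\<Sum>i<w. h - ti i) + (\<Sum>i\<le>w. ti i) = w * h + ti w"
  proof -
    have "{..w} = insert w {..<w}" by auto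
    moreover have "(\<Sum>i<w. h - ti i) + (\<Sum>i<w. ti i) = (\<Sum>i<w. h)"
      unfolding sum.distrib[symmetric] using basic by (intro sum.cong) auto
    ultimately show ?thesis by simp
  qed
  define \<alpha> where "\<alpha> = (\<Sum>j<u. h - sj j)"
  define \<beta> where "\<beta> = (\<Sum>i<w. h - ti i)"
  have mm: "mm u w + \<alpha> + \<beta> + \<mu> = sj u + ti w"
    using 1 2 3 sum_sk sum_sj sum_ti skm unfolding \<alpha>_def \<beta>_def distrib_right by linarith
  then have small: "\<alpha> + \<beta> \<le> 1 - \<mu>" using kn by linarith
  have "(w + 1) * h + \<mu> \<le> card T + h"
  proof -
    have "sj u \<le> sk (u + w)" using basic(9)[of w u] by (simp add: add.commute)
    then show ?thesis using 1 sum_sk sum_sj gmu 2 unfolding distrib_right by linarith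
  qed
  moreover have "\<alpha> = 0 \<Longrightarrow> \<forall>j<u. sj j = h" "\<beta> = 0 \<Longrightarrow> \<forall>i<w. ti i = h"
    using basic(1,2) by (auto simp: \<alpha>_def \<beta>_def intro: le_antisym)
  moreover have "\<alpha> = 0 \<or> \<beta> = 0" using small by linarith
  ultimately show ?thesis
    unfolding periodic_shape_def
    by (intro exI[of _ "\<alpha> + \<beta>"]) (use mm small in \<open>auto simp: \<alpha>_def[symmetric] \<beta>_def[symmetric]\<close>)
qed

end

context comm_group
begin

text \<open>Translated to contain \<one>, \<open>Y\<close> lies in the stabilizer of
  \<open>X\<close>, which has at most \<open>k\<close> elements; so both sets are cosets of that
  stabilizer.\<close>

lemma equal_cards_cosets:
  assumes X: "finite X" "X \<subseteq> carrier G" "X \<noteq> {}" and Y: "finite Y" "Y \<subseteq> carrier G" "Y \<noteq> {}"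
    and c: "card X = k" "card Y = k" "card (X <#> Y) = k"
  obtains y y' where "y \<in> carrier G" "X = (\<otimes>) y ` stabilizer G X" "y' \<in> carrier G" "Y = (\<otimes>) y' ` stabilizer G X"
    "card (stabilizer G X) = k"
proof -
  define K where "K = stabilizer G X"
  obtain x0 y0 where xy: "x0 \<in> X" "y0 \<in> Y" using X Y by auto
  have xyc: "x0 \<in> carrier G" "y0 \<in> carrier G" using xy X Y by auto
  have Kf: "finite K" "card K \<le> k" using stabilizer_finite[OF X(1,2) xy(1)] c by (auto simp: K_def)
  have "(\<otimes>) (inv y0) ` Y \<subseteq> K"
    using diff_stabilizes[OF X(1,2) Y(1,2) _ xy(2)] c by (auto simp: K_def)
  moreover have cY: "card ((\<otimes>) (inv y0) ` Y) = k" using card_translate[of "inv y0" Y] xyc Y c by simp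
  ultimately have YeK: "(\<otimes>) (inv y0) ` Y = K" using Kf by (intro card_seteq) simp_all
  have Ye: "(\<otimes>) (inv y0) ` Y = K" "card K = k" using YeK cY by simp_all
  have "Y = (\<otimes>) y0 ` K"
    unfolding Ye(1)[symmetric] using translate_translate[of y0 "inv y0" Y] xyc Y by (simp add: translate_one)
  moreover have "X = (\<otimes>) x0 ` K"
  proof -
    have "(\<otimes>) x0 ` K \<subseteq> X"
    proof
      fix z assume "z \<in> (\<otimes>) x0 ` K"
      then obtain l where l: "l \<in> K" "z = x0 \<otimes> l" by auto
      have "l \<in> carrier G" using l stabilizer_subset by (auto simp: K_def)
      then have "z = l \<otimes> x0" using l xyc m_comm by simp
      then show "z \<in> X" using l xy stabilizer_mult by (simp add: K_def)
    qed
    moreover have "card ((\<otimes>) x0 ` K) = card X"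
      using card_translate[OF xyc(1) stabilizer_subset[of X]] Ye c by (simp add: K_def)
    ultimately show ?thesis using X(1) card_subset_eq by metis
  qed
  ultimately show ?thesis
    using that[OF xyc(1) _ xyc(2)] Ye(2) unfolding K_def by metis
qed

end

context progression_pair
begin

text \<open>Counting leaves no slack: the end fibres and both end layers have q = h / 2 elements. So
  the end fibres are cosets of subgroups K0 and K1 of order q. Their intersection consists of
  periods of S + T and is trivial, whence q q \<le> h = 2 q; q = 1 and q = 2 are two of the three
  kinds of essential pairs.\<close>

lemma two_end_layers:
  assumes nf: "sk 0 < h" "sk (u + w) < h" and full: "\<And>k. 0 < k \<Longrightarrow> k < u + w \<Longrightarrow> sk k = h"
  shows essential_shape
proof -
  have pos: "0 < u + w" "u \<noteq> 0" "w \<noteq> 0" using u1 w1 by auto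
  have 1: "(\<Sum>k\<le>u + w. sk k) + h = sk 0 + sk (u + w) + (u + w) * h"
  proof -
    have "{..u + w} = insert 0 (insert (u + w) {0<..<u + w})" using pos by auto
    moreover have "0 \<notin> insert (u + w) {0<..<u + w}" using pos by auto
    ultimately have "(\<Sum>k\<le>u + w. sk k) = sk 0 + (sk (u + w) + (\<Sum>k\<in>{0<..<u + w}. sk k))" by simp
    moreover have "(\<Sum>k\<in>{0<..<u + w}. sk k) = (u + w - 1) * h" using full by simp
    moreover have "(u + w - 1) * h + h = (u + w) * h" using pos by (cases "u + w") auto
    ultimately show ?thesis by simp
  qed
  have t: "ti 0 + sj 0 \<le> h" "ti w + sj u \<le> h"
    using not_full_le[of 0 0] not_full_le[of u w] nf by (simp_all add: add.commute)
  have s: "sj 0 \<le> sk 0" "sj u \<le> sk (u + w)" "ti 0 \<le> sk 0" "ti w \<le> sk (u + w)"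
    using basic(9)[of 0 0] basic(9)[of w u] basic(10)[of 0 0] basic(10)[of u w] by (simp_all add: add.commute)
  define R where "R = {..w} - {0} - {w}"
  have cR: "card R + 1 = w" "finite R" using pos by (auto simp: R_def)
  have sumT: "(\<Sum>i\<le>w. ti i) = ti 0 + (ti w + (\<Sum>i\<in>R. ti i))"
    unfolding R_def using pos by (simp add: sum.remove[of _ 0] sum.remove[of _ w])
  have leR: "(\<Sum>i\<in>R. ti i) \<le> card R * h" using sum_bounded_above[of R ti h] basic by simp
  have hR: "card R * h + h = w * h" using cR by (metis add.commute mult_Suc Suc_eq_plus1)
  have pe: "h + g + \<mu> \<le> sj 0 + sj u" using pair_eq(1)[of 0 u] pos by simp
  have all: "\<mu> = 0" "g = 0" "sj 0 + sj u = h" "sk 0 = sj 0" "sk (u + w) = sj u" "ti 0 = sj u" "ti w = sj 0"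
    "card T = w * h"
    using 1 t s sumT leR hR pe sum_sk sum_ti unfolding distrib_right by linarith+
  have eq: "sj 0 = sj u" using s all by simp
  have cS: "card S = u * h" using S_card all by simp
  have m0: "mm 0 0 = sj 0" using basic(6)[of 0 0] basic(7)[of 0 0] all by simp
  have mw: "mm u w = sj u" using basic(6)[of u w] basic(7)[of w u] all by (simp add: add.commute)
  have ne: "Sa (aj 0) \<noteq> {}" "Tb (bi 0) \<noteq> {}" "Sa (aj u) \<noteq> {}" "Tb (bi w) \<noteq> {}" using Sa_ne Tb_ne by auto
  define K0 where "K0 = stabilizer G (Sa (aj 0))"
  define K1 where "K1 = stabilizer G (Sa (aj u))"
  define q where "q = sj 0"
  have q2: "2 * q = h" "1 \<le> q" using eq all basic(4)[of 0] by (auto simp: q_def)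
  obtain y0 y0' where k0: "y0 \<in> carrier G" "Sa (aj 0) = (\<lambda>z. y0 \<otimes> z) ` K0" "y0' \<in> carrier G" "Tb (bi 0) = (\<lambda>z. y0' \<otimes> z) ` K0" "card K0 = q"
    using equal_cards_cosets[OF fibs(2,1) ne(1) fibs(4,3) ne(2), of q] m0 all eq
    unfolding K0_def q_def sj_def ti_def mm_def s_def t_def m_def by metis
  obtain y1 y1' where k1: "y1 \<in> carrier G" "Sa (aj u) = (\<lambda>z. y1 \<otimes> z) ` K1" "y1' \<in> carrier G" "Tb (bi w) = (\<lambda>z. y1' \<otimes> z) ` K1" "card K1 = q"
    using equal_cards_cosets[OF fibs(2,1) ne(3) fibs(4,3) ne(4), of q] mw all eq
    unfolding K1_def q_def sj_def ti_def mm_def s_def t_def m_def by metis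
  have sg: "subgroup K0 G" "subgroup K1 G" unfolding K0_def K1_def using fibs by (auto intro: stabilizer_subgroup)
  have KN: "K0 \<subseteq> N" "K1 \<subseteq> N"
    unfolding K0_def K1_def using stabilizer_fibre(1)[OF fibs(1) ne(1) fibs(2), of "aj 0"]
      stabilizer_fibre(1)[OF fibs(1) ne(3) fibs(2), of "aj u"] by (auto simp: fib_def)
  have Z0: "Zc (ck 0) = Sa (aj 0) <#> Tb (bi 0)"
    using ST_subset_Zc[of "aj 0" "bi 0"] ab[of 0 0] m0 all fibs(6)
    by (intro card_subset_eq[symmetric]) (simp_all add: mm_def m_def sk_def \<sigma>_def)
  have Zw: "Zc (ck (u + w)) = Sa (aj u) <#> Tb (bi w)"
    using ST_subset_Zc[of "aj u" "bi w"] ab[of u w] mw all fibs(6)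
    by (intro card_subset_eq[symmetric])
      (simp_all add: mm_def m_def sk_def \<sigma>_def add.commute[of w u])
  have int: "K0 \<inter> K1 = {\<one>}"
  proof
    show "K0 \<inter> K1 \<subseteq> {\<one>}"
    proof
      fix k assume k: "k \<in> K0 \<inter> K1"
      have "k = \<one>"
      proof (rule layer_stabilizer)
        show "k \<in> N" using k KN by auto
        fix j assume "j \<le> u + w" "sk j < h"
        then have "j = 0 \<or> j = u + w" using full by (metis le_neq_implies_less less_irrefl neq0_conv)
        then show "k \<in> stabilizer G (Zc (ck j))"
          using k Z0 Zw subsetD[OF stabilizer_set_mult_mono[OF fibs(1,3)]] unfolding K0_def K1_def by auto
      qed
      then show "k \<in> {\<one>}" by simp
    qed
  qed (use sg subgroup.one_closed in auto)
  have fK: "finite K0" "finite K1" using KN N_card finite_subset by blast+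
  have inj: "inj_on (\<lambda>(k, l). k \<otimes> l) (K0 \<times> K1)"
  proof (rule inj_onI, clarsimp)
    fix k l k' l' assume kl: "k \<in> K0" "l \<in> K1" "k' \<in> K0" "l' \<in> K1" "k \<otimes> l = k' \<otimes> l'"
    have c: "k \<in> carrier G" "l \<in> carrier G" "k' \<in> carrier G" "l' \<in> carrier G"
      using subgroup.mem_carrier[OF sg(1) kl(1)] subgroup.mem_carrier[OF sg(2) kl(2)]
        subgroup.mem_carrier[OF sg(1) kl(3)] subgroup.mem_carrier[OF sg(2) kl(4)] by simp_all
    have "inv k' \<otimes> (k \<otimes> l) \<otimes> inv l = inv k' \<otimes> (k' \<otimes> l') \<otimes> inv l" by (simp only: kl(5))
    then have e: "inv k' \<otimes> k = l' \<otimes> inv l" using c by (simp add: m_assoc)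
    have "inv k' \<otimes> k \<in> K0"
      by (rule subgroup.m_closed[OF sg(1) subgroup.m_inv_closed[OF sg(1) kl(3)] kl(1)])
    moreover have "l' \<otimes> inv l \<in> K1"
      by (rule subgroup.m_closed[OF sg(2) kl(4) subgroup.m_inv_closed[OF sg(2) kl(2)]])
    ultimately have "inv k' \<otimes> k = \<one>" using e int by auto
    moreover have "k = k' \<otimes> (inv k' \<otimes> k)" using c by simp
    ultimately have "k = k'" using c by simp
    then show "k = k' \<and> l = l'" using kl c by simp
  qed
  have im: "(\<lambda>(k, l). k \<otimes> l) ` (K0 \<times> K1) = K0 <#> K1" by (auto simp: set_mult_def)
  have card01: "card (K0 <#> K1) = q * q"
    unfolding im[symmetric] using inj k0 k1 by (simp add: card_image card_cartesian_product)
  have sub01: "K0 <#> K1 \<subseteq> N"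
    using KN subgroup.m_closed[OF N_subgroup] by (auto simp: set_mult_iff subset_iff)
  have "q * q \<le> 2 * q" using card_mono[OF N_card(2) sub01] card01 N_card q2 by simp
  then have "q \<le> 2" using q2 by auto
  then have "q = 1 \<or> q = 2" using q2 by linarith
  then show ?thesis
  proof
    assume "q = 1"
    then show ?thesis unfolding essential_shape_def using all cS q2 eq by (auto simp: q_def)
  next
    assume q: "q = 2"
    have NK: "N = K0 <#> K1" using card_subset_eq[OF N_card(2) sub01] card01 N_card q2 q by simp
    have ex: "\<exists>y\<in>carrier G. Sa (aj 0) = (\<lambda>z. y \<otimes> z) ` K0" "\<exists>y\<in>carrier G. Tb (bi 0) = (\<lambda>z. y \<otimes> z) ` K0"
      "\<exists>y\<in>carrier G. Sa (aj u) = (\<lambda>z. y \<otimes> z) ` K1" "\<exists>y\<in>carrier G. Tb (bi w) = (\<lambda>z. y \<otimes> z) ` K1"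
      by (rule bexI, rule k0(2), rule k0(1), rule bexI, rule k0(4), rule k0(3),
        rule bexI, rule k1(2), rule k1(1), rule bexI, rule k1(4), rule k1(3))
    have cK: "card K0 = 2" "card K1 = 2" using k0(5) k1(5) q by simp_all
    show ?thesis unfolding essential_shape_def
      by (rule conjI[OF all(1) conjI[OF cS conjI[OF all(8) disjI2[OF disjI2]]]], intro exI conjI;
        (rule sg cK NK int ex)?)
  qed
qed

section \<open>Reversal, and inner layers that are not full\<close>

lemma reversed_layers:
  shows "j \<le> u \<Longrightarrow> progression_pair.sj Q \<phi> S (inv\<^bsub>Q\<^esub> x) (aj u) j = sj (u - j)"
    "i \<le> w \<Longrightarrow> progression_pair.ti Q \<phi> T (inv\<^bsub>Q\<^esub> x) (bi w) i = ti (w - i)"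
    "k \<le> u + w \<Longrightarrow> progression_pair.sk G Q \<phi> S T (inv\<^bsub>Q\<^esub> x) (aj u) (bi w) k = sk (u + w - k)"
proof -
  interpret rev: progression_pair G Q \<phi> S T h u g \<mu> "inv\<^bsub>Q\<^esub> x" "aj u" "bi w" w by (rule reversed)
  show "j \<le> u \<Longrightarrow> rev.sj j = sj (u - j)" unfolding rev.sj_def by (simp add: reversed_eq sj_def)
  show "i \<le> w \<Longrightarrow> rev.ti i = ti (w - i)" unfolding rev.ti_def by (simp add: reversed_eq ti_def)
  show "k \<le> u + w \<Longrightarrow> rev.sk k = sk (u + w - k)" unfolding rev.sk_def by (simp add: reversed_eq sk_def)
qed

text \<open>The second kind of essential pair read from the other end, with the one-point fibres at
  index 0.\<close>

definition essential_start where
  "essential_start \<longleftrightarrow> \<mu> = 0 \<and> g = 0 \<and> card T = w * h \<and> sj 0 = 1 \<and> ti 0 = 1 \<and> sj 1 + 1 = h \<and> ti 1 + 1 = h \<and>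
     Tb (bi 1) <#> Sa (aj 0) = Tb (bi 0) <#> Sa (aj 1)"

abbreviation "essential_end \<equiv> progression_pair.essential_start G Q \<phi> S T h g \<mu> (inv\<^bsub>Q\<^esub> x) (aj u) (bi w) w"

lemma essential_startI:
  assumes "sk 1 < h" "\<mu> = 0" "g = 0" "card T = w * h" "sj 0 = 1" "ti 0 = 1" "sj 1 + 1 = h" "ti 1 + 1 = h"
  shows essential_start
proof -
  have "Tb (bi 1) <#> Sa (aj 0) = Zc (ck 1)"
  proof (rule card_seteq[OF fibs(6)])
    show "Tb (bi 1) <#> Sa (aj 0) \<subseteq> Zc (ck 1)"
      using ST_subset_Zc[of "aj 0" "bi 1"] ab[of 0 1] set_mult_comm[OF fibs(3,1)] by simp
    have "ti 1 \<le> card (Tb (bi 1) <#> Sa (aj 0))"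
      using basic(8)[of 0 1] set_mult_comm[OF fibs(3,1)] by (simp add: mm_def m_def)
    then show "card (Zc (ck 1)) \<le> card (Tb (bi 1) <#> Sa (aj 0))"
      using assms by (simp add: sk_def \<sigma>_def)
  qed
  moreover have "Tb (bi 0) <#> Sa (aj 1) = Zc (ck 1)"
  proof (rule card_seteq[OF fibs(6)])
    show "Tb (bi 0) <#> Sa (aj 1) \<subseteq> Zc (ck 1)"
      using ST_subset_Zc[of "aj 1" "bi 0"] ab[of 1 0] set_mult_comm[OF fibs(3,1)] by simp
    have "sj 1 \<le> card (Tb (bi 0) <#> Sa (aj 1))"
      using basic(7)[of 0 1] set_mult_comm[OF fibs(3,1)] by (simp add: mm_def m_def)
    then show "card (Zc (ck 1)) \<le> card (Tb (bi 0) <#> Sa (aj 1))"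
      using assms by (simp add: sk_def \<sigma>_def)
  qed
  ultimately show ?thesis using assms unfolding essential_start_def by simp
qed

lemma essential_if_end:
  assumes essential_end
  shows essential_shape
proof -
  interpret rev: progression_pair G Q \<phi> S T h u g \<mu> "inv\<^bsub>Q\<^esub> x" "aj u" "bi w" w by (rule reversed)
  have e: "\<mu> = 0" "g = 0" "card T = w * h" "rev.sj 0 = 1" "rev.ti 0 = 1" "rev.sj 1 + 1 = h" "rev.ti 1 + 1 = h"
     "Tb (rev.bi 1) <#> Sa (rev.aj 0) = Tb (rev.bi 0) <#> Sa (rev.aj 1)"
    using assms unfolding rev.essential_start_def by auto
  have l: "sj u = 1" "ti w = 1" "sj (u - 1) + 1 = h" "ti (w - 1) + 1 = h"
    using e(4-7) reversed_layers(1)[of 0] reversed_layers(1)[of 1] reversed_layers(2)[of 0] reversed_layers(2)[of 1] u1 w1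
    by simp_all
  have "Tb (bi (w - 1)) <#> Sa (aj u) = Tb (bi w) <#> Sa (aj (u - 1))"
    using e(8) reversed_eq(1)[of 0 u] reversed_eq(1)[of 1 u] reversed_eq(2)[of 0 w] reversed_eq(2)[of 1 w] u1 w1
    by simp
  moreover have "card S = u * h" using S_card e by linarith
  ultimately show ?thesis unfolding essential_shape_def using e(1,3) l by blast
qed

text \<open>The layer is reached both from (p, q + 1) and from (p + 1, q).\<close>

lemma inner_layer:
  assumes q: "q < w" and p: "p < u" and nf: "sk (q + p + 1) < h"
  shows "sj p + ti (q + 1) \<le> h" "sj (p + 1) + ti q \<le> h"
  using not_full_le[of p "q + 1"] not_full_le[of "p + 1" q] assms by (simp_all add: add_ac)

lemma sum_diff_zero:
  "(\<Sum>i\<in>I. (f i :: nat)) \<le> n \<Longrightarrow> finite I \<Longrightarrow> i \<in> I \<Longrightarrow> f i \<le> n"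
  by (meson le_trans member_le_sum zero_le)

text \<open>\<open>column_ge\<close> exhausts \<open>column_path\<close> up to a slack of
  \<open>g\<close>, and the excess of the first layer behind the column must fit into it.\<close>

lemma column_end:
  assumes "q < w" "2 \<le> ti q \<or> 1 \<le> g + \<mu>"
  shows "sk (q + 1 + u) \<le> ti (q + 1) + g"
    and "ti (q + 1) + g \<le> sk (q + 1 + u) \<Longrightarrow> i < q \<Longrightarrow> sk i = ti i"
    and "(\<Sum>j\<le>u. sk (q + j)) + sk (q + 1 + u) \<le> u * h + g + ti q + ti (q + 1)"
proof -
  have cp: "(\<Sum>i<q. sk i - ti i) + (\<Sum>j\<le>u. sk (q + j)) + (\<Sum>i\<in>{q<..w}. sk (i + u) - ti i) = u * h + g + ti q"
    using column_path[of q] assms by simp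
  have cg: "u * h + ti q \<le> (\<Sum>j\<le>u. sk (q + j))" using column_ge(2)[of q] assms by simp
  have mem: "sk (q + 1 + u) - ti (q + 1) \<le> (\<Sum>i\<in>{q<..w}. sk (i + u) - ti i)"
    using member_le_sum[of "q + 1" "{q<..w}" "\<lambda>i. sk (i + u) - ti i"] assms by simp
  show 1: "sk (q + 1 + u) \<le> ti (q + 1) + g" using cp cg mem by linarith
  show "(\<Sum>j\<le>u. sk (q + j)) + sk (q + 1 + u) \<le> u * h + g + ti q + ti (q + 1)" using cp mem by linarith
  assume "ti (q + 1) + g \<le> sk (q + 1 + u)" "i < q"
  then have "(\<Sum>i<q. sk i - ti i) \<le> 0" using cp cg mem by linarith
  then have "sk i - ti i \<le> 0" by (rule sum_diff_zero) (use \<open>i < q\<close> in auto)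
  moreover have "ti i \<le> sk i" using basic(10)[of 0 i] by simp
  ultimately show "sk i = ti i" by simp
qed

text \<open>The inequalities sj p + ti (q + 1) \<le> h, sj u \<le> sk (q + 1 + u) \<le> ti (q + 1) +
  g and h + g + \<mu> \<le> sj p + sj u form a closed chain, so all are equalities and \<mu> = 0. By
  \<open>pair_eq\<close> the other rows are full, which leaves no room for p + 1 < u.\<close>

lemma large_left:
  assumes q: "q < w" and p: "p < u" and nf: "sk (q + p + 1) < h" and t: "2 \<le> ti q"
  shows "\<mu> = 0" "p + 1 = u" "sj p + ti (q + 1) = h" "sk (q + 1 + u) = sj u" "sj p + sj u = h + g"
    "j < p \<Longrightarrow> sj j = h" "i < q \<Longrightarrow> sk i = ti i"
proof -
  have il: "sj p + ti (q + 1) \<le> h" "sj (p + 1) + ti q \<le> h" using inner_layer[OF q p nf] by auto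
  have ce: "sk (q + 1 + u) \<le> ti (q + 1) + g" using column_end(1)[OF q] t by blast
  have su: "sj u \<le> sk (q + 1 + u)" using basic(9)[of "q + 1" u] q by simp
  have pe: "h + g + \<mu> \<le> sj p + sj u" using pair_eq(1)[of p u] p by simp
  show e: "\<mu> = 0" "sj p + ti (q + 1) = h" "sk (q + 1 + u) = sj u" "sj p + sj u = h + g"
    using il ce su pe by linarith+
  have others: "sj j = h" if "j \<le> u" "j \<noteq> p" "j \<noteq> u" for j
    using pair_eq(2)[of p u j] p that e by simp
  show "p + 1 = u"
  proof (rule ccontr)
    assume "p + 1 \<noteq> u"
    then have "sj (p + 1) = h" using others[of "p + 1"] p by simp
    then show False using il(2) t by linarith
  qed
  show "j < p \<Longrightarrow> sj j = h" using others[of j] p by simp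
  show "i < q \<Longrightarrow> sk i = ti i" using column_end(2)[OF q, of i] t e by linarith
qed

text \<open>The mirror image of \<open>large_left\<close> under \<open>reversed\<close>.\<close>

lemma large_right:
  assumes q: "q < w" and p: "p < u" and nf: "sk (q + p + 1) < h" and t: "2 \<le> ti (q + 1)"
  shows "\<mu> = 0" "p = 0" "sj (p + 1) + ti q = h" "sk q = sj 0" "sj (p + 1) + sj 0 = h + g"
    "p + 1 < j \<Longrightarrow> j \<le> u \<Longrightarrow> sj j = h" "q + 1 < i \<Longrightarrow> i \<le> w \<Longrightarrow> sk (i + u) = ti i"
proof -
  interpret rev: progression_pair G Q \<phi> S T h u g \<mu> "inv\<^bsub>Q\<^esub> x" "aj u" "bi w" w by (rule reversed)
  have a: "w - 1 - q < w" "u - 1 - p < u" using p q by auto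
  have e: "u + w - (w - 1 - q + (u - 1 - p) + 1) = q + p + 1" "w - 1 - q + (u - 1 - p) + 1 \<le> u + w" using p q by auto
  have nf': "rev.sk (w - 1 - q + (u - 1 - p) + 1) < h" using reversed_layers(3)[OF e(2)] e(1) nf by simp
  have t': "2 \<le> rev.ti (w - 1 - q)" using reversed_layers(2)[of "w - 1 - q"] q t by simp
  note ll = rev.large_left[OF a nf' t']
  show "\<mu> = 0" by (rule ll(1))
  show p0: "p = 0" using ll(2) p by linarith
  show "sj (p + 1) + ti q = h"
    using ll(3) reversed_layers(1)[of "u - 1 - p"] reversed_layers(2)[of "w - 1 - q + 1"] p q by simp
  show "sk q = sj 0"
    using ll(4) reversed_layers(3)[of "w - 1 - q + 1 + u"] reversed_layers(1)[of u] q by simp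
  show "sj (p + 1) + sj 0 = h + g"
    using ll(5) reversed_layers(1)[of "u - 1 - p"] reversed_layers(1)[of u] p by simp
  show "sj j = h" if "p + 1 < j" "j \<le> u"
    using ll(6)[of "u - j"] reversed_layers(1)[of "u - j"] that by simp
  show "sk (i + u) = ti i" if "q + 1 < i" "i \<le> w"
    using ll(7)[of "w - i"] reversed_layers(2)[of "w - i"] reversed_layers(3)[of "w - i"] that by (simp add: add.commute)
qed

lemma stabilizer_layer:
  assumes "j \<le> u" "sj j < h"
  shows "card (stabilizer G (Sa (aj j))) dvd sj j" "card (stabilizer G (Sa (aj j))) dvd h"
    "card (stabilizer G (Sa (aj j))) \<le> h - sj j"
proof -
  have ne: "Sa (aj j) \<noteq> {}" using Sa_ne assms by auto
  show d: "card (stabilizer G (Sa (aj j))) dvd sj j" "card (stabilizer G (Sa (aj j))) dvd h"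
    using stabilizer_fibre(2,3)[OF fibs(1) ne fibs(2), of "aj j"] fibD(1) by (auto simp: sj_def s_def)
  show "card (stabilizer G (Sa (aj j))) \<le> h - sj j"
    by (rule dvd_imp_le[OF dvd_diff_nat[OF d(2,1)]]) (use assms in simp)
qed

lemma diff_stabilizes_layer:
  assumes "mm j i = sj j" "v \<in> Tb (bi i)" "v' \<in> Tb (bi i)"
  shows "inv v \<otimes> v' \<in> stabilizer G (Sa (aj j))"
  using diff_stabilizes[OF fibs(2,1,4,3)] assms by (simp add: mm_def m_def sj_def s_def)

text \<open>Otherwise the difference of two points of the fibre of T would be a period of S: it
  stabilizes the rows that do not grow, and full rows in any case.\<close>

lemma diff_not_stabilizing:
  assumes "2 \<le> ti i" "\<And>j. j \<le> u \<Longrightarrow> mm j i = sj j \<or> sj j = h"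
  shows False
proof -
  obtain v v' where v: "v \<in> Tb (bi i)" "v' \<in> Tb (bi i)" "v \<noteq> v'"
  proof -
    have "\<not> card (Tb (bi i)) \<le> Suc 0" using assms(1) by (simp add: ti_def t_def)
    then show ?thesis using that card_le_Suc0_iff_eq[OF fibs(4)] by blast
  qed
  have c: "v \<in> carrier G" "v' \<in> carrier G" "\<phi> v = bi i" "\<phi> v' = bi i" using subsetD[OF fibs(3) v(1)] subsetD[OF fibs(3) v(2)] fibD(1)[OF v(1)] fibD(1)[OF v(2)] by simp_all
  define k where "k = inv v \<otimes> v'"
  have kc: "k \<in> carrier G" "\<phi> k = \<one>\<^bsub>Q\<^esub>" using c by (simp_all add: k_def)
  have "k \<in> stabilizer G S"
  proof (rule stabilizerI[OF S(2,1) kc(1)])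
    fix y assume y: "y \<in> S"
    then obtain j where j: "j \<le> u" "\<phi> y = aj j" using A_img by (metis atMost_iff imageE imageI)
    have yf: "y \<in> Sa (aj j)" using y j by (simp add: fib_def)
    have "k \<otimes> y \<in> Sa (aj j)"
    proof (cases "sj j = h")
      case True
      then have "Sa (aj j) = {z \<in> carrier G. \<phi> z = aj j}"
        using S by (intro fib_full) (auto simp: sj_def s_def)
      then show ?thesis using kc y S j by auto
    next
      case False
      then have "k \<in> stabilizer G (Sa (aj j))" using assms(2)[OF j(1)] v diff_stabilizes_layer k_def by blast
      then show ?thesis using yf stabilizer_mult by blast
    qed
    then show "k \<otimes> y \<in> S" by (rule fibD(2))
  qed
  then have k1: "k = \<one>" by (rule no_stabilizer_factor(1))
  have "v \<otimes> k = v'" using c by (simp add: k_def)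
  then show False using k1 v(3) c by simp
qed

text \<open>\<open>large_left\<close> and \<open>large_right\<close> together give u = 1. Comparing
  stabilizers shows that the fibre of T at q is a coset of the stabilizer of the first fibre of S.
  Its sum with the second fibre of S is then a union of cosets of this group; being smaller than the
  whole, it cannot exceed that fibre of S, and \<open>diff_not_stabilizing\<close> applies.\<close>

lemma both_large_false:
  assumes q: "q < w" and p: "p < u" and nf: "sk (q + p + 1) < h" and t: "2 \<le> ti q" "2 \<le> ti (q + 1)"
  shows False
proof -
  note l = large_left[OF q p nf t(1)] and r = large_right[OF q p nf t(2)]
  have u: "u = 1" "p = 0" using l(2) r(2) by auto
  have e: "sj 0 + ti (q + 1) = h" "sj 1 + ti q = h" "sk (q + 2) = sj 1" "sk q = sj 0"
    using l r u by simp_all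
  have m: "mm 1 (q + 1) = sj 1" "mm 0 q = sj 0"
    using basic(6)[of 1 "q + 1"] basic(7)[of "q + 1" 1] basic(6)[of 0 q] basic(7)[of q 0] e q by simp_all
  have lt: "sj 0 < h" "sj 1 < h" using e t by linarith+
  have ne: "Sa (aj 0) \<noteq> {}" "Sa (aj 1) \<noteq> {}" "Tb (bi q) \<noteq> {}" using Sa_ne Tb_ne u q by auto
  have "ti (q + 1) \<le> card (stabilizer G (Sa (aj 1)))"
    using card_le_stabilizer[OF fibs(2,1) ne(2) fibs(4,3)] m by (simp add: mm_def m_def sj_def s_def ti_def t_def)
  also have "\<dots> \<le> h - sj 1" using stabilizer_layer(3)[of 1] lt u by simp
  finally have 1: "ti (q + 1) \<le> ti q" using e by linarith
  have le0: "ti q \<le> card (stabilizer G (Sa (aj 0)))"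
    using card_le_stabilizer[OF fibs(2,1) ne(1) fibs(4,3)] m by (simp add: mm_def m_def sj_def s_def ti_def t_def)
  have "card (stabilizer G (Sa (aj 0))) \<le> h - sj 0" using stabilizer_layer(3)[of 0] lt by simp
  then have K: "card (stabilizer G (Sa (aj 0))) = ti q" using le0 1 e by linarith
  define K0 where "K0 = stabilizer G (Sa (aj 0))"
  have sg: "subgroup K0 G" unfolding K0_def by (rule stabilizer_subgroup[OF fibs(1)])
  have fK: "finite K0" using ne(1) stabilizer_finite(1)[OF fibs(2,1)] unfolding K0_def by blast
  obtain v where v: "v \<in> Tb (bi q)" using ne by auto
  have vc: "v \<in> carrier G" using v fibs(3) by auto
  have TK: "(\<otimes>) (inv v) ` Tb (bi q) = K0"
  proof (rule card_subset_eq[OF fK])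
    show "(\<otimes>) (inv v) ` Tb (bi q) \<subseteq> K0" using diff_stabilizes_layer[OF m(2) v] by (auto simp: K0_def)
    show "card ((\<otimes>) (inv v) ` Tb (bi q)) = card K0"
      using card_translate[OF _ fibs(3)] vc K by (simp add: K0_def ti_def t_def)
  qed
  define Y where "Y = Sa (aj 1) <#> Tb (bi q)"
  have Y: "finite Y" "Y \<subseteq> carrier G" using fibs by (auto simp: Y_def finite_set_mult setmult_subset_G)
  have inv: "k \<otimes> y \<in> Y" if k: "k \<in> K0" and y: "y \<in> Y" for k y
  proof -
    obtain a b where ab: "a \<in> Sa (aj 1)" "b \<in> Tb (bi q)" "y = a \<otimes> b" using y by (auto simp: Y_def set_mult_iff)
    have c: "a \<in> carrier G" "b \<in> carrier G" "k \<in> carrier G"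
      by (rule subsetD[OF fibs(1) ab(1)], rule subsetD[OF fibs(3) ab(2)], rule subgroup.mem_carrier[OF sg k])
    have "inv v \<otimes> b \<in> K0" using TK ab by blast
    then have "k \<otimes> (inv v \<otimes> b) \<in> K0" by (rule subgroup.m_closed[OF sg k])
    then obtain b' where b': "b' \<in> Tb (bi q)" "k \<otimes> (inv v \<otimes> b) = inv v \<otimes> b'" unfolding TK[symmetric] by auto
    have b'c: "b' \<in> carrier G" using b' fibs by blast
    have "v \<otimes> (k \<otimes> (inv v \<otimes> b)) = v \<otimes> (inv v \<otimes> b')" by (simp only: b'(2))
    moreover have "v \<otimes> (k \<otimes> (inv v \<otimes> b)) = k \<otimes> b"
    proof -
      have "v \<otimes> (k \<otimes> (inv v \<otimes> b)) = k \<otimes> (v \<otimes> (inv v \<otimes> b))" using c vc by (simp add: m_lcomm)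
      then show ?thesis using c vc by simp
    qed
    ultimately have "k \<otimes> b = b'" using b'c vc by simp
    then have "k \<otimes> y = a \<otimes> b'" using ab c m_lcomm[of k a b] by simp
    then show ?thesis using ab b' by (auto simp: Y_def intro: set_multI)
  qed
  have "card K0 dvd card Y" by (rule card_dvd_invariant[OF sg Y inv])
  then have dvd: "ti q dvd mm 1 q" using K by (simp add: K0_def Y_def mm_def m_def)
  have "mm 1 q \<le> sk (q + 1)" using basic(6)[of 1 q] by simp
  then have lth: "mm 1 q < h" using nf u by simp
  have dvdh: "ti q dvd h" using stabilizer_layer(2)[of 0] lt K by simp
  then have "ti q \<le> h - mm 1 q" using dvd lth by (intro dvd_imp_le dvd_diff_nat) simp_all
  then have "mm 1 q \<le> sj 1" using e lth by linarith
  then have "mm 1 q = sj 1" using basic(7)[of q 1] q by simp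
  then show False
    using diff_not_stabilizing[OF t(1)] m(2) u by (metis One_nat_def le_Suc_eq le_zero_eq)
qed

text \<open>By \<open>large_right\<close> the critical rows have 1 + g and h - 1 elements. A set of
  h - 1 elements in a coset has no period, and this rigidity determines the rest.\<close>

lemma small_left:
  assumes q: "q < w" and p: "p < u" and nf: "sk (q + p + 1) < h" and t: "ti q = 1" "2 \<le> ti (q + 1)"
  shows essential_start
proof -
  note r = large_right[OF q p nf t(2)]
  have p0: "p = 0" by (rule r(2))
  have s: "sj 1 + 1 = h" "sj 0 = 1 + g" "sk q = sj 0" using r(3,4,5) p0 t by simp_all
  have tq: "sj 0 + ti (q + 1) \<le> h" using inner_layer(1)[OF q p nf] p0 by simp
  have h3: "3 + g \<le> h" using tq s t by linarith
  have cp: "(\<Sum>i<q. sk i - ti i) + (\<Sum>j\<le>u. sk (q + j)) + (\<Sum>i\<in>{q<..w}. sk (i + u) - ti i) = u * h + g + ti q"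
    using column_path[of q] q by simp
  have cg: "u * h + g + \<mu> \<le> (\<Sum>j\<le>u. sk (q + j))" using column_ge(1)[of q] q by simp
  have mem: "sk (q + 1 + u) - ti (q + 1) \<le> (\<Sum>i\<in>{q<..w}. sk (i + u) - ti i)"
    using member_le_sum[of "q + 1" "{q<..w}" "\<lambda>i. sk (i + u) - ti i"] q by simp
  have sk: "sk (q + 1 + u) \<le> ti (q + 1) + 1" using cp cg mem t by linarith
  have su: "sj u \<le> sk (q + 1 + u)" using basic(9)[of "q + 1" u] q by simp
  have suh: "u = 1 \<or> sj u = h" using r(6)[of u] p0 u1 by (cases "u = 1") auto
  \<comment> \<open>If not, then u = 1 and the layer behind column q + 1 is no larger than the
    second fibre of S, which thus has a period in spite of its h - 1 elements.\<close>
  have tq1: "ti (q + 1) + 1 = h"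
  proof (rule ccontr)
    assume n: "ti (q + 1) + 1 \<noteq> h"
    then have u: "u = 1" using suh sk su tq s by linarith
    have "sk (q + 2) = sj 1" using n u s su sk tq by simp
    then have "mm 1 (q + 1) = sj 1" using basic(6)[of 1 "q + 1"] basic(7)[of "q + 1" 1] q by simp
    then have m: "m (aj 1) (bi (q + 1)) = s (aj 1)" by (simp add: mm_def sj_def)
    obtain k where k: "k \<in> stabilizer G (Sa (aj 1))" "k \<noteq> \<one>"
      by (rule nontrivial_stabilizer[OF _ m]) (use t u in \<open>auto simp: ti_def\<close>)
    show False using coprime_stabilizer[OF fibs(1) fibD(1) _ k(1)] k(2) s(1) by (simp add: sj_def s_def)
  qed
  have g0: "g = 0" using tq tq1 s by linarith
  \<comment> \<open>A column before q would put the row of h - 1 elements into layer q, which has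
    one element.\<close>
  have q0: "q = 0"
  proof (rule ccontr)
    assume "q \<noteq> 0"
    then have "sj 1 \<le> sk q" using basic(9)[of "q - 1" 1] q by simp
    then show False using s g0 h3 by linarith
  qed
  have sh: "h \<le> sj u + 1" using suh s by auto
  \<comment> \<open>For i > 1 the layer i + u is no larger than the fibre of T, but has at least h -
    1 elements; so this fibre and row u overfill the coset.\<close>
  have tf: "ti i = h" if i: "1 < i" "i \<le> w" for i
  proof -
    have e: "sk (i + u) = ti i" using r(7)[of i] q0 i by simp
    moreover have "sj u \<le> sk (i + u)" using basic(9)[of i u] i by simp
    ultimately have "h < sj u + ti i" using sh h3 by linarith
    then show ?thesis using full[of u i] e i by simp
  qed
  have "{..w} = insert 0 (insert 1 {1<..w})" using w1 by auto
  then have "card T = ti 0 + (ti 1 + (\<Sum>i\<in>{1<..w}. ti i))" using sum_ti by simp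
  also have "(\<Sum>i\<in>{1<..w}. ti i) = (w - 1) * h" using tf by simp
  finally have "card T = h + (w - 1) * h" using t tq1 q0 by simp
  also have "\<dots> = w * h" using w1 by (cases w) auto
  finally have "card T = w * h" .
  moreover have "sk 1 < h" using nf q0 p0 by simp
  ultimately show ?thesis
    using r(1) g0 s t tq1 q0 by (intro essential_startI) simp_all
qed

text \<open>A layer no larger than the fibre of T makes that fibre periodic under a group of at
  least two elements, so it has neither one nor h - 1 points.\<close>

lemma ti_stabilizer:
  assumes "i \<le> w" "j \<le> u" "2 \<le> sj j" "sk (i + j) = ti i"
  shows "2 \<le> ti i" "ti i + 1 \<noteq> h"
proof -
  have m: "mm j i = ti i" using basic(6)[of j i] basic(8)[of j i] assms by simp
  have c: "card (Tb (bi i) <#> Sa (aj j)) = card (Tb (bi i))"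
    using m set_mult_comm[OF fibs(3,1)] by (simp add: mm_def m_def ti_def t_def)
  have ne: "Tb (bi i) \<noteq> {}" using Tb_ne assms(1) by auto
  have le: "2 \<le> card (stabilizer G (Tb (bi i)))"
    using card_le_stabilizer[OF fibs(4,3) ne fibs(2,1) c] assms(3) by (simp add: sj_def s_def)
  obtain z where "z \<in> Tb (bi i)" using ne by auto
  then have "card (stabilizer G (Tb (bi i))) \<le> ti i" using stabilizer_finite(2)[OF fibs(4,3)] by (simp add: ti_def t_def)
  then show "2 \<le> ti i" using le by simp
  show "ti i + 1 \<noteq> h"
  proof
    assume e: "ti i + 1 = h"
    have "stabilizer G (Tb (bi i)) \<subseteq> {\<one>}"
      using coprime_stabilizer[OF fibs(3) fibD(1), of "bi i"] e by (auto simp: ti_def t_def)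
    then have "card (stabilizer G (Tb (bi i))) \<le> card {\<one>}" by (intro card_mono) simp_all
    then show False using le by simp
  qed
qed

text \<open>The column paths through q and q + 1 bound the last and the first row by 2 - \<mu>. The
  row paths bound every row by 2, since each of the two points contributes the row less one; a row
  of two elements leaves no slack, whence the final equations. |T| \<ge> 4 provides a third
  column.\<close>

lemma small_pair:
  assumes q: "q < w" and t: "ti q = 1" "ti (q + 1) = 1"
  shows "\<mu> = 0" "2 \<le> w" "sj 0 + sj u \<le> 4" "j \<le> u \<Longrightarrow> sj j \<le> 2"
    "j \<le> u \<Longrightarrow> (sk (q + j) - 1) + (sk (q + 1 + j) - 1) + (\<Sum>i\<in>{..w} - {q} - {q + 1}. sk (i + j) - ti i) \<le> sj j"
    "j \<le> u \<Longrightarrow> sj j = 2 \<Longrightarrow> sk (q + j) = 2" "j \<le> u \<Longrightarrow> sj j = 2 \<Longrightarrow> sk (q + 1 + j) = 2"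
    "j \<le> u \<Longrightarrow> sj j = 2 \<Longrightarrow> i \<le> w \<Longrightarrow> i \<noteq> q \<Longrightarrow> i \<noteq> q + 1 \<Longrightarrow> sk (i + j) = ti i"
proof -
  have cp: "(\<Sum>i<q. sk i - ti i) + (\<Sum>j\<le>u. sk (q + j)) + (\<Sum>i\<in>{q<..w}. sk (i + u) - ti i) = u * h + g + ti q"
    using column_path[of q] q by simp
  have cg: "u * h + g + \<mu> \<le> (\<Sum>j\<le>u. sk (q + j))" using column_ge(1)[of q] q by simp
  have mem: "sk (q + 1 + u) - ti (q + 1) \<le> (\<Sum>i\<in>{q<..w}. sk (i + u) - ti i)"
    using member_le_sum[of "q + 1" "{q<..w}" "\<lambda>i. sk (i + u) - ti i"] q by simp
  have "sj u \<le> sk (q + 1 + u)" using basic(9)[of "q + 1" u] q by simp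
  then have 1: "sj u + \<mu> \<le> 2" using cp cg mem t by linarith
  have cp': "(\<Sum>i<q + 1. sk i - ti i) + (\<Sum>j\<le>u. sk (q + 1 + j)) + (\<Sum>i\<in>{q + 1<..w}. sk (i + u) - ti i) = u * h + g + ti (q + 1)"
    using column_path[of "q + 1"] q by simp
  have cg': "u * h + g + \<mu> \<le> (\<Sum>j\<le>u. sk (q + 1 + j))" using column_ge(1)[of "q + 1"] q by simp
  have mem': "sk q - ti q \<le> (\<Sum>i<q + 1. sk i - ti i)"
    using member_le_sum[of q "{..<q + 1}" "\<lambda>i. sk i - ti i"] by simp
  have "sj 0 \<le> sk q" using basic(9)[of q 0] q by simp
  then have 2: "sj 0 + \<mu> \<le> 2" using cp' cg' mem' t by linarith
  have 3: "h + g + \<mu> \<le> sj 0 + sj u" using pair_eq(1)[of 0 u] u1 by simp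
  show \<mu>: "\<mu> = 0"
  proof (rule ccontr)
    assume "\<mu> \<noteq> 0"
    then show False using 1 2 3 gmu by linarith
  qed
  show "sj 0 + sj u \<le> 4" using 1 2 by simp
  show w2: "2 \<le> w"
  proof (rule ccontr)
    assume "\<not> 2 \<le> w"
    then have w: "w = 1" "q = 0" using q by auto
    have "{..w} = {0, 1}" using w by auto
    then have "card T = 2" using sum_ti t w by simp
    moreover have "4 \<le> card T" using T4 \<mu> by linarith
    ultimately show False by simp
  qed
  define R where "R = {..w} - {q} - {q + 1}"
  have fR: "finite R" by (simp add: R_def)
  have ex: "(sk (q + j) - 1) + (sk (q + 1 + j) - 1) + (\<Sum>i\<in>R. sk (i + j) - ti i) \<le> sj j" if j: "j \<le> u" for j
  proof -
    have "(\<Sum>i\<le>w. sk (j + i) - ti i) = (sk (j + q) - ti q) + ((sk (j + (q + 1)) - ti (q + 1)) + (\<Sum>i\<in>R. sk (j + i) - ti i))"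
      unfolding R_def using q by (simp add: sum.remove[of _ q] sum.remove[of _ "q + 1"])
    moreover have "(\<Sum>i\<in>R. sk (j + i) - ti i) = (\<Sum>i\<in>R. sk (i + j) - ti i)" by (simp add: add.commute)
    moreover have "j + q = q + j" "j + (q + 1) = q + 1 + j" by simp_all
    ultimately show ?thesis using row_excess[OF j] t \<mu> by simp
  qed
  then show "j \<le> u \<Longrightarrow> (sk (q + j) - 1) + (sk (q + 1 + j) - 1) + (\<Sum>i\<in>{..w} - {q} - {q + 1}. sk (i + j) - ti i) \<le> sj j"
    unfolding R_def .
  have lo: "sj j \<le> sk (q + j)" "sj j \<le> sk (q + 1 + j)" if "j \<le> u" for j
    using basic(9)[of q j] basic(9)[of "q + 1" j] q by simp_all
  show "j \<le> u \<Longrightarrow> sj j \<le> 2" using ex[of j] lo[of j] by linarith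
  show "sk (q + j) = 2" "sk (q + 1 + j) = 2" if "j \<le> u" "sj j = 2" using ex[OF that(1)] lo[OF that(1)] that(2) by linarith+
  show "sk (i + j) = ti i" if j: "j \<le> u" "sj j = 2" "i \<le> w" "i \<noteq> q" "i \<noteq> q + 1"
  proof -
    have "(\<Sum>i\<in>R. sk (i + j) - ti i) \<le> 0" using ex[OF j(1)] lo[OF j(1)] j(2) by linarith
    then have "sk (i + j) - ti i \<le> 0" by (rule sum_diff_zero) (use j fR in \<open>auto simp: R_def\<close>)
    then show ?thesis using basic(10)[OF j(1), of i] by simp
  qed
qed

lemma exists_nonsingle_layer: "\<exists>j\<le>u. sj j \<noteq> 1"
proof (rule ccontr)
  assume "\<not> (\<exists>j\<le>u. sj j \<noteq> 1)"
  then have "(\<Sum>j\<le>u. sj j) = (\<Sum>j\<le>u. 1)" by (intro sum.cong) auto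
  then have e: "u + 1 = u * h + g + \<mu>" using sum_sj by simp
  have "u * 2 \<le> u * h" using h2 by simp
  then have "u + 1 \<le> 2" using e by linarith
  then show False using e S_card S3 by linarith
qed

text \<open>A row j \<ge> 1 of two elements makes the next fibre of T periodic, and the neighbouring
  layer limits that fibre to two points, so h \<ge> 4. Then u = 1, both rows have two elements, and
  the difference of the two points is a period of S.\<close>

lemma small_pair_right_false:
  assumes q: "q + 2 \<le> w" and t: "ti q = 1" "ti (q + 1) = 1" and h: "3 \<le> h"
  shows False
proof -
  have q1: "q < w" using q by simp
  note sp = small_pair[OF q1 t]
  have ge1: "1 \<le> sj j" if "j \<le> u" for j using basic(4)[OF that] .
  show False
  proof (cases "\<exists>j. 1 \<le> j \<and> j \<le> u \<and> sj j = 2")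
    case True
    then obtain j where j: "1 \<le> j" "j \<le> u" "sj j = 2" by blast
    have e: "sk (q + 2 + j) = ti (q + 2)" using sp(8)[OF j(2,3), of "q + 2"] q by simp
    have T2: "2 \<le> ti (q + 2)" "ti (q + 2) + 1 \<noteq> h" using ti_stabilizer[OF q j(2) _ e] j(3) by simp_all
    have "ti (q + 2) \<le> sk (q + 2 + (j - 1))" using basic(10)[of "j - 1" "q + 2"] j by simp
    also have "q + 2 + (j - 1) = q + 1 + j" using j by simp
    finally have t2: "ti (q + 2) = 2" using sp(7)[OF j(2,3)] T2(1) by simp
    have h4: "4 \<le> h" using h T2(2) t2 by linarith
    have u1': "u = 1" "sj 0 = 2" "sj 1 = 2"
    proof -
      have pe: "h + g + \<mu> \<le> sj 0 + sj u" using pair_eq(1)[of 0 u] u1 by simp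
      have s2: "sj 0 = 2" "sj u = 2" "h = 4" using pe h4 sp(4)[of 0] sp(4)[of u] by linarith+
      show "u = 1"
      proof (rule ccontr)
        assume "u \<noteq> 1"
        then have "1 < u" using u1 by simp
        then have "h \<le> sj 0 + sj 1" "sj 1 = h"
          using pair_eq(1)[of 0 1] pair_eq(2)[of 0 u 1] s2 pe by simp_all
        then show False using sp(4)[of 1] h4 u1 by linarith
      qed
      then show "sj 0 = 2" "sj 1 = 2" using s2 by simp_all
    qed
    have "mm j' (q + 2) = sj j'" if "j' \<le> u" for j'
    proof -
      have s2: "sj j' = 2" using u1' that by (cases "j' = 0") (auto simp: le_Suc_eq)
      have "sk (q + 2 + j') = 2" using sp(8)[OF that s2, of "q + 2"] q t2 by simp
      then show ?thesis using basic(6)[of j' "q + 2"] basic(7)[OF q, of j'] s2 by simp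
    qed
    then show False using diff_not_stabilizing[OF T2(1)] by blast
  next
    \<comment> \<open>Only row 0 has two elements, so h = 3 and the fibre at q + 2 is full. Its
      layer is met by row 1 in column q + 1, and the excess there is too large for a row of one
      element.\<close>
    case False
    have one: "sj j = 1" if "1 \<le> j" "j \<le> u" for j
    proof -
      have "sj j \<noteq> 2" using that False by blast
      then show ?thesis using sp(4)[OF that(2)] ge1[OF that(2)] by linarith
    qed
    have s0: "sj 0 = 2"
    proof -
      have "sj 0 \<noteq> 1" using exists_nonsingle_layer one by (metis less_one not_le)
      then show ?thesis using sp(4)[of 0] ge1[of 0] by linarith
    qed
    have pe: "h + g + \<mu> \<le> sj 0 + sj u" using pair_eq(1)[of 0 u] u1 by simp
    have h3: "h = 3" using pe one[of u] u1 s0 h by simp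
    have e: "sk (q + 2) = ti (q + 2)" using sp(8)[OF _ s0, of "q + 2"] q by simp
    have T2: "2 \<le> ti (q + 2)" "ti (q + 2) + 1 \<noteq> h" using ti_stabilizer[OF q _ _, of 0] e s0 by simp_all
    have "ti (q + 2) = 3" using T2 basic(2)[of "q + 2"] h3 by simp
    moreover have "sk (q + 1) = 2" using sp(7)[OF _ s0] by simp
    moreover have "(sk (q + 1) - 1) + (sk (q + 1 + 1) - 1) \<le> sj 1" using sp(5)[of 1] u1 by linarith
    ultimately show False using e one[of 1] u1 by simp
  qed
qed

text \<open>For h = 2 the rows p and p + 1 are points and all others full; a full row exists because
  |S| \<ge> 3, and it makes every other fibre of T full. So the layer in question is reached from no
  further position in T, which puts it at one end.\<close>

lemma small_pair_binary:
  assumes q: "q < w" and p: "p < u" and nf: "sk (q + p + 1) < h" and t: "ti q = 1" "ti (q + 1) = 1" and h: "h = 2"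
  shows "g = 0" "card T = w * h" "sj p = 1" "sj (p + 1) = 1" "p = 0 \<and> q = 0 \<or> p + 1 = u \<and> q + 1 = w"
proof -
  note sp = small_pair[OF q t]
  have ge1: "1 \<le> sj j" if "j \<le> u" for j using basic(4)[OF that] .
  have il: "sj p + ti (q + 1) \<le> h" "sj (p + 1) + ti q \<le> h" using inner_layer[OF q p nf] by auto
  have pe: "h + g + \<mu> \<le> sj p + sj (p + 1)" using pair_eq(1)[of p "p + 1"] p by simp
  show s: "g = 0" "sj p = 1" "sj (p + 1) = 1" using il pe t h by linarith+
  have others: "sj j = h" if "j \<le> u" "j \<noteq> p" "j \<noteq> p + 1" for j
    using pair_eq(2)[of p "p + 1" j] p that s h sp(1) by simp
  have "3 \<le> u * 2" using S3 S_card s(1) sp(1) h by simp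
  then have u2: "2 \<le> u" by simp
  obtain j where j: "j \<le> u" "j \<noteq> p" "j \<noteq> p + 1"
  proof (cases "p = 0")
    case True then show ?thesis using that[of 2] u2 by simp
  next
    case False then show ?thesis using that[of 0] by simp
  qed
  have s2: "sj j = 2" using others[OF j] h by simp
  have tf: "ti i = 2" if "i \<le> w" "i \<noteq> q" "i \<noteq> q + 1" for i
  proof -
    have "2 \<le> ti i" using ti_stabilizer(1)[OF that(1) j(1) _ sp(8)[OF j(1) s2 that]] s2 by simp
    then show ?thesis using basic(2)[of i] h by simp
  qed
  have "card T + 2 = (w + 1) * 2"
  proof -
    define R where "R = {..w} - {q} - {q + 1}"
    have "card R + 2 = w + 1" using q by (simp add: R_def)
    moreover have "(\<Sum>i\<le>w. ti i) = ti q + (ti (q + 1) + (\<Sum>i\<in>R. ti i))"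
      unfolding R_def using q by (simp add: sum.remove[of _ q] sum.remove[of _ "q + 1"])
    moreover have "(\<Sum>i\<in>R. ti i) = (\<Sum>i\<in>R. 2)" using tf by (intro sum.cong) (auto simp: R_def)
    ultimately show ?thesis using sum_ti t by simp
  qed
  then show "card T = w * h" using h by simp
  have nn: False if "i \<le> w" "i \<noteq> q" "i \<noteq> q + 1" "j' \<le> u" "i + j' = q + p + 1" for i j'
    using basic(10)[OF that(4), of i] tf[OF that(1-3)] that(5) nf h by simp
  have w2: "2 \<le> w" by (rule sp(2))
  show "p = 0 \<and> q = 0 \<or> p + 1 = u \<and> q + 1 = w"
  proof (cases "q + 2 \<le> w")
    case True
    have "p = 0"
    proof (rule ccontr)
      assume "p \<noteq> 0"
      then have "p - 1 \<le> u" "q + 2 + (p - 1) = q + p + 1" using p by simp_all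
      then show False using nn[of "q + 2" "p - 1"] True by simp
    qed
    moreover have "q = 0"
    proof (rule ccontr)
      assume "q \<noteq> 0"
      then have "q - 1 \<le> w" "q - 1 \<noteq> q" "q - 1 \<noteq> q + 1" "q - 1 + (p + 2) = q + p + 1" using q by simp_all
      then show False using nn[of "q - 1" "p + 2"] \<open>p = 0\<close> u2 by simp
    qed
    ultimately show ?thesis by simp
  next
    case False
    then have "q + 1 = w" "q \<noteq> 0" using q w2 by simp_all
    moreover have "p + 1 = u"
    proof (rule ccontr)
      assume "p + 1 \<noteq> u"
      then have "p + 2 \<le> u" using p by simp
      moreover have "q - 1 \<le> w" "q - 1 \<noteq> q" "q - 1 \<noteq> q + 1" "q - 1 + (p + 2) = q + p + 1"
        using \<open>q \<noteq> 0\<close> q by simp_all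
      ultimately show False using nn[of "q - 1" "p + 2"] by simp
    qed
    ultimately show ?thesis by simp
  qed
qed

lemma small_pair_start:
  assumes q: "q < w" and p: "p < u" and nf: "sk (q + p + 1) < h" and t: "ti q = 1" "ti (q + 1) = 1"
    and h: "h = 2" and z: "p = 0" "q = 0"
  shows essential_start
proof -
  note b = small_pair_binary[OF q p nf t h]
  have "sk 1 < h" using nf z by simp
  then show ?thesis
    by (rule essential_startI) (use b t h z small_pair(1)[OF q t] in simp_all)
qed

lemma inner_layer_shape:
  assumes k: "0 < k" "k < u + w" and nf: "sk k < h"
  shows "essential_start \<or> essential_end"
proof -
  interpret rev: progression_pair G Q \<phi> S T h u g \<mu> "inv\<^bsub>Q\<^esub> x" "aj u" "bi w" w by (rule reversed)
  \<comment> \<open>Any splitting k = q + p + 1 with p < u and q < w serves; this one takes p as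
    large as possible.\<close>
  define p where "p = min (u - 1) (k - 1)"
  define q where "q = k - 1 - p"
  have pq: "p < u" "q < w" "q + p + 1 = k" using k u1 w1 by (auto simp: p_def q_def)
  have nf': "sk (q + p + 1) < h" using pq nf by simp
  define p' where "p' = u - 1 - p"
  define q' where "q' = w - 1 - q"
  have a: "p' < u" "q' < w" using pq by (auto simp: p'_def q'_def)
  have e: "u + w - (q' + p' + 1) = q + p + 1" "q' + p' + 1 \<le> u + w" using pq by (auto simp: p'_def q'_def)
  have rnf: "rev.sk (q' + p' + 1) < h" using reversed_layers(3)[OF e(2)] e(1) nf' by simp
  have rt: "rev.ti q' = ti (q + 1)" "rev.ti (q' + 1) = ti q"
    using reversed_layers(2)[of q'] reversed_layers(2)[of "q' + 1"] pq by (simp_all add: q'_def)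
  have ge1: "1 \<le> ti q" "1 \<le> ti (q + 1)" using basic(5) pq by simp_all
  consider "2 \<le> ti q" "2 \<le> ti (q + 1)" | "ti q = 1" "2 \<le> ti (q + 1)" | "2 \<le> ti q" "ti (q + 1) = 1"
    | "ti q = 1" "ti (q + 1) = 1" using ge1 by linarith
  then show ?thesis
  proof cases
    case 1 then show ?thesis using both_large_false[OF pq(2,1) nf'] by blast
  next
    case 2 then show ?thesis using small_left[OF pq(2,1) nf'] by blast
  next
    case 3 then show ?thesis using rev.small_left[OF a(2,1) rnf] rt by simp
  next
    case 4
    show ?thesis
    proof (cases "h = 2")
      case True
      have "p = 0 \<and> q = 0 \<or> p + 1 = u \<and> q + 1 = w" by (rule small_pair_binary(5)[OF pq(2,1) nf' 4 True])
      then show ?thesis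
      proof
        assume "p = 0 \<and> q = 0"
        then show ?thesis using small_pair_start[OF pq(2,1) nf' 4 True] by blast
      next
        assume "p + 1 = u \<and> q + 1 = w"
        then have z: "p' = 0" "q' = 0" by (auto simp: p'_def q'_def)
        then show ?thesis using rev.small_pair_start[OF a(2,1) rnf _ _ True z] rt 4 by simp
      qed
    next
      case False
      then have h3: "3 \<le> h" using h2 by simp
      show ?thesis
      \<comment> \<open>Since w \<ge> 2, a further fibre exists on at least one side of the two
        points.\<close>
      proof (cases "q + 2 \<le> w")
        case True then show ?thesis using small_pair_right_false[OF _ 4 h3] by blast
      next
        case False
        then have "q' + 2 \<le> w" using pq small_pair(2)[OF pq(2) 4] by (simp add: q'_def)
        moreover have "rev.ti q' = 1" "rev.ti (q' + 1) = 1" using rt 4 by simp_all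
        ultimately show ?thesis using rev.small_pair_right_false[OF _ _ _ h3] by blast
      qed
    qed
  qed
qed

abbreviation "rev_periodic \<equiv> progression_pair.periodic_shape G Q \<phi> S T h u \<mu> (inv\<^bsub>Q\<^esub> x) (aj u) (bi w) w"
abbreviation "rev_essential \<equiv> progression_pair.essential_shape G Q \<phi> S T h u \<mu> (inv\<^bsub>Q\<^esub> x) (aj u) (bi w) w"

lemma reversed_reversed: "inv\<^bsub>Q\<^esub> (inv\<^bsub>Q\<^esub> x) = x"
  "progression_pair.aj Q (inv\<^bsub>Q\<^esub> x) (aj u) u = a0" "progression_pair.bi Q (inv\<^bsub>Q\<^esub> x) (bi w) w = b0"
  using reversed_eq(1)[of u u] reversed_eq(2)[of w w] xab by (simp_all add: aj_def bi_def)

theorem shapes: "periodic_shape \<or> essential_shape \<or> rev_periodic \<or> rev_essential"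
proof -
  interpret rev: progression_pair G Q \<phi> S T h u g \<mu> "inv\<^bsub>Q\<^esub> x" "aj u" "bi w" w by (rule reversed)
  show ?thesis
  proof (cases "\<exists>k. 0 < k \<and> k < u + w \<and> sk k < h")
    case True
    then obtain k where k: "0 < k" "k < u + w" "sk k < h" by blast
    then consider essential_start | essential_end using inner_layer_shape by blast
    then show ?thesis
    proof cases
      case 1
      \<comment> \<open>Reversing twice restores the original data, so an essential start is an
        essential end of the reversed pair.\<close>
      then have "rev.essential_end" unfolding reversed_reversed .
      then show ?thesis using rev.essential_if_end by blast
    next
      case 2 then show ?thesis using essential_if_end by blast
    qed
  next
    case False
    then have full: "sk k = h" if "0 < k" "k < u + w" for k
      using that basic(3)[of k] by (metis le_neq_implies_less)
    consider "sk 0 < h" "sk (u + w) < h" | "sk 0 = h" | "sk (u + w) = h"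
      using basic(3)[of 0] basic(3)[of "u + w"] by linarith
    then show ?thesis
    proof cases
      case 1 then show ?thesis using two_end_layers full by blast
    next
      case 2
      then have "sk k = h" if "k < u + w" for k using full[of k] that by (cases "k = 0") simp_all
      then show ?thesis using one_end_layer by blast
    next
      case 3
      have "rev.sk k = h" if "k < u + w" for k
      proof (cases "k = 0")
        case True then show ?thesis using reversed_layers(3)[of 0] 3 by simp
      next
        case False then show ?thesis using reversed_layers(3)[of k] full[of "u + w - k"] that by simp
      qed
      then show ?thesis using rev.one_end_layer by blast
    qed
  qed
qed

end

context comm_group
begin

subsection \<open>The critical pair of a hyper-atom\<close>

lemma coset_projection:
  assumes H: "subgroup H G" "finite H" "2 \<le> card H"
  shows "finite_fibres G (G Mod H) (\<lambda>y. H #> y) (card H)"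
    and "\<And>x. x \<in> carrier G \<Longrightarrow> {y \<in> carrier G. H #> y = H #> x} = H #> x"
proof -
  interpret N: normal H G using subgroup_imp_normal H(1) by blast
  show fib: "{y \<in> carrier G. H #> y = H #> x} = H #> x" if "x \<in> carrier G" for x
  proof (intro equalityI subsetI)
    fix y assume y: "y \<in> {y \<in> carrier G. H #> y = H #> x}"
    then have "y \<in> H #> y" using rcos_self H(1) by blast
    then show "y \<in> H #> x" using y by simp
  next
    fix y assume y: "y \<in> H #> x"
    have "y \<in> carrier G" using y r_coset_subset_G[OF subgroup.subset[OF H(1)] that] by blast
    then show "y \<in> {y \<in> carrier G. H #> y = H #> x}" using repr_independence[OF y that H(1)] by simp
  qed
  show "finite_fibres G (G Mod H) (\<lambda>y. H #> y) (card H)"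
  proof (intro finite_fibres.intro finite_fibres_axioms.intro)
    show "comm_group G" by (rule comm_group_axioms)
    show "comm_group (G Mod H)" using H(1) by (rule abelian_FactGroup)
    show "(\<lambda>y. H #> y) \<in> hom G (G Mod H)" by (rule N.r_coset_hom_Mod)
    show img: "(\<lambda>y. H #> y) ` carrier G = carrier (G Mod H)" by (simp add: carrier_FactGroup)
    fix q assume "q \<in> carrier (G Mod H)"
    then obtain y where y: "y \<in> carrier G" "q = H #> y" unfolding carrier_FactGroup by auto
    have "H #> y \<in> rcosets H" by (rule rcosetsI[OF subgroup.subset[OF H(1)] y(1)])
    then have "card (H #> y) = card H" by (rule card_rcosets_equal[OF _ subgroup.subset[OF H(1)], symmetric])
    then show "card {x \<in> carrier G. H #> x = q} = card H" unfolding y(2) fib[OF y(1)] .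
  qed (rule H(3))
qed

text \<open>H + S consists of u + 1 cosets, so the minimal boundary \<open>kappa G 2 S\<close> is u
  h, and every 2-separating set obeys the fragment inequality.\<close>

lemma critical_pair_of_hyper_atom:
  assumes \<mu>: "\<mu> \<in> {0, 1::nat}" and S: "S \<subseteq> carrier G" "finite S" "\<one> \<in> S" "generate G S = carrier G"
    and hy: "hyper_atom G S H" and T: "T \<subseteq> carrier G" "finite T"
    and S3: "3 - \<mu> \<le> card S" and T4: "max (4 - 2 * \<mu>) (card S) \<le> card T"
    and aper: "aperiodic G (S <#> T)" and cST: "card S + card T = card (S <#> T) + \<mu>"
    and size: "infinite (carrier G) \<or> 3 * card (S <#> T) \<le> 2 * order G + 2 * \<mu>"
  shows "\<exists>u g. critical_pair G (G Mod H) (\<lambda>y. H #> y) S T (card H) u g \<mu>"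
proof -
  define \<phi> where "\<phi> = (\<lambda>y. H #> y)"
  define Q where "Q = G Mod H"
  define h where "h = card H"
  have Hsg: "subgroup H G" and Hfr: "k_fragment G 2 S H"
    and Hmax: "\<And>K. subgroup K G \<Longrightarrow> k_fragment G 2 S K \<Longrightarrow> H \<subseteq> K \<Longrightarrow> K = H"
    using hy by (auto simp: hyper_atom_def)
  have Hc: "H \<subseteq> carrier G" using Hsg by (rule subgroup.subset)
  have Hsep: "H \<in> k_separating G 2 S" and Hk: "card (boundary G S H) = kappa G 2 S" using Hfr by (auto simp: k_fragment_def)
  have Hf: "finite H" "2 \<le> h" and Hx: "infinite (exterior G S H) \<or> 2 \<le> card (exterior G S H)"
    using Hsep by (auto simp: k_separating_def h_def)
  interpret F: finite_fibres G Q \<phi> h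
    unfolding Q_def \<phi>_def h_def by (rule coset_projection(1)) (use Hsg Hf in \<open>auto simp: h_def\<close>)
  have Hpre: "H = F.pre {\<one>\<^bsub>Q\<^esub>}"
  proof -
    have "F.pre {\<one>\<^bsub>Q\<^esub>} = {y \<in> carrier G. H #> y = H #> \<one>}"
      unfolding F.pre_def unfolding \<phi>_def Q_def one_FactGroup coset_mult_one[OF Hc] by simp
    also have "\<dots> = H #> \<one>" by (rule coset_projection(2)[OF Hsg Hf(1) _ one_closed]) (use Hf(2) in \<open>simp add: h_def\<close>)
    finally show ?thesis unfolding coset_mult_one[OF Hc] by (rule sym)
  qed
  define A where "A = \<phi> ` S"
  have Af: "finite A" "A \<subseteq> carrier Q" using S by (auto simp: A_def)
  have A1: "\<one>\<^bsub>Q\<^esub> \<in> A" using S(3) F.\<phi>_one unfolding A_def by (metis imageI)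
  define u where "u = card A - 1"
  have "card A \<noteq> 0" using Af A1 by auto
  then have Ac: "card A = u + 1" by (simp add: u_def)
  have "{\<one>\<^bsub>Q\<^esub>} <#>\<^bsub>Q\<^esub> A = A" unfolding F.Q.set_mult_singleton by (rule F.Q.translate_one[OF Af(2)])
  then have HS: "H <#> S = F.pre A"
    using F.pre_set_mult[of "{\<one>\<^bsub>Q\<^esub>}" S] S(1) unfolding Hpre[symmetric] A_def[symmetric] by simp
  have HSc: "card (F.pre A) = h * (u + 1)" "finite (F.pre A)" using F.card_pre[OF Af] Ac by simp_all
  have sub: "X \<subseteq> X <#> S" if "X \<subseteq> carrier G" for X
    using that S(3) by (rule subset_set_mult_one)
  have bd: "card (boundary G S X) + card X = card (X <#> S)" if "X \<subseteq> carrier G" "finite X" for X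
  proof -
    have "card ((X <#> S) - X) = card (X <#> S) - card X" by (rule card_Diff_subset[OF that(2) sub[OF that(1)]])
    moreover have "card X \<le> card (X <#> S)"
      using that S sub[OF that(1)] by (intro card_mono finite_set_mult) auto
    ultimately show ?thesis by (simp add: boundary_def)
  qed
  have kap: "kappa G 2 S = u * h"
    using bd[OF Hc Hf(1)] HS HSc Hk h_def by (simp add: algebra_simps)
  have kle: "kappa G 2 S \<le> card (boundary G S X)" if "X \<in> k_separating G 2 S" for X
    using that Hsep unfolding kappa_def by (auto intro: Least_le)
  have sepI: "X \<in> k_separating G 2 S"
    if "X \<subseteq> carrier G" "finite X" "2 \<le> card X" "infinite (carrier G) \<or> card (X <#> S) + 2 \<le> order G" for X
  proof -
    have fXS: "finite (X <#> S)" "X <#> S \<subseteq> carrier G" using that S by (auto simp: finite_set_mult setmult_subset_G)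
    have "infinite (exterior G S X) \<or> 2 \<le> card (exterior G S X)"
    proof (cases "finite (carrier G)")
      case True
      then show ?thesis using that(4) card_Diff_subset[OF fXS] by (simp add: exterior_def order_def)
    next
      case False then show ?thesis using fXS by (simp add: exterior_def Diff_infinite_finite)
    qed
    then show ?thesis using that by (simp add: k_separating_def)
  qed
  have frag: "card X + u * h \<le> card (X <#> S)"
    if "X \<subseteq> carrier G" "finite X" "2 \<le> card X" "infinite (carrier G) \<or> card (X <#> S) + 2 \<le> order G" for X
    using kle[OF sepI[OF that]] bd[OF that(1,2)] kap by linarith
  have Hext: "infinite (carrier G) \<or> h * (u + 1) + 2 \<le> order G"
  proof (cases "finite (carrier G)")
    case True
    have sc: "F.pre A \<subseteq> carrier G" by (auto simp: F.pre_def)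
    have "2 \<le> card (carrier G - F.pre A)" using Hx True by (auto simp: exterior_def HS)
    moreover have "card (carrier G - F.pre A) + card (F.pre A) = card (carrier G)"
      using card_Diff_subset[OF HSc(2) sc] card_mono[OF True sc] by simp
    ultimately show ?thesis using HSc(1) by (simp add: order_def)
  qed simp
  \<comment> \<open>For u = 0 the set S would lie in H, so H = G, and nothing would be left outside
    H + S.\<close>
  have u1: "1 \<le> u"
  proof (rule ccontr)
    assume "\<not> 1 \<le> u"
    then have "card A = 1" using Ac by simp
    then have "A = {\<one>\<^bsub>Q\<^esub>}" using A1 by (metis card_1_singletonE singletonD)
    then have "S \<subseteq> H" unfolding Hpre using S(1) by (auto simp: F.pre_def A_def)
    then have "H = carrier G" using generate_subgroup_incl[OF _ Hsg] S(4) Hc by auto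
    then have "exterior G S H = {}" using sub[OF Hc] by (auto simp: exterior_def)
    then show False using Hx by simp
  qed
  have hu: "2 * h \<le> h * (u + 1)" using u1 by (simp add: mult.commute)
  \<comment> \<open>|S| = 2 is possible only for \<mu> = 1. Then |S + S| \<le> 3, while the fragment
    inequality for S itself gives at least 2 + u h \<ge> 4.\<close>
  have cS3: "3 \<le> card S"
  proof (rule ccontr)
    assume "\<not> 3 \<le> card S"
    then have c2: "card S = 2" using S3 \<mu> by auto
    then obtain y where y: "S = {\<one>, y}" "y \<noteq> \<one>" using S(3) by (auto simp: card_2_iff)
    then have yc: "y \<in> carrier G" using S(1) by auto
    have "S <#> S = {\<one>, y, y \<otimes> y}" unfolding y(1) using yc by (auto simp: set_mult_def)
    then have c3: "card (S <#> S) \<le> 3" using card_insert_le_m1[of 3 "{y, y \<otimes> y}" \<one>] card_insert_le_m1[of 2 "{y \<otimes> y}" y] by simp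
    have "card S + u * h \<le> card (S <#> S)"
      by (rule frag[OF S(1,2)]) (use c2 c3 Hext hu Hf in linarith)+
    moreover have "h \<le> u * h" using u1 by simp
    ultimately show False using c2 c3 Hf by linarith
  qed
  have ST: "finite (S <#> T)" "S <#> T \<subseteq> carrier G" using S T by (auto simp: finite_set_mult setmult_subset_G)
  have TS: "T <#> S = S <#> T" using set_mult_comm S T by auto
  \<comment> \<open>For finite G, 2 (|G| - |S + T|) \<ge> |S + T| - 2 \<mu> \<ge> 3, so at least two
    elements lie outside.\<close>
  have ST_ext: "infinite (carrier G) \<or> card (S <#> T) + 2 \<le> order G"
    using size \<mu> cS3 T4 cST by auto
  have T2: "2 \<le> card T" using cS3 T4 by simp
  have fT: "card T + u * h \<le> card (S <#> T)" using frag[OF T T2] ST_ext by (simp add: TS)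
  \<comment> \<open>The subtraction is exact: by \<open>fT\<close>, |S| is at least u h +
    \<mu>.\<close>
  define g where "g = card S - u * h - \<mu>"
  have S_card: "card S = u * h + g + \<mu>" using fT cST by (simp add: g_def)
  have SA: "S \<subseteq> F.pre A" using S(1) by (auto simp: F.pre_def A_def)
  have gmu: "g + \<mu> < h"
  proof (rule ccontr)
    assume "\<not> g + \<mu> < h"
    then have "card (F.pre A) \<le> card S" using S_card HSc by (simp add: algebra_simps)
    then have "S = F.pre A" using SA HSc by (intro card_seteq) auto
    then have "S <#> H = S" using HS set_mult_comm[OF S(1) Hc] by simp
    then have "H \<subseteq> stabilizer G S" using set_mult_stabilizer[OF S(1) _ Hc S(2)] by blast
    then have st: "H \<subseteq> stabilizer G (S <#> T)" using stabilizer_set_mult_mono[OF S(1) T(1)] by blast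
    obtain k where "k \<in> H" "k \<noteq> \<one>"
    proof -
      have "\<not> H \<subseteq> {\<one>}" using card_mono[of "{\<one>}" H] Hf by (auto simp: h_def)
      then show ?thesis using that by blast
    qed
    then show False using periodic_if_stabilizer[OF ST(2)] st aper by blast
  qed
  \<comment> \<open>Otherwise the preimage of L would be a subgroup that is a 2-fragment and
    strictly contains H.\<close>
  have no_larger: "card L + u < card (L <#>\<^bsub>Q\<^esub> A)"
    if L: "subgroup L Q" "finite L" "2 \<le> card L" "L <#>\<^bsub>Q\<^esub> A \<noteq> carrier Q" for L
  proof (rule ccontr)
    assume "\<not> card L + u < card (L <#>\<^bsub>Q\<^esub> A)"
    then have le: "card (L <#>\<^bsub>Q\<^esub> A) \<le> card L + u" by simp
    have Lc: "L \<subseteq> carrier Q" using L(1) by (rule subgroup.subset)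
    have LA: "finite (L <#>\<^bsub>Q\<^esub> A)" "L <#>\<^bsub>Q\<^esub> A \<subseteq> carrier Q"
      using Lc L(2) Af by (auto simp: F.Q.finite_set_mult F.Q.setmult_subset_G)
    define K where "K = F.pre L"
    have Kc: "K \<subseteq> carrier G" by (auto simp: K_def F.pre_def)
    have K: "subgroup K G"
      using L(1) subgroup.one_closed[OF L(1)] subgroup.m_closed[OF L(1)] subgroup.m_inv_closed[OF L(1)]
      by (intro subgroupI) (auto simp: K_def F.pre_def intro!: exI[of _ \<one>])
    have Kf: "finite K" "card K = h * card L" using F.card_pre[OF L(2) Lc] by (auto simp: K_def)
    have K2: "2 * h \<le> card K" using L(3) Kf by simp
    have KS: "K <#> S = F.pre (L <#>\<^bsub>Q\<^esub> A)" unfolding K_def A_def by (rule F.pre_set_mult[OF Lc S(1)])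
    have KSc: "card (K <#> S) = h * card (L <#>\<^bsub>Q\<^esub> A)" using F.card_pre[OF LA] KS by simp
    have ext: "infinite (carrier G) \<or> card (K <#> S) + 2 \<le> order G"
    proof (rule disjCI)
      assume n: "\<not> card (K <#> S) + 2 \<le> order G"
      show "infinite (carrier G)"
      proof
        assume fin: "finite (carrier G)"
        have "card (L <#>\<^bsub>Q\<^esub> A) < card (carrier Q)"
          using LA L(4) F.finite_Q[OF fin] by (intro psubset_card_mono) auto
        then have "h * (card (L <#>\<^bsub>Q\<^esub> A) + 1) \<le> h * card (carrier Q)" by (intro mult_le_mono2) simp
        then show False using n KSc F.order_G[OF fin] Hf by simp
      qed
    qed
    have sep: "K \<in> k_separating G 2 S" by (rule sepI[OF Kc Kf(1) _ ext]) (use K2 Hf in linarith)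
    have "h * card (L <#>\<^bsub>Q\<^esub> A) \<le> h * (card L + u)" using le by (rule mult_le_mono2)
    then have "card (boundary G S K) \<le> u * h" using bd[OF Kc Kf(1)] KSc Kf(2) by (simp add: algebra_simps)
    then have "k_fragment G 2 S K" using kle[OF sep] kap sep by (simp add: k_fragment_def)
    moreover have "H \<subseteq> K" using subgroup.one_closed[OF L(1)] by (subst Hpre) (auto simp: K_def F.pre_def)
    ultimately have "K = H" using Hmax K by blast
    then show False using K2 Hf by (simp add: h_def)
  qed
  have gen: "generate Q A = carrier Q"
  proof -
    interpret gh: group_hom G Q \<phi> by unfold_locales (rule F.hom)
    show ?thesis using gh.generate_img[OF S(1)] S(4) F.onto by (simp add: A_def)
  qed
  have "critical_pair G Q \<phi> S T h u g \<mu>"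
  proof (unfold_locales)
    show "card (S <#> T) = card T + u * h + g" using cST S_card by simp
    show "card (\<phi> ` S) = u + 1" "generate Q (\<phi> ` S) = carrier Q" using Ac gen by (simp_all add: A_def)
    show "\<mu> \<le> 1" "4 - 2 * \<mu> \<le> card T" "card S \<le> card T" using \<mu> T4 by auto
    show "card L + u < card (L <#>\<^bsub>Q\<^esub> (\<phi> ` S))"
      if "subgroup L Q" "finite L" "2 \<le> card L" "L <#>\<^bsub>Q\<^esub> (\<phi> ` S) \<noteq> carrier Q" for L
      using no_larger[of L] that by (simp add: A_def)
  qed (fact u1 S T S_card cS3 gmu aper ST_ext size frag)+
  then show ?thesis unfolding Q_def \<phi>_def h_def by blast
qed

end

subsection \<open>The conclusions in the original group\<close>

context comm_group
begin

lemma pointed_translate_coset: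
  assumes K: "subgroup K G" and y: "y \<in> carrier G" and Y: "Y \<in> pointed_translates G ((\<lambda>z. y \<otimes> z) ` K)"
  shows "Y = K"
proof -
  obtain v where v: "v \<in> carrier G" "Y = (\<lambda>z. y \<otimes> z) ` K #> v" "\<one> \<in> (\<lambda>z. y \<otimes> z) ` K #> v"
    using Y by (auto simp: pointed_translates_def)
  have Kc: "K \<subseteq> carrier G" using K by (rule subgroup.subset)
  have e: "(\<lambda>z. y \<otimes> z) ` K #> v = K #> (y \<otimes> v)"
    using Kc y v(1) by (auto simp: r_coset_def subset_iff m_ac)
  have "K #> (y \<otimes> v) = K #> \<one>" using repr_independence[OF _ _ K, of \<one> "y \<otimes> v"] v y e by simp
  then show ?thesis using e v coset_mult_one[OF Kc] by simp
qed

text \<open>Translating T changes no |X + T|, so the count can be made for T itself. The set of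
  \<one> and k is 2-separating with boundary 3, and \<open>lower\<close> is the matching
  bound.\<close>

lemma kappa_pointed_translate:
  assumes o: "order G = 12" and T: "T \<subseteq> carrier G" "finite T"
    and k: "k \<in> carrier G" "card (T \<union> (\<lambda>z. k \<otimes> z) ` T) = 5" "card T = 4"
    and lower: "\<And>X. X \<subseteq> carrier G \<Longrightarrow> finite X \<Longrightarrow> X \<noteq> {} \<Longrightarrow> card (X <#> T) + 2 \<le> 12 \<Longrightarrow> card X + 3 \<le> card (X <#> T)"
    and T': "T' \<in> pointed_translates G T"
  shows "kappa G 2 T' = 3"
proof -
  obtain v where v: "v \<in> carrier G" "T' = T #> v" "\<one> \<in> T'" using T' by (auto simp: pointed_translates_def)
  have fin: "finite (carrier G)" using o by (auto simp: order_def intro: card_ge_0_finite)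
  have T'c: "T' \<subseteq> carrier G" using v T r_coset_subset_G by simp
  have XT: "card (X <#> T') = card (X <#> T)" if X: "X \<subseteq> carrier G" for X
  proof -
    have Te: "T' = (\<lambda>z. v \<otimes> z) ` T" unfolding v(2) using T v(1) m_comm by (auto simp: r_coset_def subset_iff)
    have XTc: "X <#> T \<subseteq> carrier G" using X T by (simp add: setmult_subset_G)
    have "X <#> T' = T' <#> X" using X T'c by (rule set_mult_comm)
    also have "\<dots> = (\<lambda>z. v \<otimes> z) ` (T <#> X)" unfolding Te by (rule set_mult_translate[OF v(1) T(1) X])
    also have "T <#> X = X <#> T" using T(1) X by (rule set_mult_comm)
    finally show ?thesis using card_translate[OF v(1) XTc] by simp
  qed
  have bd: "card (boundary G T' X) + card X = card (X <#> T)" "card (exterior G T' X) + card (X <#> T) = 12"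
    if X: "X \<subseteq> carrier G" for X
  proof -
    have fX: "finite X" using X fin finite_subset by blast
    have sub: "X \<subseteq> X <#> T'" using X v(3) by (rule subset_set_mult_one)
    have c: "X <#> T' \<subseteq> carrier G" using X T'c by (simp add: setmult_subset_G)
    have f: "finite (X <#> T')" using c fin finite_subset by blast
    show "card (boundary G T' X) + card X = card (X <#> T)"
      using card_Diff_subset[OF fX sub] card_mono[OF f sub] XT[OF X] by (simp add: boundary_def)
    show "card (exterior G T' X) + card (X <#> T) = 12"
      using card_Diff_subset[OF f c] card_mono[OF fin c] XT[OF X] o by (simp add: exterior_def order_def)
  qed
  have sep: "X \<in> k_separating G 2 T' \<longleftrightarrow> X \<subseteq> carrier G \<and> 2 \<le> card X \<and> card (X <#> T) + 2 \<le> 12" for X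
  proof -
    have "finite (exterior G T' X)" using fin by (simp add: exterior_def)
    then show ?thesis using bd(2)[of X] finite_subset[OF _ fin, of X] by (auto simp: k_separating_def)
  qed
  define X0 where "X0 = {\<one>, k}"
  have k1: "k \<noteq> \<one>" using k translate_one[OF T(1)] by auto
  have X0c: "X0 \<subseteq> carrier G" using k by (simp add: X0_def)
  have "X0 <#> T = T \<union> (\<lambda>z. k \<otimes> z) ` T" using T translate_one[OF T(1)] unfolding X0_def by (auto simp: set_mult_def)
  then have c0: "card (X0 <#> T) = 5" using k by simp
  have X0s: "X0 \<in> k_separating G 2 T'" unfolding sep using X0c c0 k1 by (simp add: X0_def)
  have b0: "card (boundary G T' X0) = 3" using bd(1)[OF X0c] c0 k1 by (simp add: X0_def)
  have "(LEAST n. \<exists>X \<in> k_separating G 2 T'. n = card (boundary G T' X)) = 3"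
  proof (rule Least_equality)
    show "\<exists>X \<in> k_separating G 2 T'. 3 = card (boundary G T' X)" using X0s b0 by force
    fix n assume "\<exists>X \<in> k_separating G 2 T'. n = card (boundary G T' X)"
    then obtain X where X: "X \<in> k_separating G 2 T'" "n = card (boundary G T' X)" by blast
    then have Xp: "X \<subseteq> carrier G" "2 \<le> card X" "card (X <#> T) + 2 \<le> 12" unfolding sep by auto
    have "finite X" using Xp(1) fin finite_subset by blast
    moreover have "X \<noteq> {}" using Xp(2) by auto
    ultimately have "card X + 3 \<le> card (X <#> T)" using lower Xp by blast
    then show "3 \<le> n" using bd(1)[OF Xp(1)] X(2) by linarith
  qed
  then show ?thesis using X0s by (auto simp: kappa_def)
qed

end

locale coset_progression = progression_pair G "G Mod H" "\<lambda>y. H #>\<^bsub>G\<^esub> y" S T "card H" u g \<mu> x a0 b0 w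
  for G :: "('a, 'b) monoid_scheme" (structure) and H S T u g \<mu> x a0 b0 w +
  assumes H: "subgroup H G"
begin

lemma Hc: "H \<subseteq> carrier G" using H by (rule subgroup.subset)

lemma coset_iff:
  assumes c: "c \<in> carrier (G Mod H)" and y: "y \<in> carrier G"
  shows "H #> y = c \<longleftrightarrow> y \<in> c"
proof -
  obtain z where z: "z \<in> carrier G" "c = H #> z" using c unfolding carrier_FactGroup by auto
  show ?thesis
  proof
    assume "H #> y = c" then show "y \<in> c" using rcos_self[OF y H] by simp
  next
    assume "y \<in> c" then show "H #> y = c" using repr_independence[OF _ z(1) H, of y] z(2) by simp
  qed
qed

lemma mult_H: "X \<subseteq> carrier G \<Longrightarrow> X <#> H = pre ((\<lambda>y. H #> y) ` X)"
proof (intro equalityI subsetI)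
  fix z assume X: "X \<subseteq> carrier G" and "z \<in> X <#> H"
  then obtain y k where yk: "y \<in> X" "k \<in> H" "z = y \<otimes> k" by (auto simp: set_mult_iff)
  then have c: "y \<in> carrier G" "k \<in> carrier G" using X Hc by auto
  have "z \<in> H #> y" using rcosI[OF yk(2) Hc c(1)] yk(3) m_comm[OF c] by simp
  then have "H #> z = H #> y" using repr_independence[OF _ c(1) H] by simp
  then show "z \<in> pre ((\<lambda>y. H #> y) ` X)" using yk c by (auto simp: pre_def)
next
  fix z assume X: "X \<subseteq> carrier G" and "z \<in> pre ((\<lambda>y. H #> y) ` X)"
  then obtain y where y: "z \<in> carrier G" "y \<in> X" "H #> z = H #> y" by (auto simp: pre_def)
  then have yc: "y \<in> carrier G" using X by auto
  have "z \<in> H #> y" using rcos_self[OF y(1) H] y(3) by simp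
  then obtain k where k: "k \<in> H" "z = k \<otimes> y" by (auto simp: r_coset_def)
  then have "z = y \<otimes> k" using m_comm[of k y] yc Hc by auto
  then show "z \<in> X <#> H" using y(2) k(1) by (auto intro: set_multI)
qed

lemma pre_periodic: "H_periodic G H (pre U)"
proof -
  have "pre U \<subseteq> carrier G" by (auto simp: pre_def)
  moreover have "pre ((\<lambda>y. H #> y) ` pre U) = pre U" by (auto simp: pre_def)
  ultimately show ?thesis by (simp add: H_periodic_def mult_H)
qed

lemma fib_mult_H:
  assumes "X \<subseteq> carrier G" "c \<in> carrier (G Mod H)" "fib (\<lambda>y. H #> y) X c \<noteq> {}"
  shows "fib (\<lambda>y. H #> y) X c <#> H = c"
proof -
  have "fib (\<lambda>y. H #> y) X c \<subseteq> carrier G" using assms(1) by (auto simp: fib_def)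
  moreover have "(\<lambda>y. H #> y) ` fib (\<lambda>y. H #> y) X c = {c}" using assms(3) by (auto simp: fib_def)
  ultimately have "fib (\<lambda>y. H #> y) X c <#> H = pre {c}" by (simp add: mult_H)
  also have "\<dots> = c"
  proof -
    have "c \<subseteq> carrier G" using assms(2) Hc r_coset_subset_G unfolding carrier_FactGroup by auto
    then show ?thesis using coset_iff[OF assms(2)] by (auto simp: pre_def)
  qed
  finally show ?thesis .
qed

lemma progression:
  fixes c :: "nat \<Rightarrow> 'a set"
  assumes X: "X \<subseteq> carrier G" and img: "(\<lambda>y. H #> y) ` X = c ` {..n}" and inj: "inj_on c {..n}"
    and cc: "\<And>i. c i \<in> carrier (G Mod H)" and step: "\<And>i. c i \<otimes>\<^bsub>G Mod H\<^esub> x = c (Suc i)"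
  shows "H_progression G H x X n (\<lambda>i. fib (\<lambda>y. H #> y) X (c i))"
proof -
  have ne: "fib (\<lambda>y. H #> y) X (c i) \<noteq> {}" if "i \<le> n" for i
  proof -
    have "c i \<in> (\<lambda>y. H #> y) ` X" unfolding img using that by simp
    then show ?thesis by (auto simp: fib_def)
  qed
  have "H_decomposition G H X {..n} (\<lambda>i. fib (\<lambda>y. H #> y) X (c i))"
    unfolding H_decomposition_def
  proof (intro conjI ballI)
    show "X = (\<Union>i\<in>{..n}. fib (\<lambda>y. H #> y) X (c i))"
    proof (intro equalityI subsetI)
      fix y assume y: "y \<in> X"
      then have "H #> y \<in> c ` {..n}" unfolding img[symmetric] by simp
      then show "y \<in> (\<Union>i\<in>{..n}. fib (\<lambda>y. H #> y) X (c i))" using y by (auto simp: fib_def)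
    qed (auto simp: fib_def)
    show "disjoint_family_on (\<lambda>i. fib (\<lambda>y. H #> y) X (c i)) {..n}"
      using inj by (auto simp: disjoint_family_on_def fib_def inj_on_def)
    fix i assume "i \<in> {..n}"
    then show "fib (\<lambda>y. H #> y) X (c i) \<noteq> {}" using ne by simp
    have "c i \<in> rcosets H" using cc[of i] by (simp add: FactGroup_def)
    moreover have "fib (\<lambda>y. H #> y) X (c i) = c i \<inter> X"
      using coset_iff[OF cc[of i]] X by (auto simp: fib_def)
    ultimately show "\<exists>C\<in>rcosets H. fib (\<lambda>y. H #> y) X (c i) = C \<inter> X" by blast
  qed
  moreover have "fib (\<lambda>y. H #> y) X (c i) <#> H = c i" if "i \<le> n" for i
    using fib_mult_H[OF X cc ne[OF that]] .
  ultimately show ?thesis unfolding H_progression_def using step xab(1) by simp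
qed

lemma progressions:
  "H_progression G H x S u (\<lambda>j. Sa (aj j))" "H_progression G H x T w (\<lambda>i. Tb (bi i))"
proof -
  show "H_progression G H x S u (\<lambda>j. Sa (aj j))"
    by (rule progression[OF S(1) A_img inj_a]) (use xab in \<open>simp_all add: aj_def Q.m_assoc del: mult_FactGroup\<close>)
  show "H_progression G H x T w (\<lambda>i. Tb (bi i))"
    by (rule progression[OF T(1) B_img inj_b]) (use xab in \<open>simp_all add: bi_def Q.m_assoc del: mult_FactGroup\<close>)
qed

lemma card_mult_H: "card (S <#> H) = (u + 1) * card H" "card (T <#> H) = (w + 1) * card H"
  using mult_H[OF S(1)] mult_H[OF T(1)] card_pre(2)[OF A_props(1,2)] card_pre(2)[OF B_props(1,2)] A_card B_card
  by simp_all

text \<open>The periodic set is the preimage of the first n cosets; the deleted elements are those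
  that \<open>X\<close> lacks there.\<close>

lemma without_last:
  fixes c :: "nat \<Rightarrow> 'a set"
  assumes X: "X \<subseteq> carrier G" "finite X" and img: "(\<lambda>y. H #> y) ` X = c ` {..n}" and inj: "inj_on c {..n}"
    and cc: "\<And>i. c i \<in> carrier (G Mod H)"
    and sum: "(\<Sum>i<n. card H - card (fib (\<lambda>y. H #> y) X (c i))) = k"
  shows "periodic_minus G H k (X - fib (\<lambda>y. H #> y) X (c n))"
    and "k = 0 \<Longrightarrow> H_periodic G H (X - fib (\<lambda>y. H #> y) X (c n))"
proof -
  define X' where "X' = X - fib (\<lambda>y. H #> y) X (c n)"
  define P where "P = pre (c ` {..<n})"
  have e: "X' = (\<Union>i\<in>{..<n}. fib (\<lambda>y. H #> y) X (c i))"
  proof (intro equalityI subsetI)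
    fix y assume y: "y \<in> X'"
    then have "H #> y \<in> c ` {..n}" unfolding img[symmetric] by (auto simp: X'_def)
    then obtain i where "i \<le> n" "H #> y = c i" by auto
    moreover have "i \<noteq> n" using y calculation by (auto simp: X'_def fib_def)
    ultimately show "y \<in> (\<Union>i\<in>{..<n}. fib (\<lambda>y. H #> y) X (c i))" using y by (auto simp: X'_def fib_def)
  next
    fix y assume "y \<in> (\<Union>i\<in>{..<n}. fib (\<lambda>y. H #> y) X (c i))"
    then obtain i where i: "i < n" "y \<in> X" "H #> y = c i" by (auto simp: fib_def)
    have "c i \<noteq> c n" using inj_onD[OF inj, of i n] i by auto
    then show "y \<in> X'" using i by (auto simp: X'_def fib_def)
  qed
  have ff: "finite (fib (\<lambda>y. H #> y) X (c i))" for i using X by (simp add: fib_def)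
  have "card X' = (\<Sum>i<n. card (fib (\<lambda>y. H #> y) X (c i)))"
    unfolding e
  proof (rule card_UN_disjoint)
    show "\<forall>i\<in>{..<n}. \<forall>j\<in>{..<n}. i \<noteq> j \<longrightarrow> fib (\<lambda>y. H #> y) X (c i) \<inter> fib (\<lambda>y. H #> y) X (c j) = {}"
      using inj by (auto simp: fib_def inj_on_def)
  qed (use ff in auto)
  moreover have "(\<Sum>i<n. card H - card (fib (\<lambda>y. H #> y) X (c i))) + (\<Sum>i<n. card (fib (\<lambda>y. H #> y) X (c i))) = n * card H"
    unfolding sum.distrib[symmetric] using fib_le[OF X(1) cc] by simp
  ultimately have cX: "k + card X' = n * card H" using sum by simp
  have "card (c ` {..<n}) = n"
    using card_image[OF inj_on_subset[OF inj, of "{..<n}"]] by (simp add: subset_iff)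
  then have P: "finite P" "card P = card H * n" using card_pre[of "c ` {..<n}"] cc by (auto simp: P_def)
  have sub: "X' \<subseteq> P" using X(1) by (auto simp: e P_def pre_def fib_def)
  have "card (P - X') = k"
    using card_Diff_subset[OF finite_subset[OF sub P(1)] sub] P(2) cX by (simp add: mult.commute)
  moreover have "X' = P - (P - X')" using sub by blast
  ultimately have "periodic_minus G H k X'"
    unfolding periodic_minus_def using P(1) pre_periodic[of "c ` {..<n}"]
    by (intro exI[of _ P] exI[of _ "P - X'"]) (auto simp: P_def)
  then show "periodic_minus G H k (X - fib (\<lambda>y. H #> y) X (c n))" by (simp add: X'_def)
  assume "k = 0"
  then have "P - X' = {}" using \<open>card (P - X') = k\<close> P(1) by simp
  then have "X' = P" using sub by blast
  then show "H_periodic G H (X - fib (\<lambda>y. H #> y) X (c n))" using pre_periodic by (simp add: X'_def P_def)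
qed

lemma periodic_conclusion:
  assumes periodic_shape
  shows "\<exists>d u t Ss Ts \<nu>.
        H_progression G H d S u Ss \<and> H_progression G H d T t Ts \<and>
        \<nu> \<le> 1 - \<mu> \<and>
        ((H_periodic G H (S - Ss u) \<and> periodic_minus G H \<nu> (T - Ts t)) \<or>
         (H_periodic G H (T - Ts t) \<and> periodic_minus G H \<nu> (S - Ss u))) \<and>
        card (Ts t <#> Ss u) + \<nu> + \<mu> = card (Ts t) + card (Ss u) \<and>
        card (T <#> H) + \<mu> \<le> card T + card H"
proof -
  obtain \<nu> where \<nu>: "\<nu> \<le> 1 - \<mu>"
    "(\<forall>j<u. sj j = card H) \<and> (\<Sum>i<w. card H - ti i) = \<nu> \<or> (\<forall>i<w. ti i = card H) \<and> (\<Sum>j<u. card H - sj j) = \<nu>"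
    "mm u w + \<nu> + \<mu> = sj u + ti w" "(w + 1) * card H + \<mu> \<le> card T + card H"
    using assms unfolding periodic_shape_def by blast
  have TS: "card (Tb (bi w) <#> Sa (aj u)) = mm u w"
    using set_mult_comm[OF fibs(3,1)] by (simp add: mm_def m_def)
  have alt: "(H_periodic G H (S - Sa (aj u)) \<and> periodic_minus G H \<nu> (T - Tb (bi w))) \<or>
         (H_periodic G H (T - Tb (bi w)) \<and> periodic_minus G H \<nu> (S - Sa (aj u)))"
    using \<nu>(2)
  proof (elim disjE conjE)
    assume a: "\<forall>j<u. sj j = card H" "(\<Sum>i<w. card H - ti i) = \<nu>"
    have "H_periodic G H (S - Sa (aj u))"
      by (rule without_last(2)[OF S A_img inj_a closed(1) _ refl]) (use a(1) in \<open>simp add: sj_def s_def\<close>)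
    moreover have "periodic_minus G H \<nu> (T - Tb (bi w))"
      by (rule without_last(1)[OF T B_img inj_b closed(2)]) (use a(2) in \<open>simp add: ti_def t_def\<close>)
    ultimately show ?thesis by blast
  next
    assume a: "\<forall>i<w. ti i = card H" "(\<Sum>j<u. card H - sj j) = \<nu>"
    have "H_periodic G H (T - Tb (bi w))"
      by (rule without_last(2)[OF T B_img inj_b closed(2) _ refl]) (use a(1) in \<open>simp add: ti_def t_def\<close>)
    moreover have "periodic_minus G H \<nu> (S - Sa (aj u))"
      by (rule without_last(1)[OF S A_img inj_a closed(1)]) (use a(2) in \<open>simp add: sj_def s_def\<close>)
    ultimately show ?thesis by blast
  qed
  have "card (Tb (bi w) <#> Sa (aj u)) + \<nu> + \<mu> = card (Tb (bi w)) + card (Sa (aj u))"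
    using \<nu>(3) TS by (simp add: sj_def s_def ti_def t_def)
  moreover have "card (T <#> H) + \<mu> \<le> card T + card H" using \<nu>(4) card_mult_H by simp
  ultimately show ?thesis using progressions \<nu>(1) alt by blast
qed

lemma essential_conclusion:
  assumes essential_shape
  shows "\<mu> = 0 \<and> H_essential_pair G H S T"
proof -
  have N: "N = H"
  proof -
    have "N = {y \<in> carrier G. H #> y = H}" by (simp add: N_def)
    also have "\<dots> = H" using coset_join1[OF _ _ H] coset_join2[OF _ H] Hc by auto
    finally show ?thesis .
  qed
  have e: "\<mu> = 0" "card S = u * card H" "card T = w * card H" using assms unfolding essential_shape_def by auto
  have c: "card (S <#> H) = card S + card H" "card (T <#> H) = card T + card H" using card_mult_H e by simp_all
  have uw: "0 < u" "0 < w" using u1 w1 by simp_all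
  have pt: "\<forall>Y\<in>pointed_translates G Z. Y = K" if "subgroup K G" "\<exists>y\<in>carrier G. Z = (\<lambda>z. y \<otimes> z) ` K" for K Z
    using pointed_translate_coset[OF that(1)] that(2) by blast
  have shape: "(card H = 2 \<and> card (Sa (aj 0)) = 1 \<and> card (Sa (aj u)) = 1 \<and> card (Tb (bi 0)) = 1 \<and> card (Tb (bi w)) = 1) \<or>
         (0 < u \<and> 0 < w \<and> card (Sa (aj u)) = 1 \<and> card (Tb (bi w)) = 1 \<and>
          card (Sa (aj (u - 1))) + 1 = card H \<and> card (Tb (bi (w - 1))) + 1 = card H \<and>
          Tb (bi (w - 1)) <#> Sa (aj u) = Tb (bi w) <#> Sa (aj (u - 1))) \<or>
         (\<exists>K0 K1. subgroup K0 G \<and> subgroup K1 G \<and> card K0 = 2 \<and> card K1 = 2 \<and>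
            internal_direct_sum G H K0 K1 \<and>
            (\<forall>Y \<in> pointed_translates G (Sa (aj 0)). Y = K0) \<and>
            (\<forall>Y \<in> pointed_translates G (Tb (bi 0)). Y = K0) \<and>
            (\<forall>Y \<in> pointed_translates G (Sa (aj u)). Y = K1) \<and>
            (\<forall>Y \<in> pointed_translates G (Tb (bi w)). Y = K1))"
    using assms unfolding essential_shape_def
  proof (elim conjE disjE exE)
    fix K0 K1
    assume K: "subgroup K0 G" "subgroup K1 G" "card K0 = 2" "card K1 = 2" "N = K0 <#> K1" "K0 \<inter> K1 = {\<one>}"
      "\<exists>y\<in>carrier G. Sa (aj 0) = (\<lambda>z. y \<otimes> z) ` K0" "\<exists>y\<in>carrier G. Tb (bi 0) = (\<lambda>z. y \<otimes> z) ` K0"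
      "\<exists>y\<in>carrier G. Sa (aj u) = (\<lambda>z. y \<otimes> z) ` K1" "\<exists>y\<in>carrier G. Tb (bi w) = (\<lambda>z. y \<otimes> z) ` K1"
    have ids: "internal_direct_sum G H K0 K1" using K(5,6) N by (simp add: internal_direct_sum_def)
    note pts = pt[OF K(1,7)] pt[OF K(1,8)] pt[OF K(2,9)] pt[OF K(2,10)]
    show ?thesis
      by (rule disjI2, rule disjI2, rule exI, rule exI, rule conjI[OF K(1)], rule conjI[OF K(2)], rule conjI[OF K(3)],
        rule conjI[OF K(4)], rule conjI[OF ids], rule conjI[OF pts(1)], rule conjI[OF pts(2)], rule conjI[OF pts(3,4)])
  qed (use uw in \<open>simp_all add: sj_def s_def ti_def t_def\<close>)
  have "H_essential_pair G H S T"
    unfolding H_essential_pair_def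
    by (rule exI[of _ x], rule exI[of _ u], rule exI[of _ w], rule exI[of _ "\<lambda>j. Sa (aj j)"],
      rule exI[of _ "\<lambda>i. Tb (bi i)"], intro conjI progressions c shape)
  then show ?thesis using e(1) by simp
qed

end

lemma (in tight_pair) progression:
  obtains x a0 b0 w where "progression_pair G Q \<phi> S T h u g \<mu> x a0 b0 w"
proof -
  obtain x where x: "x \<in> carrier Q" "generate Q {x} = carrier Q"
    and bd: "card ((\<lambda>y. x \<otimes>\<^bsub>Q\<^esub> y) ` A - A) = 1" "card ((\<lambda>y. x \<otimes>\<^bsub>Q\<^esub> y) ` B - B) = 1"
    using same_difference by blast
  obtain a0 where a: "a0 \<in> carrier Q" "A = (\<lambda>i. a0 \<otimes>\<^bsub>Q\<^esub> x [^]\<^bsub>Q\<^esub> i) ` {..<card A}"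
    using Q.progression_of_boundary[OF A_props(1,2) x bd(1)] by metis
  obtain b0 where b: "b0 \<in> carrier Q" "B = (\<lambda>i. b0 \<otimes>\<^bsub>Q\<^esub> x [^]\<^bsub>Q\<^esub> i) ` {..<card B}"
    using Q.progression_of_boundary[OF B_props(1,2) x bd(2)] by metis
  have w: "card B = (card B - 1) + 1" "1 \<le> card B - 1" using B2 by simp_all
  have il: "{..<n + 1} = {..n}" for n :: nat by auto
  have a': "A = (\<lambda>i. a0 \<otimes>\<^bsub>Q\<^esub> x [^]\<^bsub>Q\<^esub> i) ` {..u}" using a(2) unfolding A_card il .
  have b': "B = (\<lambda>i. b0 \<otimes>\<^bsub>Q\<^esub> x [^]\<^bsub>Q\<^esub> i) ` {..card B - 1}" using b(2) w(1) il by metis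
  have "progression_pair G Q \<phi> S T h u g \<mu> x a0 b0 (card B - 1)"
  proof (intro progression_pair.intro progression_pair_axioms.intro)
    show "critical_pair G Q \<phi> S T h u g \<mu>" by (rule critical_pair_axioms)
    show "card C = u + (card B - 1) + 1" using tight w by linarith
  qed (fact x(1) a(1) b(1) w a' b')+
  then show ?thesis by (rule that)
qed

theorem theorem1:
  fixes G :: "('a, 'b) monoid_scheme" and S T H :: "'a set" and \<mu> :: nat
  assumes "comm_group G"
    and "\<mu> \<in> {0, 1}"
    and "S \<subseteq> carrier G" and "finite S" and "\<one>\<^bsub>G\<^esub> \<in> S" and "generate G S = carrier G"
    and "degenerate G S"
    and "hyper_atom G S H"
    and "T \<subseteq> carrier G" and "finite T"
    and "3 - \<mu> \<le> card S"
    and "max (4 - 2 * \<mu>) (card S) \<le> card T"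
    and "aperiodic G (S <#>\<^bsub>G\<^esub> T)"
    and "card S + card T = card (S <#>\<^bsub>G\<^esub> T) + \<mu>"
    and "infinite (carrier G) \<or> 3 * card (S <#>\<^bsub>G\<^esub> T) \<le> 2 * order G + 2 * \<mu>"
  shows
    "(\<mu> = 0 \<and> order G = 12 \<and> 3 * card S = 12 \<and> 3 * card T = 12 \<and>
        (\<forall>T' \<in> pointed_translates G T. 4 * kappa G 2 T' = 12)) \<or>
     (\<mu> = 0 \<and> H_essential_pair G H S T) \<or>
     (\<exists>d u t Ss Ts \<nu>.
        H_progression G H d S u Ss \<and> H_progression G H d T t Ts \<and>
        \<nu> \<le> 1 - \<mu> \<and>
        ((H_periodic G H (S - Ss u) \<and> periodic_minus G H \<nu> (T - Ts t)) \<or>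
         (H_periodic G H (T - Ts t) \<and> periodic_minus G H \<nu> (S - Ss u))) \<and>
        card (Ts t <#>\<^bsub>G\<^esub> Ss u) + \<nu> + \<mu> = card (Ts t) + card (Ss u) \<and>
        card (T <#>\<^bsub>G\<^esub> H) + \<mu> \<le> card T + card H)"
proof -
  interpret comm_group G by (rule assms(1))
  have Hsg: "subgroup H G" using assms(8) by (simp add: hyper_atom_def)
  obtain u g where cp: "critical_pair G (G Mod H) (\<lambda>y. H #>\<^bsub>G\<^esub> y) S T (card H) u g \<mu>"
    using critical_pair_of_hyper_atom[OF assms(2-6,8-15)] by blast
  interpret P: critical_pair G "G Mod H" "\<lambda>y. H #>\<^bsub>G\<^esub> y" S T "card H" u g \<mu> by (rule cp)
  show ?thesis
  \<comment> \<open>Either |A + B| falls below |A| + |B| - 1, or equality holds by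
    \<open>C_le\<close>.\<close>
  proof (cases "card P.C < card P.B + u")
    case True
    interpret O: overfull_pair G "G Mod H" "\<lambda>y. H #>\<^bsub>G\<^esub> y" S T "card H" u g \<mu>
      "card (carrier (G Mod H))" "card P.B + u - card (carrier (G Mod H))"
    proof (intro overfull_pair.intro overfull_pair_axioms.intro cp refl True)
      show "card P.B + u = card (carrier (G Mod H)) + (card P.B + u - card (carrier (G Mod H)))"
        using True P.C_ge by auto
    qed
    note ex = O.exceptional
    obtain k where k: "k \<in> carrier G" "card (T \<union> (\<lambda>z. k \<otimes>\<^bsub>G\<^esub> z) ` T) = 5" using ex(5) by blast
    have "\<forall>T' \<in> pointed_translates G T. 4 * kappa G 2 T' = 12"
      using kappa_pointed_translate[OF ex(2) P.T k ex(4,6)] by simp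
    then show ?thesis using ex(1-4) by simp
  next
    case False
    interpret tight_pair G "G Mod H" "\<lambda>y. H #>\<^bsub>G\<^esub> y" S T "card H" u g \<mu>
      by (intro tight_pair.intro tight_pair_axioms.intro cp) (use False P.C_le in simp)
    obtain x a0 b0 w where pp: "progression_pair G (G Mod H) (\<lambda>y. H #>\<^bsub>G\<^esub> y) S T (card H) u g \<mu> x a0 b0 w"
      by (rule progression)
    interpret R: coset_progression G H S T u g \<mu> x a0 b0 w
      by (intro coset_progression.intro coset_progression_axioms.intro pp Hsg)
    \<comment> \<open>Shapes whose exceptional layer is at the other end are alternatives for the
      reversed progressions, with the inverse of x as common difference.\<close>
    interpret R': coset_progression G H S T u g \<mu> "inv\<^bsub>G Mod H\<^esub> x" "R.aj u" "R.bi w" w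
      by (intro coset_progression.intro coset_progression_axioms.intro R.reversed Hsg)
    consider R.periodic_shape | R.essential_shape | R'.periodic_shape | R'.essential_shape
      using R.shapes by blast
    then show ?thesis
    proof cases
      case 1 then show ?thesis using R.periodic_conclusion by blast
    next
      case 2 then show ?thesis using R.essential_conclusion by blast
    next
      case 3 then show ?thesis using R'.periodic_conclusion by blast
    next
      case 4 then show ?thesis using R'.essential_conclusion by blast
    qed
  qed
qed

end
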